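(* Let $H$ be a finite-dimensional quasitriangular Hopf algebra over $\Bbbk$ with $R$-matrix $R=\sum_is_i\otimes t_i$, let $A$ be a left $H$-comodule algebra with coaction $a\mapsto a_{[-1]}\otimes a_{[0]}$, and let $R_H(A)=A\rtimes_H(\widehat{H}^* )^{\mathrm{op}}$ be the reflective algebra of $A$ with respect to $H$ (defined in the context). Let $\{h_d,\xi_d\}_d$ be a dual basis of $H$ ($h_d\in H$, $\xi_d\in H^*$). Then: (a) $R_H(A)$ is a left $H$-comodule algebra with left $H$-coaction $\delta_{\mathrm{ref}}$ given, for $a\in A$ and $\xi\in(\widehat{H}^* )^{\mathrm{op}}$, by $$\delta_{\mathrm{ref}}(a)=a_{[-1]}\otimes a_{[0]},\qquad \delta_{\mathrm{ref}}(\xi)=\sum_{i,j,d}\langle\xi,\,t_jh_ds_i\rangle\,s_jt_i\otimes\xi_d,\qquad \delta_{\mathrm{ref}}(a\,\xi)=\delta_{\mathrm{ref}}(a)\,\delta_{\mathrm{ref}}(\xi).$$ (b) $R_H(A)$ is quasitriangular as a left $H$-comodule algebra, with quantum $K$-matrix $$K_{\mathrm{ref}}(A)=\sum_dh_d\otimes\xi_d\;\in\;H\otimes(\widehat{H}^* )^{\mathrm{op}}\subset H\otimes R_H(A).$$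
   Context: $\Bbbk$ is an algebraically closed field, $\otimes=\otimes_\Bbbk$, sumless Sweedler notation $\Delta(h)=h_{(1)}\otimes h_{(2)}$. $R=\sum_is_i\otimes t_i\in H\otimes H$ is invertible with $(\Delta\otimes \mathrm{Id})R=R_{13}R_{23}$, $(\mathrm{Id}\otimes\Delta)R=R_{13}R_{12}$, $R\Delta(h)=\Delta^{\mathrm{op}}(h)R$. $\widehat{H}$ is $H$ as a vector space, with comultiplication $\widehat{\Delta}(h)=\sum_{i,j}t_jh_{(1)}t_i\otimes h_{(2)}s_iS^{-1}(s_j)$, counit $\widehat{\varepsilon}=\varepsilon$ and left $H$-action $\ell\rightharpoonup h=\ell_{(2)}hS^{-1}(\ell_{(1)})$; this is a left $H$-module coalgebra. $\widehat{H}^*$ is its dual algebra, $\langle\xi\zeta,h\rangle=\langle\xi\otimes\zeta,\widehat{\Delta}(h)\rangle$ (equal to $H^*$ as a vector space), with right $H$-action $\langle\xi\leftharpoonup\ell,h\rangle=\langle\xi,\ell\rightharpoonup h\rangle$. The reflective algebra $R_H(A)=A\rtimes_H(\widehat{H}^* )^{\mathrm{op}}$ is the quotient of the free product of the algebras $A$ and $(\widehat{H}^* )^{\mathrm{op}}$ by the relations $\xi a=a_{[0]}(\xi\leftharpoonup a_{[-1]})$ for $a\in A$, $\xi\in(\widehat{H}^* )^{\mathrm{op}}$; it contains $A$ and $(\widehat{H}^* )^{\mathrm{op}}$ as subalgebras and multiplication gives a linear isomorphism $A\otimes(\widehat{H}^* )^{\mathrm{op}}\cong R_H(A)$. A left $H$-comodule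 algebra $Q$ with coaction $\delta:Q\to H\otimes Q$ is quasitriangular if it is equipped with an invertible element $K\in H\otimes Q$ (a quantum $K$-matrix) such that $(\Delta\otimes \mathrm{Id}_Q)K=K_{23}R_{21}K_{13}R_{21}^{-1}$, $(\mathrm{Id}_H\otimes\delta)K=R_{21}K_{13}R_{12}$ in $H\otimes H\otimes Q$, and $K\delta(q)=\delta(q)K$ for all $q\in Q$. *)

theory Defs
  imports
    "HOL-Algebra.Module"
    "HOL-Algebra.QuotRing"
    "HOL-Algebra.Algebraic_Closure"
    "HOL-Library.FuncSet"
begin

section \<open>Algebras over a field\<close>

text \<open>
  The locale \<^locale>\<open>algebra\<close> of HOL-Algebra is commutative, so associative unital algebras are
  introduced here. They are \<^type>\<open>module\<close> records whose ring fields carry the multiplication.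
  The zero algebra is allowed.
\<close>

locale assoc_algebra = K?: field K + A?: ring A + module K A
  for K :: "'k ring" and A :: "('k, 'a) module" +
  assumes smult_mult_left:
      "\<lbrakk>c \<in> carrier K; x \<in> carrier A; y \<in> carrier A\<rbrakk>
        \<Longrightarrow> (c \<odot>\<^bsub>A\<^esub> x) \<otimes>\<^bsub>A\<^esub> y = c \<odot>\<^bsub>A\<^esub> (x \<otimes>\<^bsub>A\<^esub> y)"
    and smult_mult_right:
      "\<lbrakk>c \<in> carrier K; x \<in> carrier A; y \<in> carrier A\<rbrakk>
        \<Longrightarrow> x \<otimes>\<^bsub>A\<^esub> (c \<odot>\<^bsub>A\<^esub> y) = c \<odot>\<^bsub>A\<^esub> (x \<otimes>\<^bsub>A\<^esub> y)"

definition base_algebra :: "'k ring \<Rightarrow> ('k, 'k) module" where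
  "base_algebra K =
    \<lparr>carrier = carrier K, monoid.mult = (\<otimes>\<^bsub>K\<^esub>), one = \<one>\<^bsub>K\<^esub>, zero = \<zero>\<^bsub>K\<^esub>, add = (\<oplus>\<^bsub>K\<^esub>), smult = (\<otimes>\<^bsub>K\<^esub>)\<rparr>"

definition op_algebra :: "('k, 'a) module \<Rightarrow> ('k, 'a) module" where
  "op_algebra A = A\<lparr>monoid.mult := (\<lambda>x y. y \<otimes>\<^bsub>A\<^esub> x)\<rparr>"

definition lin_map :: "'k ring \<Rightarrow> ('k, 'v) module \<Rightarrow> ('k, 'w) module \<Rightarrow> ('v \<Rightarrow> 'w) set" where
  "lin_map K V W = {f \<in> carrier V \<rightarrow> carrier W.
     (\<forall>x\<in>carrier V. \<forall>y\<in>carrier V. f (x \<oplus>\<^bsub>V\<^esub> y) = f x \<oplus>\<^bsub>W\<^esub> f y) \<and>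
     (\<forall>c\<in>carrier K. \<forall>x\<in>carrier V. f (c \<odot>\<^bsub>V\<^esub> x) = c \<odot>\<^bsub>W\<^esub> f x)}"

definition alg_hom :: "'k ring \<Rightarrow> ('k, 'a) module \<Rightarrow> ('k, 'b) module \<Rightarrow> ('a \<Rightarrow> 'b) set" where
  "alg_hom K A B = ring_hom A B \<inter> lin_map K A B"

definition lin_span :: "'k ring \<Rightarrow> ('k, 'v) module \<Rightarrow> 'v set \<Rightarrow> 'v set" where
  "lin_span K V Y = \<Inter>{N. submodule N K V \<and> Y \<subseteq> N}"

definition finite_dimensional :: "'k ring \<Rightarrow> ('k, 'v) module \<Rightarrow> bool" where
  "finite_dimensional K V \<longleftrightarrow> (\<exists>B. finite B \<and> B \<subseteq> carrier V \<and> lin_span K V B = carrier V)"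

text \<open>Functionals are made extensional so that equal functionals are equal as HOL functions.\<close>

definition dual_carrier :: "'k ring \<Rightarrow> ('k, 'v) module \<Rightarrow> ('v \<Rightarrow> 'k) set" where
  "dual_carrier K V = lin_map K V (base_algebra K) \<inter> extensional (carrier V)"

definition dual_basis ::
  "'k ring \<Rightarrow> ('k, 'v) module \<Rightarrow> 'd set \<Rightarrow> ('d \<Rightarrow> 'v) \<Rightarrow> ('d \<Rightarrow> 'v \<Rightarrow> 'k) \<Rightarrow> bool" where
  "dual_basis K V D b \<beta> \<longleftrightarrow>
     finite D \<and> b \<in> D \<rightarrow> carrier V \<and> \<beta> \<in> D \<rightarrow> dual_carrier K V \<and>
     (\<forall>d\<in>D. \<forall>e\<in>D. \<beta> d (b e) = (if d = e then \<one>\<^bsub>K\<^esub> else \<zero>\<^bsub>K\<^esub>)) \<and>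
     (\<forall>v\<in>carrier V. v = (\<Oplus>\<^bsub>V\<^esub>d\<in>D. \<beta> d v \<odot>\<^bsub>V\<^esub> b d))"

text \<open>
  Quotient of an algebra by a subspace \<open>N\<close>: the ring fields are those of \<^const>\<open>FactRing\<close>.
  As a vector space this makes sense for any subspace; the multiplication is well defined
  once \<open>N\<close> is a two-sided ideal.
\<close>

definition quotient_algebra :: "('k, 'a) module \<Rightarrow> 'a set \<Rightarrow> ('k, 'a set) module" where
  "quotient_algebra A N =
    \<lparr>carrier = carrier (A Quot N), monoid.mult = (\<otimes>\<^bsub>A Quot N\<^esub>), one = \<one>\<^bsub>A Quot N\<^esub>,
     zero = \<zero>\<^bsub>A Quot N\<^esub>, add = (\<oplus>\<^bsub>A Quot N\<^esub>),
     smult = (\<lambda>c Y. \<Union>x\<in>Y. N +>\<^bsub>A\<^esub> (c \<odot>\<^bsub>A\<^esub> x))\<rparr>"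

text \<open>
  The monoid algebra: finitely supported functions on the carrier of a monoid,
  vanishing outside the carrier, with the convolution product.
\<close>

definition monoid_algebra :: "'k ring \<Rightarrow> ('g, 'm) monoid_scheme \<Rightarrow> ('k, 'g \<Rightarrow> 'k) module" where
  "monoid_algebra K M =
    \<lparr>carrier = {f. range f \<subseteq> carrier K \<and> finite {x. f x \<noteq> \<zero>\<^bsub>K\<^esub>} \<and> {x. f x \<noteq> \<zero>\<^bsub>K\<^esub>} \<subseteq> carrier M},
     monoid.mult = (\<lambda>f g x. \<Oplus>\<^bsub>K\<^esub>p\<in>{(u, v). f u \<noteq> \<zero>\<^bsub>K\<^esub> \<and> g v \<noteq> \<zero>\<^bsub>K\<^esub> \<and> u \<otimes>\<^bsub>M\<^esub> v = x}.
               f (fst p) \<otimes>\<^bsub>K\<^esub> g (snd p)),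
     one = (\<lambda>x. if x = \<one>\<^bsub>M\<^esub> then \<one>\<^bsub>K\<^esub> else \<zero>\<^bsub>K\<^esub>),
     zero = (\<lambda>x. \<zero>\<^bsub>K\<^esub>),
     add = (\<lambda>f g x. f x \<oplus>\<^bsub>K\<^esub> g x),
     smult = (\<lambda>c f x. c \<otimes>\<^bsub>K\<^esub> f x)\<rparr>"

definition basis_elt :: "'k ring \<Rightarrow> 'g \<Rightarrow> 'g \<Rightarrow> 'k" where
  "basis_elt K g = (\<lambda>x. if x = g then \<one>\<^bsub>K\<^esub> else \<zero>\<^bsub>K\<^esub>)"

definition lin_extend :: "'k ring \<Rightarrow> ('k, 'u) module \<Rightarrow> ('g \<Rightarrow> 'u) \<Rightarrow> ('g \<Rightarrow> 'k) \<Rightarrow> 'u" where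
  "lin_extend K U \<phi> f = (\<Oplus>\<^bsub>U\<^esub>x\<in>{x. f x \<noteq> \<zero>\<^bsub>K\<^esub>}. f x \<odot>\<^bsub>U\<^esub> \<phi> x)"


section \<open>Tensor products\<close>

text \<open>
  \<open>V \<otimes> W\<close> is the free vector space on \<open>V \<times> W\<close> modulo the span of the bilinearity relations.
  The free vector space is taken as the monoid algebra of the product monoid, so that the
  quotient carries the product \<open>(v \<otimes> w) (v' \<otimes> w') = v v' \<otimes> w w'\<close>.
\<close>

definition tensor_relations ::
  "'k ring \<Rightarrow> ('k, 'v) module \<Rightarrow> ('k, 'w) module \<Rightarrow> ('v \<times> 'w \<Rightarrow> 'k) set" where
  "tensor_relations K V W =
    (let F = monoid_algebra K (V \<times>\<times> W); e = (\<lambda>v w. basis_elt K (v, w)) in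
      {e (v \<oplus>\<^bsub>V\<^esub> v') w \<ominus>\<^bsub>F\<^esub> (e v w \<oplus>\<^bsub>F\<^esub> e v' w) | v v' w.
          v \<in> carrier V \<and> v' \<in> carrier V \<and> w \<in> carrier W} \<union>
      {e v (w \<oplus>\<^bsub>W\<^esub> w') \<ominus>\<^bsub>F\<^esub> (e v w \<oplus>\<^bsub>F\<^esub> e v w') | v w w'.
          v \<in> carrier V \<and> w \<in> carrier W \<and> w' \<in> carrier W} \<union>
      {e (c \<odot>\<^bsub>V\<^esub> v) w \<ominus>\<^bsub>F\<^esub> (c \<odot>\<^bsub>F\<^esub> e v w) | c v w.
          c \<in> carrier K \<and> v \<in> carrier V \<and> w \<in> carrier W} \<union>
      {e v (c \<odot>\<^bsub>W\<^esub> w) \<ominus>\<^bsub>F\<^esub> (c \<odot>\<^bsub>F\<^esub> e v w) | c v w.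
          c \<in> carrier K \<and> v \<in> carrier V \<and> w \<in> carrier W})"

definition tensor_null ::
  "'k ring \<Rightarrow> ('k, 'v) module \<Rightarrow> ('k, 'w) module \<Rightarrow> ('v \<times> 'w \<Rightarrow> 'k) set" where
  "tensor_null K V W = lin_span K (monoid_algebra K (V \<times>\<times> W)) (tensor_relations K V W)"

definition tensor ::
  "'k ring \<Rightarrow> ('k, 'v) module \<Rightarrow> ('k, 'w) module \<Rightarrow> ('k, ('v \<times> 'w \<Rightarrow> 'k) set) module" where
  "tensor K V W = quotient_algebra (monoid_algebra K (V \<times>\<times> W)) (tensor_null K V W)"

definition tens ::
  "'k ring \<Rightarrow> ('k, 'v) module \<Rightarrow> ('k, 'w) module \<Rightarrow> 'v \<Rightarrow> 'w \<Rightarrow> ('v \<times> 'w \<Rightarrow> 'k) set" where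
  "tens K V W v w = tensor_null K V W +>\<^bsub>monoid_algebra K (V \<times>\<times> W)\<^esub> basis_elt K (v, w)"

text \<open>
  The linear map \<open>V \<otimes> W \<rightarrow> U\<close> sending \<open>v \<otimes> w\<close> to \<open>\<beta> v w\<close>, for a bilinear map \<open>\<beta>\<close>. All
  Sweedler-type expressions below are written with it: a sum \<open>\<beta> h\<^sub>1 h\<^sub>2\<close> is
  \<open>tensor_lift K U \<beta> (\<Delta> h)\<close>. The value does not depend on the representative chosen.
\<close>

definition tensor_lift ::
  "'k ring \<Rightarrow> ('k, 'u) module \<Rightarrow> ('v \<Rightarrow> 'w \<Rightarrow> 'u) \<Rightarrow> ('v \<times> 'w \<Rightarrow> 'k) set \<Rightarrow> 'u" where
  "tensor_lift K U \<beta> x = lin_extend K U (\<lambda>(v, w). \<beta> v w) (SOME f. f \<in> x)"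

text \<open>The arguments \<open>V'\<close>, \<open>W'\<close> are the codomains of \<open>f\<close> and \<open>g\<close>.\<close>

definition tensor_map ::
  "'k ring \<Rightarrow> ('k, 'v2) module \<Rightarrow> ('k, 'w2) module \<Rightarrow> ('v \<Rightarrow> 'v2) \<Rightarrow> ('w \<Rightarrow> 'w2)
    \<Rightarrow> ('v \<times> 'w \<Rightarrow> 'k) set \<Rightarrow> ('v2 \<times> 'w2 \<Rightarrow> 'k) set" where
  "tensor_map K V' W' f g = tensor_lift K (tensor K V' W') (\<lambda>v w. tens K V' W' (f v) (g w))"

definition tensor_flip ::
  "'k ring \<Rightarrow> ('k, 'v) module \<Rightarrow> ('k, 'w) module
    \<Rightarrow> ('v \<times> 'w \<Rightarrow> 'k) set \<Rightarrow> ('w \<times> 'v \<Rightarrow> 'k) set" where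
  "tensor_flip K V W = tensor_lift K (tensor K W V) (\<lambda>v w. tens K W V w v)"

text \<open>
  Triple tensor products are nested to the right; \<open>tensor_assoc\<close> is the identification
  \<open>(U \<otimes> V) \<otimes> W \<rightarrow> U \<otimes> (V \<otimes> W)\<close>.
\<close>

definition tensor3 ::
  "'k ring \<Rightarrow> ('k, 'u) module \<Rightarrow> ('k, 'v) module \<Rightarrow> ('k, 'w) module
    \<Rightarrow> ('k, ('u \<times> ('v \<times> 'w \<Rightarrow> 'k) set \<Rightarrow> 'k) set) module" where
  "tensor3 K U V W = tensor K U (tensor K V W)"

definition tens3 ::
  "'k ring \<Rightarrow> ('k, 'u) module \<Rightarrow> ('k, 'v) module \<Rightarrow> ('k, 'w) module
    \<Rightarrow> 'u \<Rightarrow> 'v \<Rightarrow> 'w \<Rightarrow> ('u \<times> ('v \<times> 'w \<Rightarrow> 'k) set \<Rightarrow> 'k) set" where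
  "tens3 K U V W u v w = tens K U (tensor K V W) u (tens K V W v w)"

definition tensor_assoc ::
  "'k ring \<Rightarrow> ('k, 'u) module \<Rightarrow> ('k, 'v) module \<Rightarrow> ('k, 'w) module
    \<Rightarrow> (('u \<times> 'v \<Rightarrow> 'k) set \<times> 'w \<Rightarrow> 'k) set \<Rightarrow> ('u \<times> ('v \<times> 'w \<Rightarrow> 'k) set \<Rightarrow> 'k) set" where
  "tensor_assoc K U V W =
    tensor_lift K (tensor3 K U V W)
      (\<lambda>x w. tensor_lift K (tensor3 K U V W) (\<lambda>u v. tens3 K U V W u v w) x)"

text \<open>Leg notation in \<open>U \<otimes> V \<otimes> W\<close>. For \<open>X\<^sub>2\<^sub>1\<close> one flips and applies \<open>leg12\<close>.\<close>

definition leg12 ::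
  "'k ring \<Rightarrow> ('k, 'u) module \<Rightarrow> ('k, 'v) module \<Rightarrow> ('k, 'w) module
    \<Rightarrow> ('u \<times> 'v \<Rightarrow> 'k) set \<Rightarrow> ('u \<times> ('v \<times> 'w \<Rightarrow> 'k) set \<Rightarrow> 'k) set" where
  "leg12 K U V W = tensor_lift K (tensor3 K U V W) (\<lambda>u v. tens3 K U V W u v \<one>\<^bsub>W\<^esub>)"

definition leg13 ::
  "'k ring \<Rightarrow> ('k, 'u) module \<Rightarrow> ('k, 'v) module \<Rightarrow> ('k, 'w) module
    \<Rightarrow> ('u \<times> 'w \<Rightarrow> 'k) set \<Rightarrow> ('u \<times> ('v \<times> 'w \<Rightarrow> 'k) set \<Rightarrow> 'k) set" where
  "leg13 K U V W = tensor_lift K (tensor3 K U V W) (\<lambda>u w. tens3 K U V W u \<one>\<^bsub>V\<^esub> w)"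

definition leg23 ::
  "'k ring \<Rightarrow> ('k, 'u) module \<Rightarrow> ('k, 'v) module \<Rightarrow> ('k, 'w) module
    \<Rightarrow> ('v \<times> 'w \<Rightarrow> 'k) set \<Rightarrow> ('u \<times> ('v \<times> 'w \<Rightarrow> 'k) set \<Rightarrow> 'k) set" where
  "leg23 K U V W = tensor_lift K (tensor3 K U V W) (\<lambda>v w. tens3 K U V W \<one>\<^bsub>U\<^esub> v w)"


section \<open>Quasitriangular Hopf algebras and comodule algebras\<close>

locale bialgebra = assoc_algebra K H
  for K :: "'k ring" and H :: "('k, 'h) module"
    and \<Delta> :: "'h \<Rightarrow> ('h \<times> 'h \<Rightarrow> 'k) set" and \<epsilon> :: "'h \<Rightarrow> 'k" +
  assumes comult_hom: "\<Delta> \<in> alg_hom K H (tensor K H H)"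
    and counit_hom: "\<epsilon> \<in> alg_hom K H (base_algebra K)"
    and coassoc: "h \<in> carrier H \<Longrightarrow>
      tensor_assoc K H H H (tensor_map K (tensor K H H) H \<Delta> (\<lambda>x. x) (\<Delta> h)) =
      tensor_map K H (tensor K H H) (\<lambda>x. x) \<Delta> (\<Delta> h)"
    and counit_left: "h \<in> carrier H \<Longrightarrow> tensor_lift K H (\<lambda>x y. \<epsilon> x \<odot>\<^bsub>H\<^esub> y) (\<Delta> h) = h"
    and counit_right: "h \<in> carrier H \<Longrightarrow> tensor_lift K H (\<lambda>x y. \<epsilon> y \<odot>\<^bsub>H\<^esub> x) (\<Delta> h) = h"

locale hopf_algebra = bialgebra K H \<Delta> \<epsilon>
  for K :: "'k ring" and H :: "('k, 'h) module"
    and \<Delta> :: "'h \<Rightarrow> ('h \<times> 'h \<Rightarrow> 'k) set" and \<epsilon> :: "'h \<Rightarrow> 'k" and S :: "'h \<Rightarrow> 'h" +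
  assumes antipode_linear: "S \<in> lin_map K H H"
    and antipode_left: "h \<in> carrier H \<Longrightarrow>
      tensor_lift K H (\<lambda>x y. S x \<otimes>\<^bsub>H\<^esub> y) (\<Delta> h) = \<epsilon> h \<odot>\<^bsub>H\<^esub> \<one>\<^bsub>H\<^esub>"
    and antipode_right: "h \<in> carrier H \<Longrightarrow>
      tensor_lift K H (\<lambda>x y. x \<otimes>\<^bsub>H\<^esub> S y) (\<Delta> h) = \<epsilon> h \<odot>\<^bsub>H\<^esub> \<one>\<^bsub>H\<^esub>"

locale quasitriangular_hopf_algebra = hopf_algebra K H \<Delta> \<epsilon> S
  for K :: "'k ring" and H :: "('k, 'h) module"
    and \<Delta> :: "'h \<Rightarrow> ('h \<times> 'h \<Rightarrow> 'k) set" and \<epsilon> :: "'h \<Rightarrow> 'k" and S :: "'h \<Rightarrow> 'h"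
    and R :: "('h \<times> 'h \<Rightarrow> 'k) set" +
  assumes R_invertible: "R \<in> Units (tensor K H H)"
    and R_comult_left:
      "tensor_assoc K H H H (tensor_map K (tensor K H H) H \<Delta> (\<lambda>x. x) R) =
       leg13 K H H H R \<otimes>\<^bsub>tensor3 K H H H\<^esub> leg23 K H H H R"
    and R_comult_right:
      "tensor_map K H (tensor K H H) (\<lambda>x. x) \<Delta> R =
       leg13 K H H H R \<otimes>\<^bsub>tensor3 K H H H\<^esub> leg12 K H H H R"
    and R_intertwines: "h \<in> carrier H \<Longrightarrow>
      R \<otimes>\<^bsub>tensor K H H\<^esub> \<Delta> h = tensor_flip K H H (\<Delta> h) \<otimes>\<^bsub>tensor K H H\<^esub> R"

locale left_comodule_algebra = bialgebra K H \<Delta> \<epsilon> + Q: assoc_algebra K Q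
  for K :: "'k ring" and H :: "('k, 'h) module"
    and \<Delta> :: "'h \<Rightarrow> ('h \<times> 'h \<Rightarrow> 'k) set" and \<epsilon> :: "'h \<Rightarrow> 'k"
    and Q :: "('k, 'q) module" and \<delta> :: "'q \<Rightarrow> ('h \<times> 'q \<Rightarrow> 'k) set" +
  assumes coaction_hom: "\<delta> \<in> alg_hom K Q (tensor K H Q)"
    and coaction_coassoc: "q \<in> carrier Q \<Longrightarrow>
      tensor_assoc K H H Q (tensor_map K (tensor K H H) Q \<Delta> (\<lambda>x. x) (\<delta> q)) =
      tensor_map K H (tensor K H Q) (\<lambda>x. x) \<delta> (\<delta> q)"
    and coaction_counit: "q \<in> carrier Q \<Longrightarrow>
      tensor_lift K Q (\<lambda>x y. \<epsilon> x \<odot>\<^bsub>Q\<^esub> y) (\<delta> q) = q"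

locale quasitriangular_comodule_algebra =
  quasitriangular_hopf_algebra K H \<Delta> \<epsilon> S R + left_comodule_algebra K H \<Delta> \<epsilon> Q \<delta>
  for K :: "'k ring" and H :: "('k, 'h) module"
    and \<Delta> :: "'h \<Rightarrow> ('h \<times> 'h \<Rightarrow> 'k) set" and \<epsilon> :: "'h \<Rightarrow> 'k" and S :: "'h \<Rightarrow> 'h"
    and R :: "('h \<times> 'h \<Rightarrow> 'k) set"
    and Q :: "('k, 'q) module" and \<delta> :: "'q \<Rightarrow> ('h \<times> 'q \<Rightarrow> 'k) set"
    and Kmat :: "('h \<times> 'q \<Rightarrow> 'k) set" +
  assumes K_invertible: "Kmat \<in> Units (tensor K H Q)"
    and K_comult:
      "tensor_assoc K H H Q (tensor_map K (tensor K H H) Q \<Delta> (\<lambda>x. x) Kmat) =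
       leg23 K H H Q Kmat
         \<otimes>\<^bsub>tensor3 K H H Q\<^esub> leg12 K H H Q (tensor_flip K H H R)
         \<otimes>\<^bsub>tensor3 K H H Q\<^esub> leg13 K H H Q Kmat
         \<otimes>\<^bsub>tensor3 K H H Q\<^esub> inv\<^bsub>tensor3 K H H Q\<^esub> (leg12 K H H Q (tensor_flip K H H R))"
    and K_coaction:
      "tensor_map K H (tensor K H Q) (\<lambda>x. x) \<delta> Kmat =
       leg12 K H H Q (tensor_flip K H H R)
         \<otimes>\<^bsub>tensor3 K H H Q\<^esub> leg13 K H H Q Kmat
         \<otimes>\<^bsub>tensor3 K H H Q\<^esub> leg12 K H H Q R"
    and K_intertwines: "q \<in> carrier Q \<Longrightarrow>
      Kmat \<otimes>\<^bsub>tensor K H Q\<^esub> \<delta> q = \<delta> q \<otimes>\<^bsub>tensor K H Q\<^esub> Kmat"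


section \<open>The module coalgebra on \<open>H\<close> and its dual algebra\<close>

text \<open>
  The antipode of a finite-dimensional (or of a quasitriangular) Hopf algebra is bijective;
  this is not part of the definitions above and \<^const>\<open>inv_into\<close> is its inverse by that fact.
\<close>

abbreviation antipode_inv :: "('k, 'h) module \<Rightarrow> ('h \<Rightarrow> 'h) \<Rightarrow> 'h \<Rightarrow> 'h" where
  "antipode_inv H S \<equiv> inv_into (carrier H) S"

text \<open>Here \<open>R = (\<Sum>i\<in>I. s i \<otimes> t i)\<close>.\<close>

definition hat_comult ::
  "'k ring \<Rightarrow> ('k, 'h) module \<Rightarrow> ('h \<Rightarrow> ('h \<times> 'h \<Rightarrow> 'k) set) \<Rightarrow> ('h \<Rightarrow> 'h)
    \<Rightarrow> 'i set \<Rightarrow> ('i \<Rightarrow> 'h) \<Rightarrow> ('i \<Rightarrow> 'h) \<Rightarrow> 'h \<Rightarrow> ('h \<times> 'h \<Rightarrow> 'k) set" where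
  "hat_comult K H \<Delta> S I s t h =
    tensor_lift K (tensor K H H)
      (\<lambda>x y. \<Oplus>\<^bsub>tensor K H H\<^esub>i\<in>I. \<Oplus>\<^bsub>tensor K H H\<^esub>j\<in>I.
         tens K H H (t j \<otimes>\<^bsub>H\<^esub> x \<otimes>\<^bsub>H\<^esub> t i) (y \<otimes>\<^bsub>H\<^esub> s i \<otimes>\<^bsub>H\<^esub> antipode_inv H S (s j)))
      (\<Delta> h)"

text \<open>\<open>l \<rightharpoonup> h = l\<^sub>2 h S\<^sup>-\<^sup>1(l\<^sub>1)\<close>\<close>

definition hat_action ::
  "'k ring \<Rightarrow> ('k, 'h) module \<Rightarrow> ('h \<Rightarrow> ('h \<times> 'h \<Rightarrow> 'k) set) \<Rightarrow> ('h \<Rightarrow> 'h)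
    \<Rightarrow> 'h \<Rightarrow> 'h \<Rightarrow> 'h" where
  "hat_action K H \<Delta> S l h =
    tensor_lift K H (\<lambda>x y. y \<otimes>\<^bsub>H\<^esub> h \<otimes>\<^bsub>H\<^esub> antipode_inv H S x) (\<Delta> l)"

definition hat_dual ::
  "'k ring \<Rightarrow> ('k, 'h) module \<Rightarrow> ('h \<Rightarrow> ('h \<times> 'h \<Rightarrow> 'k) set) \<Rightarrow> ('h \<Rightarrow> 'k) \<Rightarrow> ('h \<Rightarrow> 'h)
    \<Rightarrow> 'i set \<Rightarrow> ('i \<Rightarrow> 'h) \<Rightarrow> ('i \<Rightarrow> 'h) \<Rightarrow> ('k, 'h \<Rightarrow> 'k) module" where
  "hat_dual K H \<Delta> \<epsilon> S I s t =
    \<lparr>carrier = dual_carrier K H,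
     monoid.mult = (\<lambda>\<xi> \<zeta>. \<lambda>h\<in>carrier H.
       tensor_lift K (base_algebra K) (\<lambda>x y. \<xi> x \<otimes>\<^bsub>K\<^esub> \<zeta> y) (hat_comult K H \<Delta> S I s t h)),
     one = (\<lambda>h\<in>carrier H. \<epsilon> h),
     zero = (\<lambda>h\<in>carrier H. \<zero>\<^bsub>K\<^esub>),
     add = (\<lambda>\<xi> \<zeta>. \<lambda>h\<in>carrier H. \<xi> h \<oplus>\<^bsub>K\<^esub> \<zeta> h),
     smult = (\<lambda>c \<xi>. \<lambda>h\<in>carrier H. c \<otimes>\<^bsub>K\<^esub> \<xi> h)\<rparr>"

definition hat_dual_action ::
  "'k ring \<Rightarrow> ('k, 'h) module \<Rightarrow> ('h \<Rightarrow> ('h \<times> 'h \<Rightarrow> 'k) set) \<Rightarrow> ('h \<Rightarrow> 'h)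
    \<Rightarrow> ('h \<Rightarrow> 'k) \<Rightarrow> 'h \<Rightarrow> 'h \<Rightarrow> 'k" where
  "hat_dual_action K H \<Delta> S \<xi> l = (\<lambda>h\<in>carrier H. \<xi> (hat_action K H \<Delta> S l h))"


section \<open>Free products and reflective algebras\<close>

definition free_monoid :: "'x set \<Rightarrow> 'x list monoid" where
  "free_monoid Y = \<lparr>carrier = lists Y, monoid.mult = (@), one = []\<rparr>"

text \<open>The relations in an algebra \<open>F\<close> that make \<open>e\<close> an algebra map from \<open>A\<close>.\<close>

definition hom_relations ::
  "'k ring \<Rightarrow> ('k, 'a) module \<Rightarrow> ('k, 'f) module \<Rightarrow> ('a \<Rightarrow> 'f) \<Rightarrow> 'f set" where
  "hom_relations K A F e =
    {e (a \<oplus>\<^bsub>A\<^esub> b) \<ominus>\<^bsub>F\<^esub> (e a \<oplus>\<^bsub>F\<^esub> e b) | a b. a \<in> carrier A \<and> b \<in> carrier A} \<union>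
    {e (c \<odot>\<^bsub>A\<^esub> a) \<ominus>\<^bsub>F\<^esub> (c \<odot>\<^bsub>F\<^esub> e a) | c a. c \<in> carrier K \<and> a \<in> carrier A} \<union>
    {e (a \<otimes>\<^bsub>A\<^esub> b) \<ominus>\<^bsub>F\<^esub> (e a \<otimes>\<^bsub>F\<^esub> e b) | a b. a \<in> carrier A \<and> b \<in> carrier A} \<union>
    {e \<one>\<^bsub>A\<^esub> \<ominus>\<^bsub>F\<^esub> \<one>\<^bsub>F\<^esub>}"

definition free_algebra ::
  "'k ring \<Rightarrow> ('k, 'a) module \<Rightarrow> ('k, 'b) module \<Rightarrow> ('k, ('a + 'b) list \<Rightarrow> 'k) module" where
  "free_algebra K A B = monoid_algebra K (free_monoid (carrier A <+> carrier B))"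

definition free_product_ideal ::
  "'k ring \<Rightarrow> ('k, 'a) module \<Rightarrow> ('k, 'b) module \<Rightarrow> (('a + 'b) list \<Rightarrow> 'k) set" where
  "free_product_ideal K A B =
    Idl\<^bsub>free_algebra K A B\<^esub>
      (hom_relations K A (free_algebra K A B) (\<lambda>a. basis_elt K [Inl a]) \<union>
       hom_relations K B (free_algebra K A B) (\<lambda>b. basis_elt K [Inr b]))"

definition free_product ::
  "'k ring \<Rightarrow> ('k, 'a) module \<Rightarrow> ('k, 'b) module \<Rightarrow> ('k, (('a + 'b) list \<Rightarrow> 'k) set) module" where
  "free_product K A B = quotient_algebra (free_algebra K A B) (free_product_ideal K A B)"

definition free_product_inl ::
  "'k ring \<Rightarrow> ('k, 'a) module \<Rightarrow> ('k, 'b) module \<Rightarrow> 'a \<Rightarrow> (('a + 'b) list \<Rightarrow> 'k) set" where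
  "free_product_inl K A B a =
    free_product_ideal K A B +>\<^bsub>free_algebra K A B\<^esub> basis_elt K [Inl a]"

definition free_product_inr ::
  "'k ring \<Rightarrow> ('k, 'a) module \<Rightarrow> ('k, 'b) module \<Rightarrow> 'b \<Rightarrow> (('a + 'b) list \<Rightarrow> 'k) set" where
  "free_product_inr K A B b =
    free_product_ideal K A B +>\<^bsub>free_algebra K A B\<^esub> basis_elt K [Inr b]"

text \<open>
  \<open>A\<close> is a left comodule algebra with coaction \<open>\<delta>\<close>, and \<open>B\<close> an algebra with a map
  \<open>act \<xi> l\<close>, written \<open>\<xi> \<leftharpoonup> l\<close>. The cross relations are \<open>\<xi> a = a\<^sub>0 (\<xi> \<leftharpoonup> a\<^sub>-\<^sub>1)\<close>.
\<close>

definition crossed_ideal ::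
  "'k ring \<Rightarrow> ('k, 'a) module \<Rightarrow> ('a \<Rightarrow> ('h \<times> 'a \<Rightarrow> 'k) set)
    \<Rightarrow> ('k, 'b) module \<Rightarrow> ('b \<Rightarrow> 'h \<Rightarrow> 'b) \<Rightarrow> (('a + 'b) list \<Rightarrow> 'k) set set" where
  "crossed_ideal K A \<delta> B act =
    Idl\<^bsub>free_product K A B\<^esub>
      {free_product_inr K A B \<xi> \<otimes>\<^bsub>free_product K A B\<^esub> free_product_inl K A B a
         \<ominus>\<^bsub>free_product K A B\<^esub>
       tensor_lift K (free_product K A B)
         (\<lambda>l b. free_product_inl K A B b \<otimes>\<^bsub>free_product K A B\<^esub> free_product_inr K A B (act \<xi> l))
         (\<delta> a)
       | \<xi> a. \<xi> \<in> carrier B \<and> a \<in> carrier A}"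

definition reflective_ideal ::
  "'k ring \<Rightarrow> ('k, 'h) module \<Rightarrow> ('h \<Rightarrow> ('h \<times> 'h \<Rightarrow> 'k) set) \<Rightarrow> ('h \<Rightarrow> 'k) \<Rightarrow> ('h \<Rightarrow> 'h)
    \<Rightarrow> 'i set \<Rightarrow> ('i \<Rightarrow> 'h) \<Rightarrow> ('i \<Rightarrow> 'h)
    \<Rightarrow> ('k, 'a) module \<Rightarrow> ('a \<Rightarrow> ('h \<times> 'a \<Rightarrow> 'k) set)
    \<Rightarrow> (('a + ('h \<Rightarrow> 'k)) list \<Rightarrow> 'k) set set" where
  "reflective_ideal K H \<Delta> \<epsilon> S I s t A \<delta> =
    crossed_ideal K A \<delta> (op_algebra (hat_dual K H \<Delta> \<epsilon> S I s t)) (hat_dual_action K H \<Delta> S)"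

definition reflective_algebra ::
  "'k ring \<Rightarrow> ('k, 'h) module \<Rightarrow> ('h \<Rightarrow> ('h \<times> 'h \<Rightarrow> 'k) set) \<Rightarrow> ('h \<Rightarrow> 'k) \<Rightarrow> ('h \<Rightarrow> 'h)
    \<Rightarrow> 'i set \<Rightarrow> ('i \<Rightarrow> 'h) \<Rightarrow> ('i \<Rightarrow> 'h)
    \<Rightarrow> ('k, 'a) module \<Rightarrow> ('a \<Rightarrow> ('h \<times> 'a \<Rightarrow> 'k) set)
    \<Rightarrow> ('k, (('a + ('h \<Rightarrow> 'k)) list \<Rightarrow> 'k) set set) module" where
  "reflective_algebra K H \<Delta> \<epsilon> S I s t A \<delta> =
    quotient_algebra (free_product K A (op_algebra (hat_dual K H \<Delta> \<epsilon> S I s t)))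
      (reflective_ideal K H \<Delta> \<epsilon> S I s t A \<delta>)"

definition reflective_inl ::
  "'k ring \<Rightarrow> ('k, 'h) module \<Rightarrow> ('h \<Rightarrow> ('h \<times> 'h \<Rightarrow> 'k) set) \<Rightarrow> ('h \<Rightarrow> 'k) \<Rightarrow> ('h \<Rightarrow> 'h)
    \<Rightarrow> 'i set \<Rightarrow> ('i \<Rightarrow> 'h) \<Rightarrow> ('i \<Rightarrow> 'h)
    \<Rightarrow> ('k, 'a) module \<Rightarrow> ('a \<Rightarrow> ('h \<times> 'a \<Rightarrow> 'k) set)
    \<Rightarrow> 'a \<Rightarrow> (('a + ('h \<Rightarrow> 'k)) list \<Rightarrow> 'k) set set" where
  "reflective_inl K H \<Delta> \<epsilon> S I s t A \<delta> a =
    (let B = op_algebra (hat_dual K H \<Delta> \<epsilon> S I s t)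
     in reflective_ideal K H \<Delta> \<epsilon> S I s t A \<delta> +>\<^bsub>free_product K A B\<^esub> free_product_inl K A B a)"

definition reflective_inr ::
  "'k ring \<Rightarrow> ('k, 'h) module \<Rightarrow> ('h \<Rightarrow> ('h \<times> 'h \<Rightarrow> 'k) set) \<Rightarrow> ('h \<Rightarrow> 'k) \<Rightarrow> ('h \<Rightarrow> 'h)
    \<Rightarrow> 'i set \<Rightarrow> ('i \<Rightarrow> 'h) \<Rightarrow> ('i \<Rightarrow> 'h)
    \<Rightarrow> ('k, 'a) module \<Rightarrow> ('a \<Rightarrow> ('h \<times> 'a \<Rightarrow> 'k) set)
    \<Rightarrow> ('h \<Rightarrow> 'k) \<Rightarrow> (('a + ('h \<Rightarrow> 'k)) list \<Rightarrow> 'k) set set" where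
  "reflective_inr K H \<Delta> \<epsilon> S I s t A \<delta> \<xi> =
    (let B = op_algebra (hat_dual K H \<Delta> \<epsilon> S I s t)
     in reflective_ideal K H \<Delta> \<epsilon> S I s t A \<delta> +>\<^bsub>free_product K A B\<^esub> free_product_inr K A B \<xi>)"

end

theory Submission
  imports Defs
begin

text \<open>
  A linear map \<open>x\<close> from \<open>H\<^sup>*\<close> to an algebra \<open>V\<close> is the same as the element
  \<open>K\<^sub>x = \<Sum>\<^sub>d h\<^sub>d \<otimes> x(\<xi>\<^sub>d)\<close> of \<open>H \<otimes> V\<close>. In these terms \<open>x\<close> is multiplicative on the opposite of the
  dual of the braided coalgebra iff \<open>(\<Delta> \<otimes> Id) K R\<^sub>2\<^sub>1 = K\<^sub>2\<^sub>3 R\<^sub>2\<^sub>1 K\<^sub>1\<^sub>3\<close>, and it satisfies the cross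
  relations with an algebra map \<open>\<alpha>\<close> from \<open>A\<close> iff \<open>K\<close> commutes with all \<open>(Id \<otimes> \<alpha>)(\<delta> a)\<close>. So the reflective
  algebra is the universal algebra carrying a solution \<open>K\<close> of these two equations. The coaction exists
  because \<open>R\<^sub>2\<^sub>1 K\<^sub>1\<^sub>3 R\<^sub>1\<^sub>2\<close> solves them again, by the Yang--Baxter equation and the intertwining
  property of \<open>R\<close>; all further identities between maps out of the reflective algebra are checked
  on \<open>A\<close> and on the element \<open>K\<close>. That \<open>K\<close> is invertible follows by writing its inverse
  with the antipode, using the Drinfeld element.
\<close>

text \<open>The two equations are tied together by the twist in the braided coproduct: its inner
  copy of \<open>R\<close> is right multiplication by \<open>R_21\<close>, and its outer copy, with
  \<open>S\<^sup>-\<^sup>1\<close> on one leg, cancels an \<open>R_21\<close> standing between two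
  copies of \<open>K\<close>. Evaluating the first leg of \<open>K_x\<close> at a functional
  \<open>z\<close> returns \<open>x z\<close>, so linear maps on the dual are compared through these
  elements. The obstacle is the bookkeeping of legs: coassociativity on \<open>K\<close> lives in
  four tensor factors, too deep for nested tensor products. Legs are therefore commuting algebra
  maps into an arbitrary algebra \<open>T\<close>, and a concrete tensor product is chosen when an
  identity is read off. The reflective algebra, a quotient of a quotient, is handled through its
  universal property and the fact that products \<open>a x\<close> span it; spanning also yields
  uniqueness of the coaction. The Drinfeld element serves twice: it makes the antipode bijective, so
  that \<open>S\<^sup>-\<^sup>1\<close> in the braided coalgebra is meaningful, and it enters the
  left inverse of \<open>K\<close>, where a factor has to cross an element at the price of
  \<open>S\<^sup>2\<close>.\<close>

lemma lin_mapI: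
  assumes "\<And>x. x \<in> carrier V \<Longrightarrow> f x \<in> carrier W"
    and "\<And>x y. x \<in> carrier V \<Longrightarrow> y \<in> carrier V \<Longrightarrow> f (x \<oplus>\<^bsub>V\<^esub> y) = f x \<oplus>\<^bsub>W\<^esub> f y"
    and "\<And>c x. c \<in> carrier K \<Longrightarrow> x \<in> carrier V \<Longrightarrow> f (c \<odot>\<^bsub>V\<^esub> x) = c \<odot>\<^bsub>W\<^esub> f x"
  shows "f \<in> lin_map K V W"
  using assms by (auto simp: lin_map_def)

lemma lin_mapD:
  assumes "f \<in> lin_map K V W"
  shows "x \<in> carrier V \<Longrightarrow> f x \<in> carrier W"
    and "x \<in> carrier V \<Longrightarrow> y \<in> carrier V \<Longrightarrow> f (x \<oplus>\<^bsub>V\<^esub> y) = f x \<oplus>\<^bsub>W\<^esub> f y"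
    and "c \<in> carrier K \<Longrightarrow> x \<in> carrier V \<Longrightarrow> f (c \<odot>\<^bsub>V\<^esub> x) = c \<odot>\<^bsub>W\<^esub> f x"
  using assms by (auto simp: lin_map_def)

lemma alg_homI:
  assumes "f \<in> lin_map K A B"
    and "\<And>x y. x \<in> carrier A \<Longrightarrow> y \<in> carrier A \<Longrightarrow> f (x \<otimes>\<^bsub>A\<^esub> y) = f x \<otimes>\<^bsub>B\<^esub> f y"
    and "f \<one>\<^bsub>A\<^esub> = \<one>\<^bsub>B\<^esub>"
  shows "f \<in> alg_hom K A B"
  using assms by (auto simp: alg_hom_def ring_hom_def lin_map_def)

lemma alg_homD:
  assumes "f \<in> alg_hom K A B"
  shows "f \<in> lin_map K A B"
    and "x \<in> carrier A \<Longrightarrow> y \<in> carrier A \<Longrightarrow> f (x \<otimes>\<^bsub>A\<^esub> y) = f x \<otimes>\<^bsub>B\<^esub> f y"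
    and "f \<one>\<^bsub>A\<^esub> = \<one>\<^bsub>B\<^esub>"
  using assms by (auto simp: alg_hom_def ring_hom_def)

lemma alg_hom_closed: "f \<in> alg_hom K A B \<Longrightarrow> x \<in> carrier A \<Longrightarrow> f x \<in> carrier B"
  by (auto simp: alg_hom_def ring_hom_def)

section \<open>Algebras over a field, finite sums and images\<close>

lemma (in assoc_algebra) assoc_algebra: "assoc_algebra K A"
  by unfold_locales

lemma (in assoc_algebra) smult_eq_mult_one:
  "c \<in> carrier K \<Longrightarrow> x \<in> carrier A \<Longrightarrow> c \<odot>\<^bsub>A\<^esub> x = (c \<odot>\<^bsub>A\<^esub> \<one>\<^bsub>A\<^esub>) \<otimes>\<^bsub>A\<^esub> x"
  by (simp add: smult_mult_left)

lemma (in assoc_algebra) minus_eq_smult: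
  "x \<in> carrier A \<Longrightarrow> \<ominus>\<^bsub>A\<^esub> x = (\<ominus>\<^bsub>K\<^esub> \<one>\<^bsub>K\<^esub>) \<odot>\<^bsub>A\<^esub> x"
  by (simp add: smult_l_minus)

lemma lin_map_zero:
  assumes "assoc_algebra K V" "assoc_algebra K W" "f \<in> lin_map K V W"
  shows "f \<zero>\<^bsub>V\<^esub> = \<zero>\<^bsub>W\<^esub>"
proof -
  interpret V: assoc_algebra K V by fact
  interpret W: assoc_algebra K W by fact
  have "f (\<zero>\<^bsub>K\<^esub> \<odot>\<^bsub>V\<^esub> \<zero>\<^bsub>V\<^esub>) = \<zero>\<^bsub>K\<^esub> \<odot>\<^bsub>W\<^esub> f \<zero>\<^bsub>V\<^esub>"
    by (rule lin_mapD(3)[OF assms(3)]) auto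
  then show ?thesis using lin_mapD(1)[OF assms(3)] by simp
qed

lemma lin_map_minus:
  assumes "assoc_algebra K V" "assoc_algebra K W" "f \<in> lin_map K V W" "x \<in> carrier V" "y \<in> carrier V"
  shows "f (x \<ominus>\<^bsub>V\<^esub> y) = f x \<ominus>\<^bsub>W\<^esub> f y"
proof -
  interpret V: assoc_algebra K V by fact
  interpret W: assoc_algebra K W by fact
  show ?thesis
    using assms(4,5) lin_mapD[OF assms(3)]
    by (simp add: a_minus_def V.minus_eq_smult W.minus_eq_smult)
qed

lemma lin_map_finsum:
  assumes "assoc_algebra K V" "assoc_algebra K W" "f \<in> lin_map K V W" "g \<in> F \<rightarrow> carrier V"
  shows "f (\<Oplus>\<^bsub>V\<^esub>i\<in>F. g i) = (\<Oplus>\<^bsub>W\<^esub>i\<in>F. f (g i))"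
proof -
  interpret V: assoc_algebra K V by fact
  interpret W: assoc_algebra K W by fact
  show ?thesis
  proof (cases "finite F")
    case True
    then show ?thesis using assms(4)
    proof (induction F)
      case empty
      then show ?case using lin_map_zero[OF assms(1-3)] by simp
    next
      case (insert i F)
      have "g i \<in> carrier V" "g \<in> F \<rightarrow> carrier V" using insert by auto
      moreover have "(\<lambda>i. f (g i)) \<in> F \<rightarrow> carrier W" "f (g i) \<in> carrier W"
        using calculation lin_mapD(1)[OF assms(3)] by auto
      ultimately show ?case using insert lin_mapD(2)[OF assms(3)]
        by (simp add: V.A.finsum_insert W.A.finsum_insert V.A.finsum_closed)
    qed
  next
    case False
    then show ?thesis using lin_map_zero[OF assms(1-3)] by (simp add: V.A.finsum_infinite W.A.finsum_infinite)
  qed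
qed

lemma finsum_swap:
  assumes "assoc_algebra K W" "finite F" "finite G" "\<And>i j. i \<in> F \<Longrightarrow> j \<in> G \<Longrightarrow> g i j \<in> carrier W"
  shows "(\<Oplus>\<^bsub>W\<^esub>i\<in>F. \<Oplus>\<^bsub>W\<^esub>j\<in>G. g i j) = (\<Oplus>\<^bsub>W\<^esub>j\<in>G. \<Oplus>\<^bsub>W\<^esub>i\<in>F. g i j)"
proof -
  interpret W: assoc_algebra K W by fact
  show ?thesis using assms(2,4)
  proof (induction F)
    case empty
    then show ?case by (simp add: W.A.finsum_zero)
  next
    case (insert i F)
    have 0: "(\<Oplus>\<^bsub>W\<^esub>i\<in>insert i F. g i j) = g i j \<oplus>\<^bsub>W\<^esub> (\<Oplus>\<^bsub>W\<^esub>i\<in>F. g i j)" if "j \<in> G" for j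
      by (rule W.A.finsum_insert) (use insert that in auto)
    have "(\<Oplus>\<^bsub>W\<^esub>j\<in>G. \<Oplus>\<^bsub>W\<^esub>i\<in>insert i F. g i j) = (\<Oplus>\<^bsub>W\<^esub>j\<in>G. g i j \<oplus>\<^bsub>W\<^esub> (\<Oplus>\<^bsub>W\<^esub>i\<in>F. g i j))"
      by (rule W.A.finsum_cong') (use insert in \<open>auto simp: 0\<close>)
    also have "\<dots> = (\<Oplus>\<^bsub>W\<^esub>j\<in>G. g i j) \<oplus>\<^bsub>W\<^esub> (\<Oplus>\<^bsub>W\<^esub>j\<in>G. \<Oplus>\<^bsub>W\<^esub>i\<in>F. g i j)"
      by (rule W.A.finsum_addf) (use insert in auto)
    also have "\<dots> = (\<Oplus>\<^bsub>W\<^esub>j\<in>G. g i j) \<oplus>\<^bsub>W\<^esub> (\<Oplus>\<^bsub>W\<^esub>i\<in>F. \<Oplus>\<^bsub>W\<^esub>j\<in>G. g i j)"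
      using insert by simp
    also have "\<dots> = (\<Oplus>\<^bsub>W\<^esub>i\<in>insert i F. \<Oplus>\<^bsub>W\<^esub>j\<in>G. g i j)"
      by (rule W.A.finsum_insert[symmetric]) (use insert in auto)
    finally show ?case by simp
  qed
qed

text \<open>The algebra axioms are equations between values of \<open>p\<close> and so come from
  \<open>A\<close>; negatives are images of negatives. Every quotient algebra obtains its structure
  and its projection from this lemma.\<close>

lemma assoc_algebra_image:
  assumes "assoc_algebra K A"
    and car: "carrier B = p ` carrier A"
    and padd: "\<And>x y. x \<in> carrier A \<Longrightarrow> y \<in> carrier A \<Longrightarrow> p (x \<oplus>\<^bsub>A\<^esub> y) = p x \<oplus>\<^bsub>B\<^esub> p y"
    and pmult: "\<And>x y. x \<in> carrier A \<Longrightarrow> y \<in> carrier A \<Longrightarrow> p (x \<otimes>\<^bsub>A\<^esub> y) = p x \<otimes>\<^bsub>B\<^esub> p y"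
    and psmult: "\<And>c x. c \<in> carrier K \<Longrightarrow> x \<in> carrier A \<Longrightarrow> p (c \<odot>\<^bsub>A\<^esub> x) = c \<odot>\<^bsub>B\<^esub> p x"
    and pone: "p \<one>\<^bsub>A\<^esub> = \<one>\<^bsub>B\<^esub>" and pzero: "p \<zero>\<^bsub>A\<^esub> = \<zero>\<^bsub>B\<^esub>"
  shows "assoc_algebra K B" and "p \<in> alg_hom K A B"
proof -
  interpret A: assoc_algebra K A by fact
  note ps = padd[symmetric] pmult[symmetric] psmult[symmetric] pone[symmetric] pzero[symmetric]
  have ag: "abelian_group B"
  proof (rule abelian_groupI)
    fix x assume "x \<in> carrier B"
    then obtain a where a: "a \<in> carrier A" "x = p a" using car by auto
    then have "p (\<ominus>\<^bsub>A\<^esub> a) \<oplus>\<^bsub>B\<^esub> x = \<zero>\<^bsub>B\<^esub>"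
      by (simp add: ps A.A.l_neg)
    then show "\<exists>y\<in>carrier B. y \<oplus>\<^bsub>B\<^esub> x = \<zero>\<^bsub>B\<^esub>" using a car by auto
  qed (auto simp: car ps A.A.a_ac)
  have rg: "ring B"
  proof (rule ringI[OF ag])
    show "Group.monoid B"
      by (rule monoidI) (auto simp: car ps A.A.m_assoc)
  qed (auto simp: car ps A.A.l_distr A.A.r_distr)
  have md: "module K B"
    by (rule moduleI) (auto simp: car ps A.smult_l_distr A.smult_r_distr A.smult_assoc1 A.K.is_cring ag)
  show "assoc_algebra K B"
    by (intro assoc_algebra.intro rg md A.K.field_axioms assoc_algebra_axioms.intro)
      (auto simp: car ps A.smult_mult_left A.smult_mult_right)
  show "p \<in> alg_hom K A B"
    by (intro alg_homI lin_mapI) (auto simp: assms)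
qed

lemma assoc_algebra_base:
  assumes "field K"
  shows "assoc_algebra K (base_algebra K)"
proof -
  interpret K: field K by fact
  have "abelian_group (base_algebra K)"
    by (rule abelian_groupI) (auto simp: base_algebra_def K.a_ac K.add.l_inv_ex)
  moreover have "Group.monoid (base_algebra K)"
    by (rule monoidI) (auto simp: base_algebra_def K.m_assoc)
  ultimately have "ring (base_algebra K)"
    by (intro ringI) (auto simp: base_algebra_def K.l_distr K.r_distr)
  moreover have "module K (base_algebra K)"
    by (rule moduleI) (use \<open>abelian_group _\<close> in \<open>auto simp: base_algebra_def K.l_distr K.r_distr K.m_assoc K.is_cring\<close>)
  ultimately show ?thesis
    by (intro assoc_algebra.intro K.field_axioms assoc_algebra_axioms.intro)
      (auto simp: base_algebra_def K.m_assoc K.m_lcomm)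
qed

subsection \<open>Monoid algebras\<close>

locale monoid_over_field = K?: field K + M?: monoid M
  for K :: "'k ring" and M :: "('g, 'm) monoid_scheme"
begin

abbreviation "F \<equiv> monoid_algebra K M"
abbreviation "e \<equiv> basis_elt K"

lemma F_carrier:
  "f \<in> carrier F \<longleftrightarrow> (\<forall>x. f x \<in> carrier K) \<and> finite {x. f x \<noteq> \<zero>\<^bsub>K\<^esub>} \<and> {x. f x \<noteq> \<zero>\<^bsub>K\<^esub>} \<subseteq> carrier M"
  by (auto simp: monoid_algebra_def)

lemma F_ops:
  "f \<oplus>\<^bsub>F\<^esub> g = (\<lambda>x. f x \<oplus>\<^bsub>K\<^esub> g x)" "c \<odot>\<^bsub>F\<^esub> f = (\<lambda>x. c \<otimes>\<^bsub>K\<^esub> f x)" "\<zero>\<^bsub>F\<^esub> = (\<lambda>x. \<zero>\<^bsub>K\<^esub>)"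
  by (auto simp: monoid_algebra_def)

lemma F_one: "\<one>\<^bsub>F\<^esub> = e \<one>\<^bsub>M\<^esub>"
  by (auto simp: monoid_algebra_def basis_elt_def)

lemma e_closed [simp]: "u \<in> carrier M \<Longrightarrow> e u \<in> carrier F"
  by (auto simp: F_carrier basis_elt_def)

lemma F_val [simp]: "f \<in> carrier F \<Longrightarrow> f x \<in> carrier K"
  by (auto simp: F_carrier)

lemma F_add_closed [simp]: "f \<in> carrier F \<Longrightarrow> g \<in> carrier F \<Longrightarrow> f \<oplus>\<^bsub>F\<^esub> g \<in> carrier F"
proof -
  assume a: "f \<in> carrier F" "g \<in> carrier F"
  have "{x. f x \<oplus>\<^bsub>K\<^esub> g x \<noteq> \<zero>\<^bsub>K\<^esub>} \<subseteq> {x. f x \<noteq> \<zero>\<^bsub>K\<^esub>} \<union> {x. g x \<noteq> \<zero>\<^bsub>K\<^esub>}" by auto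
  moreover have "finite ({x. f x \<noteq> \<zero>\<^bsub>K\<^esub>} \<union> {x. g x \<noteq> \<zero>\<^bsub>K\<^esub>})" using a by (simp add: F_carrier)
  ultimately show ?thesis using a unfolding F_carrier F_ops
    by (auto dest: finite_subset)
qed

lemma F_smult_closed [simp]: "c \<in> carrier K \<Longrightarrow> f \<in> carrier F \<Longrightarrow> c \<odot>\<^bsub>F\<^esub> f \<in> carrier F"
proof -
  assume a: "c \<in> carrier K" "f \<in> carrier F"
  have "{x. c \<otimes>\<^bsub>K\<^esub> f x \<noteq> \<zero>\<^bsub>K\<^esub>} \<subseteq> {x. f x \<noteq> \<zero>\<^bsub>K\<^esub>}" using a by auto
  then show ?thesis using a unfolding F_carrier F_ops
    by (auto dest: finite_subset)
qed

text \<open>The support is emptied one point at a time. Scalar multiples belong to the basis case,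
  so the zero function arises as the case \<open>c = 0\<close>.\<close>

lemma F_induct [consumes 1, case_names add basis]:
  assumes f: "f \<in> carrier F"
    and add: "\<And>f g. f \<in> carrier F \<Longrightarrow> g \<in> carrier F \<Longrightarrow> P f \<Longrightarrow> P g \<Longrightarrow> P (f \<oplus>\<^bsub>F\<^esub> g)"
    and basis: "\<And>c u. c \<in> carrier K \<Longrightarrow> u \<in> carrier M \<Longrightarrow> P (c \<odot>\<^bsub>F\<^esub> e u)"
  shows "P f"
proof -
  have "finite N \<Longrightarrow> (\<forall>f\<in>carrier F. {x. f x \<noteq> \<zero>\<^bsub>K\<^esub>} = N \<longrightarrow> P f)" for N
  proof (induction N rule: finite_induct)
    case empty
    have "\<zero>\<^bsub>K\<^esub> \<odot>\<^bsub>F\<^esub> e \<one>\<^bsub>M\<^esub> = (\<lambda>x. \<zero>\<^bsub>K\<^esub>)" by (auto simp: F_ops basis_elt_def)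
    then have "P (\<lambda>x. \<zero>\<^bsub>K\<^esub>)" using basis[of "\<zero>\<^bsub>K\<^esub>" "\<one>\<^bsub>M\<^esub>"] by simp
    moreover have "f = (\<lambda>x. \<zero>\<^bsub>K\<^esub>)" if "{x. f x \<noteq> \<zero>\<^bsub>K\<^esub>} = {}" for f :: "'g \<Rightarrow> 'k" using that by auto
    ultimately show ?case by blast
  next
    case (insert u N)
    show ?case
    proof (intro ballI impI)
      fix f assume f: "f \<in> carrier F" and s: "{x. f x \<noteq> \<zero>\<^bsub>K\<^esub>} = insert u N"
      define g where "g = f(u := \<zero>\<^bsub>K\<^esub>)"
      have gs: "{x. g x \<noteq> \<zero>\<^bsub>K\<^esub>} = N" using s insert.hyps by (auto simp: g_def)
      have u: "u \<in> carrier M" using f s by (auto simp: F_carrier)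
      have g: "g \<in> carrier F"
        unfolding F_carrier gs using f s insert.hyps by (auto simp: g_def F_carrier)
      have "f = (f u \<odot>\<^bsub>F\<^esub> e u) \<oplus>\<^bsub>F\<^esub> g"
        using f g by (auto simp: F_ops g_def basis_elt_def fun_eq_iff)
      moreover have "P g" using insert.IH g gs by blast
      ultimately show "P f" using add[of "f u \<odot>\<^bsub>F\<^esub> e u" g] basis[of "f u" u] f g u by simp
    qed
  qed
  then show ?thesis using f by (auto simp: F_carrier)
qed

lemma F_abelian_group: "abelian_group F"
proof (rule abelian_groupI)
  fix f assume f: "f \<in> carrier F"
  have "(\<ominus>\<^bsub>K\<^esub> \<one>\<^bsub>K\<^esub>) \<odot>\<^bsub>F\<^esub> f \<oplus>\<^bsub>F\<^esub> f = \<zero>\<^bsub>F\<^esub>"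
    using f by (auto simp: F_ops fun_eq_iff K.l_minus K.l_neg)
  then show "\<exists>g\<in>carrier F. g \<oplus>\<^bsub>F\<^esub> f = \<zero>\<^bsub>F\<^esub>"
    using f by (intro bexI[of _ "(\<ominus>\<^bsub>K\<^esub> \<one>\<^bsub>K\<^esub>) \<odot>\<^bsub>F\<^esub> f"]) auto
qed (auto simp: F_ops fun_eq_iff K.a_ac, simp add: F_ops[symmetric], simp add: F_carrier)

lemma F_module: "module K F"
  by (rule moduleI)
    (auto simp: F_abelian_group K.is_cring F_ops fun_eq_iff K.l_distr K.r_distr K.m_assoc, simp add: F_ops[symmetric])

text \<open>The convolution sum runs over a set that depends on \<open>x\<close> and on both
  supports. Over a fixed rectangle \<open>Z \<times> Y\<close> containing the supports, the sums for
  different functions share one index set and can be compared term by term.\<close>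

lemma F_mult_alt:
  assumes f: "f \<in> carrier F" and g: "g \<in> carrier F"
    and Z: "finite Z" "{x. f x \<noteq> \<zero>\<^bsub>K\<^esub>} \<subseteq> Z" and Y: "finite Y" "{x. g x \<noteq> \<zero>\<^bsub>K\<^esub>} \<subseteq> Y"
  shows "(f \<otimes>\<^bsub>F\<^esub> g) x =
    (\<Oplus>\<^bsub>K\<^esub>p\<in>Z \<times> Y. if fst p \<otimes>\<^bsub>M\<^esub> snd p = x then f (fst p) \<otimes>\<^bsub>K\<^esub> g (snd p) else \<zero>\<^bsub>K\<^esub>)"
  unfolding monoid_algebra_def monoid.simps
  by (rule K.add.finprod_mono_neutral_cong_left) (use assms in auto)

lemma F_mult_closed [simp]:
  assumes f: "f \<in> carrier F" and g: "g \<in> carrier F"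
  shows "f \<otimes>\<^bsub>F\<^esub> g \<in> carrier F"
proof -
  let ?Z = "{x. f x \<noteq> \<zero>\<^bsub>K\<^esub>}" and ?Y = "{x. g x \<noteq> \<zero>\<^bsub>K\<^esub>}"
  have fin: "finite ?Z" "finite ?Y" and sub: "?Z \<subseteq> carrier M" "?Y \<subseteq> carrier M"
    using f g by (auto simp: F_carrier)
  note alt = F_mult_alt[OF f g fin(1) subset_refl fin(2) subset_refl]
  have s: "{x. (f \<otimes>\<^bsub>F\<^esub> g) x \<noteq> \<zero>\<^bsub>K\<^esub>} \<subseteq> (\<lambda>p. fst p \<otimes>\<^bsub>M\<^esub> snd p) ` (?Z \<times> ?Y)"
  proof (rule subsetI, rule ccontr)
    fix x assume x: "x \<in> {x. (f \<otimes>\<^bsub>F\<^esub> g) x \<noteq> \<zero>\<^bsub>K\<^esub>}" and nx: "x \<notin> (\<lambda>p. fst p \<otimes>\<^bsub>M\<^esub> snd p) ` (?Z \<times> ?Y)"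
    have "(f \<otimes>\<^bsub>F\<^esub> g) x = \<zero>\<^bsub>K\<^esub>" unfolding alt
      by (rule K.add.finprod_one_eqI) (use nx in auto)
    with x show False by simp
  qed
  moreover have "(f \<otimes>\<^bsub>F\<^esub> g) x \<in> carrier K" for x
    unfolding alt by (rule K.add.finprod_closed) (use f g in auto)
  moreover have "(\<lambda>p. fst p \<otimes>\<^bsub>M\<^esub> snd p) ` (?Z \<times> ?Y) \<subseteq> carrier M"
    using sub by (clarsimp simp del: mem_Collect_eq, blast intro: M.m_closed)
  moreover have "finite ((\<lambda>p. fst p \<otimes>\<^bsub>M\<^esub> snd p) ` (?Z \<times> ?Y))" using fin by blast
  ultimately show ?thesis unfolding F_carrier using finite_subset[OF s] by (auto dest: order_trans[OF s])
qed

lemma F_distr: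
  assumes f: "f \<in> carrier F" and g: "g \<in> carrier F" and h: "h \<in> carrier F"
  shows "(f \<oplus>\<^bsub>F\<^esub> g) \<otimes>\<^bsub>F\<^esub> h = (f \<otimes>\<^bsub>F\<^esub> h) \<oplus>\<^bsub>F\<^esub> (g \<otimes>\<^bsub>F\<^esub> h)"
    and "h \<otimes>\<^bsub>F\<^esub> (f \<oplus>\<^bsub>F\<^esub> g) = (h \<otimes>\<^bsub>F\<^esub> f) \<oplus>\<^bsub>F\<^esub> (h \<otimes>\<^bsub>F\<^esub> g)"
proof -
  let ?Z = "{x. f x \<noteq> \<zero>\<^bsub>K\<^esub>} \<union> {x. g x \<noteq> \<zero>\<^bsub>K\<^esub>} \<union> {x. h x \<noteq> \<zero>\<^bsub>K\<^esub>}"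
  have fin: "finite ?Z" using assms by (auto simp: F_carrier)
  have fg: "f \<oplus>\<^bsub>F\<^esub> g \<in> carrier F" using assms by simp
  have sup: "{x. f x \<noteq> \<zero>\<^bsub>K\<^esub>} \<subseteq> ?Z" "{x. g x \<noteq> \<zero>\<^bsub>K\<^esub>} \<subseteq> ?Z" "{x. h x \<noteq> \<zero>\<^bsub>K\<^esub>} \<subseteq> ?Z"
    "{x. (f \<oplus>\<^bsub>F\<^esub> g) x \<noteq> \<zero>\<^bsub>K\<^esub>} \<subseteq> ?Z" by (auto simp: F_ops)
  note alt = F_mult_alt[OF _ _ fin _ fin]
  show "(f \<oplus>\<^bsub>F\<^esub> g) \<otimes>\<^bsub>F\<^esub> h = (f \<otimes>\<^bsub>F\<^esub> h) \<oplus>\<^bsub>F\<^esub> (g \<otimes>\<^bsub>F\<^esub> h)"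
    unfolding F_ops(1)[of "f \<otimes>\<^bsub>F\<^esub> h"] alt[OF fg h sup(4,3)] alt[OF f h sup(1,3)] alt[OF g h sup(2,3)]
  proof
    fix x
    have "(\<Oplus>\<^bsub>K\<^esub>p\<in>?Z \<times> ?Z. if fst p \<otimes>\<^bsub>M\<^esub> snd p = x then (f \<oplus>\<^bsub>F\<^esub> g) (fst p) \<otimes>\<^bsub>K\<^esub> h (snd p) else \<zero>\<^bsub>K\<^esub>)
      = (\<Oplus>\<^bsub>K\<^esub>p\<in>?Z \<times> ?Z. (if fst p \<otimes>\<^bsub>M\<^esub> snd p = x then f (fst p) \<otimes>\<^bsub>K\<^esub> h (snd p) else \<zero>\<^bsub>K\<^esub>) \<oplus>\<^bsub>K\<^esub>
          (if fst p \<otimes>\<^bsub>M\<^esub> snd p = x then g (fst p) \<otimes>\<^bsub>K\<^esub> h (snd p) else \<zero>\<^bsub>K\<^esub>))"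
      by (rule K.finsum_cong') (use assms in \<open>auto simp: F_ops K.l_distr\<close>)
    also have "\<dots> = (\<Oplus>\<^bsub>K\<^esub>p\<in>?Z \<times> ?Z. (if fst p \<otimes>\<^bsub>M\<^esub> snd p = x then f (fst p) \<otimes>\<^bsub>K\<^esub> h (snd p) else \<zero>\<^bsub>K\<^esub>)) \<oplus>\<^bsub>K\<^esub>
          (\<Oplus>\<^bsub>K\<^esub>p\<in>?Z \<times> ?Z. (if fst p \<otimes>\<^bsub>M\<^esub> snd p = x then g (fst p) \<otimes>\<^bsub>K\<^esub> h (snd p) else \<zero>\<^bsub>K\<^esub>))"
      by (rule K.finsum_addf) (use assms in auto)
    finally show "(\<Oplus>\<^bsub>K\<^esub>p\<in>?Z \<times> ?Z. if fst p \<otimes>\<^bsub>M\<^esub> snd p = x then (f \<oplus>\<^bsub>F\<^esub> g) (fst p) \<otimes>\<^bsub>K\<^esub> h (snd p) else \<zero>\<^bsub>K\<^esub>) = \<dots>" .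
  qed
  show "h \<otimes>\<^bsub>F\<^esub> (f \<oplus>\<^bsub>F\<^esub> g) = (h \<otimes>\<^bsub>F\<^esub> f) \<oplus>\<^bsub>F\<^esub> (h \<otimes>\<^bsub>F\<^esub> g)"
    unfolding F_ops(1)[of "h \<otimes>\<^bsub>F\<^esub> f"] alt[OF h fg sup(3,4)] alt[OF h f sup(3,1)] alt[OF h g sup(3,2)]
  proof
    fix x
    have "(\<Oplus>\<^bsub>K\<^esub>p\<in>?Z \<times> ?Z. if fst p \<otimes>\<^bsub>M\<^esub> snd p = x then h (fst p) \<otimes>\<^bsub>K\<^esub> (f \<oplus>\<^bsub>F\<^esub> g) (snd p) else \<zero>\<^bsub>K\<^esub>)
      = (\<Oplus>\<^bsub>K\<^esub>p\<in>?Z \<times> ?Z. (if fst p \<otimes>\<^bsub>M\<^esub> snd p = x then h (fst p) \<otimes>\<^bsub>K\<^esub> f (snd p) else \<zero>\<^bsub>K\<^esub>) \<oplus>\<^bsub>K\<^esub>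
          (if fst p \<otimes>\<^bsub>M\<^esub> snd p = x then h (fst p) \<otimes>\<^bsub>K\<^esub> g (snd p) else \<zero>\<^bsub>K\<^esub>))"
      by (rule K.finsum_cong') (use assms in \<open>auto simp: F_ops K.r_distr\<close>)
    also have "\<dots> = (\<Oplus>\<^bsub>K\<^esub>p\<in>?Z \<times> ?Z. (if fst p \<otimes>\<^bsub>M\<^esub> snd p = x then h (fst p) \<otimes>\<^bsub>K\<^esub> f (snd p) else \<zero>\<^bsub>K\<^esub>)) \<oplus>\<^bsub>K\<^esub>
          (\<Oplus>\<^bsub>K\<^esub>p\<in>?Z \<times> ?Z. (if fst p \<otimes>\<^bsub>M\<^esub> snd p = x then h (fst p) \<otimes>\<^bsub>K\<^esub> g (snd p) else \<zero>\<^bsub>K\<^esub>))"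
      by (rule K.finsum_addf) (use assms in auto)
    finally show "(\<Oplus>\<^bsub>K\<^esub>p\<in>?Z \<times> ?Z. if fst p \<otimes>\<^bsub>M\<^esub> snd p = x then h (fst p) \<otimes>\<^bsub>K\<^esub> (f \<oplus>\<^bsub>F\<^esub> g) (snd p) else \<zero>\<^bsub>K\<^esub>) = \<dots>" .
  qed
qed

lemma F_smult_mult:
  assumes c: "c \<in> carrier K" and f: "f \<in> carrier F" and g: "g \<in> carrier F"
  shows "(c \<odot>\<^bsub>F\<^esub> f) \<otimes>\<^bsub>F\<^esub> g = c \<odot>\<^bsub>F\<^esub> (f \<otimes>\<^bsub>F\<^esub> g)" and "f \<otimes>\<^bsub>F\<^esub> (c \<odot>\<^bsub>F\<^esub> g) = c \<odot>\<^bsub>F\<^esub> (f \<otimes>\<^bsub>F\<^esub> g)"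
proof -
  let ?Z = "{x. f x \<noteq> \<zero>\<^bsub>K\<^esub>} \<union> {x. g x \<noteq> \<zero>\<^bsub>K\<^esub>}"
  have fin: "finite ?Z" using assms by (auto simp: F_carrier)
  have cf: "c \<odot>\<^bsub>F\<^esub> f \<in> carrier F" "c \<odot>\<^bsub>F\<^esub> g \<in> carrier F" using assms by auto
  have sup: "{x. f x \<noteq> \<zero>\<^bsub>K\<^esub>} \<subseteq> ?Z" "{x. g x \<noteq> \<zero>\<^bsub>K\<^esub>} \<subseteq> ?Z"
    "{x. (c \<odot>\<^bsub>F\<^esub> f) x \<noteq> \<zero>\<^bsub>K\<^esub>} \<subseteq> ?Z" "{x. (c \<odot>\<^bsub>F\<^esub> g) x \<noteq> \<zero>\<^bsub>K\<^esub>} \<subseteq> ?Z" using c by (auto simp: F_ops)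
  note alt = F_mult_alt[OF _ _ fin _ fin]
  show "(c \<odot>\<^bsub>F\<^esub> f) \<otimes>\<^bsub>F\<^esub> g = c \<odot>\<^bsub>F\<^esub> (f \<otimes>\<^bsub>F\<^esub> g)"
    unfolding F_ops(2)[of c "f \<otimes>\<^bsub>F\<^esub> g"] alt[OF cf(1) g sup(3,2)] alt[OF f g sup(1,2)]
    apply (rule ext, subst K.finsum_rdistr)
    using fin assms by (auto intro!: K.finsum_cong' simp: F_ops K.m_assoc)
  show "f \<otimes>\<^bsub>F\<^esub> (c \<odot>\<^bsub>F\<^esub> g) = c \<odot>\<^bsub>F\<^esub> (f \<otimes>\<^bsub>F\<^esub> g)"
    unfolding F_ops(2)[of c "f \<otimes>\<^bsub>F\<^esub> g"] alt[OF f cf(2) sup(1,4)] alt[OF f g sup(1,2)]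
    apply (rule ext, subst K.finsum_rdistr)
    using fin assms by (auto intro!: K.finsum_cong' simp: F_ops K.m_lcomm)
qed

lemma e_mult: 
  assumes "u \<in> carrier M" "v \<in> carrier M"
  shows "e u \<otimes>\<^bsub>F\<^esub> e v = e (u \<otimes>\<^bsub>M\<^esub> v)"
proof
  fix x
  have sup: "{x. e w x \<noteq> \<zero>\<^bsub>K\<^esub>} \<subseteq> {w}" for w :: 'g by (auto simp: basis_elt_def)
  have "(e u \<otimes>\<^bsub>F\<^esub> e v) x = (\<Oplus>\<^bsub>K\<^esub>p\<in>{u} \<times> {v}. if fst p \<otimes>\<^bsub>M\<^esub> snd p = x then e u (fst p) \<otimes>\<^bsub>K\<^esub> e v (snd p) else \<zero>\<^bsub>K\<^esub>)"
    by (rule F_mult_alt[OF _ _ _ sup _ sup]) (use assms in auto)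
  then show "(e u \<otimes>\<^bsub>F\<^esub> e v) x = e (u \<otimes>\<^bsub>M\<^esub> v) x"
    by (auto simp: basis_elt_def)
qed

text \<open>Both sides are linear in each argument, so three nested inductions reduce the claim to
  basis elements, where it is associativity in the monoid.\<close>

lemma F_assoc:
  assumes f: "f \<in> carrier F" and g: "g \<in> carrier F" and h: "h \<in> carrier F"
  shows "(f \<otimes>\<^bsub>F\<^esub> g) \<otimes>\<^bsub>F\<^esub> h = f \<otimes>\<^bsub>F\<^esub> (g \<otimes>\<^bsub>F\<^esub> h)"
  using f
proof (induction f rule: F_induct)
  case (add f1 f2)
  then show ?case using g h by (simp add: F_distr)
next
  case (basis c u)
  have "(e u \<otimes>\<^bsub>F\<^esub> g) \<otimes>\<^bsub>F\<^esub> h = e u \<otimes>\<^bsub>F\<^esub> (g \<otimes>\<^bsub>F\<^esub> h)"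
    using g
  proof (induction g rule: F_induct)
    case (add f1 f2)
    then show ?case using basis h by (simp add: F_distr)
  next
    case b2: (basis d v)
    have "(e u \<otimes>\<^bsub>F\<^esub> e v) \<otimes>\<^bsub>F\<^esub> h = e u \<otimes>\<^bsub>F\<^esub> (e v \<otimes>\<^bsub>F\<^esub> h)"
      using h
    proof (induction h rule: F_induct)
      case (add f1 f2)
      then show ?case using basis b2 by (simp add: F_distr)
    next
      case (basis a w)
      then show ?case using \<open>u \<in> carrier M\<close> b2 by (simp add: F_smult_mult e_mult M.m_assoc)
    qed
    then show ?case using basis b2 h by (simp add: F_smult_mult)
  qed
  then show ?case using basis g h by (simp add: F_smult_mult)
qed

lemma F_unit:
  assumes f: "f \<in> carrier F"
  shows "\<one>\<^bsub>F\<^esub> \<otimes>\<^bsub>F\<^esub> f = f" "f \<otimes>\<^bsub>F\<^esub> \<one>\<^bsub>F\<^esub> = f"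
  using f by (induction f rule: F_induct) (auto simp: F_distr F_smult_mult F_one e_mult)

lemma assoc_algebra_monoid_algebra: "assoc_algebra K F"
proof -
  have "Group.monoid F"
    by (rule monoidI) (auto simp: F_assoc F_unit, simp add: F_one)
  then have "ring F" by (intro ringI F_abelian_group) (auto simp: F_distr)
  then show ?thesis
    by (intro assoc_algebra.intro K.field_axioms F_module assoc_algebra_axioms.intro) (auto simp: F_smult_mult)
qed

text \<open>As for the product, a larger index set lets the sums of two functions run over the same
  points.\<close>

lemma lin_extend_alt:
  assumes U: "assoc_algebra K U" and \<phi>: "\<And>x. x \<in> carrier M \<Longrightarrow> \<phi> x \<in> carrier U"
    and f: "f \<in> carrier F" and Z: "finite Z" "{x. f x \<noteq> \<zero>\<^bsub>K\<^esub>} \<subseteq> Z" "Z \<subseteq> carrier M"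
  shows "lin_extend K U \<phi> f = (\<Oplus>\<^bsub>U\<^esub>x\<in>Z. f x \<odot>\<^bsub>U\<^esub> \<phi> x)"
proof -
  interpret U: assoc_algebra K U by fact
  show ?thesis unfolding lin_extend_def
    by (rule U.A.add.finprod_mono_neutral_cong_left) (use assms in \<open>auto simp: subset_iff\<close>)
qed

lemma lin_extend_linear:
  assumes U: "assoc_algebra K U" and \<phi>: "\<And>x. x \<in> carrier M \<Longrightarrow> \<phi> x \<in> carrier U"
  shows "lin_extend K U \<phi> \<in> lin_map K F U"
proof -
  interpret U: assoc_algebra K U by fact
  note alt = lin_extend_alt[where \<phi> = \<phi>, OF U \<phi>]
  show ?thesis
  proof (rule lin_mapI)
    fix f assume f: "f \<in> carrier F"
    then show "lin_extend K U \<phi> f \<in> carrier U" unfolding lin_extend_def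
      by (intro U.A.finsum_closed) (auto simp: \<phi> F_carrier)
    fix g assume g: "g \<in> carrier F"
    let ?Z = "{x. f x \<noteq> \<zero>\<^bsub>K\<^esub>} \<union> {x. g x \<noteq> \<zero>\<^bsub>K\<^esub>}"
    have Z: "finite ?Z" "?Z \<subseteq> carrier M" using f g by (auto simp: F_carrier)
    show "lin_extend K U \<phi> (f \<oplus>\<^bsub>F\<^esub> g) = lin_extend K U \<phi> f \<oplus>\<^bsub>U\<^esub> lin_extend K U \<phi> g" (is "?l = ?r")
    proof -
    have "?l = (\<Oplus>\<^bsub>U\<^esub>x\<in>?Z. (f \<oplus>\<^bsub>F\<^esub> g) x \<odot>\<^bsub>U\<^esub> \<phi> x)"
      by (rule alt) (use Z f g in \<open>auto simp: F_ops(1,3)\<close>, simp_all add: F_ops[symmetric])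
    also have "\<dots> = (\<Oplus>\<^bsub>U\<^esub>x\<in>?Z. f x \<odot>\<^bsub>U\<^esub> \<phi> x \<oplus>\<^bsub>U\<^esub> g x \<odot>\<^bsub>U\<^esub> \<phi> x)"
      by (rule U.A.finsum_cong') (use Z f g \<phi> in \<open>auto simp: F_ops U.smult_l_distr subset_iff\<close>)
    also have "\<dots> = (\<Oplus>\<^bsub>U\<^esub>x\<in>?Z. f x \<odot>\<^bsub>U\<^esub> \<phi> x) \<oplus>\<^bsub>U\<^esub> (\<Oplus>\<^bsub>U\<^esub>x\<in>?Z. g x \<odot>\<^bsub>U\<^esub> \<phi> x)"
      by (rule U.A.finsum_addf) (use Z f g \<phi> in \<open>auto simp: subset_iff\<close>)
    also have "\<dots> = ?r"
      using alt[of f ?Z] alt[of g ?Z] f g Z by auto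
    finally show ?thesis .
    qed
  next
    fix c f assume c: "c \<in> carrier K" and f: "f \<in> carrier F"
    let ?Z = "{x. f x \<noteq> \<zero>\<^bsub>K\<^esub>}"
    have Z: "finite ?Z" "?Z \<subseteq> carrier M" using f by (auto simp: F_carrier)
    have "lin_extend K U \<phi> (c \<odot>\<^bsub>F\<^esub> f) = (\<Oplus>\<^bsub>U\<^esub>x\<in>?Z. (c \<odot>\<^bsub>F\<^esub> f) x \<odot>\<^bsub>U\<^esub> \<phi> x)"
      by (rule alt) (use Z f c in \<open>auto simp: F_ops(2)\<close>, simp_all add: F_ops[symmetric])
    also have "\<dots> = (\<Oplus>\<^bsub>U\<^esub>x\<in>?Z. c \<odot>\<^bsub>U\<^esub> (f x \<odot>\<^bsub>U\<^esub> \<phi> x))"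
      by (rule U.A.finsum_cong') (use Z f c \<phi> in \<open>auto simp: F_ops U.smult_assoc1 subset_iff\<close>)
    also have "\<dots> = c \<odot>\<^bsub>U\<^esub> (\<Oplus>\<^bsub>U\<^esub>x\<in>?Z. f x \<odot>\<^bsub>U\<^esub> \<phi> x)"
      by (rule U.finsum_smult_ldistr[symmetric]) (use Z f c \<phi> in \<open>auto simp: subset_iff\<close>)
    finally show "lin_extend K U \<phi> (c \<odot>\<^bsub>F\<^esub> f) = c \<odot>\<^bsub>U\<^esub> lin_extend K U \<phi> f"
      by (simp add: lin_extend_def)
  qed
qed

lemma lin_extend_basis:
  assumes U: "assoc_algebra K U" and \<phi>: "\<phi> u \<in> carrier U"
  shows "lin_extend K U \<phi> (e u) = \<phi> u"
proof -
  interpret U: assoc_algebra K U by fact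
  have "{x. e u x \<noteq> \<zero>\<^bsub>K\<^esub>} = {u}" by (auto simp: basis_elt_def)
  then show ?thesis using \<phi> by (simp add: lin_extend_def basis_elt_def)
qed

lemma lin_extend_alg_hom:
  assumes U: "assoc_algebra K U" and \<phi>: "\<And>x. x \<in> carrier M \<Longrightarrow> \<phi> x \<in> carrier U"
    and m: "\<And>x y. x \<in> carrier M \<Longrightarrow> y \<in> carrier M \<Longrightarrow> \<phi> (x \<otimes>\<^bsub>M\<^esub> y) = \<phi> x \<otimes>\<^bsub>U\<^esub> \<phi> y"
    and o: "\<phi> \<one>\<^bsub>M\<^esub> = \<one>\<^bsub>U\<^esub>"
  shows "lin_extend K U \<phi> \<in> alg_hom K F U"
proof -
  interpret U: assoc_algebra K U by fact
  note lin = lin_extend_linear[OF U \<phi>]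
  note lD = lin_mapD[OF lin]
  have eb: "u \<in> carrier M \<Longrightarrow> lin_extend K U \<phi> (e u) = \<phi> u" for u
    by (rule lin_extend_basis) (auto simp: U \<phi>)
  show ?thesis
  proof (rule alg_homI[OF lin])
    fix f g assume f: "f \<in> carrier F" and g: "g \<in> carrier F"
    show "lin_extend K U \<phi> (f \<otimes>\<^bsub>F\<^esub> g) = lin_extend K U \<phi> f \<otimes>\<^bsub>U\<^esub> lin_extend K U \<phi> g"
      using f
    proof (induction f rule: F_induct)
      case (add f1 f2)
      then show ?case using g by (simp add: F_distr lD U.A.l_distr)
    next
      case (basis c u)
      have "lin_extend K U \<phi> (e u \<otimes>\<^bsub>F\<^esub> g) = \<phi> u \<otimes>\<^bsub>U\<^esub> lin_extend K U \<phi> g"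
        using g
      proof (induction g rule: F_induct)
        case (add f1 f2)
        then show ?case using basis \<phi> by (simp add: F_distr lD U.A.r_distr)
      next
        case b2: (basis d v)
        then show ?case using basis \<phi> by (simp add: F_smult_mult lD e_mult eb m U.smult_mult_right)
      qed
      then show ?case using basis g \<phi> by (simp add: F_smult_mult lD eb U.smult_mult_left)
    qed
  next
    show "lin_extend K U \<phi> \<one>\<^bsub>F\<^esub> = \<one>\<^bsub>U\<^esub>"
      by (simp add: F_one eb o)
  qed
qed

end

subsection \<open>Quotient algebras\<close>

locale algebra_ideal = assoc_algebra K A + N?: ideal N A
  for K :: "'k ring" and A :: "('k, 'a) module" and N
begin

abbreviation "B \<equiv> quotient_algebra A N"
abbreviation pr where "pr x \<equiv> N +>\<^bsub>A\<^esub> x"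

lemma pr_eq_iff:
  "x \<in> carrier A \<Longrightarrow> y \<in> carrier A \<Longrightarrow> pr x = pr y \<longleftrightarrow> x \<ominus>\<^bsub>A\<^esub> y \<in> N"
  using quotient_eq_iff_same_a_r_cos[OF N.ideal_axioms] by blast

text \<open>A scalar acts as multiplication by the ring element \<open>c 1\<close>, so a ring ideal
  is also a subspace.\<close>

lemma smult_ideal: "c \<in> carrier K \<Longrightarrow> x \<in> N \<Longrightarrow> c \<odot>\<^bsub>A\<^esub> x \<in> N"
  by (subst smult_eq_mult_one) (auto intro: N.I_l_closed)

text \<open>The scalar multiple of a coset is defined as a union over its representatives. These
  differ by elements of \<open>N\<close>, which is closed under scalars, so all sets in the union
  are the same coset.\<close>

lemma pr_smult:
  assumes c: "c \<in> carrier K" and x: "x \<in> carrier A"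
  shows "pr (c \<odot>\<^bsub>A\<^esub> x) = c \<odot>\<^bsub>B\<^esub> pr x"
proof -
  have "pr (c \<odot>\<^bsub>A\<^esub> y) = pr (c \<odot>\<^bsub>A\<^esub> x)" if y: "y \<in> pr x" for y
  proof -
    have yA: "y \<in> carrier A" by (rule N.a_elemrcos_carrier[OF x y])
    have "pr y = pr x" by (rule N.a_repr_independence'[OF y x, symmetric])
    then have "y \<ominus>\<^bsub>A\<^esub> x \<in> N" by (simp only: pr_eq_iff[OF yA x])
    then have "c \<odot>\<^bsub>A\<^esub> (y \<ominus>\<^bsub>A\<^esub> x) \<in> N" by (rule smult_ideal[OF c])
    moreover have "c \<odot>\<^bsub>A\<^esub> (y \<ominus>\<^bsub>A\<^esub> x) = c \<odot>\<^bsub>A\<^esub> y \<ominus>\<^bsub>A\<^esub> c \<odot>\<^bsub>A\<^esub> x"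
      using c x yA by (simp add: a_minus_def smult_r_distr smult_r_minus)
    ultimately show ?thesis using pr_eq_iff[of "c \<odot>\<^bsub>A\<^esub> y" "c \<odot>\<^bsub>A\<^esub> x"] c x yA by auto
  qed
  moreover have "x \<in> pr x" using x by (simp add: N.a_rcos_self)
  ultimately have "(\<Union>y\<in>pr x. pr (c \<odot>\<^bsub>A\<^esub> y)) = pr (c \<odot>\<^bsub>A\<^esub> x)" by blast
  then show ?thesis by (simp add: quotient_algebra_def)
qed

lemma quotient_facts:
  shows assoc_algebra_quotient: "assoc_algebra K B" and pr_hom: "pr \<in> alg_hom K A B"
    and carrier_quotient: "carrier B = pr ` carrier A"
proof -
  show c: "carrier B = pr ` carrier A"
    by (auto simp: quotient_algebra_def FactRing_def A_RCOSETS_defs a_r_coset_def r_coset_def)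
  note * = assoc_algebra_image[of K A B pr, OF assoc_algebra c]
  have 0: "pr \<zero>\<^bsub>A\<^esub> = \<zero>\<^bsub>B\<^esub>" and 1: "pr \<one>\<^bsub>A\<^esub> = \<one>\<^bsub>B\<^esub>"
    by (simp_all add: quotient_algebra_def FactRing_def N.a_rcos_const)
  have 2: "pr (x \<oplus>\<^bsub>A\<^esub> y) = pr x \<oplus>\<^bsub>B\<^esub> pr y" "pr (x \<otimes>\<^bsub>A\<^esub> y) = pr x \<otimes>\<^bsub>B\<^esub> pr y"
    if "x \<in> carrier A" "y \<in> carrier A" for x y
    using that by (simp_all add: quotient_algebra_def FactRing_def N.rcoset_mult_add N.a_rcos_sum)
  show "assoc_algebra K B" "pr \<in> alg_hom K A B"
    by (rule *; (rule 0 1 2 pr_smult; assumption)?)+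
qed

lemma coset_rep:
  assumes x: "x \<in> carrier A"
  shows "(SOME f. f \<in> pr x) \<in> carrier A" "pr (SOME f. f \<in> pr x) = pr x"
proof -
  have "x \<in> pr x" using x by (simp add: N.a_rcos_self)
  then have *: "(SOME f. f \<in> pr x) \<in> pr x" by (rule someI)
  then show "(SOME f. f \<in> pr x) \<in> carrier A" by (rule N.a_elemrcos_carrier[OF x])
  show "pr (SOME f. f \<in> pr x) = pr x" by (rule N.a_repr_independence'[OF * x, symmetric])
qed

text \<open>Two representatives of a coset differ by an element of \<open>N\<close>, which
  \<open>f\<close> kills. The lift is spelled out as the value at a chosen representative because
  \<open>tensor_lift\<close> is defined in this way.\<close>

lemma quotient_lift:
  assumes U: "assoc_algebra K U" and f: "f \<in> lin_map K A U" and z: "\<And>n. n \<in> N \<Longrightarrow> f n = \<zero>\<^bsub>U\<^esub>"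
  defines "g \<equiv> (\<lambda>Z. f (SOME x. x \<in> Z))"
  shows "x \<in> carrier A \<Longrightarrow> g (pr x) = f x" and "g \<in> lin_map K B U"
    and "f \<in> alg_hom K A U \<Longrightarrow> g \<in> alg_hom K B U"
proof -
  interpret U: assoc_algebra K U by fact
  note fD = lin_mapD[OF f] and pD = lin_mapD[OF alg_homD(1)[OF pr_hom]]
  show 1: "g (pr x) = f x" if x: "x \<in> carrier A" for x
  proof -
    let ?y = "SOME f. f \<in> pr x"
    note y = coset_rep[OF x]
    have "?y \<ominus>\<^bsub>A\<^esub> x \<in> N" using pr_eq_iff[OF y(1) x] y(2) by blast
    then have "f (?y \<ominus>\<^bsub>A\<^esub> x) = \<zero>\<^bsub>U\<^esub>" by (rule z)
    then have "f ?y \<ominus>\<^bsub>U\<^esub> f x = \<zero>\<^bsub>U\<^esub>"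
      using lin_map_minus[OF assoc_algebra U f y(1) x] by simp
    then show ?thesis unfolding g_def using y x fD(1) U.A.r_right_minus_eq by blast
  qed
  show 2: "g \<in> lin_map K B U"
    by (rule lin_mapI; unfold carrier_quotient; clarify?)
      (auto simp: 1 fD pD(2,3)[symmetric])
  show "g \<in> alg_hom K B U" if "f \<in> alg_hom K A U"
  proof (rule alg_homI[OF 2]; (unfold carrier_quotient)?)
    show "g \<one>\<^bsub>B\<^esub> = \<one>\<^bsub>U\<^esub>"
      using alg_homD(3)[OF that] alg_homD(3)[OF pr_hom] 1[OF A.one_closed] by simp
  qed (auto simp: alg_homD(2)[OF pr_hom, symmetric] 1 alg_homD(2)[OF that])
qed

end

subsection \<open>Tensor products\<close>

lemma lin_span_induct:
  assumes V: "assoc_algebra K V" and Y: "Y \<subseteq> carrier V" and x: "x \<in> lin_span K V Y"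
    and "\<And>y. y \<in> Y \<Longrightarrow> P y" "P \<zero>\<^bsub>V\<^esub>"
    and "\<And>x y. x \<in> carrier V \<Longrightarrow> y \<in> carrier V \<Longrightarrow> P x \<Longrightarrow> P y \<Longrightarrow> P (x \<oplus>\<^bsub>V\<^esub> y)"
    and "\<And>c x. c \<in> carrier K \<Longrightarrow> x \<in> carrier V \<Longrightarrow> P x \<Longrightarrow> P (c \<odot>\<^bsub>V\<^esub> x)"
  shows "x \<in> carrier V \<and> P x"
proof -
  interpret V: assoc_algebra K V by fact
  have "submodule {x \<in> carrier V. P x} K V"
    by (rule V.submoduleI) (auto simp: assms V.minus_eq_smult)
  moreover have "Y \<subseteq> {x \<in> carrier V. P x}" using assms by auto
  ultimately show ?thesis using x unfolding lin_span_def by blast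
qed

lemma submodule_lin_span:
  assumes V: "assoc_algebra K V" and Y: "Y \<subseteq> carrier V"
  shows "submodule (lin_span K V Y) K V" and "Y \<subseteq> lin_span K V Y" and "lin_span K V Y \<subseteq> carrier V"
proof -
  interpret V: assoc_algebra K V by fact
  show "Y \<subseteq> lin_span K V Y" by (auto simp: lin_span_def)
  show sub: "lin_span K V Y \<subseteq> carrier V"
    using V.carrier_is_submodule Y by (auto simp: lin_span_def)
  show "submodule (lin_span K V Y) K V"
  proof (rule V.submoduleI[OF sub])
    show "\<zero>\<^bsub>V\<^esub> \<in> lin_span K V Y"
      unfolding lin_span_def using subgroup.one_closed submodule.axioms(1) by fastforce
  qed (auto simp: lin_span_def dest: V.submoduleE)
qed

definition bilin ::
  "'k ring \<Rightarrow> ('k, 'v) module \<Rightarrow> ('k, 'w) module \<Rightarrow> ('k, 'u) module \<Rightarrow> ('v \<Rightarrow> 'w \<Rightarrow> 'u) \<Rightarrow> bool" where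
  "bilin K V W U \<beta> \<longleftrightarrow> (\<forall>v\<in>carrier V. (\<lambda>w. \<beta> v w) \<in> lin_map K W U) \<and>
     (\<forall>w\<in>carrier W. (\<lambda>v. \<beta> v w) \<in> lin_map K V U)"

lemma bilinI:
  assumes "\<And>v. v \<in> carrier V \<Longrightarrow> (\<lambda>w. \<beta> v w) \<in> lin_map K W U"
    and "\<And>w. w \<in> carrier W \<Longrightarrow> (\<lambda>v. \<beta> v w) \<in> lin_map K V U"
  shows "bilin K V W U (\<lambda>v w. \<beta> v w)"
  using assms by (auto simp: bilin_def)

lemma bilinD:
  assumes "bilin K V W U \<beta>"
  shows "v \<in> carrier V \<Longrightarrow> (\<lambda>w. \<beta> v w) \<in> lin_map K W U"
    and "w \<in> carrier W \<Longrightarrow> (\<lambda>v. \<beta> v w) \<in> lin_map K V U"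
  using assms by (auto simp: bilin_def)

lemma bilin_closed:
  "bilin K V W U \<beta> \<Longrightarrow> v \<in> carrier V \<Longrightarrow> w \<in> carrier W \<Longrightarrow> \<beta> v w \<in> carrier U"
  using lin_mapD(1)[OF bilinD(1)] by fast

locale two_algebras = V: assoc_algebra K V + W: assoc_algebra K W
  for K :: "'k ring" and V :: "('k, 'v) module" and W :: "('k, 'w) module"
begin

lemma monoid_over_field: "monoid_over_field K (V \<times>\<times> W)"
  by (intro monoid_over_field.intro V.K.field_axioms DirProd_monoid V.A.monoid_axioms W.A.monoid_axioms)

abbreviation "FT \<equiv> monoid_algebra K (V \<times>\<times> W)"
abbreviation "eb \<equiv> \<lambda>v w. basis_elt K (v, w)"
abbreviation "N \<equiv> tensor_null K V W"
abbreviation "T \<equiv> tensor K V W"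
abbreviation "rels \<equiv> tensor_relations K V W"

interpretation M: monoid_over_field K "V \<times>\<times> W" by (rule monoid_over_field)
interpretation FT: assoc_algebra K FT by (rule M.assoc_algebra_monoid_algebra)

lemma eb_closed [simp]: "v \<in> carrier V \<Longrightarrow> w \<in> carrier W \<Longrightarrow> eb v w \<in> carrier FT"
  by (auto intro!: M.e_closed)

lemma eb_mult:
  "v \<in> carrier V \<Longrightarrow> w \<in> carrier W \<Longrightarrow> v' \<in> carrier V \<Longrightarrow> w' \<in> carrier W \<Longrightarrow>
    eb v w \<otimes>\<^bsub>FT\<^esub> eb v' w' = eb (v \<otimes>\<^bsub>V\<^esub> v') (w \<otimes>\<^bsub>W\<^esub> w')"
  by (subst M.e_mult) auto

lemma relI:
  "v \<in> carrier V \<Longrightarrow> v' \<in> carrier V \<Longrightarrow> w \<in> carrier W \<Longrightarrow>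
    eb (v \<oplus>\<^bsub>V\<^esub> v') w \<ominus>\<^bsub>FT\<^esub> (eb v w \<oplus>\<^bsub>FT\<^esub> eb v' w) \<in> rels"
  "v \<in> carrier V \<Longrightarrow> w \<in> carrier W \<Longrightarrow> w' \<in> carrier W \<Longrightarrow>
    eb v (w \<oplus>\<^bsub>W\<^esub> w') \<ominus>\<^bsub>FT\<^esub> (eb v w \<oplus>\<^bsub>FT\<^esub> eb v w') \<in> rels"
  "c \<in> carrier K \<Longrightarrow> v \<in> carrier V \<Longrightarrow> w \<in> carrier W \<Longrightarrow>
    eb (c \<odot>\<^bsub>V\<^esub> v) w \<ominus>\<^bsub>FT\<^esub> (c \<odot>\<^bsub>FT\<^esub> eb v w) \<in> rels"
  "c \<in> carrier K \<Longrightarrow> v \<in> carrier V \<Longrightarrow> w \<in> carrier W \<Longrightarrow>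
    eb v (c \<odot>\<^bsub>W\<^esub> w) \<ominus>\<^bsub>FT\<^esub> (c \<odot>\<^bsub>FT\<^esub> eb v w) \<in> rels"
  unfolding tensor_relations_def Let_def by blast+

lemma relE:
  assumes "r \<in> rels"
  obtains v v' w where "r = eb (v \<oplus>\<^bsub>V\<^esub> v') w \<ominus>\<^bsub>FT\<^esub> (eb v w \<oplus>\<^bsub>FT\<^esub> eb v' w)"
      "v \<in> carrier V" "v' \<in> carrier V" "w \<in> carrier W"
    | v w w' where "r = eb v (w \<oplus>\<^bsub>W\<^esub> w') \<ominus>\<^bsub>FT\<^esub> (eb v w \<oplus>\<^bsub>FT\<^esub> eb v w')"
      "v \<in> carrier V" "w \<in> carrier W" "w' \<in> carrier W"
    | c v w where "r = eb (c \<odot>\<^bsub>V\<^esub> v) w \<ominus>\<^bsub>FT\<^esub> (c \<odot>\<^bsub>FT\<^esub> eb v w)"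
      "c \<in> carrier K" "v \<in> carrier V" "w \<in> carrier W"
    | c v w where "r = eb v (c \<odot>\<^bsub>W\<^esub> w) \<ominus>\<^bsub>FT\<^esub> (c \<odot>\<^bsub>FT\<^esub> eb v w)"
      "c \<in> carrier K" "v \<in> carrier V" "w \<in> carrier W"
  using assms unfolding tensor_relations_def Let_def by blast

lemma rels_closed: "rels \<subseteq> carrier FT"
  by (rule subsetI, erule relE) auto

lemma minus_mult:
  "x \<in> carrier FT \<Longrightarrow> a \<in> carrier FT \<Longrightarrow> b \<in> carrier FT \<Longrightarrow> x \<otimes>\<^bsub>FT\<^esub> (a \<ominus>\<^bsub>FT\<^esub> b) = x \<otimes>\<^bsub>FT\<^esub> a \<ominus>\<^bsub>FT\<^esub> x \<otimes>\<^bsub>FT\<^esub> b"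
  "x \<in> carrier FT \<Longrightarrow> a \<in> carrier FT \<Longrightarrow> b \<in> carrier FT \<Longrightarrow> (a \<ominus>\<^bsub>FT\<^esub> b) \<otimes>\<^bsub>FT\<^esub> x = a \<otimes>\<^bsub>FT\<^esub> x \<ominus>\<^bsub>FT\<^esub> b \<otimes>\<^bsub>FT\<^esub> x"
  by (simp_all add: a_minus_def FT.A.r_distr FT.A.l_distr FT.A.r_minus FT.A.l_minus)

text \<open>A basis element times a bilinearity relation is again a bilinearity relation, with the
  factors multiplied in. This is why the span of the relations is an ideal.\<close>

lemma eb_mult_rel:
  assumes r: "r \<in> rels" and u: "u \<in> carrier V" "u' \<in> carrier W"
  shows "eb u u' \<otimes>\<^bsub>FT\<^esub> r \<in> rels" and "r \<otimes>\<^bsub>FT\<^esub> eb u u' \<in> rels"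
  using r
  by (cases rule: relE; insert u;
      simp add: minus_mult eb_mult FT.A.r_distr FT.A.l_distr V.A.r_distr V.A.l_distr W.A.r_distr W.A.l_distr
        FT.smult_mult_left FT.smult_mult_right V.smult_mult_left V.smult_mult_right
        W.smult_mult_left W.smult_mult_right relI)+

lemma N_sub: "submodule N K FT" "rels \<subseteq> N" "N \<subseteq> carrier FT"
  using submodule_lin_span[OF FT.assoc_algebra rels_closed] by (auto simp: tensor_null_def)

text \<open>Absorption passes from basis elements to all multipliers by induction on the multiplier,
  and from the relations to their span by \<open>lin_span_induct\<close>.\<close>

lemma N_ideal: "ideal N FT"
proof (rule idealI)
  show "ring FT" by (rule FT.A.ring_axioms)
  show "subgroup N (add_monoid FT)" by (rule submodule.axioms(1)[OF N_sub(1)])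
  note sm = FT.submoduleE[OF N_sub(1)]
  have 1: "f \<otimes>\<^bsub>FT\<^esub> r \<in> N \<and> r \<otimes>\<^bsub>FT\<^esub> f \<in> N" if r: "r \<in> rels" and f: "f \<in> carrier FT" for r f
    using f
  proof (induction f rule: M.F_induct)
    case (add f g)
    then show ?case using r rels_closed sm by (auto simp: FT.A.l_distr FT.A.r_distr)
  next
    case (basis c u)
    obtain a b where u: "u = (a, b)" by (cases u)
    then have ab: "a \<in> carrier V" "b \<in> carrier W" using basis by auto
    have rc: "r \<in> carrier FT" using r rels_closed by blast
    have "eb a b \<otimes>\<^bsub>FT\<^esub> r \<in> N" "r \<otimes>\<^bsub>FT\<^esub> eb a b \<in> N" using eb_mult_rel[OF r ab] N_sub(2) by auto
    then show ?case unfolding u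
      using ab rc basis(1) sm(4) by (simp add: FT.smult_mult_left FT.smult_mult_right)
  qed
  have 2: "a \<in> carrier FT \<and> (\<forall>f\<in>carrier FT. f \<otimes>\<^bsub>FT\<^esub> a \<in> N \<and> a \<otimes>\<^bsub>FT\<^esub> f \<in> N)" if "a \<in> N" for a
  proof (rule lin_span_induct[OF FT.assoc_algebra rels_closed])
    show "a \<in> lin_span K FT rels" using that by (simp add: tensor_null_def)
    show "\<forall>f\<in>carrier FT. f \<otimes>\<^bsub>FT\<^esub> \<zero>\<^bsub>FT\<^esub> \<in> N \<and> \<zero>\<^bsub>FT\<^esub> \<otimes>\<^bsub>FT\<^esub> f \<in> N"
      using additive_subgroup.zero_closed[OF additive_subgroup.intro[OF submodule.axioms(1)[OF N_sub(1)]]] by simp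
  qed (use 1 sm in \<open>auto simp: FT.A.l_distr FT.A.r_distr FT.smult_mult_left FT.smult_mult_right\<close>)
  fix a x assume "a \<in> N" "x \<in> carrier FT"
  then show "x \<otimes>\<^bsub>FT\<^esub> a \<in> N" "a \<otimes>\<^bsub>FT\<^esub> x \<in> N" using 2 by blast+
qed

lemma algebra_ideal: "algebra_ideal K FT N"
  by (intro algebra_ideal.intro FT.assoc_algebra N_ideal)

interpretation Q: algebra_ideal K FT N by (rule algebra_ideal)

lemma tensor_assoc_algebra: "assoc_algebra K T"
  unfolding tensor_def by (rule Q.assoc_algebra_quotient)

lemma tens_eq: "tens K V W v w = Q.pr (eb v w)"
  by (simp add: tens_def)

lemma pr_hom: "Q.pr \<in> alg_hom K FT T"
  unfolding tensor_def by (rule Q.pr_hom)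

lemma tens_closed: "v \<in> carrier V \<Longrightarrow> w \<in> carrier W \<Longrightarrow> tens K V W v w \<in> carrier T"
  unfolding tens_eq by (rule alg_hom_closed[OF pr_hom]) simp

lemma tens_one: "tens K V W \<one>\<^bsub>V\<^esub> \<one>\<^bsub>W\<^esub> = \<one>\<^bsub>T\<^esub>"
  using alg_homD(3)[OF pr_hom] by (simp add: M.F_one tens_eq)

lemma tens_mult:
  "v \<in> carrier V \<Longrightarrow> w \<in> carrier W \<Longrightarrow> v' \<in> carrier V \<Longrightarrow> w' \<in> carrier W \<Longrightarrow>
    tens K V W v w \<otimes>\<^bsub>T\<^esub> tens K V W v' w' = tens K V W (v \<otimes>\<^bsub>V\<^esub> v') (w \<otimes>\<^bsub>W\<^esub> w')"
  using alg_homD(2)[OF pr_hom, of "eb v w" "eb v' w'"] by (simp add: eb_mult tens_eq)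

lemma tens_bilin: "bilin K V W T (tens K V W)"
proof -
  note D = lin_mapD[OF alg_homD(1)[OF pr_hom]]
  have eq: "Q.pr x = Q.pr y" if "x \<ominus>\<^bsub>FT\<^esub> y \<in> rels" "x \<in> carrier FT" "y \<in> carrier FT" for x y
    using Q.pr_eq_iff[OF that(2,3)] that(1) N_sub(2) by blast
  show ?thesis
  proof (intro bilinI lin_mapI)
    fix v w w' assume c: "v \<in> carrier V" "w \<in> carrier W" "w' \<in> carrier W"
    show "tens K V W v (w \<oplus>\<^bsub>W\<^esub> w') = tens K V W v w \<oplus>\<^bsub>T\<^esub> tens K V W v w'"
      using eq[OF relI(2)[OF c]] c by (simp add: tens_eq D)
  next
    fix v v' w assume c: "v \<in> carrier V" "v' \<in> carrier V" "w \<in> carrier W"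
    show "tens K V W (v \<oplus>\<^bsub>V\<^esub> v') w = tens K V W v w \<oplus>\<^bsub>T\<^esub> tens K V W v' w"
      using eq[OF relI(1)[OF c]] c by (simp add: tens_eq D)
  next
    fix c v w assume c: "c \<in> carrier K" "v \<in> carrier V" "w \<in> carrier W"
    show "tens K V W v (c \<odot>\<^bsub>W\<^esub> w) = c \<odot>\<^bsub>T\<^esub> tens K V W v w"
      using eq[OF relI(4)[OF c]] c by (simp add: tens_eq D)
    show "tens K V W (c \<odot>\<^bsub>V\<^esub> v) w = c \<odot>\<^bsub>T\<^esub> tens K V W v w"
      using eq[OF relI(3)[OF c]] c by (simp add: tens_eq D)
  qed (auto intro: tens_closed)
qed

text \<open>A scalar is absorbed into the first factor of a pure tensor, so sums of pure tensors
  already exhaust the tensor product.\<close>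

lemma tensor_induct [consumes 1, case_names add tens]:
  assumes z: "z \<in> carrier T"
    and add: "\<And>x y. x \<in> carrier T \<Longrightarrow> y \<in> carrier T \<Longrightarrow> P x \<Longrightarrow> P y \<Longrightarrow> P (x \<oplus>\<^bsub>T\<^esub> y)"
    and tens: "\<And>v w. v \<in> carrier V \<Longrightarrow> w \<in> carrier W \<Longrightarrow> P (tens K V W v w)"
  shows "P z"
proof -
  note D = lin_mapD[OF alg_homD(1)[OF pr_hom]]
  have "P (Q.pr f)" if "f \<in> carrier FT" for f
    using that
  proof (induction f rule: M.F_induct)
    case (add f g)
    then show ?case using assms(2) D by simp
  next
    case (basis c u)
    obtain v w where u: "u = (v, w)" by (cases u)
    then have "v \<in> carrier V" "w \<in> carrier W" using basis by auto
    then show ?case using u basis tens[of "c \<odot>\<^bsub>V\<^esub> v" w] lin_mapD(3)[OF bilinD(2)[OF tens_bilin], of w c v]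
      by (simp add: D tens_eq)
  qed
  then show ?thesis using z unfolding tensor_def Q.carrier_quotient by blast
qed

text \<open>The linear extension of a bilinear map kills the relations, hence their span, and so
  descends to the quotient whatever representative \<open>SOME\<close> selects.\<close>

lemma tensor_lift_facts:
  assumes U: "assoc_algebra K U" and \<beta>: "bilin K V W U \<beta>"
  shows "tensor_lift K U \<beta> \<in> lin_map K T U"
    and "v \<in> carrier V \<Longrightarrow> w \<in> carrier W \<Longrightarrow> tensor_lift K U \<beta> (tens K V W v w) = \<beta> v w"
proof -
  interpret U: assoc_algebra K U by fact
  let ?\<phi> = "\<lambda>(v, w). \<beta> v w"
  let ?f = "lin_extend K U ?\<phi>"
  note cl = bilin_closed[OF \<beta>]
  have f: "?f \<in> lin_map K FT U"
    by (rule M.lin_extend_linear[OF U]) (auto simp: cl)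
  note D = lin_mapD[OF f]
  have fe: "?f (eb v w) = \<beta> v w" if "v \<in> carrier V" "w \<in> carrier W" for v w
    by (subst M.lin_extend_basis[OF U]) (auto simp: cl that)
  note m = lin_map_minus[OF FT.assoc_algebra U f]
  note L1 = lin_mapD(2,3)[OF bilinD(1)[OF \<beta>]] and L2 = lin_mapD(2,3)[OF bilinD(2)[OF \<beta>]]
  have z: "?f r = \<zero>\<^bsub>U\<^esub>" if "r \<in> rels" for r
    using that by (cases rule: relE) (simp_all add: m D fe L1 L2 cl U.A.r_right_minus_eq)
  have z': "?f n = \<zero>\<^bsub>U\<^esub>" if "n \<in> N" for n
    using lin_span_induct[OF FT.assoc_algebra rels_closed, of n "\<lambda>n. ?f n = \<zero>\<^bsub>U\<^esub>"] that z
      lin_map_zero[OF FT.assoc_algebra U f] D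
    by (simp add: tensor_null_def)
  note q = Q.quotient_lift[OF U f z']
  have tl: "tensor_lift K U \<beta> = (\<lambda>Z. ?f (SOME x. x \<in> Z))"
    by (simp add: tensor_lift_def fun_eq_iff)
  show "tensor_lift K U \<beta> \<in> lin_map K T U"
    unfolding tl tensor_def by (rule q(2))
  show "tensor_lift K U \<beta> (tens K V W v w) = \<beta> v w" if "v \<in> carrier V" "w \<in> carrier W"
    unfolding tl tens_eq using q(1)[of "eb v w"] eb_closed[OF that] fe[OF that] by simp
qed

end

text \<open>
  Syntax-directed rules for (multi)linearity and closure; the side conditions of the \<^const>\<open>tensor_lift\<close>
  rules are discharged by applying them repeatedly.
\<close>

named_theorems mlin

lemma two_algebrasI: "assoc_algebra K V \<Longrightarrow> assoc_algebra K W \<Longrightarrow> two_algebras K V W"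
  by (rule two_algebras.intro)

lemmas assoc_algebra_tensor [mlin] = two_algebras.tensor_assoc_algebra[OF two_algebrasI]
lemmas tens_closed [mlin] = two_algebras.tens_closed[OF two_algebrasI]
lemmas tens_one = two_algebras.tens_one[OF two_algebrasI]
lemmas tens_mult = two_algebras.tens_mult[OF two_algebrasI]
lemmas tens_bilin = two_algebras.tens_bilin[OF two_algebrasI]
lemmas tensor_lift_lin = two_algebras.tensor_lift_facts(1)[OF two_algebrasI]
lemmas tensor_lift_tens = two_algebras.tensor_lift_facts(2)[OF two_algebrasI]
lemmas tensor_induct = two_algebras.tensor_induct[OF two_algebrasI, consumes 3, case_names add tens]

lemma lin_map_tensor_eq:
  assumes "assoc_algebra K V" "assoc_algebra K W"
    and f: "f \<in> lin_map K (tensor K V W) U" and g: "g \<in> lin_map K (tensor K V W) U"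
    and eq: "\<And>v w. v \<in> carrier V \<Longrightarrow> w \<in> carrier W \<Longrightarrow> f (tens K V W v w) = g (tens K V W v w)"
    and z: "z \<in> carrier (tensor K V W)"
  shows "f z = g z"
  using assms(1,2) z by (induction z rule: tensor_induct) (auto simp: lin_mapD[OF f] lin_mapD[OF g] eq)

lemma bilin_cong:
  assumes "assoc_algebra K V" "assoc_algebra K W" "bilin K V W U \<beta>"
    and eq: "\<And>v w. v \<in> carrier V \<Longrightarrow> w \<in> carrier W \<Longrightarrow> \<beta> v w = \<beta>' v w"
  shows "bilin K V W U \<beta>'"
proof -
  interpret V: assoc_algebra K V by fact
  interpret W: assoc_algebra K W by fact
  note d = bilinD[OF assms(3)]
  show ?thesis
    by (intro bilinI lin_mapI)
      (simp_all add: eq[symmetric] bilin_closed[OF assms(3)] lin_mapD(2,3)[OF d(1)] lin_mapD(2,3)[OF d(2)])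
qed

lemma tensor_lift_cong:
  assumes "assoc_algebra K V" "assoc_algebra K W" "assoc_algebra K U" "bilin K V W U \<beta>"
    and eq: "\<And>v w. v \<in> carrier V \<Longrightarrow> w \<in> carrier W \<Longrightarrow> \<beta> v w = \<beta>' v w"
    and z: "z \<in> carrier (tensor K V W)"
  shows "tensor_lift K U \<beta> z = tensor_lift K U \<beta>' z"
proof -
  note b' = bilin_cong[OF assms(1,2,4) eq]
  show ?thesis
    by (rule lin_map_tensor_eq[OF assms(1,2) tensor_lift_lin tensor_lift_lin _ z])
      (simp_all add: assms b' tensor_lift_tens)
qed

subsection \<open>Linearity of composite expressions\<close>

lemma lin_id [mlin]: "(\<lambda>x. x) \<in> lin_map K V V"
  by (rule lin_mapI) auto

text \<open>With \<open>F\<close> schematic this rule would unify with every linearity goal, so it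
  joins \<open>mlin\<close> only in instances \<open>lin_comp[OF ...]\<close> for fixed
  maps.\<close>

lemma lin_comp:
  "F \<in> lin_map K V W \<Longrightarrow> (\<lambda>x. g x) \<in> lin_map K Z V \<Longrightarrow> (\<lambda>x. F (g x)) \<in> lin_map K Z W"
  by (auto simp: lin_map_def Pi_def)

lemma lin_mult_l [mlin]:
  assumes "assoc_algebra K T" "c \<in> carrier T" "(\<lambda>x. g x) \<in> lin_map K Z T"
  shows "(\<lambda>x. c \<otimes>\<^bsub>T\<^esub> g x) \<in> lin_map K Z T"
proof -
  interpret T: assoc_algebra K T by fact
  note D = lin_mapD[OF assms(3)]
  show ?thesis by (rule lin_mapI) (use assms(2) in \<open>auto simp: D T.A.r_distr T.smult_mult_right\<close>)
qed

lemma lin_mult_r [mlin]: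
  assumes "assoc_algebra K T" "c \<in> carrier T" "(\<lambda>x. g x) \<in> lin_map K Z T"
  shows "(\<lambda>x. g x \<otimes>\<^bsub>T\<^esub> c) \<in> lin_map K Z T"
proof -
  interpret T: assoc_algebra K T by fact
  note D = lin_mapD[OF assms(3)]
  show ?thesis by (rule lin_mapI) (use assms(2) in \<open>auto simp: D T.A.l_distr T.smult_mult_left\<close>)
qed

lemma lin_smult [mlin]:
  assumes "assoc_algebra K T" "c \<in> carrier K" "(\<lambda>x. g x) \<in> lin_map K Z T"
  shows "(\<lambda>x. c \<odot>\<^bsub>T\<^esub> g x) \<in> lin_map K Z T"
proof -
  interpret T: assoc_algebra K T by fact
  note D = lin_mapD[OF assms(3)]
  show ?thesis
    by (rule lin_mapI) (use assms(2) in \<open>auto simp: D T.smult_r_distr T.smult_assoc1[symmetric] T.K.m_comm\<close>)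
qed

lemma base_algebra_simps:
  "carrier (base_algebra K) = carrier K" "x \<oplus>\<^bsub>base_algebra K\<^esub> y = x \<oplus>\<^bsub>K\<^esub> y"
  "x \<otimes>\<^bsub>base_algebra K\<^esub> y = x \<otimes>\<^bsub>K\<^esub> y" "x \<odot>\<^bsub>base_algebra K\<^esub> y = x \<otimes>\<^bsub>K\<^esub> y"
  "\<one>\<^bsub>base_algebra K\<^esub> = \<one>\<^bsub>K\<^esub>" "\<zero>\<^bsub>base_algebra K\<^esub> = \<zero>\<^bsub>K\<^esub>"
  by (auto simp: base_algebra_def)

lemma lin_smult_fun [mlin]:
  assumes "assoc_algebra K T" "v \<in> carrier T" "(\<lambda>x. g x) \<in> lin_map K Z (base_algebra K)"
  shows "(\<lambda>x. g x \<odot>\<^bsub>T\<^esub> v) \<in> lin_map K Z T"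
proof -
  interpret T: assoc_algebra K T by fact
  note D = lin_mapD[OF assms(3), unfolded base_algebra_simps]
  show ?thesis
    by (rule lin_mapI) (use assms(2) in \<open>auto simp: D T.smult_l_distr T.smult_assoc1\<close>)
qed

lemma lin_add [mlin]:
  assumes "assoc_algebra K T" "(\<lambda>x. f x) \<in> lin_map K Z T" "(\<lambda>x. g x) \<in> lin_map K Z T"
  shows "(\<lambda>x. f x \<oplus>\<^bsub>T\<^esub> g x) \<in> lin_map K Z T"
proof -
  interpret T: assoc_algebra K T by fact
  note D = lin_mapD[OF assms(2)] lin_mapD[OF assms(3)]
  show ?thesis
    by (rule lin_mapI) (auto simp: D T.smult_r_distr T.A.a_ac)
qed

lemma lin_map_cong:
  assumes "assoc_algebra K V" "f \<in> lin_map K V W" "\<And>x. x \<in> carrier V \<Longrightarrow> f x = g x"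
  shows "g \<in> lin_map K V W"
proof -
  interpret V: assoc_algebra K V by fact
  show ?thesis using lin_mapD[OF assms(2)] assms(3)
    by (intro lin_mapI) (metis V.A.add.m_closed V.smult_closed)+
qed

lemma lin_finsum [mlin]:
  fixes T (structure)
  assumes "assoc_algebra K T" "finite I" "\<And>i. i \<in> I \<Longrightarrow> (\<lambda>x. f i x) \<in> lin_map K Z T"
  shows "(\<lambda>x. \<Oplus>i\<in>I. f i x) \<in> lin_map K Z T"
proof -
  interpret T: assoc_algebra K T by fact
  note D = lin_mapD[OF assms(3)]
  show ?thesis
  proof (rule lin_mapI)
    show "(\<Oplus>i\<in>I. f i x) \<in> carrier T" if "x \<in> carrier Z" for x
      by (rule T.A.finsum_closed) (use D(1) that in auto)
    show "(\<Oplus>i\<in>I. f i (x \<oplus>\<^bsub>Z\<^esub> y)) = (\<Oplus>i\<in>I. f i x) \<oplus> (\<Oplus>i\<in>I. f i y)"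
      if "x \<in> carrier Z" "y \<in> carrier Z" for x y
    proof -
      have "(\<Oplus>i\<in>I. f i (x \<oplus>\<^bsub>Z\<^esub> y)) = (\<Oplus>i\<in>I. f i x \<oplus> f i y)"
        by (rule T.A.finsum_cong') (use D that in auto)
      also have "\<dots> = (\<Oplus>i\<in>I. f i x) \<oplus> (\<Oplus>i\<in>I. f i y)"
        by (rule T.A.finsum_addf) (use D that in auto)
      finally show ?thesis .
    qed
    show "(\<Oplus>i\<in>I. f i (c \<odot>\<^bsub>Z\<^esub> x)) = c \<odot> (\<Oplus>i\<in>I. f i x)"
      if "c \<in> carrier K" "x \<in> carrier Z" for c x
    proof -
      have "(\<Oplus>i\<in>I. f i (c \<odot>\<^bsub>Z\<^esub> x)) = (\<Oplus>i\<in>I. c \<odot> f i x)"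
        by (rule T.A.finsum_cong') (use D that in auto)
      also have "\<dots> = c \<odot> (\<Oplus>i\<in>I. f i x)"
        by (rule T.finsum_smult_ldistr[symmetric]) (use D that assms(2) in auto)
      finally show ?thesis .
    qed
  qed
qed

lemma lin_tens_l [mlin]:
  assumes "assoc_algebra K V" "assoc_algebra K W" "v \<in> carrier V" "(\<lambda>x. g x) \<in> lin_map K Z W"
  shows "(\<lambda>x. tens K V W v (g x)) \<in> lin_map K Z (tensor K V W)"
  by (rule lin_comp[OF bilinD(1)[OF tens_bilin] assms(4)]) fact+

lemma lin_tens_r [mlin]:
  assumes "assoc_algebra K V" "assoc_algebra K W" "w \<in> carrier W" "(\<lambda>x. g x) \<in> lin_map K Z V"
  shows "(\<lambda>x. tens K V W (g x) w) \<in> lin_map K Z (tensor K V W)"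
  by (rule lin_comp[OF bilinD(2)[OF tens_bilin] assms(4)]) fact+

lemma lin_lift_arg:
  assumes "assoc_algebra K V" "assoc_algebra K W" "assoc_algebra K U"
    "(\<lambda>x. g x) \<in> lin_map K Z (tensor K V W)" "bilin K V W U (\<lambda>v w. \<beta> v w)"
  shows "(\<lambda>x. tensor_lift K U (\<lambda>v w. \<beta> v w) (g x)) \<in> lin_map K Z U"
  by (rule lin_comp[OF tensor_lift_lin assms(4)]) fact+

text \<open>Here the tensor is fixed and the bilinear map depends linearly on a parameter; induction
  on \<open>z\<close> reduces this to a single pure tensor. The conclusion does not determine
  \<open>V\<close> and \<open>W\<close>, so the rule joins \<open>mlin\<close> in instances for
  particular tensors such as \<open>\<Delta> h\<close> and \<open>R\<close>.\<close>

lemma lin_lift_fun: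
  assumes V: "assoc_algebra K V" and W: "assoc_algebra K W" and U: "assoc_algebra K U"
    and z: "z \<in> carrier (tensor K V W)" and Z: "assoc_algebra K Z"
    and b: "\<And>x. x \<in> carrier Z \<Longrightarrow> bilin K V W U (\<lambda>v w. \<beta> x v w)"
    and l: "\<And>v w. v \<in> carrier V \<Longrightarrow> w \<in> carrier W \<Longrightarrow> (\<lambda>x. \<beta> x v w) \<in> lin_map K Z U"
  shows "(\<lambda>x. tensor_lift K U (\<lambda>v w. \<beta> x v w) z) \<in> lin_map K Z U"
  using V W z
proof (induction z rule: tensor_induct)
  case (add z z')
  show ?case
    by (rule lin_map_cong[OF Z lin_add[OF U add(3,4)]])
      (simp add: lin_mapD(2)[OF tensor_lift_lin[OF V W U b]] add(1,2))
next
  case (tens v w)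
  show ?case
    by (rule lin_map_cong[OF Z l[OF tens]]) (simp add: tensor_lift_tens[OF V W U b] tens)
qed

lemma tensor_lift_closed [mlin]:
  assumes "assoc_algebra K V" "assoc_algebra K W" "assoc_algebra K U"
    "z \<in> carrier (tensor K V W)" "bilin K V W U (\<lambda>v w. \<beta> v w)"
  shows "tensor_lift K U (\<lambda>v w. \<beta> v w) z \<in> carrier U"
  using lin_mapD(1)[OF tensor_lift_lin[OF assms(1-3,5)] assms(4)] .

text \<open>Both sides are linear in \<open>z\<close> and agree on pure tensors. This is how a
  linear map is moved inside a Sweedler sum.\<close>

lemma lin_tensor_lift:
  assumes "assoc_algebra K V" "assoc_algebra K W" "assoc_algebra K U" "assoc_algebra K U'"
    and F: "F \<in> lin_map K U U'" and b: "bilin K V W U \<beta>" and z: "z \<in> carrier (tensor K V W)"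
  shows "F (tensor_lift K U \<beta> z) = tensor_lift K U' (\<lambda>v w. F (\<beta> v w)) z"
proof -
  have b': "bilin K V W U' (\<lambda>v w. F (\<beta> v w))"
    by (intro bilinI lin_comp[OF F] bilinD[OF b])
  show ?thesis
    by (rule lin_map_tensor_eq[OF assms(1,2) lin_comp[OF F tensor_lift_lin] tensor_lift_lin _ z])
      (simp_all add: assms b' tensor_lift_tens)
qed

lemma mult_tensor_lift:
  assumes "assoc_algebra K V" "assoc_algebra K W" "assoc_algebra K U"
    and b: "bilin K V W U \<beta>" and z: "z \<in> carrier (tensor K V W)" and c: "c \<in> carrier U"
  shows "c \<otimes>\<^bsub>U\<^esub> tensor_lift K U \<beta> z = tensor_lift K U (\<lambda>v w. c \<otimes>\<^bsub>U\<^esub> \<beta> v w) z"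
    and "tensor_lift K U \<beta> z \<otimes>\<^bsub>U\<^esub> c = tensor_lift K U (\<lambda>v w. \<beta> v w \<otimes>\<^bsub>U\<^esub> c) z"
  by (rule lin_tensor_lift[OF assms(1-3,3) _ b z], rule mlin; (fact | rule mlin))+

text \<open>Interchange of two Sweedler sums. Both sides are linear in \<open>z\<close>, and on a
  pure tensor the lift over \<open>z\<close> is an evaluation on either side.\<close>

lemma tensor_lift_swap:
  assumes V: "assoc_algebra K V" "assoc_algebra K W" and V': "assoc_algebra K V'" "assoc_algebra K W'"
    and U: "assoc_algebra K U"
    and z: "z \<in> carrier (tensor K V W)" and z': "z' \<in> carrier (tensor K V' W')"
    and b: "\<And>v w. v \<in> carrier V \<Longrightarrow> w \<in> carrier W \<Longrightarrow> bilin K V' W' U (\<lambda>v' w'. \<gamma> v w v' w')"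
    and b': "\<And>v' w'. v' \<in> carrier V' \<Longrightarrow> w' \<in> carrier W' \<Longrightarrow> bilin K V W U (\<lambda>v w. \<gamma> v w v' w')"
  shows "tensor_lift K U (\<lambda>v w. tensor_lift K U (\<lambda>v' w'. \<gamma> v w v' w') z') z
    = tensor_lift K U (\<lambda>v' w'. tensor_lift K U (\<lambda>v w. \<gamma> v w v' w') z) z'"
proof -
  have "bilin K V W U (\<lambda>v w. tensor_lift K U (\<lambda>v' w'. \<gamma> v w v' w') z')"
    by (rule bilinI; rule lin_lift_fun[OF V' U z']; (rule V b bilinD[OF b'] | assumption)+)
  moreover have "(\<lambda>z. tensor_lift K U (\<lambda>v' w'. tensor_lift K U (\<lambda>v w. \<gamma> v w v' w') z) z') \<in> lin_map K (tensor K V W) U"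
    if "z \<in> carrier (tensor K V W)" for z
  proof (rule lin_lift_fun[OF V' U z' assoc_algebra_tensor[OF V]])
    fix x assume x: "x \<in> carrier (tensor K V W)"
    show "bilin K V' W' U (\<lambda>v' w'. tensor_lift K U (\<lambda>v w. \<gamma> v w v' w') x)"
      by (rule bilinI; rule lin_lift_fun[OF V U x]; (rule V' b' bilinD[OF b] | assumption)+)
  qed (auto intro!: tensor_lift_lin V U b')
  ultimately show ?thesis
    apply (intro lin_map_tensor_eq[where f = "tensor_lift K U _" and g = "\<lambda>z. tensor_lift K U (\<lambda>v' w'. tensor_lift K U (\<lambda>v w. \<gamma> v w v' w') z) z'", OF V _ _ _ z])
      apply (rule tensor_lift_lin[OF V U], assumption)
     apply (use z in blast)
    apply (subst tensor_lift_tens[OF V U], assumption+)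
    apply (rule tensor_lift_cong[OF V' U b _ z'], assumption+)
    apply (simp add: tensor_lift_tens[OF V U b'])
    done
qed

declare bilinI [mlin] assoc_algebra_base [mlin]

lemma aa_mult_closed [mlin]:
  "assoc_algebra K T \<Longrightarrow> x \<in> carrier T \<Longrightarrow> y \<in> carrier T \<Longrightarrow> x \<otimes>\<^bsub>T\<^esub> y \<in> carrier T"
  by (meson assoc_algebra_def ring.ring_simprules(5))

lemma aa_one_closed [mlin]: "assoc_algebra K T \<Longrightarrow> \<one>\<^bsub>T\<^esub> \<in> carrier T"
  by (meson assoc_algebra_def ring.ring_simprules(6))

lemma aa_smult_closed [mlin]:
  "assoc_algebra K T \<Longrightarrow> c \<in> carrier K \<Longrightarrow> y \<in> carrier T \<Longrightarrow> c \<odot>\<^bsub>T\<^esub> y \<in> carrier T"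
  by (meson assoc_algebra_def module.smult_closed)

section \<open>Triple tensor products, maps of tensor products and products of lifts\<close>

definition trilin ::
  "'k ring \<Rightarrow> ('k, 'u) module \<Rightarrow> ('k, 'v) module \<Rightarrow> ('k, 'w) module \<Rightarrow> ('k, 't) module
    \<Rightarrow> ('u \<Rightarrow> 'v \<Rightarrow> 'w \<Rightarrow> 't) \<Rightarrow> bool" where
  "trilin K U V W T \<gamma> \<longleftrightarrow> (\<forall>a\<in>carrier U. bilin K V W T (\<gamma> a)) \<and>
     (\<forall>b\<in>carrier V. \<forall>c\<in>carrier W. (\<lambda>a. \<gamma> a b c) \<in> lin_map K U T)"

lemma trilinI [mlin]:
  assumes "\<And>a b. a \<in> carrier U \<Longrightarrow> b \<in> carrier V \<Longrightarrow> (\<lambda>c. \<gamma> a b c) \<in> lin_map K W T"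
    and "\<And>a c. a \<in> carrier U \<Longrightarrow> c \<in> carrier W \<Longrightarrow> (\<lambda>b. \<gamma> a b c) \<in> lin_map K V T"
    and "\<And>b c. b \<in> carrier V \<Longrightarrow> c \<in> carrier W \<Longrightarrow> (\<lambda>a. \<gamma> a b c) \<in> lin_map K U T"
  shows "trilin K U V W T (\<lambda>a b c. \<gamma> a b c)"
  using assms by (auto simp: trilin_def bilin_def)

lemma trilinD:
  assumes "trilin K U V W T \<gamma>"
  shows "a \<in> carrier U \<Longrightarrow> b \<in> carrier V \<Longrightarrow> (\<lambda>c. \<gamma> a b c) \<in> lin_map K W T"
    and "a \<in> carrier U \<Longrightarrow> c \<in> carrier W \<Longrightarrow> (\<lambda>b. \<gamma> a b c) \<in> lin_map K V T"
    and "b \<in> carrier V \<Longrightarrow> c \<in> carrier W \<Longrightarrow> (\<lambda>a. \<gamma> a b c) \<in> lin_map K U T"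
    and "a \<in> carrier U \<Longrightarrow> bilin K V W T (\<lambda>b c. \<gamma> a b c)"
    and "b \<in> carrier V \<Longrightarrow> bilin K U W T (\<lambda>a c. \<gamma> a b c)"
    and "c \<in> carrier W \<Longrightarrow> bilin K U V T (\<lambda>a b. \<gamma> a b c)"
  using assms by (auto simp: trilin_def bilin_def)

definition tensor_lift3 ::
  "'k ring \<Rightarrow> ('k, 't) module \<Rightarrow> ('u \<Rightarrow> 'v \<Rightarrow> 'w \<Rightarrow> 't) \<Rightarrow> ('u \<times> ('v \<times> 'w \<Rightarrow> 'k) set \<Rightarrow> 'k) set \<Rightarrow> 't" where
  "tensor_lift3 K T \<gamma> = tensor_lift K T (\<lambda>a z. tensor_lift K T (\<lambda>b c. \<gamma> a b c) z)"

context
  fixes K :: "'k ring" and U :: "('k, 'u) module" and V :: "('k, 'v) module" and W :: "('k, 'w) module"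
  assumes alg: "assoc_algebra K U" "assoc_algebra K V" "assoc_algebra K W"
begin

lemma alg3: "assoc_algebra K (tensor3 K U V W)"
  unfolding tensor3_def by (rule mlin alg)+

lemma tens3_trilin: "trilin K U V W (tensor3 K U V W) (\<lambda>a b c. tens3 K U V W a b c)"
  unfolding tens3_def tensor3_def by (rule mlin alg | assumption)+

lemma tens3_mult:
  assumes "u \<in> carrier U" "v \<in> carrier V" "w \<in> carrier W" "u' \<in> carrier U" "v' \<in> carrier V" "w' \<in> carrier W"
  shows "tens3 K U V W u v w \<otimes>\<^bsub>tensor3 K U V W\<^esub> tens3 K U V W u' v' w' =
    tens3 K U V W (u \<otimes>\<^bsub>U\<^esub> u') (v \<otimes>\<^bsub>V\<^esub> v') (w \<otimes>\<^bsub>W\<^esub> w')"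
  unfolding tens3_def tensor3_def using assms
  by (simp add: tens_mult alg assoc_algebra_tensor tens_closed)

lemma tensor_lift3_bilin:
  assumes T: "assoc_algebra K T" and \<gamma>: "trilin K U V W T \<gamma>"
  shows "bilin K U (tensor K V W) T (\<lambda>a z. tensor_lift K T (\<lambda>b c. \<gamma> a b c) z)"
proof (rule bilinI)
  show "(\<lambda>z. tensor_lift K T (\<lambda>b c. \<gamma> a b c) z) \<in> lin_map K (tensor K V W) T" if "a \<in> carrier U" for a
    using tensor_lift_lin[OF alg(2,3) T trilinD(4)[OF \<gamma> that]] by simp
  show "(\<lambda>a. tensor_lift K T (\<lambda>b c. \<gamma> a b c) z) \<in> lin_map K U T" if "z \<in> carrier (tensor K V W)" for z
    by (rule lin_lift_fun[OF alg(2,3) T that alg(1)]) (rule trilinD[OF \<gamma>]; assumption)+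
qed

lemma tensor_lift3_lin:
  assumes T: "assoc_algebra K T" and \<gamma>: "trilin K U V W T \<gamma>"
  shows "tensor_lift3 K T \<gamma> \<in> lin_map K (tensor3 K U V W) T"
  unfolding tensor_lift3_def tensor3_def
  by (rule tensor_lift_lin[OF alg(1) assoc_algebra_tensor[OF alg(2,3)] T tensor_lift3_bilin[OF T \<gamma>]])

lemma tensor_lift3_tens3:
  assumes T: "assoc_algebra K T" and \<gamma>: "trilin K U V W T \<gamma>"
    and c: "u \<in> carrier U" "v \<in> carrier V" "w \<in> carrier W"
  shows "tensor_lift3 K T \<gamma> (tens3 K U V W u v w) = \<gamma> u v w"
  unfolding tensor_lift3_def tens3_def using c
  by (simp add: tensor_lift_tens[OF alg(1) assoc_algebra_tensor[OF alg(2,3)] T tensor_lift3_bilin[OF T \<gamma>]]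
      tens_closed alg tensor_lift_tens[OF alg(2,3) T trilinD(4)[OF \<gamma>]])

lemma tensor_assoc_lin_aux:
  "bilin K (tensor K U V) W (tensor3 K U V W)
    (\<lambda>x w. tensor_lift K (tensor3 K U V W) (\<lambda>u v. tens3 K U V W u v w) x)"
proof (rule bilinI)
  note b = trilinD[OF tens3_trilin]
  show "(\<lambda>x. tensor_lift K (tensor3 K U V W) (\<lambda>u v. tens3 K U V W u v w) x)
      \<in> lin_map K (tensor K U V) (tensor3 K U V W)" if "w \<in> carrier W" for w
    using tensor_lift_lin[OF alg(1,2) alg3 b(6)[OF that]] by simp
  show "(\<lambda>w. tensor_lift K (tensor3 K U V W) (\<lambda>u v. tens3 K U V W u v w) x)
      \<in> lin_map K W (tensor3 K U V W)" if "x \<in> carrier (tensor K U V)" for x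
    by (rule lin_lift_fun[OF alg(1,2) alg3 that alg(3)]) (rule b; assumption)+
qed

text \<open>Pairing with a trilinear map turns the reassociation into a regrouping of iterated sums.
  Axioms stated with \<open>tensor_assoc\<close> thereby become identities between double Sweedler
  sums.\<close>

lemma tensor_lift3_assoc:
  assumes T: "assoc_algebra K T" and \<gamma>: "trilin K U V W T \<gamma>"
    and z: "z \<in> carrier (tensor K (tensor K U V) W)"
  shows "tensor_lift3 K T \<gamma> (tensor_assoc K U V W z) =
    tensor_lift K T (\<lambda>x w. tensor_lift K T (\<lambda>u v. \<gamma> u v w) x) z"
proof -
  note UV = assoc_algebra_tensor[OF alg(1,2)]
  note b = trilinD[OF tens3_trilin] and g = trilinD[OF \<gamma>]
  have "bilin K (tensor K U V) W T (\<lambda>x w. tensor_lift K T (\<lambda>u v. \<gamma> u v w) x)"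
  proof (rule bilinI)
    show "(\<lambda>x. tensor_lift K T (\<lambda>u v. \<gamma> u v w) x) \<in> lin_map K (tensor K U V) T" if "w \<in> carrier W" for w
      using tensor_lift_lin[OF alg(1,2) T g(6)[OF that]] by simp
    show "(\<lambda>w. tensor_lift K T (\<lambda>u v. \<gamma> u v w) x) \<in> lin_map K W T" if "x \<in> carrier (tensor K U V)" for x
      by (rule lin_lift_fun[OF alg(1,2) T that alg(3)]) (rule g; assumption)+
  qed
  note bb = this
  have "tensor_lift3 K T \<gamma> (tensor_assoc K U V W z) =
      tensor_lift K T (\<lambda>x w. tensor_lift3 K T \<gamma> (tensor_lift K (tensor3 K U V W) (\<lambda>u v. tens3 K U V W u v w) x)) z"
    unfolding tensor_assoc_def
    by (rule lin_tensor_lift[OF UV alg(3) alg3 T tensor_lift3_lin[OF T \<gamma>] tensor_assoc_lin_aux z])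
  also have "\<dots> = tensor_lift K T (\<lambda>x w. tensor_lift K T (\<lambda>u v. \<gamma> u v w) x) z"
  proof (rule tensor_lift_cong[OF UV alg(3) T bb _ z, symmetric])
    fix x w assume x: "x \<in> carrier (tensor K U V)" and w: "w \<in> carrier W"
    show "tensor_lift K T (\<lambda>u v. \<gamma> u v w) x =
      tensor_lift3 K T \<gamma> (tensor_lift K (tensor3 K U V W) (\<lambda>u v. tens3 K U V W u v w) x)" (is "?l = ?r")
    proof -
    have "?r =
        tensor_lift K T (\<lambda>u v. tensor_lift3 K T \<gamma> (tens3 K U V W u v w)) x"
      by (rule lin_tensor_lift[OF alg(1,2) alg3 T tensor_lift3_lin[OF T \<gamma>] b(6)[OF w] x])
    also have "\<dots> = ?l"
      by (rule tensor_lift_cong[OF alg(1,2) T g(6)[OF w] _ x, symmetric])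
        (simp add: tensor_lift3_tens3[OF T \<gamma>] w)
    finally show ?thesis by simp
    qed
  qed
  finally show ?thesis .
qed

lemma leg_bilins:
  "bilin K U V (tensor3 K U V W) (\<lambda>u v. tens3 K U V W u v \<one>\<^bsub>W\<^esub>)"
  "bilin K U W (tensor3 K U V W) (\<lambda>u w. tens3 K U V W u \<one>\<^bsub>V\<^esub> w)"
  "bilin K V W (tensor3 K U V W) (\<lambda>v w. tens3 K U V W \<one>\<^bsub>U\<^esub> v w)"
  by (rule trilinD[OF tens3_trilin] | rule mlin alg)+

end

lemma tensor_map_bilin:
  assumes "assoc_algebra K V2" "assoc_algebra K W2"
    and f: "f \<in> lin_map K V V2" and g: "g \<in> lin_map K W W2"
  shows "bilin K V W (tensor K V2 W2) (\<lambda>v w. tens K V2 W2 (f v) (g w))"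
proof -
  note [mlin] = lin_comp[OF f] lin_comp[OF g] lin_mapD(1)[OF f] lin_mapD(1)[OF g] assms
  show ?thesis by (rule mlin | assumption)+
qed

lemma tensor_map_closed:
  assumes "assoc_algebra K V" "assoc_algebra K W" "assoc_algebra K V2" "assoc_algebra K W2"
    and "f \<in> lin_map K V V2" "g \<in> lin_map K W W2" and z: "z \<in> carrier (tensor K V W)"
  shows "tensor_map K V2 W2 f g z \<in> carrier (tensor K V2 W2)"
  unfolding tensor_map_def by (rule tensor_lift_closed tensor_map_bilin assms assoc_algebra_tensor)+

lemma tensor_lift_tensor_map:
  assumes V: "assoc_algebra K V" "assoc_algebra K W" and V2: "assoc_algebra K V2" "assoc_algebra K W2"
    and T: "assoc_algebra K T"
    and f: "f \<in> lin_map K V V2" and g: "g \<in> lin_map K W W2" and \<beta>: "bilin K V2 W2 T \<beta>"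
    and z: "z \<in> carrier (tensor K V W)"
  shows "tensor_lift K T \<beta> (tensor_map K V2 W2 f g z) = tensor_lift K T (\<lambda>v w. \<beta> (f v) (g w)) z"
proof -
  have b: "bilin K V W T (\<lambda>v w. \<beta> (f v) (g w))"
    by (intro bilinI lin_comp[OF _ f] lin_comp[OF _ g] lin_comp[OF bilinD(1)[OF \<beta>] g] lin_comp[OF bilinD(2)[OF \<beta>] f])
      (use lin_mapD(1)[OF f] lin_mapD(1)[OF g] in auto)
  have "tensor_lift K T \<beta> (tensor_map K V2 W2 f g z) =
    tensor_lift K T (\<lambda>v w. tensor_lift K T \<beta> (tens K V2 W2 (f v) (g w))) z"
    unfolding tensor_map_def
    by (rule lin_tensor_lift[OF V assoc_algebra_tensor[OF V2] T tensor_lift_lin[OF V2 T \<beta>] tensor_map_bilin[OF V2 f g] z])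
  also have "\<dots> = tensor_lift K T (\<lambda>v w. \<beta> (f v) (g w)) z"
    by (rule tensor_lift_cong[OF V T b _ z, symmetric])
      (simp add: tensor_lift_tens[OF V2 T \<beta>] lin_mapD(1)[OF f] lin_mapD(1)[OF g])
  finally show ?thesis .
qed

lemma tensor_lift_flip:
  assumes V: "assoc_algebra K V" "assoc_algebra K W" and T: "assoc_algebra K T"
    and \<beta>: "bilin K W V T \<beta>" and z: "z \<in> carrier (tensor K V W)"
  shows "tensor_lift K T \<beta> (tensor_flip K V W z) = tensor_lift K T (\<lambda>v w. \<beta> w v) z"
    and "tensor_flip K V W z \<in> carrier (tensor K W V)"
proof -
  note [mlin] = V
  have b: "bilin K V W (tensor K W V) (\<lambda>v w. tens K W V w v)" by (rule mlin | assumption)+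
  have b2: "bilin K V W T (\<lambda>v w. \<beta> w v)" by (rule bilinI bilinD[OF \<beta>] | assumption)+
  show "tensor_flip K V W z \<in> carrier (tensor K W V)"
    unfolding tensor_flip_def by (rule tensor_lift_closed[OF V _ z b]) (rule mlin)+
  show "tensor_lift K T \<beta> (tensor_flip K V W z) = tensor_lift K T (\<lambda>v w. \<beta> w v) z" (is "?l = ?r")
  proof -
  have "?l = tensor_lift K T (\<lambda>v w. tensor_lift K T \<beta> (tens K W V w v)) z"
    unfolding tensor_flip_def
    by (rule lin_tensor_lift[OF V assoc_algebra_tensor[OF V(2,1)] T tensor_lift_lin[OF V(2,1) T \<beta>] b z])
  also have "\<dots> = ?r"
    by (rule tensor_lift_cong[OF V T b2 _ z, symmetric]) (simp add: tensor_lift_tens[OF V(2,1) T \<beta>])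
  finally show ?thesis .
  qed
qed

text \<open>A product in the tensor product becomes a double sum. With a pure tensor on the left
  both sides are linear in \<open>z\<close>; linearity in \<open>y\<close> then gives the general
  case.\<close>

lemma tensor_lift_mult:
  assumes V: "assoc_algebra K V" "assoc_algebra K W" and T: "assoc_algebra K T"
    and \<beta>: "bilin K V W T \<beta>" and y: "y \<in> carrier (tensor K V W)" and z: "z \<in> carrier (tensor K V W)"
  shows "tensor_lift K T \<beta> (y \<otimes>\<^bsub>tensor K V W\<^esub> z) =
    tensor_lift K T (\<lambda>a b. tensor_lift K T (\<lambda>c d. \<beta> (a \<otimes>\<^bsub>V\<^esub> c) (b \<otimes>\<^bsub>W\<^esub> d)) z) y"
proof -
  note [mlin] = V assoc_algebra_tensor[OF V]
  note L = tensor_lift_lin[OF V T \<beta>]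
  note c1 = lin_comp[OF bilinD(1)[OF \<beta>]] and c2 = lin_comp[OF bilinD(2)[OF \<beta>]]
  have b: "bilin K V W T (\<lambda>c d. \<beta> (a \<otimes>\<^bsub>V\<^esub> c) (b \<otimes>\<^bsub>W\<^esub> d))" if "a \<in> carrier V" "b \<in> carrier W" for a b
    using that by - (rule bilinI c1 c2 mlin | assumption)+
  have 1: "tensor_lift K T \<beta> (tens K V W a b \<otimes>\<^bsub>tensor K V W\<^esub> z) =
      tensor_lift K T (\<lambda>c d. \<beta> (a \<otimes>\<^bsub>V\<^esub> c) (b \<otimes>\<^bsub>W\<^esub> d)) z" if ab: "a \<in> carrier V" "b \<in> carrier W" for a b
  proof (rule lin_map_tensor_eq[OF V _ _ _ z, where U = T])
    show "(\<lambda>z. tensor_lift K T \<beta> (tens K V W a b \<otimes>\<^bsub>tensor K V W\<^esub> z)) \<in> lin_map K (tensor K V W) T"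
      by (rule lin_comp[OF L] mlin ab)+
    show "(\<lambda>z. tensor_lift K T (\<lambda>c d. \<beta> (a \<otimes>\<^bsub>V\<^esub> c) (b \<otimes>\<^bsub>W\<^esub> d)) z) \<in> lin_map K (tensor K V W) T"
      using tensor_lift_lin[OF V T b[OF ab]] by simp
    fix c d assume cd: "c \<in> carrier V" "d \<in> carrier W"
    show "tensor_lift K T \<beta> (tens K V W a b \<otimes>\<^bsub>tensor K V W\<^esub> tens K V W c d) =
      tensor_lift K T (\<lambda>c d. \<beta> (a \<otimes>\<^bsub>V\<^esub> c) (b \<otimes>\<^bsub>W\<^esub> d)) (tens K V W c d)"
      using ab cd by (simp add: tens_mult V tensor_lift_tens[OF V T \<beta>] tensor_lift_tens[OF V T b] aa_mult_closed[OF V(1)] aa_mult_closed[OF V(2)])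
  qed
  have b2: "bilin K V W T (\<lambda>a b. tensor_lift K T (\<lambda>c d. \<beta> (a \<otimes>\<^bsub>V\<^esub> c) (b \<otimes>\<^bsub>W\<^esub> d)) z)"
    by (rule bilin_cong[OF V _ 1], rule bilinI) (rule lin_comp[OF L] mlin z | assumption)+
  show ?thesis
  proof (rule lin_map_tensor_eq[OF V _ tensor_lift_lin[OF V T b2] _ y])
    show "(\<lambda>y. tensor_lift K T \<beta> (y \<otimes>\<^bsub>tensor K V W\<^esub> z)) \<in> lin_map K (tensor K V W) T"
      by (rule lin_comp[OF L] mlin z)+
  qed (simp add: 1 tensor_lift_tens[OF V T b2])
qed

lemma mult_lifts:
  fixes T (structure)
  assumes V: "assoc_algebra K V" "assoc_algebra K W" and V': "assoc_algebra K V'" "assoc_algebra K W'"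
    and T: "assoc_algebra K T" and \<beta>: "bilin K V W T \<beta>" and \<gamma>: "bilin K V' W' T \<gamma>"
    and y: "y \<in> carrier (tensor K V W)" and z: "z \<in> carrier (tensor K V' W')"
  shows "tensor_lift K T \<beta> y \<otimes> tensor_lift K T \<gamma> z =
    tensor_lift K T (\<lambda>a b. tensor_lift K T (\<lambda>c d. \<beta> a b \<otimes> \<gamma> c d) z) y"
proof -
  note [mlin] = T bilinD[OF \<beta>] tensor_lift_closed[OF V' T z \<gamma>]
  have b: "bilin K V W T (\<lambda>a b. \<beta> a b \<otimes> tensor_lift K T \<gamma> z)" by (rule mlin | assumption)+
  have "tensor_lift K T \<beta> y \<otimes> tensor_lift K T \<gamma> z = tensor_lift K T (\<lambda>a b. \<beta> a b \<otimes> tensor_lift K T \<gamma> z) y"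
    by (rule mult_tensor_lift(2)[OF V T \<beta> y]) (rule mlin)
  also have "\<dots> = tensor_lift K T (\<lambda>a b. tensor_lift K T (\<lambda>c d. \<beta> a b \<otimes> \<gamma> c d) z) y"
    by (rule tensor_lift_cong[OF V T b _ y]) (rule mult_tensor_lift(1)[OF V' T \<gamma> z], rule bilin_closed[OF \<beta>])
  finally show ?thesis .
qed

section \<open>Sweedler calculus in bialgebras and comodule algebras\<close>

context bialgebra
begin

abbreviation (input) hmult (infixl "\<star>" 70) where "x \<star> y \<equiv> x \<otimes>\<^bsub>H\<^esub> y"
abbreviation (input) "TL \<equiv> tensor_lift K"

lemma H_alg [mlin]: "assoc_algebra K H" by (rule assoc_algebra)
lemma K_field [mlin]: "field K" by (rule K.field_axioms)
lemma HH_alg: "assoc_algebra K (tensor K H H)" by (rule mlin)+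
lemma \<Delta>_lin: "\<Delta> \<in> lin_map K H (tensor K H H)" using alg_homD(1)[OF comult_hom] .
lemma \<Delta>_closed [mlin]: "h \<in> carrier H \<Longrightarrow> \<Delta> h \<in> carrier (tensor K H H)" using lin_mapD(1)[OF \<Delta>_lin] .
lemma \<epsilon>_lin: "\<epsilon> \<in> lin_map K H (base_algebra K)" using alg_homD(1)[OF counit_hom] .
lemmas \<Delta>_lin' [mlin] = lin_comp[OF \<Delta>_lin] and \<epsilon>_lin' [mlin] = lin_comp[OF \<epsilon>_lin]
lemma \<epsilon>_closed [mlin]: "h \<in> carrier H \<Longrightarrow> \<epsilon> h \<in> carrier K"
  using lin_mapD(1)[OF \<epsilon>_lin] by (simp add: base_algebra_simps)
lemma \<epsilon>_mult: "x \<in> carrier H \<Longrightarrow> y \<in> carrier H \<Longrightarrow> \<epsilon> (x \<star> y) = \<epsilon> x \<otimes>\<^bsub>K\<^esub> \<epsilon> y"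
  using alg_homD(2)[OF counit_hom] by (simp add: base_algebra_simps)
lemma \<epsilon>_one: "\<epsilon> \<one>\<^bsub>H\<^esub> = \<one>\<^bsub>K\<^esub>"
  using alg_homD(3)[OF counit_hom] by (simp add: base_algebra_simps)
lemma \<Delta>_one: "\<Delta> \<one>\<^bsub>H\<^esub> = tens K H H \<one>\<^bsub>H\<^esub> \<one>\<^bsub>H\<^esub>"
  using alg_homD(3)[OF comult_hom] by (simp add: tens_one H_alg)

lemma lin_sw_fun [mlin]:
  assumes "h \<in> carrier H" "assoc_algebra K U" "assoc_algebra K Z"
    "\<And>x. x \<in> carrier Z \<Longrightarrow> bilin K H H U (\<lambda>v w. \<beta> x v w)"
    "\<And>v w. v \<in> carrier H \<Longrightarrow> w \<in> carrier H \<Longrightarrow> (\<lambda>x. \<beta> x v w) \<in> lin_map K Z U"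
  shows "(\<lambda>x. TL U (\<lambda>v w. \<beta> x v w) (\<Delta> h)) \<in> lin_map K Z U"
  using assms by (intro lin_lift_fun[OF H_alg H_alg]) (auto intro: \<Delta>_closed)

lemma lin_sw_arg [mlin]:
  assumes "assoc_algebra K U" "(\<lambda>x. g x) \<in> lin_map K Z H" "bilin K H H U (\<lambda>v w. \<beta> v w)"
  shows "(\<lambda>x. TL U (\<lambda>v w. \<beta> v w) (\<Delta> (g x))) \<in> lin_map K Z U"
  by (rule lin_lift_arg[OF H_alg H_alg assms(1) lin_comp[OF \<Delta>_lin assms(2)] assms(3)])

lemmas sw_cong = tensor_lift_cong[OF H_alg H_alg _ _ _ \<Delta>_closed]
lemmas sw_hom = lin_tensor_lift[OF H_alg H_alg _ _ _ _ \<Delta>_closed]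

text \<open>The counit axiom carried through a linear map: in this form it deletes one Sweedler
  index in the middle of a computation.\<close>

lemma counit_left_lin:
  assumes U: "assoc_algebra K U" and F: "F \<in> lin_map K H U" and h: "h \<in> carrier H"
  shows "TL U (\<lambda>x y. \<epsilon> x \<odot>\<^bsub>U\<^esub> F y) (\<Delta> h) = F h"
proof -
  note [mlin] = U lin_comp[OF F] lin_mapD(1)[OF F] h
  have "F (TL H (\<lambda>x y. \<epsilon> x \<odot>\<^bsub>H\<^esub> y) (\<Delta> h)) = TL U (\<lambda>x y. F (\<epsilon> x \<odot>\<^bsub>H\<^esub> y)) (\<Delta> h)"
    by (rule sw_hom[OF H_alg U F _ h]) (rule mlin | assumption)+
  also have "\<dots> = TL U (\<lambda>x y. \<epsilon> x \<odot>\<^bsub>U\<^esub> F y) (\<Delta> h)"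
    by (rule sw_cong[OF U _ _ h, symmetric]) (rule mlin | assumption | simp add: lin_mapD(3)[OF F] \<epsilon>_closed)+
  finally show ?thesis by (simp add: counit_left h)
qed

lemma counit_right_lin:
  assumes U: "assoc_algebra K U" and F: "F \<in> lin_map K H U" and h: "h \<in> carrier H"
  shows "TL U (\<lambda>x y. \<epsilon> y \<odot>\<^bsub>U\<^esub> F x) (\<Delta> h) = F h"
proof -
  note [mlin] = U lin_comp[OF F] lin_mapD(1)[OF F] h
  have "F (TL H (\<lambda>x y. \<epsilon> y \<odot>\<^bsub>H\<^esub> x) (\<Delta> h)) = TL U (\<lambda>x y. F (\<epsilon> y \<odot>\<^bsub>H\<^esub> x)) (\<Delta> h)"
    by (rule sw_hom[OF H_alg U F _ h]) (rule mlin | assumption)+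
  also have "\<dots> = TL U (\<lambda>x y. \<epsilon> y \<odot>\<^bsub>U\<^esub> F x) (\<Delta> h)"
    by (rule sw_cong[OF U _ _ h, symmetric]) (rule mlin | assumption | simp add: lin_mapD(3)[OF F] \<epsilon>_closed)+
  finally show ?thesis by (simp add: counit_right h)
qed

text \<open>\<open>H\<close> coacts on itself by \<open>\<Delta>\<close>, so regrouping for
  coactions, proved once in \<open>coassoc_lift\<close>, also yields the rule
  \<open>sw_coassoc\<close> for \<open>\<Delta>\<close>.\<close>

lemma regular_comodule_algebra: "left_comodule_algebra K H \<Delta> \<epsilon> H \<Delta>"
  by unfold_locales (auto simp: comult_hom coassoc counit_left)

lemma sw_mult:
  assumes U: "assoc_algebra K U" and \<beta>: "bilin K H H U \<beta>" and "x \<in> carrier H" "y \<in> carrier H"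
  shows "TL U \<beta> (\<Delta> (x \<star> y)) =
    TL U (\<lambda>a b. TL U (\<lambda>c d. \<beta> (a \<star> c) (b \<star> d)) (\<Delta> y)) (\<Delta> x)"
  using assms by (simp add: alg_homD(2)[OF comult_hom] tensor_lift_mult[OF H_alg H_alg U \<beta>] \<Delta>_closed)

text \<open>The left side of coassociativity and of the axiom for
  \<open>(\<Delta> \<otimes> Id) R\<close>, paired with a trilinear map; both axioms are turned into
  sums through it.\<close>

lemma comult_left_lift:
  assumes Q: "assoc_algebra K Q" and U: "assoc_algebra K U" and \<gamma>: "trilin K H H Q U \<gamma>"
    and z: "z \<in> carrier (tensor K H Q)"
  shows "tensor_lift3 K U \<gamma> (tensor_assoc K H H Q (tensor_map K (tensor K H H) Q \<Delta> (\<lambda>x. x) z)) =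
    TL U (\<lambda>a b. TL U (\<lambda>c d. \<gamma> c d b) (\<Delta> a)) z"
proof -
  let ?L = "tensor_lift3 K U \<gamma>"
  note g = trilinD[OF \<gamma>]
  have 1: "bilin K (tensor K H H) Q U (\<lambda>x w. TL U (\<lambda>u v. \<gamma> u v w) x)"
  proof (rule bilinI)
    show "(\<lambda>x. TL U (\<lambda>u v. \<gamma> u v w) x) \<in> lin_map K (tensor K H H) U" if "w \<in> carrier Q" for w
      using tensor_lift_lin[OF H_alg H_alg U g(6)[OF that]] by simp
    show "(\<lambda>w. TL U (\<lambda>u v. \<gamma> u v w) x) \<in> lin_map K Q U" if "x \<in> carrier (tensor K H H)" for x
      by (rule lin_lift_fun[OF H_alg H_alg U that Q]) (rule g; assumption)+
  qed
  have "?L (tensor_assoc K H H Q (tensor_map K (tensor K H H) Q \<Delta> (\<lambda>x. x) z)) =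
      TL U (\<lambda>x w. TL U (\<lambda>u v. \<gamma> u v w) x) (tensor_map K (tensor K H H) Q \<Delta> (\<lambda>x. x) z)"
    by (rule tensor_lift3_assoc[OF H_alg H_alg Q U \<gamma>])
      (rule tensor_map_closed[OF H_alg Q HH_alg Q \<Delta>_lin lin_id z])
  also have "\<dots> = TL U (\<lambda>x w. TL U (\<lambda>u v. \<gamma> u v w) (\<Delta> x)) z"
    by (rule tensor_lift_tensor_map[OF H_alg Q HH_alg Q U \<Delta>_lin lin_id 1 z])
  finally show ?thesis .
qed

lemma map_right_lift:
  assumes Q: "assoc_algebra K Q" "assoc_algebra K Q'" and P: "assoc_algebra K P" and U: "assoc_algebra K U"
    and \<gamma>: "trilin K H P Q' U \<gamma>" and z: "z \<in> carrier (tensor K H Q)" and \<delta>: "\<delta> \<in> lin_map K Q (tensor K P Q')"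
  shows "tensor_lift3 K U \<gamma> (tensor_map K H (tensor K P Q') (\<lambda>x. x) \<delta> z) =
      TL U (\<lambda>a b. TL U (\<lambda>c d. \<gamma> a c d) (\<delta> b)) z"
  unfolding tensor_lift3_def
  by (rule tensor_lift_tensor_map[OF H_alg Q(1) H_alg assoc_algebra_tensor[OF P Q(2)] U lin_id \<delta> _ z])
    (rule tensor_lift3_bilin[OF H_alg P Q(2) U \<gamma>])

end

context left_comodule_algebra
begin

lemma Q_alg [mlin]: "assoc_algebra K Q" by (rule Q.assoc_algebra)
lemma \<delta>_lin: "\<delta> \<in> lin_map K Q (tensor K H Q)" using alg_homD(1)[OF coaction_hom] .
lemma \<delta>_closed [mlin]: "h \<in> carrier Q \<Longrightarrow> \<delta> h \<in> carrier (tensor K H Q)" using lin_mapD(1)[OF \<delta>_lin] .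

lemma lin_co_fun [mlin]:
  assumes "h \<in> carrier Q" "assoc_algebra K U" "assoc_algebra K Z"
    "\<And>x. x \<in> carrier Z \<Longrightarrow> bilin K H Q U (\<lambda>v w. \<beta> x v w)"
    "\<And>v w. v \<in> carrier H \<Longrightarrow> w \<in> carrier Q \<Longrightarrow> (\<lambda>x. \<beta> x v w) \<in> lin_map K Z U"
  shows "(\<lambda>x. TL U (\<lambda>v w. \<beta> x v w) (\<delta> h)) \<in> lin_map K Z U"
  using assms by (intro lin_lift_fun[OF H_alg Q_alg]) (auto intro: \<delta>_closed)

lemma lin_co_arg [mlin]:
  assumes "assoc_algebra K U" "(\<lambda>x. g x) \<in> lin_map K Z Q" "bilin K H Q U (\<lambda>v w. \<beta> v w)"
  shows "(\<lambda>x. TL U (\<lambda>v w. \<beta> v w) (\<delta> (g x))) \<in> lin_map K Z U"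
  by (rule lin_lift_arg[OF H_alg Q_alg assms(1) lin_comp[OF \<delta>_lin assms(2)] assms(3)])

lemma co_closed [mlin]:
  assumes "h \<in> carrier Q" "assoc_algebra K U" "bilin K H Q U (\<lambda>v w. \<beta> v w)"
  shows "TL U (\<lambda>v w. \<beta> v w) (\<delta> h) \<in> carrier U"
  using assms by (intro tensor_lift_closed[OF H_alg Q_alg]) (auto intro: \<delta>_closed)

lemmas co_cong = tensor_lift_cong[OF H_alg Q_alg _ _ _ \<delta>_closed]
lemmas co_hom = lin_tensor_lift[OF H_alg Q_alg _ _ _ _ \<delta>_closed]

lemma coassoc_lift:
  assumes U: "assoc_algebra K U" and \<gamma>: "trilin K H H Q U \<gamma>" and q: "q \<in> carrier Q"
  shows "TL U (\<lambda>a b. TL U (\<lambda>c d. \<gamma> c d b) (\<Delta> a)) (\<delta> q) =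
    TL U (\<lambda>a b. TL U (\<lambda>c d. \<gamma> a c d) (\<delta> b)) (\<delta> q)"
  using comult_left_lift[OF Q_alg U \<gamma> \<delta>_closed[OF q]]
    map_right_lift[OF Q_alg Q_alg H_alg U \<gamma> \<delta>_closed[OF q] \<delta>_lin]
  by (simp add: coaction_coassoc[OF q])

lemma coaction_counit_lin:
  assumes U: "assoc_algebra K U" and F: "F \<in> lin_map K Q U" and h: "h \<in> carrier Q"
  shows "TL U (\<lambda>x y. \<epsilon> x \<odot>\<^bsub>U\<^esub> F y) (\<delta> h) = F h"
proof -
  note [mlin] = U lin_comp[OF F] lin_mapD(1)[OF F] h
  have "F (TL Q (\<lambda>x y. \<epsilon> x \<odot>\<^bsub>Q\<^esub> y) (\<delta> h)) = TL U (\<lambda>x y. F (\<epsilon> x \<odot>\<^bsub>Q\<^esub> y)) (\<delta> h)"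
    by (rule co_hom[OF Q_alg U F _ h]) (rule mlin | assumption)+
  also have "\<dots> = TL U (\<lambda>x y. \<epsilon> x \<odot>\<^bsub>U\<^esub> F y) (\<delta> h)"
    by (rule co_cong[OF U _ _ h, symmetric]) (rule mlin | assumption | simp add: lin_mapD(3)[OF F] \<epsilon>_closed)+
  finally show ?thesis by (simp add: coaction_counit h)
qed

end

lemmas (in bialgebra) sw_coassoc = left_comodule_algebra.coassoc_lift[OF regular_comodule_algebra]

text \<open>Meant for products of two legs: the factors are lifts into a triple tensor product,
  \<open>L\<close> is evaluation of a trilinear map, and on pure tensors the product of the legs is
  again a pure tensor.\<close>

lemma lin_mult_lifts:
  fixes T (structure)
  assumes V: "assoc_algebra K V" "assoc_algebra K W" and V': "assoc_algebra K V'" "assoc_algebra K W'"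
    and T: "assoc_algebra K T" and U: "assoc_algebra K U"
    and \<beta>: "bilin K V W T \<beta>" and \<gamma>: "bilin K V' W' T \<gamma>"
    and y: "y \<in> carrier (tensor K V W)" and z: "z \<in> carrier (tensor K V' W')"
    and L: "L \<in> lin_map K T U"
    and eq: "\<And>a b c d. a \<in> carrier V \<Longrightarrow> b \<in> carrier W \<Longrightarrow> c \<in> carrier V' \<Longrightarrow> d \<in> carrier W' \<Longrightarrow>
      L (\<beta> a b \<otimes> \<gamma> c d) = \<kappa> a b c d"
  shows "L (tensor_lift K T \<beta> y \<otimes> tensor_lift K T \<gamma> z) =
    tensor_lift K U (\<lambda>a b. tensor_lift K U (\<lambda>c d. \<kappa> a b c d) z) y"
proof -
  note [mlin] = T U V bilinD[OF \<beta>] bilinD[OF \<gamma>] bilin_closed[OF \<beta>] bilin_closed[OF \<gamma>] lin_comp[OF L]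
    lin_lift_fun[OF V' T z] lin_lift_fun[OF V' U z]
  have b: "bilin K V W T (\<lambda>a b. tensor_lift K T (\<lambda>c d. \<beta> a b \<otimes> \<gamma> c d) z)"
    by (rule mlin | assumption)+
  have c: "bilin K V W U (\<lambda>a b. tensor_lift K U (\<lambda>c d. L (\<beta> a b \<otimes> \<gamma> c d)) z)"
    by (rule mlin | assumption)+
  have d: "bilin K V' W' T (\<lambda>c d. \<beta> a b \<otimes> \<gamma> c d)"
      and e: "bilin K V' W' U (\<lambda>c d. L (\<beta> a b \<otimes> \<gamma> c d))"
    if "a \<in> carrier V" "b \<in> carrier W" for a b
    using that by - (rule mlin | assumption)+
  have "L (tensor_lift K T \<beta> y \<otimes> tensor_lift K T \<gamma> z) =
      L (tensor_lift K T (\<lambda>a b. tensor_lift K T (\<lambda>c d. \<beta> a b \<otimes> \<gamma> c d) z) y)"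
    by (simp add: mult_lifts[OF V V' T \<beta> \<gamma> y z])
  also have "\<dots> = tensor_lift K U (\<lambda>a b. L (tensor_lift K T (\<lambda>c d. \<beta> a b \<otimes> \<gamma> c d) z)) y"
    by (rule lin_tensor_lift[OF V T U L b y])
  also have "\<dots> = tensor_lift K U (\<lambda>a b. tensor_lift K U (\<lambda>c d. L (\<beta> a b \<otimes> \<gamma> c d)) z) y"
    by (rule tensor_lift_cong[OF V U c _ y, symmetric]) (simp add: lin_tensor_lift[OF V' T U L d z])
  also have "\<dots> = tensor_lift K U (\<lambda>a b. tensor_lift K U (\<lambda>c d. \<kappa> a b c d) z) y"
    by (rule tensor_lift_cong[OF V U c _ y], rule tensor_lift_cong[OF V' U e _ z]) (simp_all add: eq)
  finally show ?thesis .
qed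

lemma lift_commute:
  fixes T (structure)
  assumes V: "assoc_algebra K V" "assoc_algebra K W" and T: "assoc_algebra K T"
    and \<beta>: "bilin K V W T \<beta>" and z: "z \<in> carrier (tensor K V W)" and y: "y \<in> carrier T"
    and eq: "\<And>a b. a \<in> carrier V \<Longrightarrow> b \<in> carrier W \<Longrightarrow> \<beta> a b \<otimes> y = y \<otimes> \<beta> a b"
  shows "tensor_lift K T \<beta> z \<otimes> y = y \<otimes> tensor_lift K T \<beta> z"
proof -
  note [mlin] = T bilinD[OF \<beta>] y
  have "bilin K V W T (\<lambda>a b. \<beta> a b \<otimes> y)" by (rule mlin | assumption)+
  then show ?thesis unfolding mult_tensor_lift[OF V T \<beta> z y]
    by (rule tensor_lift_cong[OF V T _ eq z])
qed

context
  fixes K :: "'k ring" and U :: "('k, 'u) module" and V :: "('k, 'v) module" and W :: "('k, 'w) module"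
    and T :: "('k, 't) module" and \<gamma>
  assumes alg: "assoc_algebra K U" "assoc_algebra K V" "assoc_algebra K W" and T: "assoc_algebra K T"
    and \<gamma>: "trilin K U V W T \<gamma>"
begin

lemma lift3_leg13_leg23:
  assumes y: "y \<in> carrier (tensor K U W)" and z: "z \<in> carrier (tensor K V W)"
  shows "tensor_lift3 K T \<gamma> (leg13 K U V W y \<otimes>\<^bsub>tensor3 K U V W\<^esub> leg23 K U V W z) =
    tensor_lift K T (\<lambda>a b. tensor_lift K T (\<lambda>c d. \<gamma> a c (b \<otimes>\<^bsub>W\<^esub> d)) z) y"
  unfolding leg13_def leg23_def
proof (rule lin_mult_lifts[OF alg(1,3) alg(2,3) alg3[OF alg] T leg_bilins(2,3)[OF alg] y z tensor_lift3_lin[OF alg T \<gamma>]])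
  interpret U: assoc_algebra K U by (rule alg)
  interpret V: assoc_algebra K V by (rule alg)
  interpret W: assoc_algebra K W by (rule alg)
  fix a b c d assume "a \<in> carrier U" "b \<in> carrier W" "c \<in> carrier V" "d \<in> carrier W"
  then show "tensor_lift3 K T \<gamma> (tens3 K U V W a \<one>\<^bsub>V\<^esub> b \<otimes>\<^bsub>tensor3 K U V W\<^esub> tens3 K U V W \<one>\<^bsub>U\<^esub> c d) = \<gamma> a c (b \<otimes>\<^bsub>W\<^esub> d)"
    by (simp add: tens3_mult[OF alg] tensor_lift3_tens3[OF alg T \<gamma>])
qed

lemma lift3_leg13_leg12:
  assumes y: "y \<in> carrier (tensor K U W)" and z: "z \<in> carrier (tensor K U V)"
  shows "tensor_lift3 K T \<gamma> (leg13 K U V W y \<otimes>\<^bsub>tensor3 K U V W\<^esub> leg12 K U V W z) =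
    tensor_lift K T (\<lambda>a b. tensor_lift K T (\<lambda>c d. \<gamma> (a \<otimes>\<^bsub>U\<^esub> c) d b) z) y"
  unfolding leg13_def leg12_def
proof (rule lin_mult_lifts[OF alg(1,3) alg(1,2) alg3[OF alg] T leg_bilins(2,1)[OF alg] y z tensor_lift3_lin[OF alg T \<gamma>]])
  interpret U: assoc_algebra K U by (rule alg)
  interpret V: assoc_algebra K V by (rule alg)
  interpret W: assoc_algebra K W by (rule alg)
  fix a b c d assume "a \<in> carrier U" "b \<in> carrier W" "c \<in> carrier U" "d \<in> carrier V"
  then show "tensor_lift3 K T \<gamma> (tens3 K U V W a \<one>\<^bsub>V\<^esub> b \<otimes>\<^bsub>tensor3 K U V W\<^esub> tens3 K U V W c d \<one>\<^bsub>W\<^esub>) = \<gamma> (a \<otimes>\<^bsub>U\<^esub> c) d b"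
    by (simp add: tens3_mult[OF alg] tensor_lift3_tens3[OF alg T \<gamma>])
qed

end

text \<open>Commuting the inner factors turns \<open>f (a a') g (b b')\<close> into
  \<open>(f a g b) (f a' g b')\<close>. This universal property of the tensor algebra is what allows
  legs to be replaced by commuting algebra maps.\<close>

lemma tensor_lift_alg_hom:
  fixes T (structure)
  assumes V: "assoc_algebra K V" "assoc_algebra K W" and T: "assoc_algebra K T"
    and f: "f \<in> alg_hom K V T" and g: "g \<in> alg_hom K W T"
    and comm: "\<And>a b. a \<in> carrier V \<Longrightarrow> b \<in> carrier W \<Longrightarrow> f a \<otimes> g b = g b \<otimes> f a"
  shows "bilin K V W T (\<lambda>a b. f a \<otimes> g b)"
    and "(\<lambda>z. tensor_lift K T (\<lambda>a b. f a \<otimes> g b) z) \<in> alg_hom K (tensor K V W) T"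
proof -
  interpret V: assoc_algebra K V by (rule V)
  interpret W: assoc_algebra K W by (rule V)
  interpret T: assoc_algebra K T by (rule T)
  note fc [simp, mlin] = alg_hom_closed[OF f] alg_hom_closed[OF g]
  note [mlin] = V T lin_comp[OF alg_homD(1)[OF f]] lin_comp[OF alg_homD(1)[OF g]]
  show b: "bilin K V W T (\<lambda>a b. f a \<otimes> g b)" by (rule mlin | assumption)+
  note L = tensor_lift_lin[OF V T b]
  show "(\<lambda>z. tensor_lift K T (\<lambda>a b. f a \<otimes> g b) z) \<in> alg_hom K (tensor K V W) T"
  proof (rule alg_homI)
    fix y z assume yz: "y \<in> carrier (tensor K V W)" "z \<in> carrier (tensor K V W)"
    note [mlin] = lin_lift_fun[OF V T yz(2)]
    have b2: "bilin K V W T (\<lambda>a' b'. f (a \<otimes>\<^bsub>V\<^esub> a') \<otimes> g (b \<otimes>\<^bsub>W\<^esub> b'))"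
      if "a \<in> carrier V" "b \<in> carrier W" for a b
      using that by - (rule mlin | assumption)+
    have "f (a \<otimes>\<^bsub>V\<^esub> a') \<otimes> g (b \<otimes>\<^bsub>W\<^esub> b') = (f a \<otimes> g b) \<otimes> (f a' \<otimes> g b')"
      if [simp]: "a \<in> carrier V" "b \<in> carrier W" "a' \<in> carrier V" "b' \<in> carrier W" for a b a' b'
    proof -
      have "f (a \<otimes>\<^bsub>V\<^esub> a') \<otimes> g (b \<otimes>\<^bsub>W\<^esub> b') = f a \<otimes> ((f a' \<otimes> g b) \<otimes> g b')"
        by (simp add: alg_homD(2)[OF f] alg_homD(2)[OF g] T.A.m_assoc)
      also have "\<dots> = f a \<otimes> ((g b \<otimes> f a') \<otimes> g b')"
        using comm[of a' b] by simp
      also have "\<dots> = (f a \<otimes> g b) \<otimes> (f a' \<otimes> g b')"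
        by (simp add: T.A.m_assoc)
      finally show ?thesis .
    qed
    then show "tensor_lift K T (\<lambda>a b. f a \<otimes> g b) (y \<otimes>\<^bsub>tensor K V W\<^esub> z) =
        tensor_lift K T (\<lambda>a b. f a \<otimes> g b) y \<otimes> tensor_lift K T (\<lambda>a b. f a \<otimes> g b) z"
      unfolding tensor_lift_mult[OF V T b yz] mult_lifts[OF V V T b b yz]
      by (intro tensor_lift_cong[OF V T _ _ yz(1)] tensor_lift_cong[OF V T b2 _ yz(2)])
        (rule mlin | assumption | simp)+
  next
    show "tensor_lift K T (\<lambda>a b. f a \<otimes> g b) \<one>\<^bsub>tensor K V W\<^esub> = \<one>"
      using tensor_lift_tens[OF V T b, of "\<one>\<^bsub>V\<^esub>" "\<one>\<^bsub>W\<^esub>"]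
      by (simp add: tens_one V alg_homD(3)[OF f] alg_homD(3)[OF g])
  qed (use L in simp)
qed

subsection \<open>The antipode of a quasitriangular Hopf algebra\<close>

context hopf_algebra
begin

lemma S_closed [mlin]: "h \<in> carrier H \<Longrightarrow> S h \<in> carrier H" using lin_mapD(1)[OF antipode_linear] .
lemmas S_lin' [mlin] = lin_comp[OF antipode_linear]

lemma S_one: "S \<one>\<^bsub>H\<^esub> = \<one>\<^bsub>H\<^esub>"
proof -
  have b: "bilin K H H H (\<lambda>x y. S x \<star> y)" by (rule mlin | assumption)+
  have "S \<one>\<^bsub>H\<^esub> \<star> \<one>\<^bsub>H\<^esub> = \<epsilon> \<one>\<^bsub>H\<^esub> \<odot>\<^bsub>H\<^esub> \<one>\<^bsub>H\<^esub>"
    using antipode_left[of "\<one>\<^bsub>H\<^esub>"] by (simp add: \<Delta>_one tensor_lift_tens[OF H_alg H_alg H_alg b])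
  then show ?thesis by (simp add: \<epsilon>_one S_closed)
qed

lemma antipode_left_mult:
  fixes T (structure)
  assumes T: "assoc_algebra K T" and F: "F \<in> lin_map K H T" and h: "h \<in> carrier H"
  shows "TL T (\<lambda>x y. F (S x \<star> y)) (\<Delta> h) = \<epsilon> h \<odot> F \<one>\<^bsub>H\<^esub>"
    and "TL T (\<lambda>x y. F (x \<star> S y)) (\<Delta> h) = \<epsilon> h \<odot> F \<one>\<^bsub>H\<^esub>"
proof -
  have b: "bilin K H H H (\<lambda>x y. S x \<star> y)" "bilin K H H H (\<lambda>x y. x \<star> S y)" by (rule mlin | assumption)+
  show "TL T (\<lambda>x y. F (S x \<star> y)) (\<Delta> h) = \<epsilon> h \<odot> F \<one>\<^bsub>H\<^esub>"
    using sw_hom[OF H_alg T F b(1) h] antipode_left[OF h] lin_mapD(3)[OF F] h by (simp add: \<epsilon>_closed)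
  show "TL T (\<lambda>x y. F (x \<star> S y)) (\<Delta> h) = \<epsilon> h \<odot> F \<one>\<^bsub>H\<^esub>"
    using sw_hom[OF H_alg T F b(2) h] antipode_right[OF h] lin_mapD(3)[OF F] h by (simp add: \<epsilon>_closed)
qed

text \<open>
  Both \<open>S (x y)\<close> and \<open>S y S x\<close> arise from the sum of \<open>S (x\<^sub>1 y\<^sub>1) x\<^sub>2 y\<^sub>2 S y\<^sub>3 S x\<^sub>3\<close>
  by contracting the last four or the first four factors.
\<close>

lemma S_mult:
  assumes x: "x \<in> carrier H" and y: "y \<in> carrier H"
  shows "S (x \<star> y) = S y \<star> S x"
proof -
  note [mlin] = x y
  define \<gamma> where "\<gamma> p q r = TL H (\<lambda>y1 y2. TL H (\<lambda>c d.
      S (p \<star> y1) \<star> ((q \<star> c) \<star> (S d \<star> S r))) (\<Delta> y2)) (\<Delta> y)" for p q r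
  have tri: "trilin K H H H H (\<lambda>p q r. \<gamma> p q r)"
    unfolding \<gamma>_def by (rule mlin | assumption)+
  have L: "TL H (\<lambda>q r. \<gamma> p q r) (\<Delta> z) = \<epsilon> z \<odot>\<^bsub>H\<^esub> S (p \<star> y)"
    if p [mlin]: "p \<in> carrier H" and z [mlin]: "z \<in> carrier H" for p z
  proof -
    have 1: "\<gamma> p q r = S (p \<star> y) \<star> (q \<star> S r)" if [mlin]: "q \<in> carrier H" "r \<in> carrier H" for q r
    proof -
      have 2: "TL H (\<lambda>c d. S (p \<star> y1) \<star> ((q \<star> c) \<star> (S d \<star> S r))) (\<Delta> y2) =
        \<epsilon> y2 \<odot>\<^bsub>H\<^esub> (S (p \<star> y1) \<star> (q \<star> S r))" if [mlin]: "y1 \<in> carrier H" "y2 \<in> carrier H" for y1 y2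
      proof -
        have F: "(\<lambda>w. S (p \<star> y1) \<star> (q \<star> w \<star> S r)) \<in> lin_map K H H"
          by (rule mlin | assumption)+
        have "TL H (\<lambda>c d. S (p \<star> y1) \<star> ((q \<star> c) \<star> (S d \<star> S r))) (\<Delta> y2) =
          TL H (\<lambda>c d. S (p \<star> y1) \<star> (q \<star> (c \<star> S d) \<star> S r)) (\<Delta> y2)"
          by (rule sw_cong[OF H_alg], (rule mlin | assumption)+)
            (simp add: A.m_assoc S_closed that \<open>q \<in> carrier H\<close> \<open>r \<in> carrier H\<close>, (rule mlin | assumption)+)
        also have "\<dots> = \<epsilon> y2 \<odot>\<^bsub>H\<^esub> (S (p \<star> y1) \<star> (q \<star> \<one>\<^bsub>H\<^esub> \<star> S r))"
          by (rule antipode_left_mult(2)[OF H_alg F]) (rule mlin)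
        finally show ?thesis by (simp add: \<open>q \<in> carrier H\<close>)
      qed
      have F: "(\<lambda>w. S (p \<star> w) \<star> (q \<star> S r)) \<in> lin_map K H H"
        by (rule mlin | assumption)+
      have "\<gamma> p q r = TL H (\<lambda>y1 y2. \<epsilon> y2 \<odot>\<^bsub>H\<^esub> (S (p \<star> y1) \<star> (q \<star> S r))) (\<Delta> y)"
        unfolding \<gamma>_def by (rule sw_cong[OF H_alg _ 2]) (rule mlin | assumption)+
      also have "\<dots> = S (p \<star> y) \<star> (q \<star> S r)"
        by (rule counit_right_lin[OF H_alg F y])
      finally show ?thesis .
    qed
    have F: "(\<lambda>w. S (p \<star> y) \<star> w) \<in> lin_map K H H"
      by (rule mlin | assumption)+
    have "TL H (\<lambda>q r. \<gamma> p q r) (\<Delta> z) =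
        TL H (\<lambda>q r. S (p \<star> y) \<star> (q \<star> S r)) (\<Delta> z)"
      by (rule sw_cong[OF H_alg trilinD(4)[OF tri p] 1 z])
    also have "\<dots> = \<epsilon> z \<odot>\<^bsub>H\<^esub> (S (p \<star> y) \<star> \<one>\<^bsub>H\<^esub>)"
      by (rule antipode_left_mult(2)[OF H_alg F z])
    finally show ?thesis by (simp add: p y S_closed)
  qed
  have Rr: "TL H (\<lambda>p q. \<gamma> p q r) (\<Delta> w) = \<epsilon> w \<odot>\<^bsub>H\<^esub> (S y \<star> S r)"
    if r [mlin]: "r \<in> carrier H" and w [mlin]: "w \<in> carrier H" for r w
  proof -
    have 1: "\<gamma> p q r = TL H (\<lambda>v d. TL H (\<lambda>y1 c.
        S (p \<star> y1) \<star> ((q \<star> c) \<star> (S d \<star> S r))) (\<Delta> v)) (\<Delta> y)"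
      if [mlin]: "p \<in> carrier H" "q \<in> carrier H" for p q
      unfolding \<gamma>_def
      by (rule sw_coassoc[OF H_alg, symmetric]) (rule mlin | assumption)+
    have "TL H (\<lambda>p q. \<gamma> p q r) (\<Delta> w) = TL H (\<lambda>p q. TL H (\<lambda>v d. TL H (\<lambda>y1 c.
        S (p \<star> y1) \<star> ((q \<star> c) \<star> (S d \<star> S r))) (\<Delta> v)) (\<Delta> y)) (\<Delta> w)"
      by (rule sw_cong[OF H_alg trilinD(6)[OF tri r] 1 w])
    also have "\<dots> = TL H (\<lambda>v d. TL H (\<lambda>p q. TL H (\<lambda>y1 c.
        S (p \<star> y1) \<star> ((q \<star> c) \<star> (S d \<star> S r))) (\<Delta> v)) (\<Delta> w)) (\<Delta> y)"
      by (rule tensor_lift_swap[OF H_alg H_alg H_alg H_alg H_alg]) (rule mlin | assumption)+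
    also have "\<dots> = TL H (\<lambda>v d. \<epsilon> v \<odot>\<^bsub>H\<^esub> (\<epsilon> w \<odot>\<^bsub>H\<^esub> (S d \<star> S r))) (\<Delta> y)"
    proof (rule sw_cong[OF H_alg _ _ y])
      fix v d assume vd [mlin]: "v \<in> carrier H" "d \<in> carrier H"
      have F: "(\<lambda>u. u \<star> (S d \<star> S r)) \<in> lin_map K H H"
        by (rule mlin | assumption)+
      show "TL H (\<lambda>p q. TL H (\<lambda>y1 c.
          S (p \<star> y1) \<star> ((q \<star> c) \<star> (S d \<star> S r))) (\<Delta> v)) (\<Delta> w) =
          \<epsilon> v \<odot>\<^bsub>H\<^esub> (\<epsilon> w \<odot>\<^bsub>H\<^esub> (S d \<star> S r))" (is "?l = ?r")
      proof -
      \<comment> \<open>The separate sums over \<open>w\<close> and \<open>v\<close> merge into the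
        coproduct of \<open>w \<star> v\<close>, to which the antipode axiom applies.\<close>
      have "?l =
        TL H (\<lambda>a b. S a \<star> (b \<star> (S d \<star> S r))) (\<Delta> (w \<star> v))"
        by (rule sw_mult[OF H_alg, symmetric]) (rule mlin | assumption)+
      also have "\<dots> = TL H (\<lambda>a b. (S a \<star> b) \<star> (S d \<star> S r)) (\<Delta> (w \<star> v))"
        by (rule sw_cong[OF H_alg], (rule mlin | assumption)+) (simp add: A.m_assoc S_closed vd r, (rule mlin | assumption)+)
      also have "\<dots> = \<epsilon> (w \<star> v) \<odot>\<^bsub>H\<^esub> (\<one>\<^bsub>H\<^esub> \<star> (S d \<star> S r))"
        by (rule antipode_left_mult(1)[OF H_alg F]) (rule mlin)+
      also have "\<dots> = ?r"
        using vd w r by (simp add: \<epsilon>_mult \<epsilon>_closed S_closed K.m_comm[of "\<epsilon> w"] smult_assoc1)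
      finally show ?thesis .
      qed
    qed (rule mlin | assumption)+
    also have "\<dots> = \<epsilon> w \<odot>\<^bsub>H\<^esub> (S y \<star> S r)"
      by (rule counit_left_lin[OF H_alg _ y]) (rule mlin | assumption)+
    finally show ?thesis .
  qed
  have "S (x \<star> y) = TL H (\<lambda>p z. \<epsilon> z \<odot>\<^bsub>H\<^esub> S (p \<star> y)) (\<Delta> x)"
    by (rule counit_right_lin[OF H_alg _ x, symmetric]) (rule mlin)+
  also have "\<dots> = TL H (\<lambda>p z. TL H (\<lambda>q r. \<gamma> p q r) (\<Delta> z)) (\<Delta> x)"
    by (rule sw_cong[OF H_alg _ L[symmetric] x]) (rule mlin | assumption)+
  also have "\<dots> = TL H (\<lambda>w r. TL H (\<lambda>p q. \<gamma> p q r) (\<Delta> w)) (\<Delta> x)"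
    by (rule sw_coassoc[OF H_alg tri x, symmetric])
  also have "\<dots> = TL H (\<lambda>w r. \<epsilon> w \<odot>\<^bsub>H\<^esub> (S y \<star> S r)) (\<Delta> x)"
    by (rule sw_cong[OF H_alg _ Rr[symmetric] x, symmetric]) (rule mlin | assumption)+
  also have "\<dots> = S y \<star> S x"
    by (rule counit_left_lin[OF H_alg _ x]) (rule mlin)+
  finally show ?thesis .
qed

end

section \<open>Sweedler sums over the R-matrix\<close>

context quasitriangular_hopf_algebra
begin

lemma R_closed [mlin]: "R \<in> carrier (tensor K H H)" using R_invertible by (simp add: Units_def)

lemma lin_R_fun [mlin]:
  assumes "assoc_algebra K U" "assoc_algebra K Z"
    "\<And>x. x \<in> carrier Z \<Longrightarrow> bilin K H H U (\<lambda>v w. \<beta> x v w)"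
    "\<And>v w. v \<in> carrier H \<Longrightarrow> w \<in> carrier H \<Longrightarrow> (\<lambda>x. \<beta> x v w) \<in> lin_map K Z U"
  shows "(\<lambda>x. TL U (\<lambda>v w. \<beta> x v w) R) \<in> lin_map K Z U"
  using assms by (intro lin_lift_fun[OF H_alg H_alg]) (auto intro: R_closed)

lemma R_lift_closed [mlin]:
  assumes "assoc_algebra K U" "bilin K H H U (\<lambda>v w. \<beta> v w)"
  shows "TL U (\<lambda>v w. \<beta> v w) R \<in> carrier U"
  by (rule tensor_lift_closed[OF H_alg H_alg assms(1) R_closed assms(2)])

lemmas R_cong = tensor_lift_cong[OF H_alg H_alg _ _ _ R_closed]
lemmas R_hom = lin_tensor_lift[OF H_alg H_alg _ _ _ _ R_closed]
lemmas R_swap = tensor_lift_swap[OF H_alg H_alg H_alg H_alg _ R_closed R_closed]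

lemma R_comult_left_lift:
  assumes U: "assoc_algebra K U" and \<gamma>: "trilin K H H H U \<gamma>"
  shows "TL U (\<lambda>a b. TL U (\<lambda>c d. \<gamma> c d b) (\<Delta> a)) R =
    TL U (\<lambda>a b. TL U (\<lambda>c d. \<gamma> a c (b \<star> d)) R) R"
  using comult_left_lift[OF H_alg U \<gamma> R_closed] lift3_leg13_leg23[OF H_alg H_alg H_alg U \<gamma> R_closed R_closed]
  by (simp add: R_comult_left)

lemma R_comult_right_lift:
  assumes U: "assoc_algebra K U" and \<gamma>: "trilin K H H H U \<gamma>"
  shows "TL U (\<lambda>a b. TL U (\<lambda>c d. \<gamma> a c d) (\<Delta> b)) R =
    TL U (\<lambda>a b. TL U (\<lambda>c d. \<gamma> (a \<star> c) d b) R) R"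
  using map_right_lift[OF H_alg H_alg H_alg U \<gamma> R_closed \<Delta>_lin] lift3_leg13_leg12[OF H_alg H_alg H_alg U \<gamma> R_closed R_closed]
  by (simp add: R_comult_right)

lemma R_intertwines_lift:
  assumes U: "assoc_algebra K U" and \<beta>: "bilin K H H U \<beta>" and h: "h \<in> carrier H"
  shows "TL U (\<lambda>a b. TL U (\<lambda>c d. \<beta> (a \<star> c) (b \<star> d)) (\<Delta> h)) R =
    TL U (\<lambda>a b. TL U (\<lambda>c d. \<beta> (d \<star> a) (c \<star> b)) (\<Delta> h)) R"
proof -
  note [mlin] = U h lin_comp[OF bilinD(1)[OF \<beta>]] lin_comp[OF bilinD(2)[OF \<beta>]] bilin_closed[OF \<beta>]
  note fl = tensor_lift_flip[OF H_alg H_alg U _ \<Delta>_closed[OF h]]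
  note Rl = R_closed and Dl = \<Delta>_closed[OF h]
  have fl2: "tensor_flip K H H (\<Delta> h) \<in> carrier (tensor K H H)"
    by (rule tensor_lift_flip(2)[OF H_alg H_alg H_alg _ Dl, of "\<lambda>x y. x \<star> y"]) (rule mlin | assumption)+
  have "TL U (\<lambda>a b. TL U (\<lambda>c d. \<beta> (a \<star> c) (b \<star> d)) (\<Delta> h)) R =
    TL U \<beta> (tensor_flip K H H (\<Delta> h) \<otimes>\<^bsub>tensor K H H\<^esub> R)"
    by (simp add: tensor_lift_mult[OF H_alg H_alg U \<beta> Rl Dl, symmetric] R_intertwines[OF h])
  also have "\<dots> = TL U (\<lambda>a b. TL U (\<lambda>c d. \<beta> (a \<star> c) (b \<star> d)) R) (tensor_flip K H H (\<Delta> h))"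
    by (rule tensor_lift_mult[OF H_alg H_alg U \<beta> fl2 Rl])
  also have "\<dots> = TL U (\<lambda>c d. TL U (\<lambda>a b. \<beta> (d \<star> a) (c \<star> b)) R) (\<Delta> h)"
    by (rule fl) (rule mlin | assumption)+
  also have "\<dots> = TL U (\<lambda>a b. TL U (\<lambda>c d. \<beta> (d \<star> a) (c \<star> b)) (\<Delta> h)) R"
    by (rule tensor_lift_swap[OF H_alg H_alg H_alg H_alg U Dl Rl]) (rule mlin | assumption)+
  finally show ?thesis .
qed

end

lemma (in assoc_algebra) mult_commute:
  assumes "a \<in> carrier A" "b \<in> carrier A" "y \<in> carrier A"
    and a: "a \<otimes>\<^bsub>A\<^esub> y = y \<otimes>\<^bsub>A\<^esub> a" and b: "b \<otimes>\<^bsub>A\<^esub> y = y \<otimes>\<^bsub>A\<^esub> b"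
  shows "(a \<otimes>\<^bsub>A\<^esub> b) \<otimes>\<^bsub>A\<^esub> y = y \<otimes>\<^bsub>A\<^esub> (a \<otimes>\<^bsub>A\<^esub> b)"
proof -
  have "(a \<otimes>\<^bsub>A\<^esub> b) \<otimes>\<^bsub>A\<^esub> y = a \<otimes>\<^bsub>A\<^esub> (b \<otimes>\<^bsub>A\<^esub> y)" using assms(1-3) by (rule A.m_assoc)
  also have "\<dots> = (a \<otimes>\<^bsub>A\<^esub> y) \<otimes>\<^bsub>A\<^esub> b" unfolding b using assms(1-3) by (simp add: A.m_assoc)
  also have "\<dots> = y \<otimes>\<^bsub>A\<^esub> (a \<otimes>\<^bsub>A\<^esub> b)" unfolding a using assms(1-3) by (simp add: A.m_assoc)
  finally show ?thesis .
qed

context quasitriangular_hopf_algebra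
begin

subsection \<open>Legs and convolution\<close>

text \<open>
  Instead of numbering the legs of an iterated tensor product, the legs are commuting algebra
  maps \<open>f\<close>, \<open>g\<close> from \<open>H\<close> to an arbitrary algebra \<open>T\<close>: \<open>RR T f g\<close> is the image of \<open>R\<close> under
  \<open>a \<otimes> b \<mapsto> f a g b\<close>, \<open>cv T f g\<close> is the composite of \<open>\<Delta>\<close> with this map, and \<open>et T\<close> is the trivial leg.
\<close>

definition RR where "RR T f g = TL T (\<lambda>a b. f a \<otimes>\<^bsub>T\<^esub> g b) R"
definition cv where "cv T f g = (\<lambda>h. TL T (\<lambda>a b. f a \<otimes>\<^bsub>T\<^esub> g b) (\<Delta> h))"
definition et :: "('k, 't) module \<Rightarrow> 'h \<Rightarrow> 't" where "et T = (\<lambda>h. \<epsilon> h \<odot>\<^bsub>T\<^esub> \<one>\<^bsub>T\<^esub>)"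

definition comm_homs where
  "comm_homs T f g \<longleftrightarrow> f \<in> alg_hom K H T \<and> g \<in> alg_hom K H T \<and>
    (\<forall>a\<in>carrier H. \<forall>b\<in>carrier H. f a \<otimes>\<^bsub>T\<^esub> g b = g b \<otimes>\<^bsub>T\<^esub> f a)"

lemma comm_homs_sym: "comm_homs T f g \<Longrightarrow> comm_homs T g f"
  by (auto simp: comm_homs_def)

context
  fixes T :: "('k, 't) module" (structure) assumes T: "assoc_algebra K T"
begin

interpretation T: assoc_algebra K T by (rule T)

lemma et_hom: "et T \<in> alg_hom K H T"
proof (rule alg_homI)
  show "et T \<in> lin_map K H T" unfolding et_def using T by - (rule mlin | assumption)+
  show "et T \<one>\<^bsub>H\<^esub> = \<one>" by (simp add: et_def \<epsilon>_one)
  show "et T (x \<star> y) = et T x \<otimes> et T y" if "x \<in> carrier H" "y \<in> carrier H" for x y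
    using that by (simp add: et_def \<epsilon>_mult \<epsilon>_closed T.smult_mult_left T.smult_assoc1)
qed

lemma comm_homs_et:
  assumes f: "f \<in> alg_hom K H T"
  shows "comm_homs T (et T) f" "comm_homs T f (et T)"
proof -
  have "et T a \<otimes> f b = f b \<otimes> et T a" if "a \<in> carrier H" "b \<in> carrier H" for a b
    using that alg_hom_closed[OF f that(2)] by (simp add: et_def \<epsilon>_closed T.smult_mult_left T.smult_mult_right)
  then show "comm_homs T (et T) f" "comm_homs T f (et T)"
    unfolding comm_homs_def using et_hom f by auto
qed

lemma commD:
  assumes "comm_homs T f g"
  shows "f \<in> alg_hom K H T" "g \<in> alg_hom K H T" "bilin K H H T (\<lambda>a b. f a \<otimes> g b)"
    and "a \<in> carrier H \<Longrightarrow> b \<in> carrier H \<Longrightarrow> f a \<otimes> g b = g b \<otimes> f a"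
    and "a \<in> carrier H \<Longrightarrow> f a \<in> carrier T" "a \<in> carrier H \<Longrightarrow> g a \<in> carrier T"
    and "a \<in> carrier H \<Longrightarrow> b \<in> carrier H \<Longrightarrow> z \<in> carrier T \<Longrightarrow>
      f a \<otimes> (g b \<otimes> z) = g b \<otimes> (f a \<otimes> z)"
proof -
  note d = assms[unfolded comm_homs_def]
  show f: "f \<in> alg_hom K H T" by (rule d[THEN conjunct1])
  show g: "g \<in> alg_hom K H T" by (rule d[THEN conjunct2, THEN conjunct1])
  have c: "f a \<otimes> g b = g b \<otimes> f a" if "a \<in> carrier H" "b \<in> carrier H" for a b
    by (rule bspec[OF bspec[OF d[THEN conjunct2, THEN conjunct2] that(1)] that(2)])
  then show "a \<in> carrier H \<Longrightarrow> b \<in> carrier H \<Longrightarrow> f a \<otimes> g b = g b \<otimes> f a" .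
  show "bilin K H H T (\<lambda>a b. f a \<otimes> g b)"
    by (rule tensor_lift_alg_hom(1)[OF H_alg H_alg T f g c])
  show fc: "a \<in> carrier H \<Longrightarrow> f a \<in> carrier T" and gc: "a \<in> carrier H \<Longrightarrow> g a \<in> carrier T" for a
    by (rule alg_hom_closed[OF f], assumption) (rule alg_hom_closed[OF g], assumption)
  show "f a \<otimes> (g b \<otimes> z) = g b \<otimes> (f a \<otimes> z)"
    if [simp]: "a \<in> carrier H" "b \<in> carrier H" "z \<in> carrier T"
  proof -
    have "f a \<otimes> (g b \<otimes> z) = (f a \<otimes> g b) \<otimes> z"
      by (simp add: T.A.m_assoc fc gc)
    also have "\<dots> = (g b \<otimes> f a) \<otimes> z" by (simp only: c[of a b] that)
    finally show ?thesis by (simp add: T.A.m_assoc fc gc)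
  qed
qed

lemma lift_hom: "comm_homs T f g \<Longrightarrow> (\<lambda>z. TL T (\<lambda>a b. f a \<otimes> g b) z) \<in> alg_hom K (tensor K H H) T"
  by (rule tensor_lift_alg_hom(2)[OF H_alg H_alg T]) (fact commD(1) commD(2) | (rule commD(4); assumption))+

lemma cv_hom: "comm_homs T f g \<Longrightarrow> cv T f g \<in> alg_hom K H T"
  using lift_hom[of f g] comult_hom unfolding cv_def alg_hom_def lin_map_def ring_hom_def
  by (auto simp: Pi_def)

lemma RR_unit: "comm_homs T f g \<Longrightarrow> RR T f g \<in> Units T"
proof -
  assume c: "comm_homs T f g"
  note l = lift_hom[OF c]
  obtain R' where R': "R' \<in> carrier (tensor K H H)" "R \<otimes>\<^bsub>tensor K H H\<^esub> R' = \<one>\<^bsub>tensor K H H\<^esub>"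
      "R' \<otimes>\<^bsub>tensor K H H\<^esub> R = \<one>\<^bsub>tensor K H H\<^esub>"
    using R_invertible unfolding Units_def by blast
  let ?F = "TL T (\<lambda>a b. f a \<otimes> g b)"
  have "?F R \<otimes> ?F R' = \<one>" "?F R' \<otimes> ?F R = \<one>"
    using alg_homD(2)[OF l R_closed R'(1)] alg_homD(2)[OF l R'(1) R_closed] alg_homD(3)[OF l] R'(2,3) by simp_all
  then show ?thesis unfolding Units_def RR_def
    using alg_hom_closed[OF l R_closed] alg_hom_closed[OF l R'(1)] by blast
qed

lemma RR_closed [simp]: "comm_homs T f g \<Longrightarrow> RR T f g \<in> carrier T"
  using RR_unit by (auto simp: Units_def)

lemma RR_commute:
  assumes "comm_homs T f g" and y: "y \<in> carrier T"
    and "\<And>a. a \<in> carrier H \<Longrightarrow> f a \<otimes> y = y \<otimes> f a" "\<And>a. a \<in> carrier H \<Longrightarrow> g a \<otimes> y = y \<otimes> g a"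
  shows "RR T f g \<otimes> y = y \<otimes> RR T f g"
  unfolding RR_def
proof (rule lift_commute[OF H_alg H_alg T commD(3)[OF assms(1)] R_closed y])
  fix a b assume ab: "a \<in> carrier H" "b \<in> carrier H"
  show "f a \<otimes> g b \<otimes> y = y \<otimes> (f a \<otimes> g b)"
    by (rule T.mult_commute[OF commD(5)[OF assms(1) ab(1)] commD(6)[OF assms(1) ab(2)] y assms(3)[OF ab(1)] assms(4)[OF ab(2)]])
qed

lemma cv_commute:
  assumes "comm_homs T f g" and y: "y \<in> carrier T" and h: "h \<in> carrier H"
    and "\<And>a. a \<in> carrier H \<Longrightarrow> f a \<otimes> y = y \<otimes> f a" "\<And>a. a \<in> carrier H \<Longrightarrow> g a \<otimes> y = y \<otimes> g a"
  shows "cv T f g h \<otimes> y = y \<otimes> cv T f g h"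
  unfolding cv_def
proof (rule lift_commute[OF H_alg H_alg T commD(3)[OF assms(1)] \<Delta>_closed[OF h] y])
  fix a b assume ab: "a \<in> carrier H" "b \<in> carrier H"
  show "f a \<otimes> g b \<otimes> y = y \<otimes> (f a \<otimes> g b)"
    by (rule T.mult_commute[OF commD(5)[OF assms(1) ab(1)] commD(6)[OF assms(1) ab(2)] y assms(4)[OF ab(1)] assms(5)[OF ab(2)]])
qed

lemma comm_homs_cv:
  assumes "comm_homs T f g" "comm_homs T f k" "comm_homs T g k"
  shows "comm_homs T (cv T f g) k"
  unfolding comm_homs_def
  by (intro conjI ballI cv_hom[OF assms(1)] commD(2)[OF assms(2)] cv_commute[OF assms(1)])
    (rule commD[OF assms(2)] commD[OF assms(3)] | assumption)+

text \<open>The axiom for \<open>(\<Delta> \<otimes> Id) R\<close> in leg form, with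
  \<open>f\<close> and \<open>g\<close> the two legs of the coproduct and \<open>k\<close> the
  remaining one. The axiom for \<open>(Id \<otimes> \<Delta>) R\<close> becomes
  \<open>RR_cv_right\<close>, where the factors come out in the opposite order.\<close>

lemma RR_cv_left:
  assumes fg: "comm_homs T f g" and fk: "comm_homs T f k" and gk: "comm_homs T g k"
  shows "RR T (cv T f g) k = RR T f k \<otimes> RR T g k"
proof -
  note c [simp, mlin] = commD(5,6)[OF fg] commD(6)[OF gk]
  note [mlin] = T lin_comp[OF alg_homD(1)[OF commD(1)[OF fg]]] lin_comp[OF alg_homD(1)[OF commD(2)[OF fg]]]
     lin_comp[OF alg_homD(1)[OF commD(2)[OF gk]]] 
  have tri: "trilin K H H H T (\<lambda>a b c. (f a \<otimes> g b) \<otimes> k c)" by (rule mlin | assumption)+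
  have "RR T (cv T f g) k = TL T (\<lambda>a b. TL T (\<lambda>c d. (f c \<otimes> g d) \<otimes> k b) (\<Delta> a)) R"
    unfolding RR_def cv_def
    by (rule R_cong[OF T _ mult_tensor_lift(2)[OF H_alg H_alg T commD(3)[OF fg] \<Delta>_closed]]) (rule mlin | assumption)+
  also have "\<dots> = TL T (\<lambda>a b. TL T (\<lambda>c d. (f a \<otimes> g c) \<otimes> k (b \<star> d)) R) R"
    by (rule R_comult_left_lift[OF T tri])
  also have "\<dots> = TL T (\<lambda>a b. TL T (\<lambda>c d. (f a \<otimes> k b) \<otimes> (g c \<otimes> k d)) R) R"
    apply (rule R_cong[OF T], (rule mlin | assumption)+)
    apply (rule R_cong[OF T], (rule mlin | assumption)+)
    apply (simp add: alg_homD(2)[OF commD(2)[OF gk]] T.A.m_assoc commD(7)[OF gk])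
    done
  also have "\<dots> = RR T f k \<otimes> RR T g k"
    unfolding RR_def by (rule mult_lifts[OF H_alg H_alg H_alg H_alg T commD(3)[OF fk] commD(3)[OF gk] R_closed R_closed, symmetric])
  finally show ?thesis .
qed

lemma RR_cv_right:
  assumes fg: "comm_homs T f g" and fk: "comm_homs T f k" and gk: "comm_homs T g k"
  shows "RR T f (cv T g k) = RR T f k \<otimes> RR T f g"
proof -
  note c [simp, mlin] = commD(5,6)[OF fg] commD(6)[OF gk]
  note [mlin] = T lin_comp[OF alg_homD(1)[OF commD(1)[OF fg]]] lin_comp[OF alg_homD(1)[OF commD(2)[OF fg]]]
     lin_comp[OF alg_homD(1)[OF commD(2)[OF gk]]] 
  have tri: "trilin K H H H T (\<lambda>a b c. f a \<otimes> (g b \<otimes> k c))" by (rule mlin | assumption)+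
  have "RR T f (cv T g k) = TL T (\<lambda>a b. TL T (\<lambda>c d. f a \<otimes> (g c \<otimes> k d)) (\<Delta> b)) R"
    unfolding RR_def cv_def
    by (rule R_cong[OF T _ mult_tensor_lift(1)[OF H_alg H_alg T commD(3)[OF gk] \<Delta>_closed]]) (rule mlin | assumption)+
  also have "\<dots> = TL T (\<lambda>a b. TL T (\<lambda>c d. f (a \<star> c) \<otimes> (g d \<otimes> k b)) R) R"
    by (rule R_comult_right_lift[OF T tri])
  also have "\<dots> = TL T (\<lambda>a b. TL T (\<lambda>c d. (f a \<otimes> k b) \<otimes> (f c \<otimes> g d)) R) R"
    apply (rule R_cong[OF T], (rule mlin | assumption)+)
    apply (rule R_cong[OF T], (rule mlin | assumption)+)
    apply (simp add: alg_homD(2)[OF commD(1)[OF fg]] T.A.m_assoc commD(4)[OF gk] commD(7)[OF fk])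
    done
  also have "\<dots> = RR T f k \<otimes> RR T f g"
    unfolding RR_def by (rule mult_lifts[OF H_alg H_alg H_alg H_alg T commD(3)[OF fk] commD(3)[OF fg] R_closed R_closed, symmetric])
  finally show ?thesis .
qed

text \<open>The intertwining axiom in leg form: the opposite coproduct is convolution with the two
  legs exchanged.\<close>

lemma RR_cv:
  assumes fg: "comm_homs T f g" and h: "h \<in> carrier H"
  shows "RR T f g \<otimes> cv T f g h = cv T g f h \<otimes> RR T f g"
proof -
  note c [simp, mlin] = commD(5,6)[OF fg]
  note gf = comm_homs_sym[OF fg]
  note fh = commD(1)[OF fg] and gh = commD(2)[OF fg]
  note [mlin] = h T lin_comp[OF alg_homD(1)[OF fh]] lin_comp[OF alg_homD(1)[OF gh]]
  have "RR T f g \<otimes> cv T f g h = TL T (\<lambda>a b. TL T (\<lambda>c d. (f a \<otimes> g b) \<otimes> (f c \<otimes> g d)) (\<Delta> h)) R"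
    unfolding RR_def cv_def by (rule mult_lifts[OF H_alg H_alg H_alg H_alg T commD(3)[OF fg] commD(3)[OF fg] R_closed \<Delta>_closed[OF h]])
  also have "\<dots> = TL T (\<lambda>a b. TL T (\<lambda>c d. f (a \<star> c) \<otimes> g (b \<star> d)) (\<Delta> h)) R"
    apply (rule R_cong[OF T], (rule mlin | assumption)+)
    apply (rule sw_cong[OF T _ _ h], (rule mlin | assumption)+)
    apply (simp add: alg_homD(2)[OF fh] alg_homD(2)[OF gh] T.A.m_assoc commD(7)[OF gf])
    done
  also have "\<dots> = TL T (\<lambda>a b. TL T (\<lambda>c d. f (d \<star> a) \<otimes> g (c \<star> b)) (\<Delta> h)) R"
    by (rule R_intertwines_lift[OF T _ h]) (rule mlin | assumption)+
  also have "\<dots> = TL T (\<lambda>a b. TL T (\<lambda>c d. (g c \<otimes> f d) \<otimes> (f a \<otimes> g b)) (\<Delta> h)) R"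
    apply (rule R_cong[OF T], (rule mlin | assumption)+)
    apply (rule sw_cong[OF T _ _ h], (rule mlin | assumption)+)
    apply (simp add: alg_homD(2)[OF fh] alg_homD(2)[OF gh] T.A.m_assoc commD(7)[OF fg])
    done
  also have "\<dots> = TL T (\<lambda>c d. TL T (\<lambda>a b. (g c \<otimes> f d) \<otimes> (f a \<otimes> g b)) R) (\<Delta> h)"
    by (rule tensor_lift_swap[OF H_alg H_alg H_alg H_alg T R_closed \<Delta>_closed[OF h]]) (rule mlin | assumption)+
  also have "\<dots> = cv T g f h \<otimes> RR T f g"
    unfolding RR_def cv_def by (rule mult_lifts[OF H_alg H_alg H_alg H_alg T commD(3)[OF gf] commD(3)[OF fg] \<Delta>_closed[OF h] R_closed, symmetric])
  finally show ?thesis .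
qed

text \<open>\<open>R_12\<close> times \<open>(\<Delta> \<otimes> Id) R\<close> is computed in two
  ways: \<open>RR_cv\<close> replaces the coproduct by its opposite while \<open>R_12\<close> moves
  to the other side, and \<open>RR_cv_left\<close> expands both versions.\<close>

lemma YBE:
  assumes fg: "comm_homs T f g" and fk: "comm_homs T f k" and gk: "comm_homs T g k"
  shows "RR T f g \<otimes> (RR T f k \<otimes> RR T g k) = RR T g k \<otimes> (RR T f k \<otimes> RR T f g)"
proof -
  note gf = comm_homs_sym[OF fg]
  note c1 = comm_homs_cv[OF fg fk gk] and c2 = comm_homs_cv[OF gf gk fk]
  note [simp] = commD(6)[OF fk] alg_hom_closed[OF cv_hom[OF fg]] alg_hom_closed[OF cv_hom[OF gf]]
  note [mlin] = commD(5,6)[OF fg] commD(6)[OF gk] alg_hom_closed[OF cv_hom[OF fg]] alg_hom_closed[OF cv_hom[OF gf]] T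
     lin_comp[OF alg_homD(1)[OF cv_hom[OF fg]]] lin_comp[OF alg_homD(1)[OF commD(2)[OF gk]]] RR_closed[OF fg]
  have com: "RR T f g \<otimes> k b = k b \<otimes> RR T f g" if "b \<in> carrier H" for b
    by (rule RR_commute[OF fg]) (use that commD(4)[OF fk] commD(4)[OF gk] in auto)
  have "RR T f g \<otimes> RR T (cv T f g) k = TL T (\<lambda>a b. RR T f g \<otimes> (cv T f g a \<otimes> k b)) R"
    unfolding RR_def[of T "cv T f g"]
    by (rule mult_tensor_lift(1)[OF H_alg H_alg T commD(3)[OF c1] R_closed RR_closed[OF fg]])
  also have "\<dots> = TL T (\<lambda>a b. (cv T g f a \<otimes> k b) \<otimes> RR T f g) R"
  proof (rule R_cong[OF T])
    fix a b assume ab [simp]: "a \<in> carrier H" "b \<in> carrier H"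
    show "RR T f g \<otimes> (cv T f g a \<otimes> k b) = (cv T g f a \<otimes> k b) \<otimes> RR T f g"
      using fg by (simp add: T.A.m_assoc[symmetric] RR_cv) (simp add: T.A.m_assoc com)
  qed (rule mlin | assumption)+
  also have "\<dots> = RR T (cv T g f) k \<otimes> RR T f g"
    unfolding RR_def[of T "cv T g f"]
    by (rule mult_tensor_lift(2)[OF H_alg H_alg T commD(3)[OF c2] R_closed RR_closed[OF fg], symmetric])
  finally show ?thesis
    using fg fk gk by (simp add: RR_cv_left[OF fg fk gk] RR_cv_left[OF gf gk fk] T.A.m_assoc)
qed

lemma RR_cong:
  assumes "comm_homs T f g" "\<And>a. a \<in> carrier H \<Longrightarrow> f a = f' a" "\<And>a. a \<in> carrier H \<Longrightarrow> g a = g' a"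
  shows "RR T f g = RR T f' g'"
  unfolding RR_def by (rule R_cong[OF T commD(3)[OF assms(1)]]) (simp add: assms)

lemma cv_et:
  assumes f: "f \<in> alg_hom K H T" and h: "h \<in> carrier H"
  shows "cv T (et T) f h = f h" "cv T f (et T) h = f h"
proof -
  note [mlin] = T lin_comp[OF alg_homD(1)[OF f]] and fc[simp, mlin] = alg_hom_closed[OF f]
  show "cv T (et T) f h = f h"
  proof -
    have "cv T (et T) f h = TL T (\<lambda>x y. \<epsilon> x \<odot> f y) (\<Delta> h)"
      unfolding cv_def et_def
      by (rule sw_cong[OF T _ _ h, symmetric], (rule mlin | assumption)+) (simp add: T.smult_mult_left \<epsilon>_closed)
    then show ?thesis using counit_left_lin[OF T alg_homD(1)[OF f] h] by simp
  qed
  show "cv T f (et T) h = f h"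
  proof -
    have "cv T f (et T) h = TL T (\<lambda>x y. \<epsilon> y \<odot> f x) (\<Delta> h)"
      unfolding cv_def et_def
      by (rule sw_cong[OF T _ _ h, symmetric], (rule mlin | assumption)+) (simp add: T.smult_mult_right \<epsilon>_closed)
    then show ?thesis using counit_right_lin[OF T alg_homD(1)[OF f] h] by simp
  qed
qed

text \<open>Convolving the trivial leg with itself changes nothing, so by the coproduct axioms
  \<open>R\<close> with one trivial leg is idempotent. An invertible idempotent is the unit.\<close>

lemma RR_et:
  assumes f: "f \<in> alg_hom K H T"
  shows "RR T (et T) f = \<one>" "RR T f (et T) = \<one>"
proof -
  have unit_idem: "\<one> = x" if u: "x \<in> Units T" and e: "x = x \<otimes> x" for x
  proof -
    have x: "x \<in> carrier T" using u by (simp add: Units_def)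
    have "x \<otimes> \<one> = x \<otimes> x" using e x by simp
    then show ?thesis using T.A.Units_l_cancel[OF u T.A.one_closed x] by blast
  qed
  note ee = comm_homs_et[OF et_hom] and ef = comm_homs_et[OF f]
  have "RR T (et T) f = RR T (et T) f \<otimes> RR T (et T) f"
    unfolding RR_cv_left[OF ee(1) ef(1) ef(1), symmetric]
    by (rule RR_cong[OF ef(1)]) (simp_all add: cv_et[OF et_hom])
  then show "RR T (et T) f = \<one>"
    by (rule unit_idem[OF RR_unit[OF ef(1)], symmetric])
  have "RR T f (et T) = RR T f (et T) \<otimes> RR T f (et T)"
    unfolding RR_cv_right[OF ef(2) ef(2) ee(1), symmetric]
    by (rule RR_cong[OF ef(2)]) (simp_all add: cv_et[OF et_hom])
  then show "RR T f (et T) = \<one>"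
    by (rule unit_idem[OF RR_unit[OF ef(2)], symmetric])
qed

end

end

section \<open>Counit and antipode on the R-matrix, and the Drinfeld element\<close>

context quasitriangular_hopf_algebra
begin

lemma R_counit_lift:
  fixes T (structure)
  assumes T: "assoc_algebra K T" and F: "F \<in> lin_map K H T"
  shows "TL T (\<lambda>a b. \<epsilon> a \<odot> F b) R = F \<one>\<^bsub>H\<^esub>"
    and "TL T (\<lambda>a b. \<epsilon> b \<odot> F a) R = F \<one>\<^bsub>H\<^esub>"
proof -
  note [mlin] = T lin_comp[OF F] lin_mapD(1)[OF F]
  have id: "(\<lambda>x. x) \<in> alg_hom K H H" by (rule alg_homI[OF lin_id]) auto
  show "TL T (\<lambda>a b. \<epsilon> a \<odot> F b) R = F \<one>\<^bsub>H\<^esub>" (is "?l = ?r")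
  proof -
  have "?l = TL T (\<lambda>a b. F (et H a \<star> b)) R"
    by (rule R_cong[OF T], (rule mlin | assumption)+)
      (simp add: et_def smult_mult_left \<epsilon>_closed lin_mapD(3)[OF F])
  also have "\<dots> = F (RR H (et H) (\<lambda>x. x))"
    unfolding RR_def by (rule R_hom[OF H_alg T F, symmetric]) (rule commD(3)[OF H_alg comm_homs_et(1)[OF H_alg id]])
  finally show ?thesis by (simp add: RR_et[OF H_alg id])
  qed
  show "TL T (\<lambda>a b. \<epsilon> b \<odot> F a) R = F \<one>\<^bsub>H\<^esub>" (is "?l = ?r")
  proof -
  have "?l = TL T (\<lambda>a b. F (a \<star> et H b)) R"
    by (rule R_cong[OF T], (rule mlin | assumption)+)
      (simp add: et_def smult_mult_right \<epsilon>_closed lin_mapD(3)[OF F])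
  also have "\<dots> = F (RR H (\<lambda>x. x) (et H))"
    unfolding RR_def by (rule R_hom[OF H_alg T F, symmetric]) (rule commD(3)[OF H_alg comm_homs_et(2)[OF H_alg id]])
  finally show ?thesis by (simp add: RR_et[OF H_alg id])
  qed
qed

context
  fixes T :: "('k, 't) module" (structure) and \<beta> :: "'h \<Rightarrow> 'h \<Rightarrow> 't"
  assumes T: "assoc_algebra K T" and \<beta>: "bilin K H H T \<beta>"
begin

interpretation T: assoc_algebra K T by (rule T)

text \<open>\<open>(S \<otimes> Id) R\<close> is a left inverse of \<open>R\<close>: the coproduct
  axiom rewrites the product as the sum of \<open>S(a1) a2 \<otimes> b\<close>, which the antipode
  and then the counit contract. \<open>R_inverse_right\<close> is the same argument on the other
  side.\<close>

lemma R_inverse_left: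
  "TL T (\<lambda>a b. TL T (\<lambda>c d. \<beta> (S a \<star> c) (b \<star> d)) R) R = \<beta> \<one>\<^bsub>H\<^esub> \<one>\<^bsub>H\<^esub>"
proof -
  note [mlin] = T lin_comp[OF bilinD(1)[OF \<beta>]] lin_comp[OF bilinD(2)[OF \<beta>]] bilin_closed[OF \<beta>]
  have tri: "trilin K H H H T (\<lambda>a b c. \<beta> (S a \<star> b) c)" by (rule mlin | assumption)+
  have "TL T (\<lambda>a b. TL T (\<lambda>c d. \<beta> (S a \<star> c) (b \<star> d)) R) R =
      TL T (\<lambda>a b. TL T (\<lambda>c d. \<beta> (S c \<star> d) b) (\<Delta> a)) R"
    by (rule R_comult_left_lift[OF T tri, symmetric])
  also have "\<dots> = TL T (\<lambda>a b. \<epsilon> a \<odot> \<beta> \<one>\<^bsub>H\<^esub> b) R"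
    by (rule R_cong[OF T _ antipode_left_mult(1)[OF T bilinD(2)[OF \<beta>]]]) (rule mlin | assumption)+
  also have "\<dots> = \<beta> \<one>\<^bsub>H\<^esub> \<one>\<^bsub>H\<^esub>"
    by (rule R_counit_lift(1)[OF T bilinD(1)[OF \<beta>]]) (rule mlin)+
  finally show ?thesis .
qed

lemma R_inverse_right:
  "TL T (\<lambda>a b. TL T (\<lambda>c d. \<beta> (a \<star> S c) (b \<star> d)) R) R = \<beta> \<one>\<^bsub>H\<^esub> \<one>\<^bsub>H\<^esub>"
proof -
  note [mlin] = T lin_comp[OF bilinD(1)[OF \<beta>]] lin_comp[OF bilinD(2)[OF \<beta>]] bilin_closed[OF \<beta>]
  have tri: "trilin K H H H T (\<lambda>a b c. \<beta> (a \<star> S b) c)" by (rule mlin | assumption)+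
  have "TL T (\<lambda>a b. TL T (\<lambda>c d. \<beta> (a \<star> S c) (b \<star> d)) R) R =
      TL T (\<lambda>a b. TL T (\<lambda>c d. \<beta> (c \<star> S d) b) (\<Delta> a)) R"
    by (rule R_comult_left_lift[OF T tri, symmetric])
  also have "\<dots> = TL T (\<lambda>a b. \<epsilon> a \<odot> \<beta> \<one>\<^bsub>H\<^esub> b) R"
    by (rule R_cong[OF T _ antipode_left_mult(2)[OF T bilinD(2)[OF \<beta>]]]) (rule mlin | assumption)+
  also have "\<dots> = \<beta> \<one>\<^bsub>H\<^esub> \<one>\<^bsub>H\<^esub>"
    by (rule R_counit_lift(1)[OF T bilinD(1)[OF \<beta>]]) (rule mlin)+
  finally show ?thesis .
qed

text \<open>\<open>(S \<otimes> S) R\<close> is a right inverse of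
  \<open>(S \<otimes> Id) R\<close>: since \<open>S\<close> reverses products, the first legs
  combine to \<open>S (a \<star> c)\<close>, the axiom for \<open>(Id \<otimes> \<Delta>) R\<close>
  applies, and the second leg becomes \<open>b1 S(b2)\<close>.\<close>

lemma R_inverse_antipode2:
  "TL T (\<lambda>a b. TL T (\<lambda>c d. \<beta> (S c \<star> S a) (d \<star> S b)) R) R = \<beta> \<one>\<^bsub>H\<^esub> \<one>\<^bsub>H\<^esub>"
proof -
  note [mlin] = T lin_comp[OF bilinD(1)[OF \<beta>]] lin_comp[OF bilinD(2)[OF \<beta>]] bilin_closed[OF \<beta>]
  have tri: "trilin K H H H T (\<lambda>a b c. \<beta> (S a) (b \<star> S c))" by (rule mlin | assumption)+
  have "TL T (\<lambda>a b. TL T (\<lambda>c d. \<beta> (S c \<star> S a) (d \<star> S b)) R) R =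
    TL T (\<lambda>a b. TL T (\<lambda>c d. \<beta> (S (a \<star> c)) (d \<star> S b)) R) R"
    apply (rule R_cong[OF T], (rule mlin | assumption)+)
    apply (rule R_cong[OF T], (rule mlin | assumption)+)
    apply (simp add: S_mult)
    done
  also have "\<dots> = TL T (\<lambda>a b. TL T (\<lambda>c d. \<beta> (S a) (c \<star> S d)) (\<Delta> b)) R"
    by (rule R_comult_right_lift[OF T tri, symmetric])
  also have "\<dots> = TL T (\<lambda>a b. \<epsilon> b \<odot> \<beta> (S a) \<one>\<^bsub>H\<^esub>) R"
    by (rule R_cong[OF T _ antipode_left_mult(2)[OF T bilinD(1)[OF \<beta>]]]) (rule mlin | assumption)+
  also have "\<dots> = \<beta> (S \<one>\<^bsub>H\<^esub>) \<one>\<^bsub>H\<^esub>"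
    by (rule R_counit_lift(2)[OF T]) (rule mlin)+
  finally show ?thesis by (simp add: S_one)
qed

end

text \<open>\<open>R\<close> is a left inverse and \<open>(S \<otimes> S) R\<close> a right inverse
  of \<open>(S \<otimes> Id) R\<close>, so the two coincide.\<close>

lemma R_antipode2:
  assumes T: "assoc_algebra K T" and \<beta>: "bilin K H H T \<beta>"
  shows "TL T (\<lambda>a b. \<beta> (S a) (S b)) R = TL T (\<lambda>a b. \<beta> a b) R"
proof -
  note [mlin] = T lin_comp[OF bilinD(1)[OF \<beta>]] lin_comp[OF bilinD(2)[OF \<beta>]] bilin_closed[OF \<beta>]
  \<comment> \<open>\<open>?b x y\<close> is the image of \<open>R (x \<otimes> y)\<close>, so the
    two inverse laws are applied to a threefold product bracketed in two ways.\<close>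
  let ?b = "\<lambda>x y. TL T (\<lambda>p q. \<beta> (p \<star> x) (q \<star> y)) R"
  have b: "bilin K H H T ?b" by (rule mlin | assumption)+
  have "TL T (\<lambda>a b. \<beta> a b) R = ?b \<one>\<^bsub>H\<^esub> \<one>\<^bsub>H\<^esub>"
    by (rule R_cong[OF T], (rule mlin bilinD[OF \<beta>] | assumption)+) simp
  also have "\<dots> = TL T (\<lambda>a b. TL T (\<lambda>c d. ?b (S c \<star> S a) (d \<star> S b)) R) R"
    by (rule R_inverse_antipode2[OF T b, symmetric])
  also have "\<dots> = TL T (\<lambda>a b. \<beta> (S a) (S b)) R"
  proof (rule R_cong[OF T])
    fix a b assume [simp, mlin]: "a \<in> carrier H" "b \<in> carrier H"
    have b2: "bilin K H H T (\<lambda>x y. \<beta> (x \<star> S a) (y \<star> S b))" by (rule mlin | assumption)+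
    have "TL T (\<lambda>c d. ?b (S c \<star> S a) (d \<star> S b)) R =
      TL T (\<lambda>p q. TL T (\<lambda>c d. \<beta> (p \<star> (S c \<star> S a)) (q \<star> (d \<star> S b))) R) R"
      by (rule R_swap[OF T]) (rule mlin | assumption)+
    also have "\<dots> = TL T (\<lambda>p q. TL T (\<lambda>c d. \<beta> ((p \<star> S c) \<star> S a) ((q \<star> d) \<star> S b)) R) R"
      apply (rule R_cong[OF T], (rule mlin | assumption)+)
      apply (rule R_cong[OF T], (rule mlin | assumption)+)
      apply (simp add: A.m_assoc S_closed)
      done
    also have "\<dots> = \<beta> (\<one>\<^bsub>H\<^esub> \<star> S a) (\<one>\<^bsub>H\<^esub> \<star> S b)"
      by (rule R_inverse_right[OF T b2])
    finally show "TL T (\<lambda>c d. ?b (S c \<star> S a) (d \<star> S b)) R = \<beta> (S a) (S b)"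
      by (simp add: S_closed)
  qed (rule mlin | assumption)+
  finally show ?thesis by simp
qed

text \<open>The Drinfeld element \<open>\<Sum> S(t\<^sub>i) s\<^sub>i\<close>, with right inverse \<open>\<Sum> t\<^sub>i S\<^sup>2(s\<^sub>i)\<close>; it implements \<open>S\<^sup>2\<close>.\<close>

definition drinfeld where "drinfeld = TL H (\<lambda>a b. S b \<star> a) R"
definition drinfeld' where "drinfeld' = TL H (\<lambda>a b. b \<star> S (S a)) R"

lemma drinfeld_closed [simp, mlin]: "drinfeld \<in> carrier H" "drinfeld' \<in> carrier H"
  unfolding drinfeld_def drinfeld'_def by (rule mlin | assumption)+

text \<open>Inside the sum stands \<open>S(b d) (a c)\<close>. The intertwining axiom replaces it by
  \<open>S(c b) (d a) = S(b) S(c) d a\<close>, and now the antipode meets its partner.\<close>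

lemma drinfeld_contract:
  assumes h: "h \<in> carrier H"
  shows "TL H (\<lambda>c d. (S d \<star> drinfeld) \<star> c) (\<Delta> h) = \<epsilon> h \<odot>\<^bsub>H\<^esub> drinfeld"
proof -
  note [mlin] = h
  have b: "bilin K H H H (\<lambda>a b. S b \<star> a)" by (rule mlin | assumption)+
  have 1: "S d \<star> drinfeld \<star> c = TL H (\<lambda>a b. S (b \<star> d) \<star> (a \<star> c)) R"
    if [simp, mlin]: "c \<in> carrier H" "d \<in> carrier H" for c d
  proof -
    have F: "(\<lambda>w. S d \<star> w \<star> c) \<in> lin_map K H H" by (rule mlin)+
    have "S d \<star> drinfeld \<star> c = TL H (\<lambda>a b. S d \<star> (S b \<star> a) \<star> c) R"
      unfolding drinfeld_def by (rule R_hom[OF H_alg H_alg F b])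
    also have "\<dots> = TL H (\<lambda>a b. S (b \<star> d) \<star> (a \<star> c)) R"
      by (rule R_cong[OF H_alg], (rule mlin | assumption)+) (simp add: S_mult A.m_assoc S_closed)
    finally show ?thesis .
  qed
  have "TL H (\<lambda>c d. (S d \<star> drinfeld) \<star> c) (\<Delta> h) =
    TL H (\<lambda>c d. TL H (\<lambda>a b. S (b \<star> d) \<star> (a \<star> c)) R) (\<Delta> h)"
    by (rule sw_cong[OF H_alg _ 1 h]) (rule mlin | assumption)+
  also have "\<dots> = TL H (\<lambda>a b. TL H (\<lambda>c d. S (b \<star> d) \<star> (a \<star> c)) (\<Delta> h)) R"
    by (rule tensor_lift_swap[OF H_alg H_alg H_alg H_alg H_alg \<Delta>_closed[OF h] R_closed]) (rule mlin | assumption)+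
  also have "\<dots> = TL H (\<lambda>a b. TL H (\<lambda>c d. S (c \<star> b) \<star> (d \<star> a)) (\<Delta> h)) R"
    by (rule R_intertwines_lift[OF H_alg b h])
  also have "\<dots> = TL H (\<lambda>a b. \<epsilon> h \<odot>\<^bsub>H\<^esub> (S b \<star> a)) R"
  proof (rule R_cong[OF H_alg])
    fix a b assume [simp, mlin]: "a \<in> carrier H" "b \<in> carrier H"
    have F: "(\<lambda>w. S b \<star> w \<star> a) \<in> lin_map K H H" by (rule mlin)+
    have "TL H (\<lambda>c d. S (c \<star> b) \<star> (d \<star> a)) (\<Delta> h) =
      TL H (\<lambda>c d. S b \<star> (S c \<star> d) \<star> a) (\<Delta> h)"
      by (rule sw_cong[OF H_alg _ _ h], (rule mlin | assumption)+) (simp add: S_mult A.m_assoc S_closed)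
    also have "\<dots> = \<epsilon> h \<odot>\<^bsub>H\<^esub> (S b \<star> \<one>\<^bsub>H\<^esub> \<star> a)"
      by (rule antipode_left_mult(1)[OF H_alg F h])
    finally show "TL H (\<lambda>c d. S (c \<star> b) \<star> (d \<star> a)) (\<Delta> h) = \<epsilon> h \<odot>\<^bsub>H\<^esub> (S b \<star> a)"
      by (simp add: S_closed)
  qed (rule mlin | assumption)+
  also have "\<dots> = \<epsilon> h \<odot>\<^bsub>H\<^esub> drinfeld"
    unfolding drinfeld_def by (rule R_hom[OF H_alg H_alg _ b, symmetric]) (rule mlin)+
  finally show ?thesis .
qed

text \<open>With \<open>u\<close> the Drinfeld element, the sum of
  \<open>S(S(h3)) S(h2) u h1\<close> contracts in two ways: \<open>S(h2) u h1\<close> shrinks by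
  \<open>drinfeld_contract\<close>, and \<open>S(S(h3)) S(h2) = S(h2 S(h3))\<close> shrinks by the
  antipode axiom.\<close>

lemma antipode2_drinfeld:
  assumes h: "h \<in> carrier H"
  shows "S (S h) \<star> drinfeld = drinfeld \<star> h"
proof -
  note [mlin] = h
  have tri: "trilin K H H H H (\<lambda>x y z. S (S z) \<star> (S y \<star> drinfeld \<star> x))" by (rule mlin | assumption)+
  have "S (S h) \<star> drinfeld = TL H (\<lambda>a b. \<epsilon> a \<odot>\<^bsub>H\<^esub> (S (S b) \<star> drinfeld)) (\<Delta> h)"
    by (rule counit_left_lin[OF H_alg _ h, symmetric]) (rule mlin)+
  also have "\<dots> = TL H (\<lambda>a b. TL H (\<lambda>c d. S (S b) \<star> (S d \<star> drinfeld \<star> c)) (\<Delta> a)) (\<Delta> h)"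
  proof (rule sw_cong[OF H_alg _ _ h])
    fix a b assume ab [simp, mlin]: "a \<in> carrier H" "b \<in> carrier H"
    have b: "bilin K H H H (\<lambda>c d. S d \<star> drinfeld \<star> c)" by (rule mlin | assumption)+
    have F: "(\<lambda>w. S (S b) \<star> w) \<in> lin_map K H H" by (rule mlin)+
    show "\<epsilon> a \<odot>\<^bsub>H\<^esub> (S (S b) \<star> drinfeld) = TL H (\<lambda>c d. S (S b) \<star> (S d \<star> drinfeld \<star> c)) (\<Delta> a)"
      using sw_hom[OF H_alg H_alg F b ab(1)] drinfeld_contract[OF ab(1)] by (simp add: smult_mult_right \<epsilon>_closed S_closed)
  qed (rule mlin | assumption)+
  also have "\<dots> = TL H (\<lambda>a b. TL H (\<lambda>c d. S (S d) \<star> (S c \<star> drinfeld \<star> a)) (\<Delta> b)) (\<Delta> h)"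
    by (rule sw_coassoc[OF H_alg tri h])
  also have "\<dots> = TL H (\<lambda>a b. \<epsilon> b \<odot>\<^bsub>H\<^esub> (drinfeld \<star> a)) (\<Delta> h)"
  proof (rule sw_cong[OF H_alg _ _ h])
    fix a b assume ab [simp, mlin]: "a \<in> carrier H" "b \<in> carrier H"
    have F: "(\<lambda>w. S w \<star> (drinfeld \<star> a)) \<in> lin_map K H H" by (rule mlin)+
    have "TL H (\<lambda>c d. S (S d) \<star> (S c \<star> drinfeld \<star> a)) (\<Delta> b) =
        TL H (\<lambda>c d. S (c \<star> S d) \<star> (drinfeld \<star> a)) (\<Delta> b)"
      by (rule sw_cong[OF H_alg _ _ ab(2)], (rule mlin | assumption)+) (simp add: S_mult A.m_assoc S_closed)
    also have "\<dots> = \<epsilon> b \<odot>\<^bsub>H\<^esub> (S \<one>\<^bsub>H\<^esub> \<star> (drinfeld \<star> a))"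
      by (rule antipode_left_mult(2)[OF H_alg F ab(2)])
    finally show "TL H (\<lambda>c d. S (S d) \<star> (S c \<star> drinfeld \<star> a)) (\<Delta> b) = \<epsilon> b \<odot>\<^bsub>H\<^esub> (drinfeld \<star> a)"
      by (simp add: S_one)
  qed (rule mlin | assumption)+
  also have "\<dots> = drinfeld \<star> h"
    by (rule counit_right_lin[OF H_alg _ h]) (rule mlin)+
  finally show ?thesis .
qed

text \<open>Carrying \<open>drinfeld\<close> past \<open>d\<close> in its product with
  \<open>drinfeld'\<close> gives the sum of \<open>S(S(d)) drinfeld S(S(c))\<close>. Invariance of
  \<open>R\<close> under \<open>S \<otimes> S\<close> strips one \<open>S\<close> from each side,
  and what is left is the image of \<open>R\<close> times \<open>(S \<otimes> Id) R\<close>. The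
  second identity is commutation of \<open>drinfeld\<close> with \<open>drinfeld'\<close> up to
  \<open>S\<^sup>2\<close>.\<close>

lemma drinfeld_inverse:
  shows "drinfeld \<star> drinfeld' = \<one>\<^bsub>H\<^esub>" and "S (S drinfeld') \<star> drinfeld = \<one>\<^bsub>H\<^esub>"
proof -
  have b: "bilin K H H H (\<lambda>a b. S b \<star> a)" and b': "bilin K H H H (\<lambda>a b. b \<star> S (S a))" by (rule mlin | assumption)+
  have "drinfeld \<star> drinfeld' = TL H (\<lambda>c d. drinfeld \<star> (d \<star> S (S c))) R"
    unfolding drinfeld'_def by (rule mult_tensor_lift(1)[OF H_alg H_alg H_alg b' R_closed]) (rule mlin)
  also have "\<dots> = TL H (\<lambda>c d. (S (S d) \<star> drinfeld) \<star> S (S c)) R"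
    by (rule R_cong[OF H_alg], (rule mlin | assumption)+) (simp add: antipode2_drinfeld A.m_assoc[symmetric] S_closed)
  also have "\<dots> = TL H (\<lambda>c d. (S d \<star> drinfeld) \<star> S c) R"
    by (rule R_antipode2[OF H_alg]) (rule mlin | assumption)+
  also have "\<dots> = TL H (\<lambda>c d. TL H (\<lambda>a b. S (b \<star> d) \<star> (a \<star> S c)) R) R"
  proof (rule R_cong[OF H_alg])
    fix c d assume [simp, mlin]: "c \<in> carrier H" "d \<in> carrier H"
    have F: "(\<lambda>w. S d \<star> w \<star> S c) \<in> lin_map K H H" by (rule mlin)+
    show "S d \<star> drinfeld \<star> S c = TL H (\<lambda>a b. S (b \<star> d) \<star> (a \<star> S c)) R" (is "?l = ?r")
    proof -
    have "?l = TL H (\<lambda>a b. S d \<star> (S b \<star> a) \<star> S c) R"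
      unfolding drinfeld_def by (rule R_hom[OF H_alg H_alg F b])
    also have "\<dots> = ?r"
      by (rule R_cong[OF H_alg], (rule mlin | assumption)+) (simp add: S_mult A.m_assoc S_closed)
    finally show ?thesis .
    qed
  qed (rule mlin | assumption)+
  also have "\<dots> = TL H (\<lambda>a b. TL H (\<lambda>c d. S (b \<star> d) \<star> (a \<star> S c)) R) R"
    by (rule R_swap[OF H_alg]) (rule mlin | assumption)+
  also have "\<dots> = S \<one>\<^bsub>H\<^esub> \<star> \<one>\<^bsub>H\<^esub>"
    by (rule R_inverse_right[OF H_alg b])
  finally show 1: "drinfeld \<star> drinfeld' = \<one>\<^bsub>H\<^esub>" by (simp add: S_one)
  show "S (S drinfeld') \<star> drinfeld = \<one>\<^bsub>H\<^esub>"
    by (simp add: antipode2_drinfeld 1)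
qed

text \<open>The left and right inverses of the Drinfeld element agree, so \<open>S\<^sup>2\<close>
  is conjugation by an invertible element and hence bijective; then so is \<open>S\<close>.\<close>

lemma S_bij: "bij_betw S (carrier H) (carrier H)"
proof -
  let ?u = drinfeld and ?v = "drinfeld'" and ?w = "S (S drinfeld')"
  have w: "?w \<in> carrier H" by (rule mlin)+
  have wv: "?w = ?v"
  proof -
    have "?w = ?w \<star> (?u \<star> ?v)" using w by (simp add: drinfeld_inverse)
    also have "\<dots> = (?w \<star> ?u) \<star> ?v" using w by (simp add: A.m_assoc)
    finally show ?thesis by (simp add: drinfeld_inverse)
  qed
  have vu: "?v \<star> ?u = \<one>\<^bsub>H\<^esub>" using drinfeld_inverse(2) wv by simp
  have inj: "x = y" if [simp]: "x \<in> carrier H" "y \<in> carrier H" and e: "S x = S y" for x y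
  proof -
    have "?u \<star> x = ?u \<star> y" using antipode2_drinfeld[of x] antipode2_drinfeld[of y] e by simp
    then have "?v \<star> (?u \<star> x) = ?v \<star> (?u \<star> y)" by simp
    then show ?thesis by (simp add: A.m_assoc[symmetric] vu)
  qed
  have surj: "\<exists>x\<in>carrier H. S x = y" if y [simp]: "y \<in> carrier H" for y
  proof -
    \<comment> \<open>\<open>S\<^sup>2\<close> conjugates by \<open>?u\<close>, so it sends
      \<open>?h\<close> to \<open>y\<close>, and \<open>S ?h\<close> is the preimage of
      \<open>y\<close> under \<open>S\<close>.\<close>
    let ?h = "?v \<star> y \<star> ?u"
    have h: "?h \<in> carrier H" by simp
    have "S (S ?h) = S (S ?h) \<star> (?u \<star> ?v)" using S_closed[OF S_closed[OF h]] by (simp add: drinfeld_inverse)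
    also have "\<dots> = (S (S ?h) \<star> ?u) \<star> ?v" using S_closed[OF S_closed[OF h]] by (simp add: A.m_assoc)
    also have "\<dots> = (?u \<star> ?h) \<star> ?v" by (simp only: antipode2_drinfeld[OF h])
    also have "\<dots> = (?u \<star> ?v) \<star> (y \<star> (?u \<star> ?v))" by (simp add: A.m_assoc)
    also have "\<dots> = y" by (simp add: drinfeld_inverse)
    finally show ?thesis using S_closed[OF h] by blast
  qed
  show ?thesis
  proof (rule bij_betw_imageI)
    show "inj_on S (carrier H)" by (rule inj_onI) (rule inj)
    show "S ` carrier H = carrier H"
    proof
      show "S ` carrier H \<subseteq> carrier H" by (rule image_subsetI) (rule S_closed)
      show "carrier H \<subseteq> S ` carrier H"
      proof
        fix y assume "y \<in> carrier H"
        then obtain x where "x \<in> carrier H" "S x = y" using surj by fast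
        then show "y \<in> S ` carrier H" by (auto intro: rev_image_eqI)
      qed
    qed
  qed
qed

section \<open>The inverse antipode\<close>

abbreviation "Si \<equiv> antipode_inv H S"

lemma Si_closed [mlin]: "h \<in> carrier H \<Longrightarrow> Si h \<in> carrier H"
  and S_Si: "h \<in> carrier H \<Longrightarrow> S (Si h) = h"
  and Si_S: "h \<in> carrier H \<Longrightarrow> Si (S h) = h"
  using inv_into_into[of h S "carrier H"] f_inv_into_f[of h S "carrier H"] inv_into_f_f[of S "carrier H" h] S_bij
  by (simp_all add: bij_betw_def)

lemma S_inj: "x \<in> carrier H \<Longrightarrow> y \<in> carrier H \<Longrightarrow> S x = S y \<Longrightarrow> x = y"
  using S_bij inj_onD[of S "carrier H" x y] by (simp add: bij_betw_def)

lemma Si_lin: "Si \<in> lin_map K H H"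
proof (rule lin_mapI)
  fix x y assume [simp]: "x \<in> carrier H" "y \<in> carrier H"
  show "Si (x \<oplus>\<^bsub>H\<^esub> y) = Si x \<oplus>\<^bsub>H\<^esub> Si y"
    by (rule S_inj) (simp_all add: S_Si Si_closed lin_mapD(2)[OF antipode_linear])
next
  fix c x assume [simp]: "c \<in> carrier K" "x \<in> carrier H"
  show "Si (c \<odot>\<^bsub>H\<^esub> x) = c \<odot>\<^bsub>H\<^esub> Si x"
    by (rule S_inj) (simp_all add: S_Si Si_closed lin_mapD(3)[OF antipode_linear])
qed (rule Si_closed)
lemmas Si_lin' [mlin] = lin_comp[OF Si_lin]

lemma Si_mult: "x \<in> carrier H \<Longrightarrow> y \<in> carrier H \<Longrightarrow> Si (x \<star> y) = Si y \<star> Si x"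
  by (rule S_inj) (simp_all add: S_Si Si_closed S_mult)

lemma Si_one: "Si \<one>\<^bsub>H\<^esub> = \<one>\<^bsub>H\<^esub>"
  using Si_S[of "\<one>\<^bsub>H\<^esub>"] by (simp add: S_one)

text \<open>\<open>S\<^sup>-\<^sup>1\<close> applied to the two antipode axioms: as it reverses
  products, it acts as an antipode for the opposite coproduct.\<close>

lemma Si_contract:
  fixes T (structure)
  assumes T: "assoc_algebra K T" and F: "F \<in> lin_map K H T" and h: "h \<in> carrier H"
  shows "TL T (\<lambda>x y. F (y \<star> Si x)) (\<Delta> h) = \<epsilon> h \<odot> F \<one>\<^bsub>H\<^esub>"
    and "TL T (\<lambda>x y. F (Si y \<star> x)) (\<Delta> h) = \<epsilon> h \<odot> F \<one>\<^bsub>H\<^esub>"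
proof -
  note [mlin] = T lin_comp[OF F] lin_comp[OF lin_comp[OF F Si_lin]]
  have FS: "(\<lambda>x. F (Si x)) \<in> lin_map K H T" by (rule mlin)+
  show "TL T (\<lambda>x y. F (y \<star> Si x)) (\<Delta> h) = \<epsilon> h \<odot> F \<one>\<^bsub>H\<^esub>"
  proof -
    have "TL T (\<lambda>x y. F (y \<star> Si x)) (\<Delta> h) = TL T (\<lambda>x y. F (Si (x \<star> S y))) (\<Delta> h)"
      by (rule sw_cong[OF T _ _ h], (rule mlin | assumption)+) (simp add: Si_mult Si_S S_closed)
    then show ?thesis using antipode_left_mult(2)[OF T FS h] by (simp add: Si_one)
  qed
  show "TL T (\<lambda>x y. F (Si y \<star> x)) (\<Delta> h) = \<epsilon> h \<odot> F \<one>\<^bsub>H\<^esub>"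
  proof -
    have "TL T (\<lambda>x y. F (Si y \<star> x)) (\<Delta> h) = TL T (\<lambda>x y. F (Si (S x \<star> y))) (\<Delta> h)"
      by (rule sw_cong[OF T _ _ h], (rule mlin | assumption)+) (simp add: Si_mult Si_S S_closed)
    then show ?thesis using antipode_left_mult(1)[OF T FS h] by (simp add: Si_one)
  qed
qed

text \<open>\<open>S\<^sup>-\<^sup>1\<close> applied to the first leg of the two inverse laws for
  \<open>R\<close> and \<open>(S \<otimes> Id) R\<close>; it reverses the products in that leg
  alone. This mixed order is the one in which the outer copy of \<open>R\<close> in the braided
  coproduct cancels.\<close>

lemma R_inverse_Si:
  assumes T: "assoc_algebra K T" and \<beta>: "bilin K H H T \<beta>"
  shows "TL T (\<lambda>a b. TL T (\<lambda>c d. \<beta> (b \<star> d) (c \<star> Si a)) R) R = \<beta> \<one>\<^bsub>H\<^esub> \<one>\<^bsub>H\<^esub>"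
    and "TL T (\<lambda>a b. TL T (\<lambda>c d. \<beta> (b \<star> d) (Si c \<star> a)) R) R = \<beta> \<one>\<^bsub>H\<^esub> \<one>\<^bsub>H\<^esub>"
proof -
  note [mlin] = T lin_comp[OF bilinD(1)[OF \<beta>]] lin_comp[OF bilinD(2)[OF \<beta>]] bilin_closed[OF \<beta>]
  have b: "bilin K H H T (\<lambda>x y. \<beta> y (Si x))" by (rule mlin | assumption)+
  have "TL T (\<lambda>a b. TL T (\<lambda>c d. \<beta> (b \<star> d) (c \<star> Si a)) R) R =
    TL T (\<lambda>a b. TL T (\<lambda>c d. \<beta> (b \<star> d) (Si (a \<star> S c))) R) R"
    apply (rule R_cong[OF T], (rule mlin | assumption)+)
    apply (rule R_cong[OF T], (rule mlin | assumption)+)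
    apply (simp add: Si_mult Si_S S_closed)
    done
  also have "\<dots> = \<beta> \<one>\<^bsub>H\<^esub> (Si \<one>\<^bsub>H\<^esub>)" by (rule R_inverse_right[OF T b])
  finally show "TL T (\<lambda>a b. TL T (\<lambda>c d. \<beta> (b \<star> d) (c \<star> Si a)) R) R = \<beta> \<one>\<^bsub>H\<^esub> \<one>\<^bsub>H\<^esub>"
    by (simp add: Si_one)
  have "TL T (\<lambda>a b. TL T (\<lambda>c d. \<beta> (b \<star> d) (Si c \<star> a)) R) R =
    TL T (\<lambda>a b. TL T (\<lambda>c d. \<beta> (b \<star> d) (Si (S a \<star> c))) R) R"
    apply (rule R_cong[OF T], (rule mlin | assumption)+)
    apply (rule R_cong[OF T], (rule mlin | assumption)+)
    apply (simp add: Si_mult Si_S S_closed)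
    done
  also have "\<dots> = \<beta> \<one>\<^bsub>H\<^esub> (Si \<one>\<^bsub>H\<^esub>)" by (rule R_inverse_left[OF T b])
  finally show "TL T (\<lambda>a b. TL T (\<lambda>c d. \<beta> (b \<star> d) (Si c \<star> a)) R) R = \<beta> \<one>\<^bsub>H\<^esub> \<one>\<^bsub>H\<^esub>"
    by (simp add: Si_one)
qed

end

subsection \<open>Free products and crossed products\<close>

text \<open>The kernel of \<open>f\<close> is an ideal containing \<open>Y\<close>, hence contains
  the ideal that \<open>Y\<close> generates.\<close>

lemma genideal_vanish:
  fixes T (structure)
  assumes A: "assoc_algebra K A" and T: "assoc_algebra K T" and f: "f \<in> alg_hom K A T"
    and Y: "Y \<subseteq> carrier A" and z: "\<And>y. y \<in> Y \<Longrightarrow> f y = \<zero>" and n: "n \<in> Idl\<^bsub>A\<^esub> Y"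
  shows "f n = \<zero>"
proof -
  interpret A: assoc_algebra K A by (rule A)
  interpret T: assoc_algebra K T by (rule T)
  have "f \<in> ring_hom A T" using f by (simp add: alg_hom_def)
  then have "ideal (a_kernel A T f) A"
    by (intro ring_hom_ring.kernel_is_ideal ring_hom_ringI2 A.A.ring_axioms T.A.ring_axioms)
  moreover have "Y \<subseteq> a_kernel A T f" using Y z by (auto simp: a_kernel_def')
  ultimately have "Idl\<^bsub>A\<^esub> Y \<subseteq> a_kernel A T f" by (rule A.A.genideal_minimal)
  then show ?thesis using n by (auto simp: a_kernel_def')
qed

lemma algebra_ideal_genideal:
  assumes A: "assoc_algebra K A" and Y: "Y \<subseteq> carrier A"
  shows "algebra_ideal K A (Idl\<^bsub>A\<^esub> Y)" and "Y \<subseteq> Idl\<^bsub>A\<^esub> Y"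
proof -
  interpret A: assoc_algebra K A by (rule A)
  show "algebra_ideal K A (Idl\<^bsub>A\<^esub> Y)"
    by (intro algebra_ideal.intro A A.A.genideal_ideal[OF Y])
  show "Y \<subseteq> Idl\<^bsub>A\<^esub> Y" by (rule A.A.genideal_self[OF Y])
qed

lemma (in algebra_ideal) pr_eqI:
  assumes "x \<in> carrier A" "y \<in> carrier A" "x \<ominus>\<^bsub>A\<^esub> y \<in> N"
  shows "pr x = pr y"
  using pr_eq_iff assms by simp

text \<open>\<open>B\<close> enters through its operations: the relations turn its letters into an
  algebra map, and closure under the operations keeps these relations inside the free
  algebra.\<close>

locale crossed_product = left_comodule_algebra K H \<Delta> \<epsilon> A \<delta>
  for K :: "'k ring" and H :: "('k, 'h) module"
    and \<Delta> :: "'h \<Rightarrow> ('h \<times> 'h \<Rightarrow> 'k) set" and \<epsilon> :: "'h \<Rightarrow> 'k"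
    and A :: "('k, 'a) module" and \<delta> :: "'a \<Rightarrow> ('h \<times> 'a \<Rightarrow> 'k) set" +
  fixes B :: "('k, 'b) module" and act :: "'b \<Rightarrow> 'h \<Rightarrow> 'b"
  assumes B_closed: "\<one>\<^bsub>B\<^esub> \<in> carrier B"
      "x \<in> carrier B \<Longrightarrow> y \<in> carrier B \<Longrightarrow> x \<oplus>\<^bsub>B\<^esub> y \<in> carrier B"
      "x \<in> carrier B \<Longrightarrow> y \<in> carrier B \<Longrightarrow> x \<otimes>\<^bsub>B\<^esub> y \<in> carrier B"
      "c \<in> carrier K \<Longrightarrow> x \<in> carrier B \<Longrightarrow> c \<odot>\<^bsub>B\<^esub> x \<in> carrier B"
    and act_lin: "x \<in> carrier B \<Longrightarrow> (\<lambda>l. act x l) \<in> lin_map K H B"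
begin

abbreviation "Y \<equiv> carrier A <+> carrier B"
abbreviation "F0 \<equiv> free_algebra K A B"
abbreviation "N0 \<equiv> free_product_ideal K A B"
abbreviation "FP \<equiv> free_product K A B"
abbreviation "inl0 \<equiv> free_product_inl K A B"
abbreviation "inr0 \<equiv> free_product_inr K A B"
abbreviation "N1 \<equiv> crossed_ideal K A \<delta> B act"
abbreviation "CP \<equiv> quotient_algebra FP N1"
definition "inl1 a = N1 +>\<^bsub>FP\<^esub> inl0 a"
definition "inr1 b = N1 +>\<^bsub>FP\<^esub> inr0 b"

lemma monoid_over_field: "monoid_over_field K (free_monoid Y)"
proof (intro monoid_over_field.intro K.field_axioms)
  show "Group.monoid (free_monoid Y)" by (rule monoidI) (auto simp: free_monoid_def)
qed

interpretation M: monoid_over_field K "free_monoid Y" by (rule monoid_over_field)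

lemma F0_alg: "assoc_algebra K F0"
  using M.assoc_algebra_monoid_algebra by (simp add: free_algebra_def)

interpretation F0: assoc_algebra K F0 by (rule F0_alg)

lemma letter_closed [simp]:
  "a \<in> carrier A \<Longrightarrow> basis_elt K [Inl a] \<in> carrier F0" "b \<in> carrier B \<Longrightarrow> basis_elt K [Inr b] \<in> carrier F0"
  unfolding free_algebra_def by (rule M.e_closed, simp add: free_monoid_def InlI InrI)+

abbreviation "rels0 \<equiv> hom_relations K A F0 (\<lambda>a. basis_elt K [Inl a]) \<union> hom_relations K B F0 (\<lambda>b. basis_elt K [Inr b])"

lemma rels0_closed: "rels0 \<subseteq> carrier F0"
  by (auto simp: hom_relations_def B_closed)

lemma ideal0: "algebra_ideal K F0 N0" and rels0_N0: "rels0 \<subseteq> N0"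
  unfolding free_product_ideal_def by (rule algebra_ideal_genideal[OF F0_alg rels0_closed])+

interpretation I0: algebra_ideal K F0 N0 by (rule ideal0)

lemma FP_alg: "assoc_algebra K FP"
  unfolding free_product_def by (rule I0.assoc_algebra_quotient)

interpretation FP: assoc_algebra K FP by (rule FP_alg)

lemma pr0_hom: "I0.pr \<in> alg_hom K F0 FP"
  unfolding free_product_def by (rule I0.pr_hom)

lemma inl0_hom: "inl0 \<in> alg_hom K A FP"
proof -
  note D = lin_mapD(2,3)[OF alg_homD(1)[OF pr0_hom]] alg_homD(2,3)[OF pr0_hom]
  have eq: "I0.pr x = I0.pr y" if "x \<in> carrier F0" "y \<in> carrier F0" "x \<ominus>\<^bsub>F0\<^esub> y \<in> rels0" for x y
    using I0.pr_eqI that rels0_N0 by blast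
  show ?thesis unfolding free_product_inl_def
  proof (intro alg_homI lin_mapI)
    fix x y assume [simp]: "x \<in> carrier A" "y \<in> carrier A"
    show "I0.pr (basis_elt K [Inl (x \<oplus>\<^bsub>A\<^esub> y)]) = I0.pr (basis_elt K [Inl x]) \<oplus>\<^bsub>FP\<^esub> I0.pr (basis_elt K [Inl y])"
      unfolding D(1)[symmetric, OF letter_closed(1)[OF \<open>x \<in> _\<close>] letter_closed(1)[OF \<open>y \<in> _\<close>]]
      by (rule eq) (simp, simp, simp add: hom_relations_def, blast intro: \<open>x \<in> _\<close> \<open>y \<in> _\<close>)
    show "I0.pr (basis_elt K [Inl (x \<otimes>\<^bsub>A\<^esub> y)]) = I0.pr (basis_elt K [Inl x]) \<otimes>\<^bsub>FP\<^esub> I0.pr (basis_elt K [Inl y])"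
      unfolding D(3)[symmetric, OF letter_closed(1)[OF \<open>x \<in> _\<close>] letter_closed(1)[OF \<open>y \<in> _\<close>]]
      by (rule eq) (simp, simp, simp add: hom_relations_def, blast intro: \<open>x \<in> _\<close> \<open>y \<in> _\<close>)
  next
    fix c x assume [simp]: "c \<in> carrier K" "x \<in> carrier A"
    show "I0.pr (basis_elt K [Inl (c \<odot>\<^bsub>A\<^esub> x)]) = c \<odot>\<^bsub>FP\<^esub> I0.pr (basis_elt K [Inl x])"
      unfolding D(2)[symmetric, OF \<open>c \<in> _\<close> letter_closed(1)[OF \<open>x \<in> _\<close>]]
      by (rule eq) (simp, simp, simp add: hom_relations_def, blast intro: \<open>x \<in> _\<close> \<open>c \<in> _\<close>)
  next
    show "I0.pr (basis_elt K [Inl \<one>\<^bsub>A\<^esub>]) = \<one>\<^bsub>FP\<^esub>"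
      unfolding D(4)[symmetric] by (rule eq) (simp_all add: hom_relations_def)
  qed (use alg_hom_closed[OF pr0_hom] in auto)
qed

lemma inr0_hom: "inr0 \<in> alg_hom K B FP"
proof -
  note D = lin_mapD(2,3)[OF alg_homD(1)[OF pr0_hom]] alg_homD(2,3)[OF pr0_hom]
  have eq: "I0.pr x = I0.pr y" if "x \<in> carrier F0" "y \<in> carrier F0" "x \<ominus>\<^bsub>F0\<^esub> y \<in> rels0" for x y
    using I0.pr_eqI that rels0_N0 by blast
  show ?thesis unfolding free_product_inr_def
  proof (intro alg_homI lin_mapI)
    fix x y assume [simp]: "x \<in> carrier B" "y \<in> carrier B"
    show "I0.pr (basis_elt K [Inr (x \<oplus>\<^bsub>B\<^esub> y)]) = I0.pr (basis_elt K [Inr x]) \<oplus>\<^bsub>FP\<^esub> I0.pr (basis_elt K [Inr y])"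
      unfolding D(1)[symmetric, OF letter_closed(2)[OF \<open>x \<in> _\<close>] letter_closed(2)[OF \<open>y \<in> _\<close>]]
      by (rule eq) (simp add: B_closed, simp, simp add: hom_relations_def, blast intro: \<open>x \<in> _\<close> \<open>y \<in> _\<close>)
    show "I0.pr (basis_elt K [Inr (x \<otimes>\<^bsub>B\<^esub> y)]) = I0.pr (basis_elt K [Inr x]) \<otimes>\<^bsub>FP\<^esub> I0.pr (basis_elt K [Inr y])"
      unfolding D(3)[symmetric, OF letter_closed(2)[OF \<open>x \<in> _\<close>] letter_closed(2)[OF \<open>y \<in> _\<close>]]
      by (rule eq) (simp add: B_closed, simp, simp add: hom_relations_def, blast intro: \<open>x \<in> _\<close> \<open>y \<in> _\<close>)
  next
    fix c x assume [simp]: "c \<in> carrier K" "x \<in> carrier B"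
    show "I0.pr (basis_elt K [Inr (c \<odot>\<^bsub>B\<^esub> x)]) = c \<odot>\<^bsub>FP\<^esub> I0.pr (basis_elt K [Inr x])"
      unfolding D(2)[symmetric, OF \<open>c \<in> _\<close> letter_closed(2)[OF \<open>x \<in> _\<close>]]
      by (rule eq) (simp add: B_closed, simp, simp add: hom_relations_def, blast intro: \<open>x \<in> _\<close> \<open>c \<in> _\<close>)
  next
    show "I0.pr (basis_elt K [Inr \<one>\<^bsub>B\<^esub>]) = \<one>\<^bsub>FP\<^esub>"
      unfolding D(4)[symmetric] by (rule eq) (simp_all add: hom_relations_def B_closed)
  qed (use alg_hom_closed[OF pr0_hom] in auto)
qed

text \<open>Words grow from the empty word by prefixing letters, so closure under left
  multiplication by the two kinds of generators takes the place of closure under arbitrary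
  products.\<close>

lemma FP_induct:
  assumes z: "z \<in> carrier FP" and one: "P \<one>\<^bsub>FP\<^esub>"
    and add: "\<And>x y. x \<in> carrier FP \<Longrightarrow> y \<in> carrier FP \<Longrightarrow> P x \<Longrightarrow> P y \<Longrightarrow> P (x \<oplus>\<^bsub>FP\<^esub> y)"
    and smult: "\<And>c x. c \<in> carrier K \<Longrightarrow> x \<in> carrier FP \<Longrightarrow> P x \<Longrightarrow> P (c \<odot>\<^bsub>FP\<^esub> x)"
    and inl: "\<And>a x. a \<in> carrier A \<Longrightarrow> x \<in> carrier FP \<Longrightarrow> P x \<Longrightarrow> P (inl0 a \<otimes>\<^bsub>FP\<^esub> x)"
    and inr: "\<And>b x. b \<in> carrier B \<Longrightarrow> x \<in> carrier FP \<Longrightarrow> P x \<Longrightarrow> P (inr0 b \<otimes>\<^bsub>FP\<^esub> x)"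
  shows "P z"
proof -
  note cl = alg_hom_closed[OF pr0_hom]
  note D = lin_mapD(2,3)[OF alg_homD(1)[OF pr0_hom]] alg_homD(2,3)[OF pr0_hom]
  have ec: "basis_elt K w \<in> carrier F0" if "w \<in> lists Y" for w
    using M.e_closed[of w] that by (simp add: free_algebra_def free_monoid_def)
  have word: "P (I0.pr (basis_elt K w))" if "w \<in> lists Y" for w
    using that
  proof (induction w)
    case Nil
    have "basis_elt K [] = \<one>\<^bsub>F0\<^esub>" using M.F_one by (simp add: free_monoid_def free_algebra_def)
    then show ?case using one D(4) by simp
  next
    case (Cons l w)
    have l: "l \<in> Y" and w: "w \<in> lists Y" using Cons.hyps Cons.prems by auto
    have "basis_elt K [l] \<otimes>\<^bsub>F0\<^esub> basis_elt K w = basis_elt K (l # w)"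
      using M.e_mult[of "[l]" w] l w by (simp add: free_monoid_def free_algebra_def)
    moreover have "basis_elt K [l] \<in> carrier F0" using ec[of "[l]"] l by simp
    ultimately have e: "I0.pr (basis_elt K (l # w)) = I0.pr (basis_elt K [l]) \<otimes>\<^bsub>FP\<^esub> I0.pr (basis_elt K w)"
      using D(3) ec[OF w] by metis
    from l show ?case
    proof
      fix a assume a: "l = Inl a" "a \<in> carrier A"
      show ?thesis unfolding e using inl[OF a(2) cl[OF ec[OF w]] Cons.IH] a by (simp add: free_product_inl_def)
    next
      fix b assume b: "l = Inr b" "b \<in> carrier B"
      show ?thesis unfolding e using inr[OF b(2) cl[OF ec[OF w]] Cons.IH] b by (simp add: free_product_inr_def)
    qed
  qed
  have "P (I0.pr f)" if "f \<in> carrier F0" for f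
    using that unfolding free_algebra_def
  proof (induction f rule: M.F_induct)
    case (add f g)
    then show ?case using assms(3)[of "I0.pr f" "I0.pr g"] D(1)[of f g] cl by (simp add: free_algebra_def)
  next
    case (basis c u)
    then have u: "u \<in> lists Y" by (simp add: free_monoid_def)
    show ?case
      using smult[OF basis(1) cl[OF ec[OF u]] word[OF u]] D(2)[OF basis(1) ec[OF u]] by (simp add: free_algebra_def)
  qed
  moreover have "z \<in> I0.pr ` carrier F0" using z I0.carrier_quotient by (simp add: free_product_def)
  ultimately show ?thesis by blast
qed

lemma FP_universal:
  fixes T (structure)
  assumes T: "assoc_algebra K T" and f: "f \<in> alg_hom K A T" and g: "g \<in> alg_hom K B T"
  obtains p where "p \<in> alg_hom K FP T" "\<And>a. a \<in> carrier A \<Longrightarrow> p (inl0 a) = f a" "\<And>b. b \<in> carrier B \<Longrightarrow> p (inr0 b) = g b"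
proof -
  interpret T: assoc_algebra K T by (rule T)
  note fc = alg_hom_closed[OF f] and gc = alg_hom_closed[OF g]
  note fD = lin_mapD(2,3)[OF alg_homD(1)[OF f]] alg_homD(2,3)[OF f]
    and gD = lin_mapD(2,3)[OF alg_homD(1)[OF g]] alg_homD(2,3)[OF g]
  define lt where "lt = case_sum f g"
  define ph where "ph w = foldr (\<lambda>l r. lt l \<otimes> r) w \<one>" for w
  have ltc: "lt l \<in> carrier T" if "l \<in> Y" for l using that fc gc by (auto simp: lt_def)
  have phc: "ph w \<in> carrier T" if "w \<in> lists Y" for w
    using that by (induction w) (auto simp: ph_def ltc)
  have phm: "ph (v @ w) = ph v \<otimes> ph w" if "v \<in> lists Y" "w \<in> lists Y" for v w
    using that(1)
  proof (induction v)
    case Nil then show ?case using phc[OF that(2)] by (simp add: ph_def)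
  next
    case (Cons l v)
    have "ph ((l # v) @ w) = lt l \<otimes> ph (v @ w)" by (simp add: ph_def)
    also have "\<dots> = lt l \<otimes> (ph v \<otimes> ph w)" using Cons by simp
    also have "\<dots> = (lt l \<otimes> ph v) \<otimes> ph w"
      using Cons.hyps phc that(2) ltc by (simp add: T.A.m_assoc)
    finally show ?case by (simp add: ph_def)
  qed
  let ?p = "lin_extend K T ph"
  have p: "?p \<in> alg_hom K F0 T"
    unfolding free_algebra_def
    by (rule M.lin_extend_alg_hom[OF T]) (auto simp: free_monoid_def phc phm, simp add: ph_def)
  have pl: "?p (basis_elt K [Inl a]) = f a" if "a \<in> carrier A" for a
    using M.lin_extend_basis[OF T, of ph "[Inl a]"] phc[of "[Inl a]"] that fc by (simp add: ph_def lt_def)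
  have pr: "?p (basis_elt K [Inr b]) = g b" if "b \<in> carrier B" for b
    using M.lin_extend_basis[OF T, of ph "[Inr b]"] phc[of "[Inr b]"] that gc by (simp add: ph_def lt_def)
  note pD = lin_mapD(2,3)[OF alg_homD(1)[OF p]] alg_homD(2,3)[OF p] lin_map_minus[OF F0_alg T alg_homD(1)[OF p]]
  have "?p r = \<zero>" if "r \<in> rels0" for r
    using that by (auto simp: hom_relations_def pD pl pr fD gD B_closed fc gc T.A.r_right_minus_eq)
  then have v: "?p n = \<zero>" if "n \<in> N0" for n
    using genideal_vanish[OF F0_alg T p rels0_closed] that by (simp add: free_product_ideal_def)
  let ?q = "\<lambda>Z. ?p (SOME x. x \<in> Z)"
  have "?q \<in> alg_hom K FP T"
    unfolding free_product_def by (rule I0.quotient_lift(3)[OF T alg_homD(1)[OF p] v p])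
  moreover have "?q (inl0 a) = f a" if "a \<in> carrier A" for a
    using I0.quotient_lift(1)[OF T alg_homD(1)[OF p] v, of "basis_elt K [Inl a]"] that pl by (simp add: free_product_inl_def)
  moreover have "?q (inr0 b) = g b" if "b \<in> carrier B" for b
    using I0.quotient_lift(1)[OF T alg_homD(1)[OF p] v, of "basis_elt K [Inr b]"] that pr by (simp add: free_product_inr_def)
  ultimately show ?thesis by (rule that)
qed

abbreviation "rels1 \<equiv> {inr0 x \<otimes>\<^bsub>FP\<^esub> inl0 a \<ominus>\<^bsub>FP\<^esub>
   TL FP (\<lambda>l b. inl0 b \<otimes>\<^bsub>FP\<^esub> inr0 (act x l)) (\<delta> a) | x a. x \<in> carrier B \<and> a \<in> carrier A}"

lemma cross_bilin:
  assumes T: "assoc_algebra K T" and f: "f \<in> alg_hom K A T" and g: "g \<in> alg_hom K B T" and x: "x \<in> carrier B"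
  shows "bilin K H A T (\<lambda>l b. f b \<otimes>\<^bsub>T\<^esub> g (act x l))"
proof -
  note [mlin] = T lin_comp[OF alg_homD(1)[OF f]] lin_comp[OF alg_homD(1)[OF g]] act_lin[OF x]
    alg_hom_closed[OF f] alg_hom_closed[OF g] lin_mapD(1)[OF act_lin[OF x]]
  show ?thesis by (rule mlin | assumption)+
qed

lemma rels1_closed: "rels1 \<subseteq> carrier FP"
proof -
  note [mlin] = FP_alg alg_hom_closed[OF inl0_hom] alg_hom_closed[OF inr0_hom]
  have "TL FP (\<lambda>l b. inl0 b \<otimes>\<^bsub>FP\<^esub> inr0 (act x l)) (\<delta> a) \<in> carrier FP"
    if "x \<in> carrier B" "a \<in> carrier A" for x a
    by (rule co_closed[OF that(2) FP_alg cross_bilin[OF FP_alg inl0_hom inr0_hom that(1)]])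
  then show ?thesis using alg_hom_closed[OF inl0_hom] alg_hom_closed[OF inr0_hom] by auto
qed

lemma ideal1: "algebra_ideal K FP N1" and rels1_N1: "rels1 \<subseteq> N1"
  unfolding crossed_ideal_def by (rule algebra_ideal_genideal[OF FP_alg rels1_closed])+

interpretation I1: algebra_ideal K FP N1 by (rule ideal1)

lemma CP_alg: "assoc_algebra K CP" by (rule I1.assoc_algebra_quotient)

interpretation CP: assoc_algebra K CP by (rule CP_alg)

lemma inl1_hom: "inl1 \<in> alg_hom K A CP" and inr1_hom: "inr1 \<in> alg_hom K B CP"
  using inl0_hom inr0_hom I1.pr_hom unfolding inl1_def[abs_def] inr1_def[abs_def]
  by (auto simp: alg_hom_def ring_hom_def lin_map_def Pi_def)

lemma CP_cross:
  assumes x: "x \<in> carrier B" and a: "a \<in> carrier A"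
  shows "inr1 x \<otimes>\<^bsub>CP\<^esub> inl1 a = TL CP (\<lambda>l b. inl1 b \<otimes>\<^bsub>CP\<^esub> inr1 (act x l)) (\<delta> a)"
proof -
  note cb = cross_bilin[OF FP_alg inl0_hom inr0_hom x]
  note c0 = alg_hom_closed[OF inl0_hom] alg_hom_closed[OF inr0_hom]
  have "inr1 x \<otimes>\<^bsub>CP\<^esub> inl1 a = I1.pr (inr0 x \<otimes>\<^bsub>FP\<^esub> inl0 a)"
    by (simp add: inl1_def inr1_def alg_homD(2)[OF I1.pr_hom] c0 x a)
  also have "\<dots> = I1.pr (TL FP (\<lambda>l b. inl0 b \<otimes>\<^bsub>FP\<^esub> inr0 (act x l)) (\<delta> a))"
    by (rule I1.pr_eqI) (use rels1_N1 x a c0 co_closed[OF a FP_alg cb] in \<open>auto\<close>)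
  also have "\<dots> = TL CP (\<lambda>l b. I1.pr (inl0 b \<otimes>\<^bsub>FP\<^esub> inr0 (act x l))) (\<delta> a)"
    by (rule co_hom[OF FP_alg CP_alg alg_homD(1)[OF I1.pr_hom] cb a])
  also have "\<dots> = TL CP (\<lambda>l b. inl1 b \<otimes>\<^bsub>CP\<^esub> inr1 (act x l)) (\<delta> a)"
    by (rule co_cong[OF CP_alg cross_bilin[OF CP_alg inl1_hom inr1_hom x] _ a, symmetric])
      (simp add: inl1_def inr1_def alg_homD(2)[OF I1.pr_hom] c0 lin_mapD(1)[OF act_lin[OF x]])
  finally show ?thesis .
qed

lemma CP_induct:
  assumes z: "z \<in> carrier CP" and one: "P \<one>\<^bsub>CP\<^esub>"
    and add: "\<And>x y. x \<in> carrier CP \<Longrightarrow> y \<in> carrier CP \<Longrightarrow> P x \<Longrightarrow> P y \<Longrightarrow> P (x \<oplus>\<^bsub>CP\<^esub> y)"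
    and smult: "\<And>c x. c \<in> carrier K \<Longrightarrow> x \<in> carrier CP \<Longrightarrow> P x \<Longrightarrow> P (c \<odot>\<^bsub>CP\<^esub> x)"
    and inl: "\<And>a x. a \<in> carrier A \<Longrightarrow> x \<in> carrier CP \<Longrightarrow> P x \<Longrightarrow> P (inl1 a \<otimes>\<^bsub>CP\<^esub> x)"
    and inr: "\<And>b x. b \<in> carrier B \<Longrightarrow> x \<in> carrier CP \<Longrightarrow> P x \<Longrightarrow> P (inr1 b \<otimes>\<^bsub>CP\<^esub> x)"
  shows "P z"
proof -
  note cl = alg_hom_closed[OF I1.pr_hom]
  note c0 = alg_hom_closed[OF inl0_hom] alg_hom_closed[OF inr0_hom]
  note D = lin_mapD(2,3)[OF alg_homD(1)[OF I1.pr_hom]] alg_homD(2,3)[OF I1.pr_hom]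
  obtain y where y: "y \<in> carrier FP" "z = I1.pr y" using z I1.carrier_quotient by auto
  have "P (I1.pr y)"
    by (rule FP_induct[OF y(1)]) (simp_all add: D one add smult cl c0 inl[unfolded inl1_def] inr[unfolded inr1_def])
  then show ?thesis using y by simp
qed

lemma CP_universal:
  fixes T (structure)
  assumes T: "assoc_algebra K T" and f: "f \<in> alg_hom K A T" and g: "g \<in> alg_hom K B T"
    and cross: "\<And>x a. x \<in> carrier B \<Longrightarrow> a \<in> carrier A \<Longrightarrow>
      g x \<otimes> f a = TL T (\<lambda>l b. f b \<otimes> g (act x l)) (\<delta> a)"
  obtains p where "p \<in> alg_hom K CP T" "\<And>a. a \<in> carrier A \<Longrightarrow> p (inl1 a) = f a" "\<And>b. b \<in> carrier B \<Longrightarrow> p (inr1 b) = g b"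
proof -
  interpret T: assoc_algebra K T by (rule T)
  obtain p where p: "p \<in> alg_hom K FP T" and pl: "\<And>a. a \<in> carrier A \<Longrightarrow> p (inl0 a) = f a"
    and pr: "\<And>b. b \<in> carrier B \<Longrightarrow> p (inr0 b) = g b"
    using FP_universal[OF T f g] by blast
  note c0 = alg_hom_closed[OF inl0_hom] alg_hom_closed[OF inr0_hom]
  note fc = alg_hom_closed[OF f] alg_hom_closed[OF g]
  have z: "p r = \<zero>" if r: "r \<in> rels1" for r
  proof -
    obtain x a where x: "x \<in> carrier B" and a: "a \<in> carrier A"
      and rr: "r = inr0 x \<otimes>\<^bsub>FP\<^esub> inl0 a \<ominus>\<^bsub>FP\<^esub> TL FP (\<lambda>l b. inl0 b \<otimes>\<^bsub>FP\<^esub> inr0 (act x l)) (\<delta> a)"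
      using r by blast
    note cb = cross_bilin[OF FP_alg inl0_hom inr0_hom x]
    have "p (TL FP (\<lambda>l b. inl0 b \<otimes>\<^bsub>FP\<^esub> inr0 (act x l)) (\<delta> a)) =
      TL T (\<lambda>l b. p (inl0 b \<otimes>\<^bsub>FP\<^esub> inr0 (act x l))) (\<delta> a)"
      by (rule co_hom[OF FP_alg T alg_homD(1)[OF p] cb a])
    also have "\<dots> = TL T (\<lambda>l b. f b \<otimes> g (act x l)) (\<delta> a)"
      by (rule co_cong[OF T cross_bilin[OF T f g x] _ a, symmetric])
        (simp add: alg_homD(2)[OF p] c0 pl pr lin_mapD(1)[OF act_lin[OF x]])
    also have "\<dots> = g x \<otimes> f a" by (rule cross[OF x a, symmetric])
    finally show ?thesis
      using x a fc by (simp add: rr lin_map_minus[OF FP_alg T alg_homD(1)[OF p]] co_closed[OF a FP_alg cb] c0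
          alg_homD(2)[OF p] pl pr T.A.r_right_minus_eq)
  qed
  then have v: "p n = \<zero>" if "n \<in> N1" for n
    using genideal_vanish[OF FP_alg T p rels1_closed] that unfolding crossed_ideal_def by blast
  let ?q = "\<lambda>Z. p (SOME x. x \<in> Z)"
  have "?q \<in> alg_hom K CP T"
    by (rule I1.quotient_lift(3)[OF T alg_homD(1)[OF p] v p])
  moreover have "?q (inl1 a) = f a" if "a \<in> carrier A" for a
    using I1.quotient_lift(1)[OF T alg_homD(1)[OF p] v, of "inl0 a"] that c0 pl by (simp add: inl1_def)
  moreover have "?q (inr1 b) = g b" if "b \<in> carrier B" for b
    using I1.quotient_lift(1)[OF T alg_homD(1)[OF p] v, of "inr0 b"] that c0 pr by (simp add: inr1_def)
  ultimately show ?thesis by (rule that)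
qed

text \<open>By the cross relations, the products \<open>a x\<close> span.\<close>

lemma lin_map_CP_eq:
  assumes T: "assoc_algebra K T" and f: "f \<in> lin_map K CP T" and g: "g \<in> lin_map K CP T"
    and eq: "\<And>a x. a \<in> carrier A \<Longrightarrow> x \<in> carrier B \<Longrightarrow> f (inl1 a \<otimes>\<^bsub>CP\<^esub> inr1 x) = g (inl1 a \<otimes>\<^bsub>CP\<^esub> inr1 x)"
    and z: "z \<in> carrier CP"
  shows "f z = g z"
proof -
  note c1 [simp] = alg_hom_closed[OF inl1_hom] alg_hom_closed[OF inr1_hom]
  note fD = lin_mapD(2,3)[OF f] and gD = lin_mapD(2,3)[OF g]
  interpret T: assoc_algebra K T by (rule T)
  define L where "L = lin_span K CP {inl1 a \<otimes>\<^bsub>CP\<^esub> inr1 x | a x. a \<in> carrier A \<and> x \<in> carrier B}"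
  have gens: "{inl1 a \<otimes>\<^bsub>CP\<^esub> inr1 x | a x. a \<in> carrier A \<and> x \<in> carrier B} \<subseteq> carrier CP" by auto
  note L = submodule_lin_span[OF CP_alg gens, folded L_def]
  note sm = CP.submoduleE[OF L(1)]
  have Lz: "\<zero>\<^bsub>CP\<^esub> \<in> L" using submodule.axioms(1)[OF L(1)] subgroup.one_closed by fastforce
  have gL: "inl1 a \<otimes>\<^bsub>CP\<^esub> inr1 x \<in> L" if "a \<in> carrier A" "x \<in> carrier B" for a x
    using L(2) that by blast
  have liftL: "TL CP \<beta> w \<in> L" if \<beta>: "bilin K H A CP \<beta>" and w: "w \<in> carrier (tensor K H A)"
    and in_L: "\<And>l b. l \<in> carrier H \<Longrightarrow> b \<in> carrier A \<Longrightarrow> \<beta> l b \<in> L" for \<beta> w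
    using H_alg Q_alg w
  proof (induction w rule: tensor_induct)
    case (add x y)
    then show ?case using lin_mapD(2)[OF tensor_lift_lin[OF H_alg Q_alg CP_alg \<beta>]] sm(5) by simp
  next
    case (tens v w)
    then show ?case by (simp add: tensor_lift_tens[OF H_alg Q_alg CP_alg \<beta>] in_L)
  qed
  have ind: "u \<otimes>\<^bsub>CP\<^esub> y \<in> L" if y: "y \<in> L" and u: "u \<in> carrier CP"
    and g: "\<And>a x. a \<in> carrier A \<Longrightarrow> x \<in> carrier B \<Longrightarrow> u \<otimes>\<^bsub>CP\<^esub> (inl1 a \<otimes>\<^bsub>CP\<^esub> inr1 x) \<in> L" for u y
    using lin_span_induct[OF CP_alg gens, of y "\<lambda>y. u \<otimes>\<^bsub>CP\<^esub> y \<in> L"] y u g Lz sm(4,5)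
    by (auto simp: L_def[symmetric] CP.A.r_distr CP.smult_mult_right)
  \<comment> \<open>\<open>L\<close> contains the unit and is stable under left multiplication by
    both kinds of generators, so \<open>CP_induct\<close> makes it everything.\<close>
  have "z \<in> L"
  proof (rule CP_induct[OF z])
    show "\<one>\<^bsub>CP\<^esub> \<in> L"
      using gL[OF Q.A.one_closed B_closed(1)] by (simp add: alg_homD(3)[OF inl1_hom] alg_homD(3)[OF inr1_hom])
  next
    fix a y assume a: "a \<in> carrier A" and y: "y \<in> L"
    show "inl1 a \<otimes>\<^bsub>CP\<^esub> y \<in> L"
    proof (rule ind[OF y])
      fix b x assume b: "b \<in> carrier A" "x \<in> carrier B"
      show "inl1 a \<otimes>\<^bsub>CP\<^esub> (inl1 b \<otimes>\<^bsub>CP\<^esub> inr1 x) \<in> L"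
        using gL[of "a \<otimes>\<^bsub>A\<^esub> b" x] a b by (simp add: alg_homD(2)[OF inl1_hom] CP.A.m_assoc)
    qed (use a in simp)
  next
    fix x y assume x: "x \<in> carrier B" and y: "y \<in> L"
    show "inr1 x \<otimes>\<^bsub>CP\<^esub> y \<in> L"
    proof (rule ind[OF y])
      fix b x' assume b: "b \<in> carrier A" "x' \<in> carrier B"
      note cb = cross_bilin[OF CP_alg inl1_hom inr1_hom x]
      note [mlin] = CP_alg bilinD[OF cb] b c1
      \<comment> \<open>The cross relation carries \<open>inr1 x\<close> to the right of the factor
        from \<open>A\<close>, where it merges with \<open>inr1 x'\<close> into one element of
        \<open>B\<close>.\<close>
      have "inr1 x \<otimes>\<^bsub>CP\<^esub> (inl1 b \<otimes>\<^bsub>CP\<^esub> inr1 x') = TL CP (\<lambda>l b. inl1 b \<otimes>\<^bsub>CP\<^esub> inr1 (act x l)) (\<delta> b) \<otimes>\<^bsub>CP\<^esub> inr1 x'"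
        using x b CP_cross[OF x b(1)] by (simp add: CP.A.m_assoc[symmetric])
      also have "\<dots> = TL CP (\<lambda>l b. inl1 b \<otimes>\<^bsub>CP\<^esub> inr1 (act x l) \<otimes>\<^bsub>CP\<^esub> inr1 x') (\<delta> b)"
        by (rule mult_tensor_lift(2)[OF H_alg Q_alg CP_alg cb \<delta>_closed]) (use b in simp_all)
      also have "\<dots> \<in> L"
      proof (rule liftL)
        show "bilin K H A CP (\<lambda>l b. inl1 b \<otimes>\<^bsub>CP\<^esub> inr1 (act x l) \<otimes>\<^bsub>CP\<^esub> inr1 x')" by (rule mlin | assumption)+
        show "\<delta> b \<in> carrier (tensor K H A)" using b(1) by (rule \<delta>_closed)
        fix l b' assume lb: "l \<in> carrier H" "b' \<in> carrier A"
        show "inl1 b' \<otimes>\<^bsub>CP\<^esub> inr1 (act x l) \<otimes>\<^bsub>CP\<^esub> inr1 x' \<in> L"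
          using gL[of b' "act x l \<otimes>\<^bsub>B\<^esub> x'"] lb b lin_mapD(1)[OF act_lin[OF x] lb(1)]
          by (simp add: alg_homD(2)[OF inr1_hom] B_closed CP.A.m_assoc)
      qed
      finally show "inr1 x \<otimes>\<^bsub>CP\<^esub> (inl1 b \<otimes>\<^bsub>CP\<^esub> inr1 x') \<in> L" .
    qed (use x in simp)
  qed (use sm(4,5) in blast)+
  then have "z \<in> lin_span K CP {inl1 a \<otimes>\<^bsub>CP\<^esub> inr1 x | a x. a \<in> carrier A \<and> x \<in> carrier B}" by (simp add: L_def)
  then have "z \<in> carrier CP \<and> f z = g z"
    by (rule lin_span_induct[OF CP_alg gens])
      (auto simp: fD gD eq lin_map_zero[OF CP_alg T f] lin_map_zero[OF CP_alg T g])
  then show ?thesis by simp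
qed

end

subsection \<open>The dual algebra in coordinates\<close>

text \<open>The braided coproduct and the coaction are written with a decomposition of
  \<open>R\<close> and a dual basis, so both are parameters. \<open>R_lift_sum\<close> and
  \<open>Kt_lift\<close> trade these sums for lifts over \<open>R\<close> and over
  \<open>K\<close>.\<close>

locale reflective_data = quasitriangular_hopf_algebra K H \<Delta> \<epsilon> S R + A: left_comodule_algebra K H \<Delta> \<epsilon> A \<delta>
  for K :: "'k ring" and H :: "('k, 'h) module"
    and \<Delta> :: "'h \<Rightarrow> ('h \<times> 'h \<Rightarrow> 'k) set" and \<epsilon> :: "'h \<Rightarrow> 'k" and S :: "'h \<Rightarrow> 'h"
    and R :: "('h \<times> 'h \<Rightarrow> 'k) set"
    and A :: "('k, 'a) module" and \<delta> :: "'a \<Rightarrow> ('h \<times> 'a \<Rightarrow> 'k) set" +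
  fixes I :: "'i set" and s t :: "'i \<Rightarrow> 'h"
    and D :: "'d set" and hb :: "'d \<Rightarrow> 'h" and xb :: "'d \<Rightarrow> 'h \<Rightarrow> 'k"
  assumes finite_I: "finite I" and s: "s \<in> I \<rightarrow> carrier H" and t: "t \<in> I \<rightarrow> carrier H"
    and R_eq: "R = (\<Oplus>\<^bsub>tensor K H H\<^esub>i\<in>I. tens K H H (s i) (t i))"
    and basis: "dual_basis K H D hb xb"
begin

abbreviation "base \<equiv> base_algebra K"
abbreviation "dual \<equiv> dual_carrier K H"
abbreviation "hat \<equiv> hat_comult K H \<Delta> S I s t"
abbreviation "B \<equiv> op_algebra (hat_dual K H \<Delta> \<epsilon> S I s t)"
abbreviation "act \<equiv> hat_dual_action K H \<Delta> S"
abbreviation "hact \<equiv> hat_action K H \<Delta> S"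

lemma base_alg [mlin]: "assoc_algebra K base" by (rule mlin)+

lemma A_alg [mlin]: "assoc_algebra K A" by (rule A.Q_alg)

lemma st_closed [simp, mlin]: "i \<in> I \<Longrightarrow> s i \<in> carrier H" "i \<in> I \<Longrightarrow> t i \<in> carrier H"
  using s t by auto

lemma R_lift_sum:
  assumes U: "assoc_algebra K U" and \<beta>: "bilin K H H U \<beta>"
  shows "TL U \<beta> R = (\<Oplus>\<^bsub>U\<^esub>i\<in>I. \<beta> (s i) (t i))"
proof -
  interpret U: assoc_algebra K U by (rule U)
  have "TL U \<beta> R = (\<Oplus>\<^bsub>U\<^esub>i\<in>I. TL U \<beta> (tens K H H (s i) (t i)))"
    unfolding R_eq by (rule lin_map_finsum[OF HH_alg U tensor_lift_lin[OF H_alg H_alg U \<beta>]]) (auto intro!: tens_closed H_alg)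
  also have "\<dots> = (\<Oplus>\<^bsub>U\<^esub>i\<in>I. \<beta> (s i) (t i))"
    by (rule U.A.finsum_cong') (auto simp: tensor_lift_tens[OF H_alg H_alg U \<beta>] bilin_closed[OF \<beta>])
  finally show ?thesis .
qed

text \<open>\<open>R = \<Sum> a \<otimes> b = \<Sum> c \<otimes> d\<close> below.\<close>

lemma hat_comult_eq:
  assumes h: "h \<in> carrier H"
  shows "hat h = TL (tensor K H H) (\<lambda>x y. TL (tensor K H H) (\<lambda>a b.
    TL (tensor K H H) (\<lambda>c d. tens K H H (d \<star> x \<star> b) (y \<star> a \<star> Si c)) R) R) (\<Delta> h)"
  unfolding hat_comult_def
proof (rule sw_cong[OF HH_alg _ _ h, symmetric])
  interpret HH: assoc_algebra K "tensor K H H" by (rule HH_alg)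
  fix x y assume [simp, mlin]: "x \<in> carrier H" "y \<in> carrier H"
  let ?t = "\<lambda>a b c d. tens K H H (d \<star> x \<star> b) (y \<star> a \<star> Si c)"
  have "TL (tensor K H H) (\<lambda>a b. TL (tensor K H H) (\<lambda>c d. ?t a b c d) R) R =
    (\<Oplus>\<^bsub>tensor K H H\<^esub>i\<in>I. TL (tensor K H H) (\<lambda>c d. ?t (s i) (t i) c d) R)"
    by (rule R_lift_sum[OF HH_alg]) (rule mlin | assumption)+
  also have "\<dots> = (\<Oplus>\<^bsub>tensor K H H\<^esub>i\<in>I. \<Oplus>\<^bsub>tensor K H H\<^esub>j\<in>I. ?t (s i) (t i) (s j) (t j))"
  proof (rule HH.A.finsum_cong')
    fix i assume "i \<in> I"
    then show "TL (tensor K H H) (\<lambda>c d. ?t (s i) (t i) c d) R = (\<Oplus>\<^bsub>tensor K H H\<^esub>j\<in>I. ?t (s i) (t i) (s j) (t j))"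
      by - (rule R_lift_sum[OF HH_alg], (rule mlin | assumption)+)
  qed (auto intro!: HH.A.finsum_closed tens_closed H_alg A.m_closed Si_closed)
  finally show "TL (tensor K H H) (\<lambda>a b. TL (tensor K H H) (\<lambda>c d. ?t a b c d) R) R = \<dots>" .
qed (rule mlin HH_alg | assumption)+

lemma hat_lin: "hat \<in> lin_map K H (tensor K H H)"
proof (rule lin_map_cong[OF H_alg _ hat_comult_eq[symmetric]])
  note [mlin] = HH_alg
  show "(\<lambda>h. TL (tensor K H H) (\<lambda>x y. TL (tensor K H H) (\<lambda>a b.
    TL (tensor K H H) (\<lambda>c d. tens K H H (d \<star> x \<star> b) (y \<star> a \<star> Si c)) R) R) (\<Delta> h)) \<in> lin_map K H (tensor K H H)"
    by (rule mlin | assumption)+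
qed
lemmas hat_lin' [mlin] = lin_comp[OF hat_lin]
lemma hat_closed [mlin]: "h \<in> carrier H \<Longrightarrow> hat h \<in> carrier (tensor K H H)" by (rule lin_mapD(1)[OF hat_lin])

lemma hat_lift:
  assumes U: "assoc_algebra K U" and \<beta>: "bilin K H H U \<beta>" and h: "h \<in> carrier H"
  shows "TL U \<beta> (hat h) = TL U (\<lambda>x y. TL U (\<lambda>a b.
    TL U (\<lambda>c d. \<beta> (d \<star> x \<star> b) (y \<star> a \<star> Si c)) R) R) (\<Delta> h)"
proof -
  note [mlin] = HH_alg U lin_comp[OF bilinD(1)[OF \<beta>]] lin_comp[OF bilinD(2)[OF \<beta>]] bilin_closed[OF \<beta>]
  note L = tensor_lift_lin[OF H_alg H_alg U \<beta>]
  note LT = tensor_lift_tens[OF H_alg H_alg U \<beta>]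
  let ?T = "tensor K H H"
  let ?t = "\<lambda>x y a b c d. tens K H H (d \<star> x \<star> b) (y \<star> a \<star> Si c)"
  have "TL U \<beta> (hat h) =
    TL U (\<lambda>x y. TL U \<beta> (TL ?T (\<lambda>a b. TL ?T (\<lambda>c d. ?t x y a b c d) R) R)) (\<Delta> h)"
    unfolding hat_comult_eq[OF h] by (rule sw_hom[OF HH_alg U L _ h]) (rule mlin | assumption)+
  also have "\<dots> = TL U (\<lambda>x y. TL U (\<lambda>a b.
    TL U (\<lambda>c d. \<beta> (d \<star> x \<star> b) (y \<star> a \<star> Si c)) R) R) (\<Delta> h)"
  proof (rule sw_cong[OF U _ _ h, symmetric])
    fix x y assume [simp, mlin]: "x \<in> carrier H" "y \<in> carrier H"
    have "TL U \<beta> (TL ?T (\<lambda>a b. TL ?T (\<lambda>c d. ?t x y a b c d) R) R) =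
      TL U (\<lambda>a b. TL U \<beta> (TL ?T (\<lambda>c d. ?t x y a b c d) R)) R"
      by (rule R_hom[OF HH_alg U L]) (rule mlin | assumption)+
    also have "\<dots> = TL U (\<lambda>a b. TL U (\<lambda>c d. \<beta> (d \<star> x \<star> b) (y \<star> a \<star> Si c)) R) R"
    proof (rule R_cong[OF U, symmetric])
      fix a b assume [simp, mlin]: "a \<in> carrier H" "b \<in> carrier H"
      show "TL U (\<lambda>c d. \<beta> (d \<star> x \<star> b) (y \<star> a \<star> Si c)) R =
        TL U \<beta> (TL ?T (\<lambda>c d. ?t x y a b c d) R)" (is "?l = ?r")
      proof -
      have "?r =
        TL U (\<lambda>c d. TL U \<beta> (?t x y a b c d)) R"
        by (rule R_hom[OF HH_alg U L]) (rule mlin | assumption)+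
      also have "\<dots> = ?l"
        by (rule R_cong[OF U, symmetric], (rule mlin | assumption)+) (simp add: LT Si_closed)
      finally show ?thesis by simp
      qed
    qed (rule mlin | assumption)+
    finally show "TL U (\<lambda>a b. TL U (\<lambda>c d. \<beta> (d \<star> x \<star> b) (y \<star> a \<star> Si c)) R) R =
      TL U \<beta> (TL ?T (\<lambda>a b. TL ?T (\<lambda>c d. ?t x y a b c d) R) R)" by simp
  qed (rule mlin | assumption)+
  finally show ?thesis .
qed

lemma hact_lin1 [mlin]:
  assumes l: "l \<in> carrier H" and g: "(\<lambda>x. g x) \<in> lin_map K Z H" and Z: "assoc_algebra K Z"
  shows "(\<lambda>x. hact l (g x)) \<in> lin_map K Z H"
proof -
  note [mlin] = l g Z lin_mapD(1)[OF g]
  show ?thesis unfolding hat_action_def by (rule mlin | assumption)+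
qed

lemma hact_lin2 [mlin]: "h \<in> carrier H \<Longrightarrow> (\<lambda>x. g x) \<in> lin_map K Z H \<Longrightarrow> (\<lambda>x. hact (g x) h) \<in> lin_map K Z H"
  unfolding hat_action_def by (rule lin_sw_arg) (assumption | rule mlin)+

lemma hact_closed [simp, mlin]: "l \<in> carrier H \<Longrightarrow> h \<in> carrier H \<Longrightarrow> hact l h \<in> carrier H"
  using lin_mapD(1)[OF hact_lin2[OF _ lin_id]] by blast

text \<open>\<open>(m\<^sub>2 \<rightharpoonup> c) m\<^sub>1 = m c\<close>\<close>

lemma hact_contract:
  assumes U: "assoc_algebra K U" and F: "F \<in> lin_map K H U" and m: "m \<in> carrier H" and c: "c \<in> carrier H"
  shows "TL U (\<lambda>l l'. F (hact l' c \<star> l)) (\<Delta> m) = F (m \<star> c)"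
proof -
  note [mlin] = U m c lin_comp[OF F] lin_mapD(1)[OF F]
  note [simp] = c m
  have tri: "trilin K H H H U (\<lambda>l x y. F (y \<star> c \<star> Si x \<star> l))" by (rule mlin | assumption)+
  have "TL U (\<lambda>l l'. F (hact l' c \<star> l)) (\<Delta> m) =
    TL U (\<lambda>l l'. TL U (\<lambda>x y. F (y \<star> c \<star> Si x \<star> l)) (\<Delta> l')) (\<Delta> m)"
  proof (rule sw_cong[OF U _ _ m])
    fix l l' assume [simp, mlin]: "l \<in> carrier H" "l' \<in> carrier H"
    have G: "(\<lambda>w. F (w \<star> l)) \<in> lin_map K H U" by (rule mlin)+
    show "F (hact l' c \<star> l) = TL U (\<lambda>x y. F (y \<star> c \<star> Si x \<star> l)) (\<Delta> l')"
      unfolding hat_action_def by (rule sw_hom[OF H_alg U G]) (rule mlin | assumption)+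
  qed (rule mlin | assumption)+
  also have "\<dots> = TL U (\<lambda>a b. TL U (\<lambda>l x. F (b \<star> c \<star> Si x \<star> l)) (\<Delta> a)) (\<Delta> m)"
    by (rule sw_coassoc[OF U tri m, symmetric])
  also have "\<dots> = TL U (\<lambda>a b. \<epsilon> a \<odot>\<^bsub>U\<^esub> F (b \<star> c)) (\<Delta> m)"
  proof (rule sw_cong[OF U _ _ m])
    fix a b assume [simp, mlin]: "a \<in> carrier H" "b \<in> carrier H"
    have G: "(\<lambda>w. F (b \<star> c \<star> w)) \<in> lin_map K H U" by (rule mlin)+
    have "TL U (\<lambda>l x. F (b \<star> c \<star> Si x \<star> l)) (\<Delta> a) =
        TL U (\<lambda>l x. F (b \<star> c \<star> (Si x \<star> l))) (\<Delta> a)"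
      by (rule sw_cong[OF U], (rule mlin | assumption)+) (simp add: A.m_assoc Si_closed, rule mlin)
    also have "\<dots> = \<epsilon> a \<odot>\<^bsub>U\<^esub> F (b \<star> c \<star> \<one>\<^bsub>H\<^esub>)" by (rule Si_contract(2)[OF U G]) (rule mlin)
    finally show "TL U (\<lambda>l x. F (b \<star> c \<star> Si x \<star> l)) (\<Delta> a) = \<epsilon> a \<odot>\<^bsub>U\<^esub> F (b \<star> c)"
      by simp
  qed (rule mlin | assumption)+
  also have "\<dots> = F (m \<star> c)"
    by (rule counit_left_lin[OF U _ m]) (rule mlin)+
  finally show ?thesis .
qed

lemma dualD: "z \<in> dual \<Longrightarrow> z \<in> lin_map K H base" "z \<in> dual \<Longrightarrow> z \<in> extensional (carrier H)"
  by (auto simp: dual_carrier_def)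

lemma dual_val: "z \<in> dual \<Longrightarrow> h \<in> carrier H \<Longrightarrow> z h \<in> carrier K"
  using lin_mapD(1)[OF dualD(1)] by (simp add: base_algebra_simps)

lemma dualI: "f \<in> lin_map K H base \<Longrightarrow> (\<lambda>h\<in>carrier H. f h) \<in> dual"
  unfolding dual_carrier_def by (auto intro: lin_map_cong[OF H_alg])

lemma dual_eqI: "y \<in> dual \<Longrightarrow> z \<in> dual \<Longrightarrow> (\<And>h. h \<in> carrier H \<Longrightarrow> y h = z h) \<Longrightarrow> y = z"
  using dualD(2) by (blast intro: extensionalityI)

text \<open>In the product rule the order is already reversed: \<open>B\<close> is the opposite
  algebra, so the left factor \<open>x\<close> is paired with the second leg of
  \<open>hat\<close>.\<close>

lemma B_simps:
  "carrier B = dual" "x \<oplus>\<^bsub>B\<^esub> y = (\<lambda>h\<in>carrier H. x h \<oplus>\<^bsub>K\<^esub> y h)" "c \<odot>\<^bsub>B\<^esub> x = (\<lambda>h\<in>carrier H. c \<otimes>\<^bsub>K\<^esub> x h)"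
  "x \<otimes>\<^bsub>B\<^esub> y = (\<lambda>h\<in>carrier H. TL base (\<lambda>a b. y a \<otimes>\<^bsub>K\<^esub> x b) (hat h))"
  "\<one>\<^bsub>B\<^esub> = (\<lambda>h\<in>carrier H. \<epsilon> h)"
  by (simp_all add: op_algebra_def hat_dual_def)

lemma pair_bilin: "x \<in> dual \<Longrightarrow> y \<in> dual \<Longrightarrow> bilin K H H base (\<lambda>a b. x a \<otimes>\<^bsub>K\<^esub> y b)"
proof -
  assume x: "x \<in> dual" and y: "y \<in> dual"
  note [mlin] = dualD(1)[OF x] dualD(1)[OF y] dual_val[OF x] dual_val[OF y]
  have "bilin K H H base (\<lambda>a b. x a \<odot>\<^bsub>base\<^esub> y b)" by (rule mlin | simp add: base_algebra_simps | assumption)+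
  then show ?thesis by (simp add: base_algebra_simps)
qed

lemma B_closed:
  shows "\<one>\<^bsub>B\<^esub> \<in> carrier B"
    and "x \<in> carrier B \<Longrightarrow> y \<in> carrier B \<Longrightarrow> x \<oplus>\<^bsub>B\<^esub> y \<in> carrier B"
    and "x \<in> carrier B \<Longrightarrow> y \<in> carrier B \<Longrightarrow> x \<otimes>\<^bsub>B\<^esub> y \<in> carrier B"
    and "c \<in> carrier K \<Longrightarrow> x \<in> carrier B \<Longrightarrow> c \<odot>\<^bsub>B\<^esub> x \<in> carrier B"
proof -
  show "\<one>\<^bsub>B\<^esub> \<in> carrier B" unfolding B_simps by (rule dualI, rule \<epsilon>_lin)
  show "x \<oplus>\<^bsub>B\<^esub> y \<in> carrier B" if "x \<in> carrier B" "y \<in> carrier B"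
    using that lin_add[OF base_alg dualD(1) dualD(1)] unfolding B_simps base_algebra_simps by (intro dualI) simp
  show "c \<odot>\<^bsub>B\<^esub> x \<in> carrier B" if "c \<in> carrier K" "x \<in> carrier B"
    using that lin_smult[OF base_alg _ dualD(1)] unfolding B_simps base_algebra_simps by (intro dualI) simp
  show "x \<otimes>\<^bsub>B\<^esub> y \<in> carrier B" if "x \<in> carrier B" "y \<in> carrier B"
    using that unfolding B_simps
    by (intro dualI lin_lift_arg[OF H_alg H_alg base_alg hat_lin pair_bilin])
qed

lemma act_closed: "x \<in> dual \<Longrightarrow> l \<in> carrier H \<Longrightarrow> act x l \<in> dual"
  unfolding hat_dual_action_def
  by (rule dualI, rule lin_comp[OF dualD(1)], assumption) (rule mlin | assumption)+

lemma act_lin: "x \<in> carrier B \<Longrightarrow> (\<lambda>l. act x l) \<in> lin_map K H B"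
proof (rule lin_mapI)
  assume x: "x \<in> carrier B"
  then have xd: "x \<in> dual" by (simp add: B_simps)
  note L = lin_mapD(2,3)[OF lin_comp[OF dualD(1)[OF xd] hact_lin2[OF _ lin_id]], unfolded base_algebra_simps]
  show "act x l \<in> carrier B" if "l \<in> carrier H" for l using act_closed[OF xd that] by (simp add: B_simps)
  show "act x (l \<oplus>\<^bsub>H\<^esub> l') = act x l \<oplus>\<^bsub>B\<^esub> act x l'" if "l \<in> carrier H" "l' \<in> carrier H" for l l'
    unfolding B_simps hat_dual_action_def by (rule restrict_ext) (simp add: L that)
  show "act x (c \<odot>\<^bsub>H\<^esub> l) = c \<odot>\<^bsub>B\<^esub> act x l" if "c \<in> carrier K" "l \<in> carrier H" for c l
    unfolding B_simps hat_dual_action_def by (rule restrict_ext) (simp add: L that)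
qed

lemma basis_facts:
  shows finite_D: "finite D" and hb [simp, mlin]: "d \<in> D \<Longrightarrow> hb d \<in> carrier H" and xb: "d \<in> D \<Longrightarrow> xb d \<in> dual"
    and expand: "h \<in> carrier H \<Longrightarrow> h = (\<Oplus>\<^bsub>H\<^esub>d\<in>D. xb d h \<odot>\<^bsub>H\<^esub> hb d)"
  using basis unfolding dual_basis_def by auto

lemma xb_val [simp, mlin]: "d \<in> D \<Longrightarrow> h \<in> carrier H \<Longrightarrow> xb d h \<in> carrier K"
  using dual_val[OF xb] .

lemma xb_lin: "d \<in> D \<Longrightarrow> xb d \<in> lin_map K H base" using dualD(1)[OF xb] .

lemma lin_expand:
  assumes U: "assoc_algebra K U" and F: "F \<in> lin_map K H U" and h: "h \<in> carrier H"
  shows "F h = (\<Oplus>\<^bsub>U\<^esub>d\<in>D. xb d h \<odot>\<^bsub>U\<^esub> F (hb d))"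
proof -
  interpret U: assoc_algebra K U by (rule U)
  have "F h = F (\<Oplus>\<^bsub>H\<^esub>d\<in>D. xb d h \<odot>\<^bsub>H\<^esub> hb d)" using expand[OF h] by simp
  also have "\<dots> = (\<Oplus>\<^bsub>U\<^esub>d\<in>D. F (xb d h \<odot>\<^bsub>H\<^esub> hb d))"
    by (rule lin_map_finsum[OF H_alg U F]) (use h in auto)
  also have "\<dots> = (\<Oplus>\<^bsub>U\<^esub>d\<in>D. xb d h \<odot>\<^bsub>U\<^esub> F (hb d))"
    by (rule U.A.finsum_cong') (use h in \<open>auto simp: lin_mapD[OF F]\<close>)
  finally show ?thesis .
qed

text \<open>Expansion in the product basis. For \<open>z = hat c\<close> the coefficient at
  \<open>hb e \<otimes> hb d\<close> is the value at \<open>c\<close> of the product in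
  \<open>B\<close> of \<open>xb d\<close> and \<open>xb e\<close>, which is how multiplicativity on
  the dual meets the braided coproduct.\<close>

lemma pair_expand:
  assumes U: "assoc_algebra K U" and \<gamma>: "bilin K H H U \<gamma>" and z: "z \<in> carrier (tensor K H H)"
  shows "TL U \<gamma> z = (\<Oplus>\<^bsub>U\<^esub>d\<in>D. \<Oplus>\<^bsub>U\<^esub>e\<in>D.
    TL base (\<lambda>a b. xb e a \<otimes>\<^bsub>K\<^esub> xb d b) z \<odot>\<^bsub>U\<^esub> \<gamma> (hb e) (hb d))"
proof (rule lin_map_tensor_eq[OF H_alg H_alg tensor_lift_lin[OF H_alg H_alg U \<gamma>] _ _ z])
  interpret U: assoc_algebra K U by (rule U)
  note pl = tensor_lift_lin[OF H_alg H_alg base_alg pair_bilin[OF xb xb]]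
  note [mlin] = U HH_alg bilin_closed[OF \<gamma>] finite_D pl
  show "(\<lambda>z. \<Oplus>\<^bsub>U\<^esub>d\<in>D. \<Oplus>\<^bsub>U\<^esub>e\<in>D. TL base (\<lambda>a b. xb e a \<otimes>\<^bsub>K\<^esub> xb d b) z \<odot>\<^bsub>U\<^esub> \<gamma> (hb e) (hb d))
      \<in> lin_map K (tensor K H H) U"
    by (rule mlin | assumption)+
  fix v w assume v [simp]: "v \<in> carrier H" and w [simp]: "w \<in> carrier H"
  have "\<gamma> v w = (\<Oplus>\<^bsub>U\<^esub>d\<in>D. xb d w \<odot>\<^bsub>U\<^esub> \<gamma> v (hb d))" by (rule lin_expand[OF U bilinD(1)[OF \<gamma> v] w])
  also have "\<dots> = (\<Oplus>\<^bsub>U\<^esub>d\<in>D. \<Oplus>\<^bsub>U\<^esub>e\<in>D. (xb e v \<otimes>\<^bsub>K\<^esub> xb d w) \<odot>\<^bsub>U\<^esub> \<gamma> (hb e) (hb d))"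
  proof (rule U.A.finsum_cong')
    fix d assume d [simp]: "d \<in> D"
    show "xb d w \<odot>\<^bsub>U\<^esub> \<gamma> v (hb d) = (\<Oplus>\<^bsub>U\<^esub>e\<in>D. (xb e v \<otimes>\<^bsub>K\<^esub> xb d w) \<odot>\<^bsub>U\<^esub> \<gamma> (hb e) (hb d))" (is "?l = ?r")
    proof -
    have "?l = xb d w \<odot>\<^bsub>U\<^esub> (\<Oplus>\<^bsub>U\<^esub>e\<in>D. xb e v \<odot>\<^bsub>U\<^esub> \<gamma> (hb e) (hb d))"
      using lin_expand[OF U bilinD(2)[OF \<gamma>] v, of "hb d"] by simp
    also have "\<dots> = (\<Oplus>\<^bsub>U\<^esub>e\<in>D. xb d w \<odot>\<^bsub>U\<^esub> (xb e v \<odot>\<^bsub>U\<^esub> \<gamma> (hb e) (hb d)))"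
      by (rule U.finsum_smult_ldistr[OF finite_D]) (auto simp: bilin_closed[OF \<gamma>])
    also have "\<dots> = ?r"
      by (rule U.A.finsum_cong') (auto simp: bilin_closed[OF \<gamma>] U.smult_assoc1[symmetric] K.m_comm)
    finally show ?thesis .
    qed
  qed (auto intro!: U.A.finsum_closed simp: bilin_closed[OF \<gamma>])
  also have "\<dots> = (\<Oplus>\<^bsub>U\<^esub>d\<in>D. \<Oplus>\<^bsub>U\<^esub>e\<in>D.
    TL base (\<lambda>a b. xb e a \<otimes>\<^bsub>K\<^esub> xb d b) (tens K H H v w) \<odot>\<^bsub>U\<^esub> \<gamma> (hb e) (hb d))"
    by (intro U.A.finsum_cong') (auto intro!: U.A.finsum_closed simp: bilin_closed[OF \<gamma>] tensor_lift_tens[OF H_alg H_alg base_alg pair_bilin[OF xb xb]])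
  finally show "TL U \<gamma> (tens K H H v w) = (\<Oplus>\<^bsub>U\<^esub>d\<in>D. \<Oplus>\<^bsub>U\<^esub>e\<in>D.
    TL base (\<lambda>a b. xb e a \<otimes>\<^bsub>K\<^esub> xb d b) (tens K H H v w) \<odot>\<^bsub>U\<^esub> \<gamma> (hb e) (hb d))"
    by (simp add: tensor_lift_tens[OF H_alg H_alg U \<gamma>])
qed

text \<open>The unit is treated apart: it is reached by putting the trivial leg into
  \<open>K\<close> (\<open>KK_et\<close>).\<close>

definition dual_mult where
  "dual_mult T x \<longleftrightarrow> (\<forall>y\<in>dual. \<forall>z\<in>dual. x (y \<otimes>\<^bsub>B\<^esub> z) = x y \<otimes>\<^bsub>T\<^esub> x z)"

context
  fixes T :: "('k, 't) module" (structure) and x :: "('h \<Rightarrow> 'k) \<Rightarrow> 't"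
  assumes T: "assoc_algebra K T" and x: "x \<in> lin_map K B T"
begin

interpretation T: assoc_algebra K T by (rule T)

lemma x_closed [simp]: "z \<in> dual \<Longrightarrow> x z \<in> carrier T"
  using lin_mapD(1)[OF x] by (simp add: B_simps)

text \<open>\<open>lin_map_finsum\<close> takes an algebra as source, which has not been established
  for \<open>B\<close>. The expansion is therefore assembled one basis functional at a time through
  the partial sums \<open>p F\<close>, starting from \<open>0\<close> times the unit.\<close>

lemma dual_expand:
  assumes z: "z \<in> dual"
  shows "x z = (\<Oplus>d\<in>D. z (hb d) \<odot> x (xb d))"
proof -
  interpret base: assoc_algebra K base by (rule base_alg)
  define p where "p F = (\<lambda>h\<in>carrier H. \<Oplus>\<^bsub>base\<^esub>d\<in>F. xb d h \<odot>\<^bsub>base\<^esub> z (hb d))" for F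
  have zl: "d \<in> D \<Longrightarrow> z (hb d) \<in> carrier base" for d using dual_val[OF z] by (simp add: base_algebra_simps)
  have pd: "p F \<in> dual" if "F \<subseteq> D" for F
    unfolding p_def
    by (intro dualI lin_finsum[OF base_alg] lin_smult_fun[OF base_alg])
      (use that finite_D zl in \<open>auto intro: finite_subset xb_lin\<close>)
  have "F \<subseteq> D \<Longrightarrow> x (p F) = (\<Oplus>d\<in>F. z (hb d) \<odot> x (xb d))" if "finite F" for F
    using that
  proof (induction F rule: finite_induct)
    case empty
    have "p {} = \<zero>\<^bsub>K\<^esub> \<odot>\<^bsub>B\<^esub> \<one>\<^bsub>B\<^esub>"
      unfolding p_def B_simps by (rule restrict_ext) (simp add: base.A.finsum_empty base_algebra_simps \<epsilon>_closed)
    then show ?case using lin_mapD(3)[OF x, of "\<zero>\<^bsub>K\<^esub>" "\<one>\<^bsub>B\<^esub>"] B_closed(1) lin_mapD(1)[OF x] by simp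
  next
    case (insert d F)
    then have d: "d \<in> D" and F: "F \<subseteq> D" by auto
    have "p (insert d F) = (z (hb d) \<odot>\<^bsub>B\<^esub> xb d) \<oplus>\<^bsub>B\<^esub> p F"
    proof (rule dual_eqI)
      show "p (insert d F) \<in> dual" by (rule pd) (use d F in auto)
      show "z (hb d) \<odot>\<^bsub>B\<^esub> xb d \<oplus>\<^bsub>B\<^esub> p F \<in> dual"
        using B_closed(2,4) pd[OF F] xb[OF d] dual_val[OF z] d by (simp add: B_simps(1))
      fix h assume h: "h \<in> carrier H"
      have "(\<Oplus>\<^bsub>base\<^esub>d\<in>insert d F. xb d h \<odot>\<^bsub>base\<^esub> z (hb d)) =
          xb d h \<odot>\<^bsub>base\<^esub> z (hb d) \<oplus>\<^bsub>base\<^esub> (\<Oplus>\<^bsub>base\<^esub>d\<in>F. xb d h \<odot>\<^bsub>base\<^esub> z (hb d))"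
        by (rule base.A.finsum_insert) (use insert F d zl h in \<open>auto intro!: base.smult_closed\<close>)
      then show "p (insert d F) h = (z (hb d) \<odot>\<^bsub>B\<^esub> xb d \<oplus>\<^bsub>B\<^esub> p F) h"
        using h d dual_val[OF z hb[OF d]] by (simp add: p_def B_simps base_algebra_simps K.m_comm)
    qed
    then have "x (p (insert d F)) = z (hb d) \<odot> x (xb d) \<oplus> x (p F)"
      using lin_mapD(2,3)[OF x] B_closed(4) pd[OF F] xb[OF d] dual_val[OF z hb[OF d]] by (simp add: B_simps(1))
    also have "\<dots> = (\<Oplus>d\<in>insert d F. z (hb d) \<odot> x (xb d))"
      using insert F d dual_val[OF z] xb by (subst T.A.finsum_insert) (auto intro!: T.smult_closed)
    finally show ?case .
  qed
  from this[OF finite_D] have 1: "x (p D) = (\<Oplus>d\<in>D. z (hb d) \<odot> x (xb d))" by simp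
  have "z = p D"
  proof (rule dual_eqI[OF z pd])
    fix h assume h: "h \<in> carrier H"
    show "z h = p D h" using lin_expand[OF base_alg dualD(1)[OF z] h] h by (simp add: p_def)
  qed simp
  then show ?thesis using 1 by simp
qed

text \<open>A linear map \<open>x\<close> from the dual of \<open>H\<close> to \<open>T\<close>, encoded as an element of \<open>H \<otimes> T\<close>.\<close>

definition Kt where "Kt = (\<Oplus>\<^bsub>tensor K H T\<^esub>d\<in>D. tens K H T (hb d) (x (xb d)))"

lemma Kt_closed: "Kt \<in> carrier (tensor K H T)"
proof -
  interpret HT: assoc_algebra K "tensor K H T" by (intro assoc_algebra_tensor H_alg T)
  show ?thesis unfolding Kt_def by (rule HT.A.finsum_closed) (auto intro!: tens_closed H_alg T simp: xb)
qed

lemma Kt_lift: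
  assumes U: "assoc_algebra K U" and \<beta>: "bilin K H T U \<beta>"
  shows "TL U \<beta> Kt = (\<Oplus>\<^bsub>U\<^esub>d\<in>D. \<beta> (hb d) (x (xb d)))"
proof -
  interpret U: assoc_algebra K U by (rule U)
  have "TL U \<beta> Kt = (\<Oplus>\<^bsub>U\<^esub>d\<in>D. TL U \<beta> (tens K H T (hb d) (x (xb d))))"
    unfolding Kt_def by (rule lin_map_finsum[OF assoc_algebra_tensor[OF H_alg T] U tensor_lift_lin[OF H_alg T U \<beta>]])
      (auto intro!: tens_closed H_alg T simp: xb)
  also have "\<dots> = (\<Oplus>\<^bsub>U\<^esub>d\<in>D. \<beta> (hb d) (x (xb d)))"
    by (rule U.A.finsum_cong') (auto simp: tensor_lift_tens[OF H_alg T U \<beta>] bilin_closed[OF \<beta>] xb)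
  finally show ?thesis .
qed

lemma eval_bilin: "z \<in> dual \<Longrightarrow> bilin K H T T (\<lambda>c w. z c \<odot> w)"
proof -
  assume z: "z \<in> dual"
  note [mlin] = T dualD(1)[OF z] dual_val[OF z]
  show ?thesis by (rule mlin | assumption)+
qed

text \<open>The encoding loses nothing: pairing the first leg with a functional recovers the value
  of \<open>x\<close>. All conversions from identities of \<open>K\<close> back to identities of
  maps rest on this.\<close>

lemma Kt_eval:
  assumes z: "z \<in> dual"
  shows "TL T (\<lambda>c w. z c \<odot> w) Kt = x z"
  using dual_expand[OF z] Kt_lift[OF T eval_bilin[OF z]] by simp

text \<open>The transpose of \<open>g\<close> on functionals equals \<open>g\<close> on the first
  leg of the canonical element: each \<open>xb d\<close> composed with \<open>g\<close> is expanded
  in the dual basis, and the sum over \<open>d\<close> is then reassembled.\<close>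

lemma Kt_precomp:
  assumes U: "assoc_algebra K U" and \<beta>: "bilin K H T U \<beta>" and g: "g \<in> lin_map K H H"
  shows "(\<Oplus>\<^bsub>U\<^esub>d\<in>D. \<beta> (hb d) (x (\<lambda>h\<in>carrier H. xb d (g h)))) = TL U (\<lambda>c w. \<beta> (g c) w) Kt"
proof -
  interpret U: assoc_algebra K U by (rule U)
  note gc [simp] = lin_mapD(1)[OF g]
  have y: "(\<lambda>h\<in>carrier H. xb d (g h)) \<in> dual" if "d \<in> D" for d
    by (rule dualI[OF lin_comp[OF xb_lin[OF that] g]])
  have b: "bilin K H T U (\<lambda>c w. \<beta> (g c) w)"
    by (intro bilinI lin_comp[OF bilinD(2)[OF \<beta>] g] bilinD(1)[OF \<beta>] gc)
  note bc = bilin_closed[OF \<beta>]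
  have "(\<Oplus>\<^bsub>U\<^esub>d\<in>D. \<beta> (hb d) (x (\<lambda>h\<in>carrier H. xb d (g h)))) =
      (\<Oplus>\<^bsub>U\<^esub>d\<in>D. \<Oplus>\<^bsub>U\<^esub>c\<in>D. xb d (g (hb c)) \<odot>\<^bsub>U\<^esub> \<beta> (hb d) (x (xb c)))"
  proof (rule U.A.finsum_cong')
    fix d assume d [simp]: "d \<in> D"
    show "\<beta> (hb d) (x (\<lambda>h\<in>carrier H. xb d (g h))) = (\<Oplus>\<^bsub>U\<^esub>c\<in>D. xb d (g (hb c)) \<odot>\<^bsub>U\<^esub> \<beta> (hb d) (x (xb c)))" (is "?l = ?r")
    proof -
    have "?l = \<beta> (hb d) (\<Oplus>c\<in>D. (\<lambda>h\<in>carrier H. xb d (g h)) (hb c) \<odot> x (xb c))"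
      using dual_expand[OF y[OF d]] by simp
    also have "\<dots> = (\<Oplus>\<^bsub>U\<^esub>c\<in>D. \<beta> (hb d) ((\<lambda>h\<in>carrier H. xb d (g h)) (hb c) \<odot> x (xb c)))"
      by (rule lin_map_finsum[OF T U bilinD(1)[OF \<beta>]]) (auto simp: xb)
    also have "\<dots> = ?r"
      by (rule U.A.finsum_cong') (auto simp: xb bc lin_mapD(3)[OF bilinD(1)[OF \<beta>]])
    finally show ?thesis .
    qed
  qed (auto intro!: U.A.finsum_closed simp: bc xb)
  also have "\<dots> = (\<Oplus>\<^bsub>U\<^esub>c\<in>D. \<Oplus>\<^bsub>U\<^esub>d\<in>D. xb d (g (hb c)) \<odot>\<^bsub>U\<^esub> \<beta> (hb d) (x (xb c)))"
    by (rule finsum_swap[OF U finite_D finite_D]) (auto simp: bc xb)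
  also have "\<dots> = (\<Oplus>\<^bsub>U\<^esub>c\<in>D. \<beta> (g (hb c)) (x (xb c)))"
    by (rule U.A.finsum_cong') (auto simp: bc xb lin_expand[OF U bilinD(2)[OF \<beta>], symmetric])
  also have "\<dots> = TL U (\<lambda>c w. \<beta> (g c) w) Kt" by (rule Kt_lift[OF U b, symmetric])
  finally show ?thesis .
qed

text \<open>Two copies of \<open>K\<close> whose last legs are multiplied: by multiplicativity
  \<open>x (xb d) \<otimes> x (xb e)\<close> is \<open>x\<close> of a product in \<open>B\<close>,
  whose coordinates are pairings with the braided coproduct. Resumming by \<open>pair_expand\<close>
  leaves one copy of \<open>K\<close> with \<open>hat\<close> applied to its first leg.\<close>

lemma Kt_mult:
  assumes m: "dual_mult T x" and U: "assoc_algebra K U" and \<gamma>: "trilin K H H T U \<gamma>"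
  shows "TL U (\<lambda>b w. TL U (\<lambda>a w'. \<gamma> a b (w \<otimes> w')) Kt) Kt =
    TL U (\<lambda>c w. TL U (\<lambda>a b. \<gamma> a b w) (hat c)) Kt"
proof -
  interpret U: assoc_algebra K U by (rule U)
  note gc = bilin_closed[OF trilinD(4)[OF \<gamma>]]
  note [mlin] = U T lin_comp[OF trilinD(1)[OF \<gamma>]] trilinD[OF \<gamma>] lin_lift_fun[OF H_alg T _ Kt_closed]
  have "TL U (\<lambda>b w. TL U (\<lambda>a w'. \<gamma> a b (w \<otimes> w')) Kt) Kt =
    (\<Oplus>\<^bsub>U\<^esub>d\<in>D. TL U (\<lambda>a w'. \<gamma> a (hb d) (x (xb d) \<otimes> w')) Kt)"
    by (rule Kt_lift[OF U]) (rule mlin | assumption)+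
  also have "\<dots> = (\<Oplus>\<^bsub>U\<^esub>d\<in>D. \<Oplus>\<^bsub>U\<^esub>e\<in>D. \<gamma> (hb e) (hb d) (x (xb d) \<otimes> x (xb e)))"
  proof (rule U.A.finsum_cong')
    fix d assume d [mlin]: "d \<in> D"
    note [mlin] = x_closed[OF xb[OF d]]
    show "TL U (\<lambda>a w'. \<gamma> a (hb d) (x (xb d) \<otimes> w')) Kt = (\<Oplus>\<^bsub>U\<^esub>e\<in>D. \<gamma> (hb e) (hb d) (x (xb d) \<otimes> x (xb e)))"
      by (rule Kt_lift[OF U]) (rule mlin | assumption)+
  qed (auto intro!: U.A.finsum_closed simp: gc xb)
  also have "\<dots> = (\<Oplus>\<^bsub>U\<^esub>d\<in>D. \<Oplus>\<^bsub>U\<^esub>e\<in>D. \<Oplus>\<^bsub>U\<^esub>c\<in>D.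
      TL base (\<lambda>a b. xb e a \<otimes>\<^bsub>K\<^esub> xb d b) (hat (hb c)) \<odot>\<^bsub>U\<^esub> \<gamma> (hb e) (hb d) (x (xb c)))"
  proof (intro U.A.finsum_cong' refl)
    fix d e assume de [simp]: "d \<in> D" "e \<in> D"
    have pv: "TL base (\<lambda>a b. xb e a \<otimes>\<^bsub>K\<^esub> xb d b) (hat c) \<in> carrier K" if "c \<in> carrier H" for c
      using tensor_lift_closed[OF H_alg H_alg base_alg hat_closed[OF that] pair_bilin[OF xb xb], of e d] by (simp add: base_algebra_simps)
    have "\<gamma> (hb e) (hb d) (x (xb d) \<otimes> x (xb e)) = \<gamma> (hb e) (hb d) (x (xb d \<otimes>\<^bsub>B\<^esub> xb e))"
      using m xb by (simp add: dual_mult_def)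
    also have "\<dots> = \<gamma> (hb e) (hb d) (\<Oplus>c\<in>D. (xb d \<otimes>\<^bsub>B\<^esub> xb e) (hb c) \<odot> x (xb c))"
      using dual_expand[of "xb d \<otimes>\<^bsub>B\<^esub> xb e"] B_closed(3)[of "xb d" "xb e"] xb by (simp add: B_simps(1))
    also have "\<dots> = (\<Oplus>\<^bsub>U\<^esub>c\<in>D. \<gamma> (hb e) (hb d) ((xb d \<otimes>\<^bsub>B\<^esub> xb e) (hb c) \<odot> x (xb c)))"
      by (rule lin_map_finsum[OF T U trilinD(1)[OF \<gamma>]]) (auto simp: xb B_simps(4) pv)
    also have "\<dots> = (\<Oplus>\<^bsub>U\<^esub>c\<in>D. TL base (\<lambda>a b. xb e a \<otimes>\<^bsub>K\<^esub> xb d b) (hat (hb c)) \<odot>\<^bsub>U\<^esub> \<gamma> (hb e) (hb d) (x (xb c)))"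
      by (rule U.A.finsum_cong') (auto simp: xb gc B_simps(4) pv lin_mapD(3)[OF trilinD(1)[OF \<gamma>]])
    finally show "\<gamma> (hb e) (hb d) (x (xb d) \<otimes> x (xb e)) = \<dots>" .
  qed (auto intro!: U.A.finsum_closed U.smult_closed tensor_lift_closed[OF H_alg H_alg base_alg hat_closed pair_bilin[OF xb xb], unfolded base_algebra_simps] simp: gc xb)
  \<comment> \<open>Two exchanges bring the sum over \<open>c\<close> to the outside, so that the
    inner double sum has the shape of \<open>pair_expand\<close>.\<close>
  also have "\<dots> = (\<Oplus>\<^bsub>U\<^esub>d\<in>D. \<Oplus>\<^bsub>U\<^esub>c\<in>D. \<Oplus>\<^bsub>U\<^esub>e\<in>D.
      TL base (\<lambda>a b. xb e a \<otimes>\<^bsub>K\<^esub> xb d b) (hat (hb c)) \<odot>\<^bsub>U\<^esub> \<gamma> (hb e) (hb d) (x (xb c)))"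
    by (intro U.A.finsum_cong' finsum_swap[OF U finite_D finite_D] refl)
      (auto intro!: U.A.finsum_closed U.smult_closed tensor_lift_closed[OF H_alg H_alg base_alg hat_closed pair_bilin[OF xb xb], unfolded base_algebra_simps] simp: gc xb)
  also have "\<dots> = (\<Oplus>\<^bsub>U\<^esub>c\<in>D. \<Oplus>\<^bsub>U\<^esub>d\<in>D. \<Oplus>\<^bsub>U\<^esub>e\<in>D.
      TL base (\<lambda>a b. xb e a \<otimes>\<^bsub>K\<^esub> xb d b) (hat (hb c)) \<odot>\<^bsub>U\<^esub> \<gamma> (hb e) (hb d) (x (xb c)))"
    by (rule finsum_swap[OF U finite_D finite_D])
      (auto intro!: U.A.finsum_closed U.smult_closed tensor_lift_closed[OF H_alg H_alg base_alg hat_closed pair_bilin[OF xb xb], unfolded base_algebra_simps] simp: gc xb)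
  also have "\<dots> = (\<Oplus>\<^bsub>U\<^esub>c\<in>D. TL U (\<lambda>a b. \<gamma> a b (x (xb c))) (hat (hb c)))"
    by (intro U.A.finsum_cong' refl)
      (auto intro!: pair_expand[OF U trilinD(6)[OF \<gamma>] hat_closed, symmetric] tensor_lift_closed[OF H_alg H_alg U hat_closed trilinD(6)[OF \<gamma>]] simp: xb)
  also have "\<dots> = TL U (\<lambda>c w. TL U (\<lambda>a b. \<gamma> a b w) (hat c)) Kt"
  proof (rule Kt_lift[OF U, symmetric], rule bilinI)
    fix v assume "v \<in> carrier H"
    then show "(\<lambda>w. TL U (\<lambda>a b. \<gamma> a b w) (hat v)) \<in> lin_map K T U"
      by (intro lin_lift_fun[OF H_alg H_alg U hat_closed T]) (auto intro: trilinD[OF \<gamma>])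
  next
    fix w assume "w \<in> carrier T"
    then show "(\<lambda>v. TL U (\<lambda>a b. \<gamma> a b w) (hat v)) \<in> lin_map K H U"
      by (intro lin_lift_arg[OF H_alg H_alg U hat_lin] trilinD(6)[OF \<gamma>])
  qed
  finally show ?thesis .
qed

end

end

subsection \<open>Elements of tensor products encoding linear maps\<close>

lemma tens_hom:
  assumes V: "assoc_algebra K V" and W: "assoc_algebra K W"
  shows "(\<lambda>v. tens K V W v \<one>\<^bsub>W\<^esub>) \<in> alg_hom K V (tensor K V W)"
    and "(\<lambda>w. tens K V W \<one>\<^bsub>V\<^esub> w) \<in> alg_hom K W (tensor K V W)"
    and "v \<in> carrier V \<Longrightarrow> w \<in> carrier W \<Longrightarrow> tens K V W v \<one>\<^bsub>W\<^esub> \<otimes>\<^bsub>tensor K V W\<^esub> tens K V W \<one>\<^bsub>V\<^esub> w = tens K V W v w"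
    and "v \<in> carrier V \<Longrightarrow> w \<in> carrier W \<Longrightarrow> tens K V W \<one>\<^bsub>V\<^esub> w \<otimes>\<^bsub>tensor K V W\<^esub> tens K V W v \<one>\<^bsub>W\<^esub> = tens K V W v w"
proof -
  interpret V: assoc_algebra K V by (rule V)
  interpret W: assoc_algebra K W by (rule W)
  note [mlin] = V W
  show "(\<lambda>v. tens K V W v \<one>\<^bsub>W\<^esub>) \<in> alg_hom K V (tensor K V W)"
  proof (rule alg_homI)
    show "(\<lambda>v. tens K V W v \<one>\<^bsub>W\<^esub>) \<in> lin_map K V (tensor K V W)" by (rule mlin)+
  qed (simp_all add: tens_mult V W tens_one)
  show "(\<lambda>w. tens K V W \<one>\<^bsub>V\<^esub> w) \<in> alg_hom K W (tensor K V W)"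
  proof (rule alg_homI)
    show "(\<lambda>w. tens K V W \<one>\<^bsub>V\<^esub> w) \<in> lin_map K W (tensor K V W)" by (rule mlin)+
  qed (simp_all add: tens_mult V W tens_one)
  show "tens K V W v \<one>\<^bsub>W\<^esub> \<otimes>\<^bsub>tensor K V W\<^esub> tens K V W \<one>\<^bsub>V\<^esub> w = tens K V W v w"
    "tens K V W \<one>\<^bsub>V\<^esub> w \<otimes>\<^bsub>tensor K V W\<^esub> tens K V W v \<one>\<^bsub>W\<^esub> = tens K V W v w"
    if "v \<in> carrier V" "w \<in> carrier W"
    using that by (simp_all add: tens_mult V W)
qed

lemma alg_hom_comp:
  "p \<in> alg_hom K A B \<Longrightarrow> q \<in> alg_hom K B C \<Longrightarrow> (\<lambda>x. q (p x)) \<in> alg_hom K A C"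
  by (auto simp: alg_hom_def ring_hom_def lin_map_def Pi_def)

lemma tensor_lift_finsum:
  assumes V: "assoc_algebra K V" and W: "assoc_algebra K W" and U: "assoc_algebra K U" and F: "finite F"
    and \<beta>: "\<And>d. d \<in> F \<Longrightarrow> bilin K V W U (\<beta> d)" and z: "z \<in> carrier (tensor K V W)"
  shows "(\<Oplus>\<^bsub>U\<^esub>d\<in>F. tensor_lift K U (\<beta> d) z) = tensor_lift K U (\<lambda>a b. \<Oplus>\<^bsub>U\<^esub>d\<in>F. \<beta> d a b) z"
proof -
  interpret U: assoc_algebra K U by (rule U)
  have b: "bilin K V W U (\<lambda>a b. \<Oplus>\<^bsub>U\<^esub>d\<in>F. \<beta> d a b)"
    by (intro bilinI lin_finsum[OF U F] bilinD[OF \<beta>])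
  show ?thesis
  proof (rule lin_map_tensor_eq[OF V W _ tensor_lift_lin[OF V W U b] _ z])
    show "(\<lambda>z. \<Oplus>\<^bsub>U\<^esub>d\<in>F. tensor_lift K U (\<beta> d) z) \<in> lin_map K (tensor K V W) U"
      by (intro lin_finsum[OF U F]) (use tensor_lift_lin[OF V W U \<beta>] in simp)
    fix v w assume "v \<in> carrier V" "w \<in> carrier W"
    then show "(\<Oplus>\<^bsub>U\<^esub>d\<in>F. tensor_lift K U (\<beta> d) (tens K V W v w)) = tensor_lift K U (\<lambda>a b. \<Oplus>\<^bsub>U\<^esub>d\<in>F. \<beta> d a b) (tens K V W v w)"
      by (simp add: tensor_lift_tens[OF V W U b])
        (rule U.A.finsum_cong', auto simp: tensor_lift_tens[OF V W U \<beta>] bilin_closed[OF \<beta>])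
  qed
qed

context reflective_data
begin

definition commute_with where
  "commute_with V T f p \<longleftrightarrow> f \<in> alg_hom K H T \<and> p \<in> alg_hom K V T \<and>
    (\<forall>a\<in>carrier H. \<forall>q\<in>carrier V. f a \<otimes>\<^bsub>T\<^esub> p q = p q \<otimes>\<^bsub>T\<^esub> f a)"

text \<open>The counterpart of \<open>RR\<close> for elements of \<open>H \<otimes> V\<close>: it
  places \<open>k\<close> into the legs \<open>f\<close> and \<open>p\<close>.\<close>

definition KK where "KK T f p k = TL T (\<lambda>a q. f a \<otimes>\<^bsub>T\<^esub> p q) k"

context
  fixes V :: "('k, 'v) module" and T :: "('k, 't) module" (structure)
  assumes V: "assoc_algebra K V" and T: "assoc_algebra K T"
begin

interpretation V: assoc_algebra K V by (rule V)
interpretation T: assoc_algebra K T by (rule T)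

text \<open>The commutation rules are oriented so that rewriting moves images of \<open>H\<close> to
  the left of images of \<open>V\<close>.\<close>

lemma cwD:
  assumes "commute_with V T f p"
  shows "f \<in> alg_hom K H T" "p \<in> alg_hom K V T" "bilin K H V T (\<lambda>a q. f a \<otimes> p q)"
    and "a \<in> carrier H \<Longrightarrow> q \<in> carrier V \<Longrightarrow> p q \<otimes> f a = f a \<otimes> p q"
    and "a \<in> carrier H \<Longrightarrow> f a \<in> carrier T" "q \<in> carrier V \<Longrightarrow> p q \<in> carrier T"
    and "a \<in> carrier H \<Longrightarrow> q \<in> carrier V \<Longrightarrow> z \<in> carrier T \<Longrightarrow>
      p q \<otimes> (f a \<otimes> z) = f a \<otimes> (p q \<otimes> z)"
proof -
  note d = assms[unfolded commute_with_def]
  show f: "f \<in> alg_hom K H T" by (rule d[THEN conjunct1])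
  show g: "p \<in> alg_hom K V T" by (rule d[THEN conjunct2, THEN conjunct1])
  have c: "f a \<otimes> p q = p q \<otimes> f a" if "a \<in> carrier H" "q \<in> carrier V" for a q
    by (rule bspec[OF bspec[OF d[THEN conjunct2, THEN conjunct2] that(1)] that(2)])
  show "a \<in> carrier H \<Longrightarrow> q \<in> carrier V \<Longrightarrow> p q \<otimes> f a = f a \<otimes> p q" by (rule c[symmetric])
  show "bilin K H V T (\<lambda>a q. f a \<otimes> p q)"
    by (rule tensor_lift_alg_hom(1)[OF H_alg V T f g c])
  show fc: "a \<in> carrier H \<Longrightarrow> f a \<in> carrier T" and gc: "q \<in> carrier V \<Longrightarrow> p q \<in> carrier T" for a q
    by (rule alg_hom_closed[OF f], assumption) (rule alg_hom_closed[OF g], assumption)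
  show "p q \<otimes> (f a \<otimes> z) = f a \<otimes> (p q \<otimes> z)"
    if [simp]: "a \<in> carrier H" "q \<in> carrier V" "z \<in> carrier T"
  proof -
    have "p q \<otimes> (f a \<otimes> z) = (p q \<otimes> f a) \<otimes> z"
      by (simp add: T.A.m_assoc fc gc)
    also have "\<dots> = (f a \<otimes> p q) \<otimes> z" by (simp only: c[of a q] that)
    finally show ?thesis by (simp add: T.A.m_assoc fc gc)
  qed
qed

lemma KK_closed:
  assumes "commute_with V T f p" and k: "k \<in> carrier (tensor K H V)"
  shows "KK T f p k \<in> carrier T"
  unfolding KK_def by (rule tensor_lift_closed[OF H_alg V T k cwD(3)[OF assms(1)]])

lemma KK_commute:
  assumes fp: "commute_with V T f p" and k: "k \<in> carrier (tensor K H V)" and y: "y \<in> carrier T"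
    and "\<And>a. a \<in> carrier H \<Longrightarrow> f a \<otimes> y = y \<otimes> f a" "\<And>q. q \<in> carrier V \<Longrightarrow> p q \<otimes> y = y \<otimes> p q"
  shows "KK T f p k \<otimes> y = y \<otimes> KK T f p k"
  unfolding KK_def
proof (rule lift_commute[OF H_alg V T cwD(3)[OF fp] k y])
  fix a b assume ab: "a \<in> carrier H" "b \<in> carrier V"
  show "f a \<otimes> p b \<otimes> y = y \<otimes> (f a \<otimes> p b)"
    by (rule T.mult_commute[OF cwD(5)[OF fp ab(1)] cwD(6)[OF fp ab(2)] y assms(4)[OF ab(1)] assms(5)[OF ab(2)]])
qed

lemma commute_with_cv:
  assumes fg: "comm_homs T f g" and fp: "commute_with V T f p" and gp: "commute_with V T g p"
  shows "commute_with V T (cv T f g) p"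
  unfolding commute_with_def
  by (intro conjI ballI cv_hom[OF T fg] cwD(2)[OF fp] cv_commute[OF T fg])
    (rule cwD[OF fp] cwD(4)[OF fp, symmetric] cwD(4)[OF gp, symmetric] | assumption)+

context
  fixes f g p k
  assumes fg: "comm_homs T f g" and fp: "commute_with V T f p" and gp: "commute_with V T g p"
    and k: "k \<in> carrier (tensor K H V)"
begin

lemma gf: "comm_homs T g f" by (rule comm_homs_sym[OF fg])

text \<open>Rewriting with these sorts a product into \<open>f\<close> factors, then
  \<open>g\<close> factors, then \<open>p\<close> factors. An identity between words in three legs
  then becomes one identity in each leg.\<close>

lemmas fgp_simps = cwD(5,6)[OF fp] cwD(5)[OF gp] alg_homD(2)[OF cwD(1)[OF fp]] alg_homD(2)[OF cwD(1)[OF gp]]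
  alg_homD(2)[OF cwD(2)[OF fp]] T.A.m_assoc cwD(4,7)[OF fp] cwD(4,7)[OF gp] commD(4,7)[OF T gf]

lemmas fgp_lin = V T lin_comp[OF alg_homD(1)[OF cwD(1)[OF fp]]] lin_comp[OF alg_homD(1)[OF cwD(1)[OF gp]]]
  lin_comp[OF alg_homD(1)[OF cwD(2)[OF fp]]] cwD(5,6)[OF fp] cwD(5)[OF gp]
  lin_lift_fun[OF H_alg V T k] lin_lift_fun[OF H_alg H_alg _ hat_closed]

text \<open>The left side of the equation for \<open>K\<close> in coordinates. The products
  \<open>x \<star> b\<close> and \<open>y \<star> a\<close> are exactly the inner half of the
  braided coproduct.\<close>

lemma KK_cv_RR:
  "KK T (cv T f g) p k \<otimes> RR T g f = TL T (\<lambda>c w. TL T (\<lambda>x y. TL T (\<lambda>a b.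
      f (x \<star> b) \<otimes> (g (y \<star> a) \<otimes> p w)) R) (\<Delta> c)) k"
proof -
  note [mlin] = fgp_lin
  note cw = commute_with_cv[OF fg fp gp]
  have "KK T (cv T f g) p k \<otimes> RR T g f = TL T (\<lambda>c w. (cv T f g c \<otimes> p w) \<otimes> RR T g f) k"
    unfolding KK_def by (rule mult_tensor_lift(2)[OF H_alg V T cwD(3)[OF cw] k RR_closed[OF T gf]])
  also have "\<dots> = TL T (\<lambda>c w. TL T (\<lambda>x y. TL T (\<lambda>a b.
      f (x \<star> b) \<otimes> (g (y \<star> a) \<otimes> p w)) R) (\<Delta> c)) k"
  proof (rule tensor_lift_cong[OF H_alg V T _ _ k, symmetric])
    fix c w assume [simp, mlin]: "c \<in> carrier H" "w \<in> carrier V"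
    have F: "(\<lambda>u. (u \<otimes> p w) \<otimes> RR T g f) \<in> lin_map K T T" by (rule mlin RR_closed[OF T gf])+
    have "cv T f g c \<otimes> p w \<otimes> RR T g f = TL T (\<lambda>x y. ((f x \<otimes> g y) \<otimes> p w) \<otimes> RR T g f) (\<Delta> c)"
      unfolding cv_def by (rule sw_hom[OF T T F]) (rule mlin | assumption)+
    also have "\<dots> = TL T (\<lambda>x y. TL T (\<lambda>a b.
      f (x \<star> b) \<otimes> (g (y \<star> a) \<otimes> p w)) R) (\<Delta> c)"
    proof (rule sw_cong[OF T, symmetric])
      fix x y assume [simp, mlin]: "x \<in> carrier H" "y \<in> carrier H"
      show "TL T (\<lambda>a b. f (x \<star> b) \<otimes> (g (y \<star> a) \<otimes> p w)) R =
        ((f x \<otimes> g y) \<otimes> p w) \<otimes> RR T g f" (is "?l = ?r")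
      proof -
      have "?r = TL T (\<lambda>a b. ((f x \<otimes> g y) \<otimes> p w) \<otimes> (g a \<otimes> f b)) R"
        unfolding RR_def by (rule mult_tensor_lift(1)[OF H_alg H_alg T commD(3)[OF T gf] R_closed]) (rule mlin)+
      also have "\<dots> = ?l"
        by (rule R_cong[OF T], (rule mlin | assumption)+) (simp add: fgp_simps)
      finally show ?thesis by simp
      qed
    qed (rule mlin | assumption)+
    finally show "TL T (\<lambda>x y. TL T (\<lambda>a b.
      f (x \<star> b) \<otimes> (g (y \<star> a) \<otimes> p w)) R) (\<Delta> c) = cv T f g c \<otimes> p w \<otimes> RR T g f" by simp
  qed (rule mlin | assumption)+
  finally show ?thesis .
qed

text \<open>The outer half of the braided coproduct, placed around \<open>R_21\<close>, cancels it.
  This is the form of the unit that is inserted between two copies of \<open>K\<close>.\<close>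

lemma RR_Si:
  "TL T (\<lambda>m n. f n \<otimes> (RR T g f \<otimes> g (Si m))) R = \<one>"
proof -
  note [mlin] = fgp_lin RR_closed[OF T gf]
  have b: "bilin K H H T (\<lambda>x y. f x \<otimes> g y)" by (rule mlin | assumption)+
  have "TL T (\<lambda>m n. f n \<otimes> (RR T g f \<otimes> g (Si m))) R =
    TL T (\<lambda>m n. TL T (\<lambda>u v. f (n \<star> v) \<otimes> g (u \<star> Si m)) R) R"
  proof (rule R_cong[OF T])
    fix m n assume [simp, mlin]: "m \<in> carrier H" "n \<in> carrier H"
    have F: "(\<lambda>u. f n \<otimes> (u \<otimes> g (Si m))) \<in> lin_map K T T" by (rule mlin)+
    have "f n \<otimes> (RR T g f \<otimes> g (Si m)) = TL T (\<lambda>u v. f n \<otimes> ((g u \<otimes> f v) \<otimes> g (Si m))) R"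
      unfolding RR_def by (rule R_hom[OF T T F commD(3)[OF T gf]])
    also have "\<dots> = TL T (\<lambda>u v. f (n \<star> v) \<otimes> g (u \<star> Si m)) R"
      by (rule R_cong[OF T], (rule mlin | assumption)+) (simp add: fgp_simps Si_closed)
    finally show "f n \<otimes> (RR T g f \<otimes> g (Si m)) = \<dots>" .
  qed (rule mlin | assumption)+
  also have "\<dots> = f \<one>\<^bsub>H\<^esub> \<otimes> g \<one>\<^bsub>H\<^esub>" by (rule R_inverse_Si(1)[OF T b])
  finally show ?thesis by (simp add: alg_homD(3)[OF cwD(1)[OF fp]] alg_homD(3)[OF cwD(1)[OF gp]])
qed

text \<open>The unit from \<open>RR_Si\<close> is inserted between the two copies of
  \<open>K\<close>. Its outer factors \<open>f n\<close> and \<open>g (Si m)\<close> live in legs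
  that the neighbouring copy of \<open>K\<close> does not touch, so they move outward and expose the
  right side of \<open>KC\<close>. Its left side, by \<open>KK_cv_RR\<close>, supplies the inner
  half of the braided coproduct, and the factors outside supply the outer half.\<close>

lemma KK_KK_of_KC:
  assumes KC: "KK T (cv T f g) p k \<otimes> RR T g f = KK T g p k \<otimes> (RR T g f \<otimes> KK T f p k)"
  shows "KK T g p k \<otimes> KK T f p k = TL T (\<lambda>c w. TL T (\<lambda>a b. f a \<otimes> (g b \<otimes> p w)) (hat c)) k"
proof -
  note Rc [simp] = RR_closed[OF T gf]
  note Kc [simp] = KK_closed[OF fp k] KK_closed[OF gp k] KK_closed[OF commute_with_cv[OF fg fp gp] k]
  note [mlin] = fgp_lin Rc Kc
  have cf: "f n \<otimes> KK T g p k = KK T g p k \<otimes> f n" if "n \<in> carrier H" for n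
    by (rule KK_commute[OF gp k, symmetric])
      (rule cwD(5)[OF fp that] commD(4)[OF T gf _ that] cwD(4)[OF fp that] | assumption)+
  have cg: "KK T f p k \<otimes> g n = g n \<otimes> KK T f p k" if "n \<in> carrier H" for n
    by (rule KK_commute[OF fp k])
      (rule cwD(5)[OF gp that] commD(4)[OF T fg _ that] cwD(4)[OF gp that] | assumption)+
  have b: "bilin K H H T (\<lambda>m n. f n \<otimes> (RR T g f \<otimes> g (Si m)))" by (rule mlin | assumption)+
  have F: "(\<lambda>u. KK T g p k \<otimes> (u \<otimes> KK T f p k)) \<in> lin_map K T T" by (rule mlin)+
  have "KK T g p k \<otimes> KK T f p k =
      KK T g p k \<otimes> (TL T (\<lambda>m n. f n \<otimes> (RR T g f \<otimes> g (Si m))) R \<otimes> KK T f p k)"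
    by (simp add: RR_Si)
  also have "\<dots> = TL T (\<lambda>m n. KK T g p k \<otimes> ((f n \<otimes> (RR T g f \<otimes> g (Si m))) \<otimes> KK T f p k)) R"
    by (rule R_hom[OF T T F b])
  also have "\<dots> = TL T (\<lambda>m n. f n \<otimes> ((KK T (cv T f g) p k \<otimes> RR T g f) \<otimes> g (Si m))) R"
  proof (rule R_cong[OF T])
    fix m n assume [simp]: "m \<in> carrier H" "n \<in> carrier H"
    have [simp]: "Si m \<in> carrier H" "f n \<in> carrier T" "g (Si m) \<in> carrier T"
      by (simp_all add: Si_closed cwD(5)[OF fp] cwD(5)[OF gp])
    have "KK T g p k \<otimes> ((f n \<otimes> (RR T g f \<otimes> g (Si m))) \<otimes> KK T f p k) =
      (KK T g p k \<otimes> f n) \<otimes> (RR T g f \<otimes> (g (Si m) \<otimes> KK T f p k))"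
      by (simp add: T.A.m_assoc)
    also have "\<dots> = (f n \<otimes> KK T g p k) \<otimes> (RR T g f \<otimes> (KK T f p k \<otimes> g (Si m)))"
      by (simp only: cf[OF \<open>n \<in> _\<close>] cg[OF \<open>Si m \<in> _\<close>])
    also have "\<dots> = f n \<otimes> ((KK T g p k \<otimes> (RR T g f \<otimes> KK T f p k)) \<otimes> g (Si m))"
      by (simp add: T.A.m_assoc)
    also have "\<dots> = f n \<otimes> ((KK T (cv T f g) p k \<otimes> RR T g f) \<otimes> g (Si m))" by (simp only: KC)
    finally show "KK T g p k \<otimes> ((f n \<otimes> (RR T g f \<otimes> g (Si m))) \<otimes> KK T f p k) = \<dots>" .
  qed (rule mlin | assumption)+
  also have "\<dots> = TL T (\<lambda>m n. TL T (\<lambda>c w. TL T (\<lambda>x y. TL T (\<lambda>a b.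
      f (n \<star> x \<star> b) \<otimes> (g (y \<star> a \<star> Si m) \<otimes> p w)) R) (\<Delta> c)) k) R"
  proof (rule R_cong[OF T])
    fix m n assume [simp, mlin]: "m \<in> carrier H" "n \<in> carrier H"
    let ?F = "\<lambda>u. f n \<otimes> (u \<otimes> g (Si m))"
    have F: "?F \<in> lin_map K T T" by (rule mlin)+
    have "?F (KK T (cv T f g) p k \<otimes> RR T g f) = TL T (\<lambda>c w. ?F (TL T (\<lambda>x y. TL T (\<lambda>a b.
      f (x \<star> b) \<otimes> (g (y \<star> a) \<otimes> p w)) R) (\<Delta> c))) k"
      unfolding KK_cv_RR by (rule lin_tensor_lift[OF H_alg V T T F _ k]) (rule mlin | assumption)+
    also have "\<dots> = TL T (\<lambda>c w. TL T (\<lambda>x y. TL T (\<lambda>a b.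
      f (n \<star> x \<star> b) \<otimes> (g (y \<star> a \<star> Si m) \<otimes> p w)) R) (\<Delta> c)) k"
    proof (rule tensor_lift_cong[OF H_alg V T _ _ k, symmetric])
      fix c w assume [simp, mlin]: "c \<in> carrier H" "w \<in> carrier V"
      have "?F (TL T (\<lambda>x y. TL T (\<lambda>a b.
          f (x \<star> b) \<otimes> (g (y \<star> a) \<otimes> p w)) R) (\<Delta> c)) =
        TL T (\<lambda>x y. ?F (TL T (\<lambda>a b.
          f (x \<star> b) \<otimes> (g (y \<star> a) \<otimes> p w)) R)) (\<Delta> c)"
        by (rule sw_hom[OF T T F]) (rule mlin | assumption)+
      also have "\<dots> = TL T (\<lambda>x y. TL T (\<lambda>a b.
        f (n \<star> x \<star> b) \<otimes> (g (y \<star> a \<star> Si m) \<otimes> p w)) R) (\<Delta> c)"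
      proof (rule sw_cong[OF T, symmetric])
        fix x y assume [simp, mlin]: "x \<in> carrier H" "y \<in> carrier H"
        show "TL T (\<lambda>a b. f (n \<star> x \<star> b) \<otimes> (g (y \<star> a \<star> Si m) \<otimes> p w)) R =
          ?F (TL T (\<lambda>a b. f (x \<star> b) \<otimes> (g (y \<star> a) \<otimes> p w)) R)" (is "?l = ?r")
        proof -
        have "?r =
          TL T (\<lambda>a b. ?F (f (x \<star> b) \<otimes> (g (y \<star> a) \<otimes> p w))) R"
          by (rule R_hom[OF T T F]) (rule mlin | assumption)+
        also have "\<dots> = ?l"
          by (rule R_cong[OF T], (rule mlin | assumption)+) (simp add: fgp_simps Si_closed)
        finally show ?thesis by simp
        qed
      qed (rule mlin | assumption)+
      finally show "TL T (\<lambda>x y. TL T (\<lambda>a b.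
        f (n \<star> x \<star> b) \<otimes> (g (y \<star> a \<star> Si m) \<otimes> p w)) R) (\<Delta> c) =
        ?F (TL T (\<lambda>x y. TL T (\<lambda>a b.
          f (x \<star> b) \<otimes> (g (y \<star> a) \<otimes> p w)) R) (\<Delta> c))" by simp
    qed (rule mlin | assumption)+
    finally show "?F (KK T (cv T f g) p k \<otimes> RR T g f) = \<dots>" .
  qed (rule mlin | assumption)+
  also have "\<dots> = TL T (\<lambda>c w. TL T (\<lambda>m n. TL T (\<lambda>x y. TL T (\<lambda>a b.
      f (n \<star> x \<star> b) \<otimes> (g (y \<star> a \<star> Si m) \<otimes> p w)) R) (\<Delta> c)) R) k"
    by (rule tensor_lift_swap[OF H_alg H_alg H_alg V T R_closed k]) (rule mlin | assumption)+
  also have "\<dots> = TL T (\<lambda>c w. TL T (\<lambda>a b. f a \<otimes> (g b \<otimes> p w)) (hat c)) k"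
  proof (rule tensor_lift_cong[OF H_alg V T _ _ k, symmetric])
    fix c w assume c [simp, mlin]: "c \<in> carrier H" and [simp, mlin]: "w \<in> carrier V"
    have bb: "bilin K H H T (\<lambda>a b. f a \<otimes> (g b \<otimes> p w))" by (rule mlin | assumption)+
    have "TL T (\<lambda>m n. TL T (\<lambda>x y. TL T (\<lambda>a b.
        f (n \<star> x \<star> b) \<otimes> (g (y \<star> a \<star> Si m) \<otimes> p w)) R) (\<Delta> c)) R =
      TL T (\<lambda>x y. TL T (\<lambda>m n. TL T (\<lambda>a b.
        f (n \<star> x \<star> b) \<otimes> (g (y \<star> a \<star> Si m) \<otimes> p w)) R) R) (\<Delta> c)"
      by (rule tensor_lift_swap[OF H_alg H_alg H_alg H_alg T R_closed \<Delta>_closed[OF c]]) (rule mlin | assumption)+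
    also have "\<dots> = TL T (\<lambda>x y. TL T (\<lambda>a b. TL T (\<lambda>m n.
        f (n \<star> x \<star> b) \<otimes> (g (y \<star> a \<star> Si m) \<otimes> p w)) R) R) (\<Delta> c)"
    proof (rule sw_cong[OF T _ _ c])
      fix x y assume [simp, mlin]: "x \<in> carrier H" "y \<in> carrier H"
      show "TL T (\<lambda>m n. TL T (\<lambda>a b.
        f (n \<star> x \<star> b) \<otimes> (g (y \<star> a \<star> Si m) \<otimes> p w)) R) R = TL T (\<lambda>a b. TL T (\<lambda>m n.
        f (n \<star> x \<star> b) \<otimes> (g (y \<star> a \<star> Si m) \<otimes> p w)) R) R"
        by (rule R_swap[OF T]) (rule mlin | assumption)+
    qed (rule mlin | assumption)+
    also have "\<dots> = TL T (\<lambda>a b. f a \<otimes> (g b \<otimes> p w)) (hat c)"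
      by (rule hat_lift[OF T bb c, symmetric])
    finally show "TL T (\<lambda>a b. f a \<otimes> (g b \<otimes> p w)) (hat c) = TL T (\<lambda>m n. TL T (\<lambda>x y. TL T (\<lambda>a b.
        f (n \<star> x \<star> b) \<otimes> (g (y \<star> a \<star> Si m) \<otimes> p w)) R) (\<Delta> c)) R" by simp
  qed (rule mlin hat_lin | rule lin_lift_arg[OF H_alg H_alg] | assumption)+
  finally show ?thesis .
qed

end

text \<open>The opposite direction: multiplicativity merges the two copies of \<open>K\<close> by
  \<open>Kt_mult\<close> and produces a full braided coproduct. Its outer half cancels against the
  \<open>R_21\<close> that stood between the copies, so only the inner half remains, which is
  \<open>KK_cv_RR\<close>.\<close>

lemma KC_of_mult:
  assumes fg: "comm_homs T f g" and fp: "commute_with V T f p" and gp: "commute_with V T g p"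
    and x: "x \<in> lin_map K B V" and m: "dual_mult V x"
  shows "KK T (cv T f g) p (Kt V x) \<otimes> RR T g f = KK T g p (Kt V x) \<otimes> (RR T g f \<otimes> KK T f p (Kt V x))"
proof -
  note k = Kt_closed[OF V x]
  note gf = gf[OF fg fp gp k]
  note Rc [simp] = RR_closed[OF T gf]
  note ss = fgp_simps[OF fg fp gp k]
  note [mlin] = fgp_lin[OF fg fp gp k] Rc
  let ?k = "Kt V x"
  \<comment> \<open>\<open>u\<close> and \<open>v\<close> are the components of the
    \<open>R_21\<close> between the two copies; both are moved into the arguments that the braided
    coproduct will fill.\<close>
  let ?g = "\<lambda>a b w. TL T (\<lambda>u v. f (v \<star> a) \<otimes> (g (b \<star> u) \<otimes> p w)) R"
  have tri: "trilin K H H V T ?g" by (rule mlin | assumption)+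
  have b: "bilin K H V T (\<lambda>a w'. RR T g f \<otimes> (f a \<otimes> p w'))" by (rule mlin | assumption)+
  have "KK T g p ?k \<otimes> (RR T g f \<otimes> KK T f p ?k) =
    KK T g p ?k \<otimes> TL T (\<lambda>a w'. RR T g f \<otimes> (f a \<otimes> p w')) ?k"
    unfolding KK_def by (simp only: mult_tensor_lift(1)[OF H_alg V T cwD(3)[OF fp] k Rc])
  also have "\<dots> = TL T (\<lambda>b w. TL T (\<lambda>a w'. (g b \<otimes> p w) \<otimes> (RR T g f \<otimes> (f a \<otimes> p w'))) ?k) ?k"
    unfolding KK_def by (rule mult_lifts[OF H_alg V H_alg V T cwD(3)[OF gp] b k k])
  also have "\<dots> = TL T (\<lambda>b w. TL T (\<lambda>a w'. ?g a b (w \<otimes>\<^bsub>V\<^esub> w')) ?k) ?k"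
  proof (rule tensor_lift_cong[OF H_alg V T _ _ k], (rule mlin | assumption)+, rule tensor_lift_cong[OF H_alg V T _ _ k])
    fix b w a w' assume [simp, mlin]: "b \<in> carrier H" "w \<in> carrier V" "a \<in> carrier H" "w' \<in> carrier V"
    have F: "(\<lambda>y. (g b \<otimes> p w) \<otimes> (y \<otimes> (f a \<otimes> p w'))) \<in> lin_map K T T" by (rule mlin)+
    show "(g b \<otimes> p w) \<otimes> (RR T g f \<otimes> (f a \<otimes> p w')) = ?g a b (w \<otimes>\<^bsub>V\<^esub> w')" (is "?l = ?r")
    proof -
    have "?l =
      TL T (\<lambda>u v. (g b \<otimes> p w) \<otimes> ((g u \<otimes> f v) \<otimes> (f a \<otimes> p w'))) R"
      unfolding RR_def by (rule R_hom[OF T T F commD(3)[OF T gf]])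
    also have "\<dots> = ?r"
      by (rule R_cong[OF T], (rule mlin | assumption)+) (simp add: ss)
    finally show ?thesis .
    qed
  qed (rule mlin | assumption)+
  also have "\<dots> = TL T (\<lambda>c w. TL T (\<lambda>a b. ?g a b w) (hat c)) ?k"
    by (rule Kt_mult[OF V x m T tri])
  also have "\<dots> = TL T (\<lambda>c w. TL T (\<lambda>x y. TL T (\<lambda>a b.
      f (x \<star> b) \<otimes> (g (y \<star> a) \<otimes> p w)) R) (\<Delta> c)) ?k"
  proof (rule tensor_lift_cong[OF H_alg V T _ _ k, symmetric])
    fix c w assume c [simp, mlin]: "c \<in> carrier H" and w [simp, mlin]: "w \<in> carrier V"
    have "TL T (\<lambda>a b. ?g a b w) (hat c) = TL T (\<lambda>x y. TL T (\<lambda>a b.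
      TL T (\<lambda>c d. ?g (d \<star> x \<star> b) (y \<star> a \<star> Si c) w) R) R) (\<Delta> c)"
      by (rule hat_lift[OF T trilinD(6)[OF tri w] c])
    also have "\<dots> = TL T (\<lambda>x y. TL T (\<lambda>a b.
      f (x \<star> b) \<otimes> (g (y \<star> a) \<otimes> p w)) R) (\<Delta> c)"
    proof (rule sw_cong[OF T _ _ c], (rule mlin | assumption)+, rule R_cong[OF T])
      fix x y a b assume [simp, mlin]: "x \<in> carrier H" "y \<in> carrier H" "a \<in> carrier H" "b \<in> carrier H"
      \<comment> \<open>The slots \<open>m\<close> and \<open>n\<close> receive
        \<open>v \<star> d\<close> and \<open>Si c \<star> u\<close>, the combination that
        \<open>R_inverse_Si\<close> collapses to the unit.\<close>
      let ?be = "\<lambda>m n. f (m \<star> (x \<star> b)) \<otimes> (g (y \<star> a \<star> n) \<otimes> p w)"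
      have be: "bilin K H H T ?be" by (rule mlin | assumption)+
      show "TL T (\<lambda>c d. ?g (d \<star> x \<star> b) (y \<star> a \<star> Si c) w) R =
        f (x \<star> b) \<otimes> (g (y \<star> a) \<otimes> p w)" (is "?l = ?r")
      proof -
      have "?l =
        TL T (\<lambda>c d. TL T (\<lambda>u v. ?be (v \<star> d) (Si c \<star> u)) R) R"
        apply (rule R_cong[OF T], (rule mlin | assumption)+)
        apply (rule R_cong[OF T], (rule mlin | assumption)+)
        apply (simp add: A.m_assoc Si_closed)
        done
      also have "\<dots> = TL T (\<lambda>u v. TL T (\<lambda>c d. ?be (v \<star> d) (Si c \<star> u)) R) R"
        by (rule R_swap[OF T]) (rule mlin | assumption)+
      also have "\<dots> = ?be \<one>\<^bsub>H\<^esub> \<one>\<^bsub>H\<^esub>" by (rule R_inverse_Si(2)[OF T be])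
      finally show ?thesis by simp
      qed
    qed (rule mlin | assumption)+
    finally show "TL T (\<lambda>x y. TL T (\<lambda>a b.
      f (x \<star> b) \<otimes> (g (y \<star> a) \<otimes> p w)) R) (\<Delta> c) = TL T (\<lambda>a b. ?g a b w) (hat c)" by simp
  qed (rule mlin | assumption)+
  also have "\<dots> = KK T (cv T f g) p ?k \<otimes> RR T g f"
    by (rule KK_cv_RR[OF fg fp gp k, symmetric])
  finally show ?thesis by simp
qed

end

end

section \<open>Reading multiplicativity and the cross relations off the element K\<close>

context reflective_data
begin

definition cross_rel where
  "cross_rel V x \<alpha> \<longleftrightarrow> (\<forall>z\<in>dual. \<forall>a\<in>carrier A.
     x z \<otimes>\<^bsub>V\<^esub> \<alpha> a = TL V (\<lambda>l b. \<alpha> b \<otimes>\<^bsub>V\<^esub> x (act z l)) (\<delta> a))"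

definition co where "co T f al = (\<lambda>a. TL T (\<lambda>l b. f l \<otimes>\<^bsub>T\<^esub> al b) (\<delta> a))"

context
  fixes V :: "('k, 'v) module" and x
  assumes V: "assoc_algebra K V" and x: "x \<in> lin_map K B V"
begin

interpretation V: assoc_algebra K V by (rule V)

abbreviation "T3 \<equiv> tensor3 K H H V"

lemma T3_alg: "assoc_algebra K T3" by (rule alg3[OF H_alg H_alg V])

abbreviation "f3 \<equiv> \<lambda>a. tens3 K H H V a \<one>\<^bsub>H\<^esub> \<one>\<^bsub>V\<^esub>"
abbreviation "g3 \<equiv> \<lambda>b. tens3 K H H V \<one>\<^bsub>H\<^esub> b \<one>\<^bsub>V\<^esub>"
abbreviation "p3 \<equiv> \<lambda>w. tens3 K H H V \<one>\<^bsub>H\<^esub> \<one>\<^bsub>H\<^esub> w"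

lemma legs3:
  shows f3: "f3 \<in> alg_hom K H T3" and g3: "g3 \<in> alg_hom K H T3" and p3: "p3 \<in> alg_hom K V T3"
proof -
  note HV = assoc_algebra_tensor[OF H_alg V]
  show "f3 \<in> alg_hom K H T3"
    using tens_hom(1)[OF H_alg HV] by (simp add: tens3_def tensor3_def tens_one[OF H_alg V])
  show "g3 \<in> alg_hom K H T3" "p3 \<in> alg_hom K V T3"
    unfolding tens3_def tensor3_def
    by (rule alg_hom_comp[OF tens_hom(1)[OF H_alg V] tens_hom(2)[OF H_alg HV]],
        rule alg_hom_comp[OF tens_hom(2)[OF H_alg V] tens_hom(2)[OF H_alg HV]])
qed

lemma legs3_comm:
  shows fg3: "comm_homs T3 f3 g3" and fp3: "commute_with V T3 f3 p3" and gp3: "commute_with V T3 g3 p3"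
  unfolding comm_homs_def commute_with_def
  by (intro conjI ballI legs3; simp add: tens3_mult[OF H_alg H_alg V])+

lemma legs3_mult:
  assumes "a \<in> carrier H" "b \<in> carrier H" "w \<in> carrier V"
  shows "f3 a \<otimes>\<^bsub>T3\<^esub> (g3 b \<otimes>\<^bsub>T3\<^esub> p3 w) = tens3 K H H V a b w"
  using assms by (simp add: tens3_mult[OF H_alg H_alg V])

text \<open>The product \<open>K_23 K_13\<close> in \<open>H \<otimes> H \<otimes> V\<close> is
  paired with two functionals. Evaluated directly this is \<open>x y\<close> times
  \<open>x z\<close>; with \<open>KK_KK_of_KC\<close> the functionals meet the braided coproduct and
  give \<open>x\<close> of the product in \<open>B\<close>.\<close>

lemma mult_of_KC:
  assumes KC: "KK T3 (cv T3 f3 g3) p3 (Kt V x) \<otimes>\<^bsub>T3\<^esub> RR T3 g3 f3 =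
    KK T3 g3 p3 (Kt V x) \<otimes>\<^bsub>T3\<^esub> (RR T3 g3 f3 \<otimes>\<^bsub>T3\<^esub> KK T3 f3 p3 (Kt V x))"
  shows "dual_mult V x"
  unfolding dual_mult_def
proof (intro ballI)
  fix y z assume y: "y \<in> dual" and z: "z \<in> dual"
  let ?k = "Kt V x"
  note k = Kt_closed[OF V x]
  note xc [simp, mlin] = x_closed[OF V x y] x_closed[OF V x z]
  note yv [simp, mlin] = dual_val[OF y] dual_val[OF z]
  note ss = base_algebra_simps
  note [mlin] = V lin_comp[OF dualD(1)[OF y]] lin_comp[OF dualD(1)[OF z]]
    lin_lift_fun[OF H_alg V _ k] lin_lift_fun[OF H_alg H_alg _ hat_closed]
  \<comment> \<open>\<open>z\<close> sits on the first leg and \<open>y\<close> on the second, as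
    the opposite product of \<open>B\<close> demands.\<close>
  let ?g = "\<lambda>a b w. z a \<odot>\<^bsub>V\<^esub> (y b \<odot>\<^bsub>V\<^esub> w)"
  have tri: "trilin K H H V V ?g" by (rule mlin | assumption)+
  let ?P = "tensor_lift3 K V ?g"
  note P = tensor_lift3_lin[OF H_alg H_alg V V tri]
  note Pt = tensor_lift3_tens3[OF H_alg H_alg V V tri]
  have "?P (KK T3 g3 p3 ?k \<otimes>\<^bsub>T3\<^esub> KK T3 f3 p3 ?k) =
    TL V (\<lambda>b w. TL V (\<lambda>a w'. ?g a b (w \<otimes>\<^bsub>V\<^esub> w')) ?k) ?k"
    unfolding KK_def
    by (rule lin_mult_lifts[OF H_alg V H_alg V T3_alg V cwD(3)[OF V T3_alg gp3] cwD(3)[OF V T3_alg fp3] k k P])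
      (simp add: tens3_mult[OF H_alg H_alg V] Pt)
  also have "\<dots> = TL V (\<lambda>b w. y b \<odot>\<^bsub>V\<^esub> (w \<otimes>\<^bsub>V\<^esub> x z)) ?k"
  proof (rule tensor_lift_cong[OF H_alg V V _ _ k])
    fix b w assume [simp, mlin]: "b \<in> carrier H" "w \<in> carrier V"
    have F: "(\<lambda>u. y b \<odot>\<^bsub>V\<^esub> (w \<otimes>\<^bsub>V\<^esub> u)) \<in> lin_map K V V" by (rule mlin | simp)+
    have "TL V (\<lambda>a w'. ?g a b (w \<otimes>\<^bsub>V\<^esub> w')) ?k = TL V (\<lambda>a w'. y b \<odot>\<^bsub>V\<^esub> (w \<otimes>\<^bsub>V\<^esub> (z a \<odot>\<^bsub>V\<^esub> w'))) ?k"
      by (rule tensor_lift_cong[OF H_alg V V _ _ k], (rule mlin | assumption)+)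
        (simp add: V.smult_mult_right V.smult_assoc1[symmetric] K.m_comm)
    also have "\<dots> = y b \<odot>\<^bsub>V\<^esub> (w \<otimes>\<^bsub>V\<^esub> TL V (\<lambda>a w'. z a \<odot>\<^bsub>V\<^esub> w') ?k)"
      by (rule lin_tensor_lift[OF H_alg V V V F eval_bilin[OF V x z] k, symmetric])
    finally show "TL V (\<lambda>a w'. ?g a b (w \<otimes>\<^bsub>V\<^esub> w')) ?k = y b \<odot>\<^bsub>V\<^esub> (w \<otimes>\<^bsub>V\<^esub> x z)"
      by (simp add: Kt_eval[OF V x z])
  qed (rule mlin | assumption)+
  also have "\<dots> = TL V (\<lambda>b w. (y b \<odot>\<^bsub>V\<^esub> w) \<otimes>\<^bsub>V\<^esub> x z) ?k"
    by (rule tensor_lift_cong[OF H_alg V V _ _ k], (rule mlin | assumption)+) (simp add: V.smult_mult_left)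
  also have "\<dots> = x y \<otimes>\<^bsub>V\<^esub> x z"
    unfolding Kt_eval[OF V x y, symmetric]
    by (rule mult_tensor_lift(2)[OF H_alg V V eval_bilin[OF V x y] k, symmetric]) (simp add: Kt_eval[OF V x y])
  finally have 1: "?P (KK T3 g3 p3 ?k \<otimes>\<^bsub>T3\<^esub> KK T3 f3 p3 ?k) = x y \<otimes>\<^bsub>V\<^esub> x z" .
  note [mlin] = fgp_lin[OF V T3_alg fg3 fp3 gp3 k]
  have bb: "bilin K H V T3 (\<lambda>c w. TL T3 (\<lambda>a b. f3 a \<otimes>\<^bsub>T3\<^esub> (g3 b \<otimes>\<^bsub>T3\<^esub> p3 w)) (hat c))"
    by (rule mlin hat_lin | rule lin_lift_arg[OF H_alg H_alg] | assumption)+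
  have "?P (KK T3 g3 p3 ?k \<otimes>\<^bsub>T3\<^esub> KK T3 f3 p3 ?k) =
    TL V (\<lambda>c w. ?P (TL T3 (\<lambda>a b. f3 a \<otimes>\<^bsub>T3\<^esub> (g3 b \<otimes>\<^bsub>T3\<^esub> p3 w)) (hat c))) ?k"
    unfolding KK_KK_of_KC[OF V T3_alg fg3 fp3 gp3 k KC]
    by (rule lin_tensor_lift[OF H_alg V T3_alg V P bb k])
  also have "\<dots> = TL V (\<lambda>c w. (y \<otimes>\<^bsub>B\<^esub> z) c \<odot>\<^bsub>V\<^esub> w) ?k"
  proof (rule tensor_lift_cong[OF H_alg V V _ _ k, symmetric])
    have yz: "y \<otimes>\<^bsub>B\<^esub> z \<in> dual" using B_closed(3)[of y z] y z by (simp add: B_simps(1))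
    show "bilin K H V V (\<lambda>c w. (y \<otimes>\<^bsub>B\<^esub> z) c \<odot>\<^bsub>V\<^esub> w)" by (rule eval_bilin[OF V x yz])
    fix c w assume c [simp, mlin]: "c \<in> carrier H" and [simp, mlin]: "w \<in> carrier V"
    have bt: "bilin K H H T3 (\<lambda>a b. f3 a \<otimes>\<^bsub>T3\<^esub> (g3 b \<otimes>\<^bsub>T3\<^esub> p3 w))" by (rule mlin | assumption)+
    have G: "(\<lambda>r. r \<odot>\<^bsub>V\<^esub> w) \<in> lin_map K base V" by (rule mlin)+
    have "?P (TL T3 (\<lambda>a b. f3 a \<otimes>\<^bsub>T3\<^esub> (g3 b \<otimes>\<^bsub>T3\<^esub> p3 w)) (hat c)) =
      TL V (\<lambda>a b. ?P (f3 a \<otimes>\<^bsub>T3\<^esub> (g3 b \<otimes>\<^bsub>T3\<^esub> p3 w))) (hat c)"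
      by (rule lin_tensor_lift[OF H_alg H_alg T3_alg V P bt hat_closed[OF c]])
    also have "\<dots> = TL V (\<lambda>a b. (z a \<otimes>\<^bsub>K\<^esub> y b) \<odot>\<^bsub>V\<^esub> w) (hat c)"
    proof (rule tensor_lift_cong[OF H_alg H_alg V _ _ hat_closed[OF c]])
      show "bilin K H H V (\<lambda>a b. ?P (f3 a \<otimes>\<^bsub>T3\<^esub> (g3 b \<otimes>\<^bsub>T3\<^esub> p3 w)))"
        by (intro bilinI lin_comp[OF P] bilinD[OF bt])
      show "?P (f3 a \<otimes>\<^bsub>T3\<^esub> (g3 b \<otimes>\<^bsub>T3\<^esub> p3 w)) = (z a \<otimes>\<^bsub>K\<^esub> y b) \<odot>\<^bsub>V\<^esub> w" if "a \<in> carrier H" "b \<in> carrier H" for a b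
        using that by (simp add: legs3_mult Pt V.smult_assoc1)
    qed
    also have "\<dots> = TL base (\<lambda>a b. z a \<otimes>\<^bsub>K\<^esub> y b) (hat c) \<odot>\<^bsub>V\<^esub> w"
      by (rule lin_tensor_lift[OF H_alg H_alg base_alg V G pair_bilin[OF z y] hat_closed[OF c], symmetric])
    finally show "(y \<otimes>\<^bsub>B\<^esub> z) c \<odot>\<^bsub>V\<^esub> w = ?P (TL T3 (\<lambda>a b. f3 a \<otimes>\<^bsub>T3\<^esub> (g3 b \<otimes>\<^bsub>T3\<^esub> p3 w)) (hat c))"
      by (simp add: B_simps(4))
  qed
  also have "\<dots> = x (y \<otimes>\<^bsub>B\<^esub> z)"
    by (rule Kt_eval[OF V x]) (use B_closed(3)[of y z] y z in \<open>simp add: B_simps(1)\<close>)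
  finally show "x (y \<otimes>\<^bsub>B\<^esub> z) = x y \<otimes>\<^bsub>V\<^esub> x z" using 1 by simp
qed

context
  fixes \<alpha> assumes al: "\<alpha> \<in> alg_hom K A V"
begin

lemma al_closed [simp, mlin]: "a \<in> carrier A \<Longrightarrow> \<alpha> a \<in> carrier V" by (rule alg_hom_closed[OF al])

text \<open>The cross relation applied to every \<open>x (xb d)\<close>; by
  \<open>Kt_precomp\<close> the action on functionals then becomes the action \<open>hact\<close> on
  the first leg of \<open>K\<close>.\<close>

lemma Kt_cross:
  assumes cr: "cross_rel V x \<alpha>" and U: "assoc_algebra K U" and \<gamma>: "bilin K H V U \<gamma>" and a: "a \<in> carrier A"
  shows "TL U (\<lambda>c w. \<gamma> c (w \<otimes>\<^bsub>V\<^esub> \<alpha> a)) (Kt V x) =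
    TL U (\<lambda>l b. TL U (\<lambda>c w. \<gamma> (hact l c) (\<alpha> b \<otimes>\<^bsub>V\<^esub> w)) (Kt V x)) (\<delta> a)"
proof -
  interpret U: assoc_algebra K U by (rule U)
  note k = Kt_closed[OF V x]
  note [mlin] = a V U lin_comp[OF bilinD(1)[OF \<gamma>]] lin_comp[OF bilinD(2)[OF \<gamma>]] bilin_closed[OF \<gamma>]
    lin_lift_fun[OF H_alg V _ k] lin_comp[OF alg_homD(1)[OF al]] al_closed
  have xl: "(\<lambda>l. x (act (xb d) l)) \<in> lin_map K H V" if "d \<in> D" for d
    by (rule lin_comp[OF x act_lin]) (simp add: B_simps xb that)
  have actc [simp]: "act (xb d) l \<in> dual" if "d \<in> D" "l \<in> carrier H" for d l by (rule act_closed[OF xb[OF that(1)] that(2)])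
  have cb: "bilin K H A V (\<lambda>l b. \<alpha> b \<otimes>\<^bsub>V\<^esub> x (act (xb d) l))" if d: "d \<in> D" for d
  proof -
    note [mlin] = xl[OF d] lin_mapD(1)[OF xl[OF d]]
    show ?thesis by (rule mlin | assumption)+
  qed
  have cb2: "bilin K H A U (\<lambda>l b. \<gamma> (hb d) (\<alpha> b \<otimes>\<^bsub>V\<^esub> x (act (xb d) l)))" if d: "d \<in> D" for d
    by (intro bilinI lin_comp[OF bilinD(1)[OF \<gamma> hb[OF d]]] bilinD[OF cb[OF d]])
  have "TL U (\<lambda>c w. \<gamma> c (w \<otimes>\<^bsub>V\<^esub> \<alpha> a)) (Kt V x) = (\<Oplus>\<^bsub>U\<^esub>d\<in>D. \<gamma> (hb d) (x (xb d) \<otimes>\<^bsub>V\<^esub> \<alpha> a))"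
    by (rule Kt_lift[OF V x U]) (rule mlin | assumption)+
  also have "\<dots> = (\<Oplus>\<^bsub>U\<^esub>d\<in>D. TL U (\<lambda>l b. \<gamma> (hb d) (\<alpha> b \<otimes>\<^bsub>V\<^esub> x (act (xb d) l))) (\<delta> a))"
  proof (rule U.A.finsum_cong')
    fix d assume d: "d \<in> D"
    show "\<gamma> (hb d) (x (xb d) \<otimes>\<^bsub>V\<^esub> \<alpha> a) = TL U (\<lambda>l b. \<gamma> (hb d) (\<alpha> b \<otimes>\<^bsub>V\<^esub> x (act (xb d) l))) (\<delta> a)" (is "?l = ?r")
    proof -
    have "?l = \<gamma> (hb d) (TL V (\<lambda>l b. \<alpha> b \<otimes>\<^bsub>V\<^esub> x (act (xb d) l)) (\<delta> a))"
      using cr xb[OF d] a by (simp add: cross_rel_def)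
    also have "\<dots> = ?r"
      by (rule A.co_hom[OF V U bilinD(1)[OF \<gamma> hb[OF d]] cb[OF d] a])
    finally show ?thesis .
    qed
  qed (auto intro!: A.co_closed[OF a U cb2])
  also have "\<dots> = TL U (\<lambda>l b. \<Oplus>\<^bsub>U\<^esub>d\<in>D. \<gamma> (hb d) (\<alpha> b \<otimes>\<^bsub>V\<^esub> x (act (xb d) l))) (\<delta> a)"
    by (rule tensor_lift_finsum[OF H_alg A_alg U finite_D cb2 A.\<delta>_closed[OF a]])
  also have "\<dots> = TL U (\<lambda>l b. TL U (\<lambda>c w. \<gamma> (hact l c) (\<alpha> b \<otimes>\<^bsub>V\<^esub> w)) (Kt V x)) (\<delta> a)"
  proof (rule A.co_cong[OF U _ _ a])
    show "bilin K H A U (\<lambda>l b. \<Oplus>\<^bsub>U\<^esub>d\<in>D. \<gamma> (hb d) (\<alpha> b \<otimes>\<^bsub>V\<^esub> x (act (xb d) l)))"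
      by (intro bilinI lin_finsum[OF U finite_D] bilinD[OF cb2])
    fix l b assume l [mlin]: "l \<in> carrier H" and b [mlin]: "b \<in> carrier A"
    have be: "bilin K H V U (\<lambda>c w. \<gamma> c (\<alpha> b \<otimes>\<^bsub>V\<^esub> w))" by (rule mlin | assumption)+
    show "(\<Oplus>\<^bsub>U\<^esub>d\<in>D. \<gamma> (hb d) (\<alpha> b \<otimes>\<^bsub>V\<^esub> x (act (xb d) l))) = TL U (\<lambda>c w. \<gamma> (hact l c) (\<alpha> b \<otimes>\<^bsub>V\<^esub> w)) (Kt V x)"
      using Kt_precomp[OF V x U be hact_lin1[OF l lin_id H_alg]] by (simp add: hat_dual_action_def)
  qed
  finally show ?thesis .
qed

context
  fixes T :: "('k, 't) module" (structure) and f p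
  assumes T: "assoc_algebra K T" and fp: "commute_with V T f p"
begin

interpretation T: assoc_algebra K T by (rule T)

lemmas fp_lin = V T lin_comp[OF alg_homD(1)[OF cwD(1)[OF V T fp]]]
  lin_comp[OF alg_homD(1)[OF cwD(2)[OF V T fp]]] cwD(5,6)[OF V T fp]
  lin_lift_fun[OF H_alg V _ Kt_closed[OF V x]] lin_comp[OF alg_homD(1)[OF al]] al_closed

lemmas fp_simps = cwD(5,6)[OF V T fp] alg_homD(2)[OF cwD(1)[OF V T fp]] 
  alg_homD(2)[OF cwD(2)[OF V T fp]] T.A.m_assoc cwD(4,7)[OF V T fp]

lemma co_bilin: "bilin K H A T (\<lambda>l b. f l \<otimes> p (\<alpha> b))"
proof -
  note [mlin] = fp_lin
  show ?thesis by (rule mlin | assumption)+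
qed

lemma co_KK:
  assumes a: "a \<in> carrier A"
  shows "co T f (\<lambda>b. p (\<alpha> b)) a \<otimes> KK T f p (Kt V x) =
    TL T (\<lambda>m b. TL T (\<lambda>c w. f (m \<star> c) \<otimes> p (\<alpha> b \<otimes>\<^bsub>V\<^esub> w)) (Kt V x)) (\<delta> a)"
proof -
  note k = Kt_closed[OF V x]
  note [mlin] = fp_lin a
  have "co T f (\<lambda>b. p (\<alpha> b)) a \<otimes> KK T f p (Kt V x) =
    TL T (\<lambda>m b. TL T (\<lambda>c w. (f m \<otimes> p (\<alpha> b)) \<otimes> (f c \<otimes> p w)) (Kt V x)) (\<delta> a)"
    unfolding co_def KK_def
    by (rule mult_lifts[OF H_alg A_alg H_alg V T co_bilin cwD(3)[OF V T fp] A.\<delta>_closed[OF a] k])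
  also have "\<dots> = TL T (\<lambda>m b. TL T (\<lambda>c w. f (m \<star> c) \<otimes> p (\<alpha> b \<otimes>\<^bsub>V\<^esub> w)) (Kt V x)) (\<delta> a)"
    apply (rule A.co_cong[OF T _ _ a], (rule mlin | assumption)+)
    apply (rule tensor_lift_cong[OF H_alg V T _ _ k], (rule mlin | assumption)+)
    apply (simp add: fp_simps)
    done
  finally show ?thesis .
qed

text \<open>Moving the image of \<open>a\<close> to the left through \<open>K\<close> costs a factor
  \<open>hact l' c\<close> next to the \<open>l\<close> already present. Coassociativity gathers
  \<open>l\<close> and \<open>l'\<close> into one coproduct, where \<open>hact_contract\<close>
  leaves \<open>m \<star> c\<close>: the two factors in the other order.\<close>

lemma KA_of_cross:
  assumes cr: "cross_rel V x \<alpha>" and a: "a \<in> carrier A"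
  shows "KK T f p (Kt V x) \<otimes> co T f (\<lambda>b. p (\<alpha> b)) a = co T f (\<lambda>b. p (\<alpha> b)) a \<otimes> KK T f p (Kt V x)"
proof -
  note k = Kt_closed[OF V x]
  note [mlin] = fp_lin a
  let ?k = "Kt V x"
  have "KK T f p ?k \<otimes> co T f (\<lambda>b. p (\<alpha> b)) a =
    TL T (\<lambda>c w. TL T (\<lambda>l b. (f c \<otimes> p w) \<otimes> (f l \<otimes> p (\<alpha> b))) (\<delta> a)) ?k"
    unfolding co_def KK_def
    by (rule mult_lifts[OF H_alg V H_alg A_alg T cwD(3)[OF V T fp] co_bilin k A.\<delta>_closed[OF a]])
  also have "\<dots> = TL T (\<lambda>l b. TL T (\<lambda>c w. (f c \<otimes> p w) \<otimes> (f l \<otimes> p (\<alpha> b))) ?k) (\<delta> a)"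
    by (rule tensor_lift_swap[OF H_alg V H_alg A_alg T k A.\<delta>_closed[OF a]]) (rule mlin | assumption)+
  also have "\<dots> = TL T (\<lambda>l b. TL T (\<lambda>l' b'. TL T (\<lambda>c w.
      f (hact l' c \<star> l) \<otimes> p (\<alpha> b' \<otimes>\<^bsub>V\<^esub> w)) ?k) (\<delta> b)) (\<delta> a)"
  proof (rule A.co_cong[OF T _ _ a])
    fix l b assume [simp, mlin]: "l \<in> carrier H" and b [simp, mlin]: "b \<in> carrier A"
    have be: "bilin K H V T (\<lambda>c w. f (c \<star> l) \<otimes> p w)" by (rule mlin | assumption)+
    have "TL T (\<lambda>c w. (f c \<otimes> p w) \<otimes> (f l \<otimes> p (\<alpha> b))) ?k =
      TL T (\<lambda>c w. f (c \<star> l) \<otimes> p (w \<otimes>\<^bsub>V\<^esub> \<alpha> b)) ?k"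
      by (rule tensor_lift_cong[OF H_alg V T _ _ k], (rule mlin | assumption)+) (simp add: fp_simps)
    also have "\<dots> = TL T (\<lambda>l' b'. TL T (\<lambda>c w.
      f (hact l' c \<star> l) \<otimes> p (\<alpha> b' \<otimes>\<^bsub>V\<^esub> w)) ?k) (\<delta> b)"
      by (rule Kt_cross[OF cr T be b])
    finally show "TL T (\<lambda>c w. (f c \<otimes> p w) \<otimes> (f l \<otimes> p (\<alpha> b))) ?k = \<dots>" .
  qed (rule mlin | assumption)+
  also have "\<dots> = TL T (\<lambda>m b'. TL T (\<lambda>l l'. TL T (\<lambda>c w.
      f (hact l' c \<star> l) \<otimes> p (\<alpha> b' \<otimes>\<^bsub>V\<^esub> w)) ?k) (\<Delta> m)) (\<delta> a)"
    by (rule A.coassoc_lift[OF T _ a, symmetric]) (rule mlin | assumption)+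
  also have "\<dots> = TL T (\<lambda>m b'. TL T (\<lambda>c w. f (m \<star> c) \<otimes> p (\<alpha> b' \<otimes>\<^bsub>V\<^esub> w)) ?k) (\<delta> a)"
  proof (rule A.co_cong[OF T _ _ a])
    fix m b' assume m [simp, mlin]: "m \<in> carrier H" and [simp, mlin]: "b' \<in> carrier A"
    have "TL T (\<lambda>l l'. TL T (\<lambda>c w.
      f (hact l' c \<star> l) \<otimes> p (\<alpha> b' \<otimes>\<^bsub>V\<^esub> w)) ?k) (\<Delta> m) =
      TL T (\<lambda>c w. TL T (\<lambda>l l'.
      f (hact l' c \<star> l) \<otimes> p (\<alpha> b' \<otimes>\<^bsub>V\<^esub> w)) (\<Delta> m)) ?k"
      by (rule tensor_lift_swap[OF H_alg H_alg H_alg V T \<Delta>_closed[OF m] k]) (rule mlin | assumption)+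
    also have "\<dots> = TL T (\<lambda>c w. f (m \<star> c) \<otimes> p (\<alpha> b' \<otimes>\<^bsub>V\<^esub> w)) ?k"
    proof (rule tensor_lift_cong[OF H_alg V T _ _ k])
      fix c w assume [simp, mlin]: "c \<in> carrier H" "w \<in> carrier V"
      have F: "(\<lambda>u. f u \<otimes> p (\<alpha> b' \<otimes>\<^bsub>V\<^esub> w)) \<in> lin_map K H T" by (rule mlin)+
      show "TL T (\<lambda>l l'. f (hact l' c \<star> l) \<otimes> p (\<alpha> b' \<otimes>\<^bsub>V\<^esub> w)) (\<Delta> m) = f (m \<star> c) \<otimes> p (\<alpha> b' \<otimes>\<^bsub>V\<^esub> w)"
        by (rule hact_contract[OF T F m]) simp
    qed (rule mlin | assumption)+
    finally show "TL T (\<lambda>l l'. TL T (\<lambda>c w.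
      f (hact l' c \<star> l) \<otimes> p (\<alpha> b' \<otimes>\<^bsub>V\<^esub> w)) ?k) (\<Delta> m) = \<dots>" .
  qed (rule mlin | assumption)+
  also have "\<dots> = co T f (\<lambda>b. p (\<alpha> b)) a \<otimes> KK T f p ?k"
    by (rule co_KK[OF a, symmetric])
  finally show ?thesis .
qed

text \<open>The hypothesis commutes \<open>K\<close> with the whole coaction, not with
  \<open>p (\<alpha> a)\<close> alone. The missing \<open>f\<close>-component is created from the
  counit as \<open>f (l' \<star> Si l)\<close>; after commuting, \<open>l'\<close> stands left of
  \<open>c\<close> and \<open>Si l\<close> right of it, which is \<open>hact\<close>.\<close>

lemma KK_mult_of_KA:
  assumes KA: "\<And>b. b \<in> carrier A \<Longrightarrow>
      KK T f p (Kt V x) \<otimes> co T f (\<lambda>b. p (\<alpha> b)) b = co T f (\<lambda>b. p (\<alpha> b)) b \<otimes> KK T f p (Kt V x)"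
    and a: "a \<in> carrier A"
  shows "KK T f p (Kt V x) \<otimes> p (\<alpha> a) =
    TL T (\<lambda>m b. TL T (\<lambda>c w. f (hact m c) \<otimes> p (\<alpha> b \<otimes>\<^bsub>V\<^esub> w)) (Kt V x)) (\<delta> a)"
proof -
  let ?k = "Kt V x"
  let ?K = "KK T f p ?k"
  note k = Kt_closed[OF V x]
  note Kc [simp] = KK_closed[OF V T fp k]
  note [mlin] = fp_lin a Kc
  have "?K \<otimes> p (\<alpha> a) = TL T (\<lambda>m b'. \<epsilon> m \<odot> (?K \<otimes> p (\<alpha> b'))) (\<delta> a)"
    by (rule A.coaction_counit_lin[OF T _ a, symmetric]) (rule mlin)+
  also have "\<dots> = TL T (\<lambda>m b'. TL T (\<lambda>l l'. (?K \<otimes> p (\<alpha> b')) \<otimes> f (l' \<star> Si l)) (\<Delta> m)) (\<delta> a)"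
  proof (rule A.co_cong[OF T _ _ a])
    fix m b' assume m: "m \<in> carrier H" and [simp, mlin]: "b' \<in> carrier A"
    have F: "(\<lambda>u. (?K \<otimes> p (\<alpha> b')) \<otimes> f u) \<in> lin_map K H T" by (rule mlin)+
    show "\<epsilon> m \<odot> (?K \<otimes> p (\<alpha> b')) = TL T (\<lambda>l l'. (?K \<otimes> p (\<alpha> b')) \<otimes> f (l' \<star> Si l)) (\<Delta> m)"
      using Si_contract(1)[OF T F m] by (simp add: alg_homD(3)[OF cwD(1)[OF V T fp]] cwD(6)[OF V T fp])
  qed (rule mlin | assumption)+
  also have "\<dots> = TL T (\<lambda>l b. TL T (\<lambda>l' b'. (?K \<otimes> p (\<alpha> b')) \<otimes> f (l' \<star> Si l)) (\<delta> b)) (\<delta> a)"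
    by (rule A.coassoc_lift[OF T _ a]) (rule mlin | assumption)+
  also have "\<dots> = TL T (\<lambda>l b. TL T (\<lambda>l' b'. TL T (\<lambda>c w.
      f (l' \<star> c \<star> Si l) \<otimes> p (\<alpha> b' \<otimes>\<^bsub>V\<^esub> w)) ?k) (\<delta> b)) (\<delta> a)"
  proof (rule A.co_cong[OF T _ _ a])
    fix l b assume l [simp, mlin]: "l \<in> carrier H" and b [simp, mlin]: "b \<in> carrier A"
    have Sl: "Si l \<in> carrier H" "f (Si l) \<in> carrier T" by (rule mlin)+
    have F: "(\<lambda>u. (?K \<otimes> u) \<otimes> f (Si l)) \<in> lin_map K T T" by (rule mlin)+
    have G: "(\<lambda>u. u \<otimes> f (Si l)) \<in> lin_map K T T" by (rule mlin)+
    have "TL T (\<lambda>l' b'. (?K \<otimes> p (\<alpha> b')) \<otimes> f (l' \<star> Si l)) (\<delta> b) =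
      TL T (\<lambda>l' b'. (?K \<otimes> (f l' \<otimes> p (\<alpha> b'))) \<otimes> f (Si l)) (\<delta> b)"
      by (rule A.co_cong[OF T _ _ b], (rule mlin | assumption)+) (simp add: fp_simps Sl)
    also have "\<dots> = (?K \<otimes> co T f (\<lambda>b. p (\<alpha> b)) b) \<otimes> f (Si l)"
      unfolding co_def by (rule A.co_hom[OF T T F co_bilin b, symmetric])
    also have "\<dots> = TL T (\<lambda>m b. TL T (\<lambda>c w. f (m \<star> c) \<otimes> p (\<alpha> b \<otimes>\<^bsub>V\<^esub> w)) ?k) (\<delta> b) \<otimes> f (Si l)"
      by (simp only: KA[OF b] co_KK[OF b])
    also have "\<dots> = TL T (\<lambda>m b. TL T (\<lambda>c w. f (m \<star> c) \<otimes> p (\<alpha> b \<otimes>\<^bsub>V\<^esub> w)) ?k \<otimes> f (Si l)) (\<delta> b)"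
      by (rule A.co_hom[OF T T G _ b]) (rule mlin | assumption)+
    also have "\<dots> = TL T (\<lambda>l' b'. TL T (\<lambda>c w.
      f (l' \<star> c \<star> Si l) \<otimes> p (\<alpha> b' \<otimes>\<^bsub>V\<^esub> w)) ?k) (\<delta> b)"
    proof (rule A.co_cong[OF T _ _ b])
      fix m b' assume [simp, mlin]: "m \<in> carrier H" "b' \<in> carrier A"
      have "TL T (\<lambda>c w. f (m \<star> c) \<otimes> p (\<alpha> b' \<otimes>\<^bsub>V\<^esub> w)) ?k \<otimes> f (Si l) =
        TL T (\<lambda>c w. (f (m \<star> c) \<otimes> p (\<alpha> b' \<otimes>\<^bsub>V\<^esub> w)) \<otimes> f (Si l)) ?k"
        by (rule lin_tensor_lift[OF H_alg V T T G _ k]) (rule mlin | assumption)+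
      also have "\<dots> = TL T (\<lambda>c w. f (m \<star> c \<star> Si l) \<otimes> p (\<alpha> b' \<otimes>\<^bsub>V\<^esub> w)) ?k"
        by (rule tensor_lift_cong[OF H_alg V T _ _ k], (rule mlin | assumption)+) (simp add: fp_simps Sl)
      finally show "TL T (\<lambda>c w. f (m \<star> c) \<otimes> p (\<alpha> b' \<otimes>\<^bsub>V\<^esub> w)) ?k \<otimes> f (Si l) = \<dots>" .
    qed (rule mlin | assumption)+
    finally show "TL T (\<lambda>l' b'. (?K \<otimes> p (\<alpha> b')) \<otimes> f (l' \<star> Si l)) (\<delta> b) = \<dots>" .
  qed (rule mlin | assumption)+
  also have "\<dots> = TL T (\<lambda>m b'. TL T (\<lambda>l l'. TL T (\<lambda>c w.
      f (l' \<star> c \<star> Si l) \<otimes> p (\<alpha> b' \<otimes>\<^bsub>V\<^esub> w)) ?k) (\<Delta> m)) (\<delta> a)"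
    by (rule A.coassoc_lift[OF T _ a, symmetric]) (rule mlin | assumption)+
  also have "\<dots> = TL T (\<lambda>m b'. TL T (\<lambda>c w. f (hact m c) \<otimes> p (\<alpha> b' \<otimes>\<^bsub>V\<^esub> w)) ?k) (\<delta> a)"
  proof (rule A.co_cong[OF T _ _ a])
    fix m b' assume m [simp, mlin]: "m \<in> carrier H" and [simp, mlin]: "b' \<in> carrier A"
    have "TL T (\<lambda>l l'. TL T (\<lambda>c w.
      f (l' \<star> c \<star> Si l) \<otimes> p (\<alpha> b' \<otimes>\<^bsub>V\<^esub> w)) ?k) (\<Delta> m) =
      TL T (\<lambda>c w. TL T (\<lambda>l l'.
      f (l' \<star> c \<star> Si l) \<otimes> p (\<alpha> b' \<otimes>\<^bsub>V\<^esub> w)) (\<Delta> m)) ?k"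
      by (rule tensor_lift_swap[OF H_alg H_alg H_alg V T \<Delta>_closed[OF m] k]) (rule mlin | assumption)+
    also have "\<dots> = TL T (\<lambda>c w. f (hact m c) \<otimes> p (\<alpha> b' \<otimes>\<^bsub>V\<^esub> w)) ?k"
    proof (rule tensor_lift_cong[OF H_alg V T _ _ k])
      fix c w assume [simp, mlin]: "c \<in> carrier H" "w \<in> carrier V"
      have F: "(\<lambda>u. f u \<otimes> p (\<alpha> b' \<otimes>\<^bsub>V\<^esub> w)) \<in> lin_map K H T" by (rule mlin)+
      show "TL T (\<lambda>l l'. f (l' \<star> c \<star> Si l) \<otimes> p (\<alpha> b' \<otimes>\<^bsub>V\<^esub> w)) (\<Delta> m) = f (hact m c) \<otimes> p (\<alpha> b' \<otimes>\<^bsub>V\<^esub> w)"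
        unfolding hat_action_def by (rule sw_hom[OF H_alg T F _ m, symmetric]) (rule mlin | assumption)+
    qed (rule mlin | assumption)+
    finally show "TL T (\<lambda>l l'. TL T (\<lambda>c w.
      f (l' \<star> c \<star> Si l) \<otimes> p (\<alpha> b' \<otimes>\<^bsub>V\<^esub> w)) ?k) (\<Delta> m) = \<dots>" .
  qed (rule mlin | assumption)+
  finally show ?thesis .
qed

end

abbreviation "HV \<equiv> tensor K H V"
abbreviation "f2 \<equiv> \<lambda>a. tens K H V a \<one>\<^bsub>V\<^esub>"
abbreviation "p2 \<equiv> \<lambda>w. tens K H V \<one>\<^bsub>H\<^esub> w"

lemma HV_alg: "assoc_algebra K HV" by (rule assoc_algebra_tensor[OF H_alg V])

lemma fp2: "commute_with V HV f2 p2"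
  unfolding commute_with_def
  by (intro conjI ballI tens_hom[OF H_alg V]) (simp add: tens_hom[OF H_alg V])

text \<open>With the legs of \<open>H \<otimes> V\<close> the formula of
  \<open>KK_mult_of_KA\<close> is an equation in this tensor product; pairing its first leg with
  \<open>z\<close> gives the cross relation, because \<open>z\<close> composed with
  \<open>hact m\<close> is \<open>act z m\<close>.\<close>

lemma cross_of_KA:
  assumes KA: "\<And>b. b \<in> carrier A \<Longrightarrow>
      KK HV f2 p2 (Kt V x) \<otimes>\<^bsub>HV\<^esub> co HV f2 (\<lambda>b. p2 (\<alpha> b)) b = co HV f2 (\<lambda>b. p2 (\<alpha> b)) b \<otimes>\<^bsub>HV\<^esub> KK HV f2 p2 (Kt V x)"
  shows "cross_rel V x \<alpha>"
  unfolding cross_rel_def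
proof (intro ballI)
  fix z a assume z: "z \<in> dual" and a: "a \<in> carrier A"
  let ?k = "Kt V x"
  note k = Kt_closed[OF V x]
  note [mlin] = fp_lin[OF HV_alg fp2] a dual_val[OF z] lin_comp[OF dualD(1)[OF z]]
  let ?P = "TL V (\<lambda>c w. z c \<odot>\<^bsub>V\<^esub> w)"
  note eb = eval_bilin[OF V x z]
  note P = tensor_lift_lin[OF H_alg V V eb]
  note Pt = tensor_lift_tens[OF H_alg V V eb]
  note zv [simp] = dual_val[OF z]
  have f2p2: "f2 c \<otimes>\<^bsub>HV\<^esub> p2 w = tens K H V c w" if "c \<in> carrier H" "w \<in> carrier V" for c w
    by (rule tens_hom(3)[OF H_alg V that])
  have pa: "p2 (\<alpha> a) \<in> carrier HV" by (rule cwD(6)[OF V HV_alg fp2 al_closed[OF a]])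
  have "?P (KK HV f2 p2 ?k \<otimes>\<^bsub>HV\<^esub> p2 (\<alpha> a)) = ?P (TL HV (\<lambda>c w. (f2 c \<otimes>\<^bsub>HV\<^esub> p2 w) \<otimes>\<^bsub>HV\<^esub> p2 (\<alpha> a)) ?k)"
    unfolding KK_def by (simp only: mult_tensor_lift(2)[OF H_alg V HV_alg cwD(3)[OF V HV_alg fp2] k pa])
  also have "\<dots> = TL V (\<lambda>c w. ?P ((f2 c \<otimes>\<^bsub>HV\<^esub> p2 w) \<otimes>\<^bsub>HV\<^esub> p2 (\<alpha> a))) ?k"
    by (rule lin_tensor_lift[OF H_alg V HV_alg V P _ k]) (rule mlin | assumption)+
  also have "\<dots> = TL V (\<lambda>c w. (z c \<odot>\<^bsub>V\<^esub> w) \<otimes>\<^bsub>V\<^esub> \<alpha> a) ?k"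
    by (rule tensor_lift_cong[OF H_alg V V _ _ k, symmetric], (rule mlin | assumption)+)
      (simp add: tens_mult H_alg V Pt a V.smult_mult_left)
  also have "\<dots> = x z \<otimes>\<^bsub>V\<^esub> \<alpha> a"
    unfolding Kt_eval[OF V x z, symmetric]
    by (rule mult_tensor_lift(2)[OF H_alg V V eb k, symmetric]) (simp add: a)
  finally have 1: "?P (KK HV f2 p2 ?k \<otimes>\<^bsub>HV\<^esub> p2 (\<alpha> a)) = x z \<otimes>\<^bsub>V\<^esub> \<alpha> a" .
  have zb: "z \<in> carrier B" by (simp add: B_simps z)
  note [mlin] = lin_comp[OF x act_lin[OF zb]] lin_mapD(1)[OF lin_comp[OF x act_lin[OF zb]]]
  have e: "KK HV f2 p2 ?k \<otimes>\<^bsub>HV\<^esub> p2 (\<alpha> a) = TL HV (\<lambda>m b. TL HV (\<lambda>c w. f2 (hact m c) \<otimes>\<^bsub>HV\<^esub> p2 (\<alpha> b \<otimes>\<^bsub>V\<^esub> w)) ?k) (\<delta> a)"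
    by (rule KK_mult_of_KA[OF HV_alg fp2 _ a]) (rule KA)
  have "?P (KK HV f2 p2 ?k \<otimes>\<^bsub>HV\<^esub> p2 (\<alpha> a)) =
    TL V (\<lambda>m b. ?P (TL HV (\<lambda>c w. f2 (hact m c) \<otimes>\<^bsub>HV\<^esub> p2 (\<alpha> b \<otimes>\<^bsub>V\<^esub> w)) ?k)) (\<delta> a)"
    unfolding e
    by (rule A.co_hom[OF HV_alg V P _ a]) (rule mlin | assumption)+
  also have "\<dots> = TL V (\<lambda>l b. \<alpha> b \<otimes>\<^bsub>V\<^esub> x (act z l)) (\<delta> a)"
  proof (rule A.co_cong[OF V _ _ a, symmetric])
    show "bilin K H A V (\<lambda>l b. \<alpha> b \<otimes>\<^bsub>V\<^esub> x (act z l))" by (rule mlin lin_id | assumption)+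
    fix m b assume m [simp, mlin]: "m \<in> carrier H" and b [simp, mlin]: "b \<in> carrier A"
    note az = act_closed[OF z m]
    note [mlin] = dual_val[OF az] lin_comp[OF dualD(1)[OF az]]
    show "\<alpha> b \<otimes>\<^bsub>V\<^esub> x (act z m) = ?P (TL HV (\<lambda>c w. f2 (hact m c) \<otimes>\<^bsub>HV\<^esub> p2 (\<alpha> b \<otimes>\<^bsub>V\<^esub> w)) ?k)" (is "?l = ?r")
    proof -
    have "?r =
      TL V (\<lambda>c w. ?P (f2 (hact m c) \<otimes>\<^bsub>HV\<^esub> p2 (\<alpha> b \<otimes>\<^bsub>V\<^esub> w))) ?k"
      by (rule lin_tensor_lift[OF H_alg V HV_alg V P _ k]) (rule mlin | assumption)+
    also have "\<dots> = TL V (\<lambda>c w. \<alpha> b \<otimes>\<^bsub>V\<^esub> (act z m c \<odot>\<^bsub>V\<^esub> w)) ?k"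
      by (rule tensor_lift_cong[OF H_alg V V _ _ k, symmetric], (rule mlin | assumption)+)
        (simp add: f2p2 Pt V.smult_mult_right hat_dual_action_def)
    also have "\<dots> = ?l"
      unfolding Kt_eval[OF V x az, symmetric]
      by (rule mult_tensor_lift(1)[OF H_alg V V eval_bilin[OF V x az] k, symmetric]) (rule mlin)+
    finally show ?thesis by simp
    qed
  qed
  finally show "x z \<otimes>\<^bsub>V\<^esub> \<alpha> a = TL V (\<lambda>l b. \<alpha> b \<otimes>\<^bsub>V\<^esub> x (act z l)) (\<delta> a)" using 1 by simp
qed

end

end

end

subsection \<open>The reflective algebra\<close>

lemma tensor_lift_tens_id:
  assumes V: "assoc_algebra K V" "assoc_algebra K W" and z: "z \<in> carrier (tensor K V W)"
  shows "tensor_lift K (tensor K V W) (\<lambda>a b. tens K V W a b) z = z"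
  by (rule lin_map_tensor_eq[OF V tensor_lift_lin[OF V assoc_algebra_tensor[OF V] tens_bilin[OF V]] lin_id _ z])
    (simp add: tensor_lift_tens[OF V assoc_algebra_tensor[OF V] tens_bilin[OF V]])

context reflective_data
begin

text \<open>Outside its context \<open>\<alpha>\<close> is schematic, so this rule would apply to every closure goal.\<close>

declare al_closed [simp del, mlin del]

lemma commute_withI:
  assumes "f \<in> alg_hom K H T" "p \<in> alg_hom K V T"
    and "\<And>a q. a \<in> carrier H \<Longrightarrow> q \<in> carrier V \<Longrightarrow> f a \<otimes>\<^bsub>T\<^esub> p q = p q \<otimes>\<^bsub>T\<^esub> f a"
  shows "commute_with V T f p"
  unfolding commute_with_def by (intro conjI ballI assms)

lemma commute_with_comp:
  assumes V: "assoc_algebra K V" and T: "assoc_algebra K T"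
    and fp: "commute_with V T f p" and q: "q \<in> alg_hom K W V"
  shows "commute_with W T f (\<lambda>w. p (q w))"
  by (rule commute_withI[OF cwD(1)[OF V T fp] alg_hom_comp[OF q cwD(2)[OF V T fp]]])
    (rule cwD(4)[OF V T fp, symmetric], assumption, erule alg_hom_closed[OF q])

lemma KK_cong:
  assumes V: "assoc_algebra K V" and T: "assoc_algebra K T" and fp: "commute_with V T f p"
    and k: "k \<in> carrier (tensor K H V)"
    and "\<And>a. a \<in> carrier H \<Longrightarrow> f a = f' a" "\<And>w. w \<in> carrier V \<Longrightarrow> p w = p' w"
  shows "KK T f p k = KK T f' p' k"
  unfolding KK_def by (rule tensor_lift_cong[OF H_alg V T cwD(3)[OF V T fp] _ k]) (simp add: assms(5,6))

lemma KK_hom: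
  assumes V: "assoc_algebra K V" and T: "assoc_algebra K T" and fp: "commute_with V T f p"
  shows "KK T f p \<in> alg_hom K (tensor K H V) T"
  using tensor_lift_alg_hom(2)[OF H_alg V T cwD(1)[OF V T fp] cwD(2)[OF V T fp] cwD(4)[OF V T fp, symmetric]]
  by (simp add: KK_def[abs_def])

lemma KK_tens:
  assumes V: "assoc_algebra K V" and T: "assoc_algebra K T" and fp: "commute_with V T f p"
    and "a \<in> carrier H" "w \<in> carrier V"
  shows "KK T f p (tens K H V a w) = f a \<otimes>\<^bsub>T\<^esub> p w"
  unfolding KK_def by (rule tensor_lift_tens[OF H_alg V T cwD(3)[OF V T fp] assms(4,5)])

lemma KK_Kt:
  fixes T (structure)
  assumes V: "assoc_algebra K V" and T: "assoc_algebra K T" and x: "x \<in> lin_map K B V"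
    and f: "f \<in> lin_map K H T" and p: "p \<in> lin_map K V T"
  shows "KK T f p (Kt V x) = (\<Oplus>d\<in>D. f (hb d) \<otimes> p (x (xb d)))"
proof -
  have b: "bilin K H V T (\<lambda>a q. f a \<otimes> p q)"
    by (intro bilinI lin_mult_l[OF T _ p] lin_mult_r[OF T _ f] lin_mapD(1)[OF p] lin_mapD(1)[OF f])
  show ?thesis unfolding KK_def by (rule Kt_lift[OF V x T b])
qed

lemma KK_Kt_comp:
  assumes V: "assoc_algebra K V" and V2: "assoc_algebra K V2" and T: "assoc_algebra K T" and x: "x \<in> lin_map K B V"
    and f: "f \<in> lin_map K H T" and p: "p \<in> lin_map K V2 T" and q: "q \<in> lin_map K V V2"
  shows "KK T f p (Kt V2 (\<lambda>z. q (x z))) = KK T f (\<lambda>w. p (q w)) (Kt V x)"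
  by (simp add: KK_Kt[OF V2 T lin_comp[OF q x] f p] KK_Kt[OF V T x f lin_comp[OF p q]])

text \<open>The universal legs: \<open>KK\<close> with them is the identity (\<open>KK_id\<close>),
  so an identity proved for arbitrary legs yields the one in \<open>tensor K H V\<close>.\<close>

lemma commute_tens:
  assumes V: "assoc_algebra K V"
  shows "commute_with V (tensor K H V) (\<lambda>a. tens K H V a \<one>\<^bsub>V\<^esub>) (\<lambda>w. tens K H V \<one>\<^bsub>H\<^esub> w)"
  by (rule commute_withI[OF tens_hom(1,2)[OF H_alg V]]) (simp add: tens_hom(3,4)[OF H_alg V])

lemma KK_id:
  assumes V: "assoc_algebra K V" and z: "z \<in> carrier (tensor K H V)"
  shows "KK (tensor K H V) (\<lambda>a. tens K H V a \<one>\<^bsub>V\<^esub>) (\<lambda>w. tens K H V \<one>\<^bsub>H\<^esub> w) z = z"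
proof -
  have "KK (tensor K H V) (\<lambda>a. tens K H V a \<one>\<^bsub>V\<^esub>) (\<lambda>w. tens K H V \<one>\<^bsub>H\<^esub> w) z = TL (tensor K H V) (\<lambda>a b. tens K H V a b) z"
    unfolding KK_def
    by (rule tensor_lift_cong[OF H_alg V assoc_algebra_tensor[OF H_alg V] tens_bilin[OF H_alg V] _ z, symmetric]) (simp add: tens_hom(3)[OF H_alg V])
  then show ?thesis by (simp add: tensor_lift_tens_id[OF H_alg V z])
qed

text \<open>Taking the universal legs shows that the two elements \<open>Kt\<close> agree, and
  \<open>Kt_eval\<close> recovers the maps. The type of \<open>T\<close> is that of
  \<open>tensor K H V\<close>, since a premise cannot quantify over types.\<close>

lemma lin_dual_eq:
  fixes V :: "('k, 'v) module"
  assumes V: "assoc_algebra K V" and x: "x \<in> lin_map K B V" and y: "y \<in> lin_map K B V"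
    and eq: "\<And>(T :: ('k, ('h \<times> 'v \<Rightarrow> 'k) set) module) f p. assoc_algebra K T \<Longrightarrow> commute_with V T f p \<Longrightarrow> KK T f p (Kt V x) = KK T f p (Kt V y)"
    and z: "z \<in> dual"
  shows "x z = y z"
proof -
  have "Kt V x = Kt V y"
    using eq[OF assoc_algebra_tensor[OF H_alg V] commute_tens[OF V]] by (simp add: KK_id[OF V] Kt_closed[OF V x] Kt_closed[OF V y])
  then show ?thesis using Kt_eval[OF V x z] Kt_eval[OF V y z] by simp
qed

text \<open>The unit of \<open>B\<close> is the counit, so the trivial leg evaluates
  \<open>K\<close> at this unit.\<close>

lemma KK_et:
  assumes V: "assoc_algebra K V" and T: "assoc_algebra K T" and x: "x \<in> lin_map K B V" and p: "p \<in> alg_hom K V T"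
  shows "KK T (et T) p (Kt V x) = p (x \<one>\<^bsub>B\<^esub>)"
proof -
  interpret T: assoc_algebra K T by (rule T)
  note k = Kt_closed[OF V x]
  note pl = alg_homD(1)[OF p] and pc [simp, mlin] = alg_hom_closed[OF p]
  note [mlin] = V T lin_comp[OF pl] lin_comp[OF alg_homD(1)[OF et_hom[OF T]]] alg_hom_closed[OF et_hom[OF T]]
  have o: "\<one>\<^bsub>B\<^esub> \<in> dual" using B_closed(1) by (simp add: B_simps(1))
  have "p (x \<one>\<^bsub>B\<^esub>) = p (TL V (\<lambda>c w. \<one>\<^bsub>B\<^esub> c \<odot>\<^bsub>V\<^esub> w) (Kt V x))" by (simp add: Kt_eval[OF V x o])
  also have "\<dots> = TL T (\<lambda>c w. p (\<one>\<^bsub>B\<^esub> c \<odot>\<^bsub>V\<^esub> w)) (Kt V x)"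
    by (rule lin_tensor_lift[OF H_alg V V T pl eval_bilin[OF V x o] k])
  also have "\<dots> = KK T (et T) p (Kt V x)"
    unfolding KK_def
    by (rule tensor_lift_cong[OF H_alg V T _ _ k, symmetric], (rule mlin | assumption)+)
      (simp add: et_def B_simps(5) \<epsilon>_closed lin_mapD(3)[OF pl] T.smult_mult_left)
  finally show ?thesis by simp
qed

lemma co_lin:
  fixes T (structure)
  assumes T: "assoc_algebra K T" and f: "f \<in> lin_map K H T" and be: "be \<in> lin_map K A T"
  shows "bilin K H A T (\<lambda>l b. f l \<otimes> be b)" and "co T f be \<in> lin_map K A T"
proof -
  note [mlin] = T lin_comp[OF f] lin_comp[OF be] lin_mapD(1)[OF f] lin_mapD(1)[OF be]
  show "bilin K H A T (\<lambda>l b. f l \<otimes> be b)" by (rule mlin | assumption)+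
  show "co T f be \<in> lin_map K A T" unfolding co_def by (rule mlin | assumption)+
qed

lemma co_co:
  fixes T (structure)
  assumes T: "assoc_algebra K T" and fk: "comm_homs T f k" and be: "be \<in> lin_map K A T" and a: "a \<in> carrier A"
  shows "co T f (co T k be) a = co T (cv T f k) be a"
proof -
  interpret T: assoc_algebra K T by (rule T)
  note f = alg_homD(1)[OF commD(1)[OF T fk]] and k = alg_homD(1)[OF commD(2)[OF T fk]]
  note [mlin] = T lin_comp[OF f] lin_comp[OF k] lin_comp[OF be] lin_mapD(1)[OF f] lin_mapD(1)[OF k] lin_mapD(1)[OF be] a
  note [simp] = lin_mapD(1)[OF f] lin_mapD(1)[OF k] lin_mapD(1)[OF be]
  have "co T f (co T k be) a = TL T (\<lambda>l b. TL T (\<lambda>l' b'. f l \<otimes> (k l' \<otimes> be b')) (\<delta> b)) (\<delta> a)"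
    unfolding co_def
    by (rule A.co_cong[OF T _ _ a], (rule mlin | assumption)+)
      (rule mult_tensor_lift(1)[OF H_alg A_alg T co_lin(1)[OF T k be] A.\<delta>_closed], assumption, simp)
  also have "\<dots> = TL T (\<lambda>m b'. TL T (\<lambda>l l'. f l \<otimes> (k l' \<otimes> be b')) (\<Delta> m)) (\<delta> a)"
    by (rule A.coassoc_lift[OF T _ a, symmetric]) (rule mlin | assumption)+
  also have "\<dots> = co T (cv T f k) be a"
    unfolding co_def
  proof (rule A.co_cong[OF T _ _ a])
    fix m b' assume m [mlin]: "m \<in> carrier H" and b [simp, mlin]: "b' \<in> carrier A"
    show "TL T (\<lambda>l l'. f l \<otimes> (k l' \<otimes> be b')) (\<Delta> m) = cv T f k m \<otimes> be b'" (is "?l = ?r")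
    proof -
    have "?r = TL T (\<lambda>l l'. (f l \<otimes> k l') \<otimes> be b') (\<Delta> m)"
      unfolding cv_def by (rule mult_tensor_lift(2)[OF H_alg H_alg T commD(3)[OF T fk] \<Delta>_closed[OF m]]) simp
    also have "\<dots> = ?l"
      by (rule sw_cong[OF T _ _ m], (rule mlin | assumption)+) (simp add: T.A.m_assoc)
    finally show ?thesis by simp
    qed
  qed (rule mlin | assumption)+
  finally show ?thesis .
qed

lemma co_intertwine:
  fixes T (structure)
  assumes T: "assoc_algebra K T" and f: "f \<in> lin_map K H T" and g: "g \<in> lin_map K H T" and be: "be \<in> lin_map K A T"
    and a: "a \<in> carrier A" and y: "y \<in> carrier T"
    and fg: "\<And>l. l \<in> carrier H \<Longrightarrow> y \<otimes> f l = g l \<otimes> y"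
    and c: "\<And>b. b \<in> carrier A \<Longrightarrow> y \<otimes> be b = be b \<otimes> y"
  shows "y \<otimes> co T f be a = co T g be a \<otimes> y"
proof -
  interpret T: assoc_algebra K T by (rule T)
  note [mlin] = T lin_comp[OF f] lin_comp[OF be] lin_mapD(1)[OF f] lin_mapD(1)[OF be] y
  note [simp] = lin_mapD(1)[OF f] lin_mapD(1)[OF g] lin_mapD(1)[OF be] y
  have "y \<otimes> co T f be a = TL T (\<lambda>l b. y \<otimes> (f l \<otimes> be b)) (\<delta> a)"
    unfolding co_def by (rule mult_tensor_lift(1)[OF H_alg A_alg T co_lin(1)[OF T f be] A.\<delta>_closed[OF a] y])
  also have "\<dots> = TL T (\<lambda>l b. (g l \<otimes> be b) \<otimes> y) (\<delta> a)"
  proof (rule A.co_cong[OF T _ _ a])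
    fix l b assume lb [simp]: "l \<in> carrier H" "b \<in> carrier A"
    show "y \<otimes> (f l \<otimes> be b) = (g l \<otimes> be b) \<otimes> y" (is "?l = ?r")
    proof -
    have "?l = (y \<otimes> f l) \<otimes> be b" by (simp add: T.A.m_assoc)
    also have "\<dots> = g l \<otimes> (y \<otimes> be b)" by (simp only: fg[OF lb(1)]) (simp add: T.A.m_assoc)
    also have "\<dots> = ?r" by (simp only: c[OF lb(2)]) (simp add: T.A.m_assoc)
    finally show ?thesis .
    qed
  qed (rule mlin | assumption)+
  also have "\<dots> = co T g be a \<otimes> y"
    unfolding co_def by (rule mult_tensor_lift(2)[OF H_alg A_alg T co_lin(1)[OF T g be] A.\<delta>_closed[OF a] y, symmetric])
  finally show ?thesis .
qed

sublocale C: crossed_product K H \<Delta> \<epsilon> A \<delta> B act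
  by (intro crossed_product.intro A.left_comodule_algebra_axioms crossed_product_axioms.intro B_closed act_lin)

abbreviation "Q \<equiv> quotient_algebra (free_product K A B) (crossed_ideal K A \<delta> B act)"
abbreviation "iA \<equiv> C.inl1"
abbreviation "iX \<equiv> C.inr1"
abbreviation "HQ \<equiv> tensor K H Q"
abbreviation "kq \<equiv> Kt Q iX"

lemma Q_alg [mlin]: "assoc_algebra K Q" by (rule C.CP_alg)
lemma HQ_alg [mlin]: "assoc_algebra K HQ" by (rule mlin)+
lemma iX_lin: "iX \<in> lin_map K B Q" by (rule alg_homD(1)[OF C.inr1_hom])
lemma iA_lin: "iA \<in> lin_map K A Q" by (rule alg_homD(1)[OF C.inl1_hom])
lemma kq_closed [mlin]: "kq \<in> carrier HQ" by (rule Kt_closed[OF Q_alg iX_lin])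
lemma iX_mult: "dual_mult Q iX"
  unfolding dual_mult_def using alg_homD(2)[OF C.inr1_hom] by (simp add: B_simps(1))
lemma iA_cross: "cross_rel Q iX iA"
  unfolding cross_rel_def using C.CP_cross by (simp add: B_simps(1))

lemma lin_kq_fun [mlin]:
  assumes "assoc_algebra K U" "assoc_algebra K Z"
    "\<And>x. x \<in> carrier Z \<Longrightarrow> bilin K H Q U (\<lambda>v w. \<beta> x v w)"
    "\<And>v w. v \<in> carrier H \<Longrightarrow> w \<in> carrier Q \<Longrightarrow> (\<lambda>x. \<beta> x v w) \<in> lin_map K Z U"
  shows "(\<lambda>x. TL U (\<lambda>v w. \<beta> x v w) kq) \<in> lin_map K Z U"
  using assms by (intro lin_lift_fun[OF H_alg Q_alg]) (auto intro: kq_closed)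

lemmas kq_KC = KC_of_mult[OF Q_alg _ _ _ _ iX_lin iX_mult]
lemmas kq_KA = KA_of_cross[OF Q_alg iX_lin C.inl1_hom _ _ iA_cross]

lemma kq_et:
  assumes T: "assoc_algebra K T" and p: "p \<in> alg_hom K Q T"
  shows "KK T (et T) p kq = \<one>\<^bsub>T\<^esub>"
  by (simp add: KK_et[OF Q_alg T iX_lin p] alg_homD(3)[OF C.inr1_hom] alg_homD(3)[OF p])

text \<open>The value prescribed for the coaction on functionals, taken as a definition; that it
  respects the relations of \<open>Q\<close> is shown by computing its \<open>K\<close>.\<close>

definition dX where
  "dX z = (\<Oplus>\<^bsub>HQ\<^esub>i\<in>I. \<Oplus>\<^bsub>HQ\<^esub>j\<in>I. \<Oplus>\<^bsub>HQ\<^esub>d\<in>D. z (t j \<star> hb d \<star> s i) \<odot>\<^bsub>HQ\<^esub> tens K H Q (s j \<star> t i) (iX (xb d)))"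

lemma dX_eq:
  assumes z: "z \<in> dual"
  shows "dX z = TL HQ (\<lambda>a b. TL HQ (\<lambda>c d. TL HQ (\<lambda>h w.
    z (d \<star> h \<star> a) \<odot>\<^bsub>HQ\<^esub> tens K H Q (c \<star> b) w) kq) R) R"
proof -
  interpret HQ: assoc_algebra K HQ by (rule HQ_alg)
  note zv [mlin] = dual_val[OF z] lin_comp[OF dualD(1)[OF z]]
  let ?F = "\<lambda>a b c d h w. z (d \<star> h \<star> a) \<odot>\<^bsub>HQ\<^esub> tens K H Q (c \<star> b) w"
  have xc: "d \<in> D \<Longrightarrow> iX (xb d) \<in> carrier Q" for d using x_closed[OF Q_alg iX_lin xb] .
  have "TL HQ (\<lambda>a b. TL HQ (\<lambda>c d. TL HQ (?F a b c d) kq) R) R =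
    (\<Oplus>\<^bsub>HQ\<^esub>i\<in>I. TL HQ (\<lambda>c d. TL HQ (?F (s i) (t i) c d) kq) R)"
    by (rule R_lift_sum[OF HQ_alg]) (rule mlin | assumption)+
  also have "\<dots> = (\<Oplus>\<^bsub>HQ\<^esub>i\<in>I. \<Oplus>\<^bsub>HQ\<^esub>j\<in>I. TL HQ (?F (s i) (t i) (s j) (t j)) kq)"
  proof (rule HQ.A.finsum_cong')
    fix i assume "i \<in> I"
    then show "TL HQ (\<lambda>c d. TL HQ (?F (s i) (t i) c d) kq) R = (\<Oplus>\<^bsub>HQ\<^esub>j\<in>I. TL HQ (?F (s i) (t i) (s j) (t j)) kq)"
      by - (rule R_lift_sum[OF HQ_alg], (rule mlin | assumption)+)
  next
    show "(\<lambda>i. \<Oplus>\<^bsub>HQ\<^esub>j\<in>I. TL HQ (?F (s i) (t i) (s j) (t j)) kq) \<in> I \<rightarrow> carrier HQ"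
      by (intro Pi_I HQ.A.finsum_closed) (rule mlin | assumption)+
  qed simp
  also have "\<dots> = (\<Oplus>\<^bsub>HQ\<^esub>i\<in>I. \<Oplus>\<^bsub>HQ\<^esub>j\<in>I. \<Oplus>\<^bsub>HQ\<^esub>d\<in>D. ?F (s i) (t i) (s j) (t j) (hb d) (iX (xb d)))"
  proof (intro HQ.A.finsum_cong' refl)
    fix i j assume "i \<in> I" "j \<in> I"
    then show "TL HQ (?F (s i) (t i) (s j) (t j)) kq = (\<Oplus>\<^bsub>HQ\<^esub>d\<in>D. ?F (s i) (t i) (s j) (t j) (hb d) (iX (xb d)))"
      by - (rule Kt_lift[OF Q_alg iX_lin HQ_alg], (rule mlin | assumption)+)
  qed (intro Pi_I HQ.A.finsum_closed; (rule mlin xc | assumption)+)+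
  finally show ?thesis by (simp add: dX_def)
qed

lemma dX_lin: "dX \<in> lin_map K B HQ"
proof -
  interpret HQ: assoc_algebra K HQ by (rule HQ_alg)
  have xc: "d \<in> D \<Longrightarrow> iX (xb d) \<in> carrier Q" for d using x_closed[OF Q_alg iX_lin xb] .
  have ev: "(\<lambda>z. z h) \<in> lin_map K B base" if "h \<in> carrier H" for h
    by (rule lin_mapI) (use that dual_val in \<open>auto simp: B_simps base_algebra_simps\<close>)
  show ?thesis unfolding dX_def[abs_def]
    by (intro lin_finsum[OF HQ_alg] finite_I finite_D lin_smult_fun[OF HQ_alg] ev) (rule mlin xc | assumption)+
qed

text \<open>The coaction sends \<open>K\<close> to \<open>R\<^sub>2\<^sub>1 K\<^sub>1\<^sub>3 R\<^sub>1\<^sub>2\<close>.\<close>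

lemma KK_dX:
  fixes T (structure)
  assumes T: "assoc_algebra K T" and fk: "comm_homs T f k" and fp: "commute_with Q T f p" and kp: "commute_with Q T k p"
    and p': "p' \<in> lin_map K HQ T" and v: "\<And>c w. c \<in> carrier H \<Longrightarrow> w \<in> carrier Q \<Longrightarrow> p' (tens K H Q c w) = k c \<otimes> p w"
  shows "KK T f p' (Kt HQ dX) = RR T k f \<otimes> (KK T f p kq \<otimes> RR T f k)"
proof -
  interpret T: assoc_algebra K T by (rule T)
  note kf = comm_homs_sym[OF fk]
  note f = alg_homD(1)[OF commD(1)[OF T fk]] and kl = alg_homD(1)[OF commD(2)[OF T fk]] and pl = alg_homD(1)[OF cwD(2)[OF Q_alg T fp]]
  note [mlin] = T lin_comp[OF f] lin_comp[OF kl] lin_comp[OF pl] lin_comp[OF p'] commD(5,6)[OF T fk] cwD(6)[OF Q_alg T fp] lin_mapD(1)[OF p']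
  note [simp] = commD(5,6)[OF T fk] cwD(6)[OF Q_alg T fp] lin_mapD(1)[OF p']
  note ss = alg_homD(2)[OF commD(1)[OF T fk]] alg_homD(2)[OF commD(2)[OF T fk]] T.A.m_assoc
    cwD(4,7)[OF Q_alg T fp] cwD(4,7)[OF Q_alg T kp] commD(4,7)[OF T kf]
  let ?E = "\<lambda>a b c d h w. f (d \<star> h \<star> a) \<otimes> (k (c \<star> b) \<otimes> p w)"
  \<comment> \<open>The \<open>e\<close>-th coordinate of \<open>?E\<close> with respect to the
    argument of \<open>f\<close>; summation over \<open>e\<close> restores \<open>?E\<close> by
    \<open>lin_expand\<close>.\<close>
  let ?G = "\<lambda>e a b c d h w. xb e (d \<star> h \<star> a) \<odot> (f (hb e) \<otimes> (k (c \<star> b) \<otimes> p w))"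
  have step: "f (hb e) \<otimes> p' (dX (xb e)) = TL T (\<lambda>a b. TL T (\<lambda>c d. TL T (?G e a b c d) kq) R) R"
    if e: "e \<in> D" for e
  proof -
    note z = xb[OF e]
    note [mlin] = e dual_val[OF z] lin_comp[OF dualD(1)[OF z]]
    let ?L = "\<lambda>u. f (hb e) \<otimes> p' u"
    let ?F = "\<lambda>a b c d h w. xb e (d \<star> h \<star> a) \<odot>\<^bsub>HQ\<^esub> tens K H Q (c \<star> b) w"
    have L: "?L \<in> lin_map K HQ T" by (rule mlin lin_id)+
    have "?L (dX (xb e)) = TL T (\<lambda>a b. ?L (TL HQ (\<lambda>c d. TL HQ (?F a b c d) kq) R)) R"
      unfolding dX_eq[OF z] by (rule R_hom[OF HQ_alg T L]) (rule mlin | assumption)+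
    also have "\<dots> = TL T (\<lambda>a b. TL T (\<lambda>c d. TL T (?G e a b c d) kq) R) R"
    proof (rule R_cong[OF T, symmetric])
      fix a b assume [simp, mlin]: "a \<in> carrier H" "b \<in> carrier H"
      have "?L (TL HQ (\<lambda>c d. TL HQ (?F a b c d) kq) R) = TL T (\<lambda>c d. ?L (TL HQ (?F a b c d) kq)) R"
        by (rule R_hom[OF HQ_alg T L]) (rule mlin | assumption)+
      also have "\<dots> = TL T (\<lambda>c d. TL T (?G e a b c d) kq) R"
      proof (rule R_cong[OF T, symmetric])
        fix c d assume [simp, mlin]: "c \<in> carrier H" "d \<in> carrier H"
        show "TL T (?G e a b c d) kq = ?L (TL HQ (?F a b c d) kq)" (is "?l = ?r")
        proof -
        have "?r = TL T (\<lambda>h w. ?L (?F a b c d h w)) kq"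
          by (rule lin_tensor_lift[OF H_alg Q_alg HQ_alg T L _ kq_closed]) (rule mlin | assumption)+
        also have "\<dots> = ?l"
          by (rule tensor_lift_cong[OF H_alg Q_alg T _ _ kq_closed, symmetric], (rule mlin | assumption)+)
            (simp add: v lin_mapD(3)[OF p'] dual_val[OF z] e tens_closed[OF H_alg Q_alg] T.smult_mult_right)
        finally show ?thesis by simp
        qed
      qed (rule mlin | assumption)+
      finally show "TL T (\<lambda>c d. TL T (?G e a b c d) kq) R = ?L (TL HQ (\<lambda>c d. TL HQ (?F a b c d) kq) R)" by simp
    qed (rule mlin | assumption)+
    finally show ?thesis .
  qed
  have G: "bilin K H H T (\<lambda>a b. TL T (\<lambda>c d. TL T (?G e a b c d) kq) R)"
    "a \<in> carrier H \<Longrightarrow> b \<in> carrier H \<Longrightarrow> bilin K H H T (\<lambda>c d. TL T (?G e a b c d) kq)"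
    "a \<in> carrier H \<Longrightarrow> b \<in> carrier H \<Longrightarrow> c \<in> carrier H \<Longrightarrow> d \<in> carrier H \<Longrightarrow> bilin K H Q T (?G e a b c d)"
    if e: "e \<in> D" for e a b c d
  proof -
    note z = xb[OF e]
    note [mlin] = e dual_val[OF z] lin_comp[OF dualD(1)[OF z]]
    show "bilin K H H T (\<lambda>a b. TL T (\<lambda>c d. TL T (?G e a b c d) kq) R)"
      "a \<in> carrier H \<Longrightarrow> b \<in> carrier H \<Longrightarrow> bilin K H H T (\<lambda>c d. TL T (?G e a b c d) kq)"
      "a \<in> carrier H \<Longrightarrow> b \<in> carrier H \<Longrightarrow> c \<in> carrier H \<Longrightarrow> d \<in> carrier H \<Longrightarrow> bilin K H Q T (?G e a b c d)"
      by (rule mlin | assumption)+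
  qed
  have "KK T f p' (Kt HQ dX) = (\<Oplus>e\<in>D. f (hb e) \<otimes> p' (dX (xb e)))"
    by (rule KK_Kt[OF HQ_alg T dX_lin f p'])
  also have "\<dots> = (\<Oplus>e\<in>D. TL T (\<lambda>a b. TL T (\<lambda>c d. TL T (?G e a b c d) kq) R) R)"
    by (rule T.A.finsum_cong') (use step R_lift_closed[OF T G(1)] in auto)
  also have "\<dots> = TL T (\<lambda>a b. \<Oplus>e\<in>D. TL T (\<lambda>c d. TL T (?G e a b c d) kq) R) R"
    by (rule tensor_lift_finsum[OF H_alg H_alg T finite_D G(1) R_closed])
  also have "\<dots> = TL T (\<lambda>a b. TL T (\<lambda>c d. TL T (?E a b c d) kq) R) R"
  proof (rule R_cong[OF T, symmetric])
    fix a b assume ab [simp, mlin]: "a \<in> carrier H" "b \<in> carrier H"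
    have "(\<Oplus>e\<in>D. TL T (\<lambda>c d. TL T (?G e a b c d) kq) R) =
      TL T (\<lambda>c d. \<Oplus>e\<in>D. TL T (?G e a b c d) kq) R"
      by (rule tensor_lift_finsum[OF H_alg H_alg T finite_D G(2)[OF _ ab] R_closed])
    also have "\<dots> = TL T (\<lambda>c d. TL T (?E a b c d) kq) R"
    proof (rule R_cong[OF T, symmetric])
      fix c d assume cd [simp, mlin]: "c \<in> carrier H" "d \<in> carrier H"
      have "(\<Oplus>e\<in>D. TL T (?G e a b c d) kq) = TL T (\<lambda>h w. \<Oplus>e\<in>D. ?G e a b c d h w) kq"
        by (rule tensor_lift_finsum[OF H_alg Q_alg T finite_D G(3)[OF _ ab cd] kq_closed])
      also have "\<dots> = TL T (?E a b c d) kq"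
      proof (rule tensor_lift_cong[OF H_alg Q_alg T _ _ kq_closed, symmetric])
        fix h w assume [simp, mlin]: "h \<in> carrier H" "w \<in> carrier Q"
        have "(\<lambda>u. f u \<otimes> (k (c \<star> b) \<otimes> p w)) \<in> lin_map K H T" by (rule mlin)+
        from lin_expand[OF T this, of "d \<star> h \<star> a"] show "?E a b c d h w = (\<Oplus>e\<in>D. ?G e a b c d h w)" by simp
      qed (rule mlin | assumption)+
      finally show "TL T (?E a b c d) kq = (\<Oplus>e\<in>D. TL T (?G e a b c d) kq)" by simp
    qed (rule mlin | assumption)+
    finally show "TL T (\<lambda>c d. TL T (?E a b c d) kq) R =
      (\<Oplus>e\<in>D. TL T (\<lambda>c d. TL T (?G e a b c d) kq) R)" by simp
  qed (rule mlin | assumption)+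
  also have "\<dots> = TL T (\<lambda>c d. TL T (\<lambda>a b. TL T (?E a b c d) kq) R) R"
    by (rule R_swap[OF T]) (rule mlin | assumption)+
  also have "\<dots> = TL T (\<lambda>c d. (k c \<otimes> f d) \<otimes> (KK T f p kq \<otimes> RR T f k)) R"
  proof (rule R_cong[OF T])
    fix c d assume [simp, mlin]: "c \<in> carrier H" "d \<in> carrier H"
    let ?L = "\<lambda>u. (k c \<otimes> f d) \<otimes> u"
    have L: "?L \<in> lin_map K T T" by (rule mlin)+
    have "KK T f p kq \<otimes> RR T f k = TL T (\<lambda>h w. TL T (\<lambda>a b. (f h \<otimes> p w) \<otimes> (f a \<otimes> k b)) R) kq"
      unfolding KK_def RR_def
      by (rule mult_lifts[OF H_alg Q_alg H_alg H_alg T cwD(3)[OF Q_alg T fp] commD(3)[OF T fk] kq_closed R_closed])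
    also have "\<dots> = TL T (\<lambda>a b. TL T (\<lambda>h w. (f h \<otimes> p w) \<otimes> (f a \<otimes> k b)) kq) R"
      by (rule tensor_lift_swap[OF H_alg Q_alg H_alg H_alg T kq_closed R_closed]) (rule mlin | assumption)+
    finally have "?L (KK T f p kq \<otimes> RR T f k) = ?L \<dots>" by simp
    also have "\<dots> = TL T (\<lambda>a b. ?L (TL T (\<lambda>h w. (f h \<otimes> p w) \<otimes> (f a \<otimes> k b)) kq)) R"
      by (rule R_hom[OF T T L]) (rule mlin | assumption)+
    also have "\<dots> = TL T (\<lambda>a b. TL T (?E a b c d) kq) R"
    proof (rule R_cong[OF T, symmetric])
      fix a b assume [simp, mlin]: "a \<in> carrier H" "b \<in> carrier H"
      show "TL T (?E a b c d) kq = ?L (TL T (\<lambda>h w. (f h \<otimes> p w) \<otimes> (f a \<otimes> k b)) kq)" (is "?l = ?r")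
      proof -
      have "?r =
        TL T (\<lambda>h w. ?L ((f h \<otimes> p w) \<otimes> (f a \<otimes> k b))) kq"
        by (rule lin_tensor_lift[OF H_alg Q_alg T T L _ kq_closed]) (rule mlin | assumption)+
      also have "\<dots> = ?l"
        by (rule tensor_lift_cong[OF H_alg Q_alg T _ _ kq_closed], (rule mlin | assumption)+) (simp add: ss)
      finally show ?thesis by simp
      qed
    qed (rule mlin | assumption)+
    finally show "TL T (\<lambda>a b. TL T (?E a b c d) kq) R = ?L (KK T f p kq \<otimes> RR T f k)" by simp
  qed (rule mlin | assumption)+
  also have "\<dots> = RR T k f \<otimes> (KK T f p kq \<otimes> RR T f k)"
    unfolding RR_def[of T k f]
    by (rule mult_tensor_lift(2)[OF H_alg H_alg T commD(3)[OF T kf] R_closed, symmetric])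
      (simp add: KK_closed[OF Q_alg T fp kq_closed] RR_closed[OF T fk])
  finally show ?thesis .
qed

end

text \<open>Each two-letter variable is the R-matrix in the legs named by its letters, and
  \<open>Kf\<close>, \<open>Kg\<close>, \<open>Kc\<close> are \<open>K\<close> in the legs
  \<open>f\<close>, \<open>g\<close> and their convolution. With \<open>y1\<close>,
  \<open>y2\<close> the Yang--Baxter equations and \<open>c1\<close>, \<open>c2\<close> commutation
  of disjoint legs, it says that surrounding a solution by R-matrices gives a solution.\<close>

lemma (in monoid) reflection_swap:
  assumes [simp]: "kg \<in> carrier G" "kf \<in> carrier G" "fk \<in> carrier G" "gk \<in> carrier G" "gf \<in> carrier G"
    "Kf \<in> carrier G" "Kg \<in> carrier G" "Kc \<in> carrier G"
    and KC: "Kc \<otimes> gf = Kg \<otimes> (gf \<otimes> Kf)"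
    and y1: "gf \<otimes> (gk \<otimes> fk) = fk \<otimes> (gk \<otimes> gf)" and y2: "gk \<otimes> (gf \<otimes> kf) = kf \<otimes> (gf \<otimes> gk)"
    and c1: "kf \<otimes> Kg = Kg \<otimes> kf" and c2: "gk \<otimes> Kf = Kf \<otimes> gk"
  shows "((kg \<otimes> kf) \<otimes> (Kc \<otimes> (fk \<otimes> gk))) \<otimes> gf = (kg \<otimes> (Kg \<otimes> gk)) \<otimes> (gf \<otimes> (kf \<otimes> (Kf \<otimes> fk)))"
proof -
  have "((kg \<otimes> kf) \<otimes> (Kc \<otimes> (fk \<otimes> gk))) \<otimes> gf = (kg \<otimes> kf) \<otimes> (Kc \<otimes> (fk \<otimes> (gk \<otimes> gf)))" by (simp add: m_assoc)
  also have "\<dots> = (kg \<otimes> kf) \<otimes> ((Kc \<otimes> gf) \<otimes> (gk \<otimes> fk))" by (simp only: y1[symmetric]) (simp add: m_assoc)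
  also have "\<dots> = kg \<otimes> ((kf \<otimes> Kg) \<otimes> (gf \<otimes> ((Kf \<otimes> gk) \<otimes> fk)))" by (simp add: KC m_assoc)
  also have "\<dots> = kg \<otimes> (Kg \<otimes> ((kf \<otimes> (gf \<otimes> gk)) \<otimes> (Kf \<otimes> fk)))" by (simp only: c1 c2[symmetric]) (simp add: m_assoc)
  also have "\<dots> = (kg \<otimes> (Kg \<otimes> gk)) \<otimes> (gf \<otimes> (kf \<otimes> (Kf \<otimes> fk)))" by (simp only: y2[symmetric]) (simp add: m_assoc)
  finally show ?thesis .
qed

section \<open>The transformed solution and the coaction it defines\<close>

context reflective_data
begin

lemma RR_KK:
  fixes T (structure)
  assumes T: "assoc_algebra K T" and V: "assoc_algebra K V" and k: "k \<in> carrier (tensor K H V)"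
    and gh: "comm_homs T g h" and fp: "commute_with V T f p" and gp: "commute_with V T g p" and hp: "commute_with V T h p"
    and fg: "comm_homs T f g" and fh: "comm_homs T f h"
  shows "RR T g h \<otimes> KK T f p k = KK T f p k \<otimes> RR T g h"
proof (rule RR_commute[OF T gh KK_closed[OF V T fp k]])
  fix a assume a: "a \<in> carrier H"
  show "g a \<otimes> KK T f p k = KK T f p k \<otimes> g a"
    by (rule KK_commute[OF V T fp k commD(6)[OF T fg a], symmetric])
      (erule commD(4)[OF T fg _ a], erule cwD(4)[OF V T gp a])
  show "h a \<otimes> KK T f p k = KK T f p k \<otimes> h a"
    by (rule KK_commute[OF V T fp k commD(6)[OF T fh a], symmetric])
      (erule commD(4)[OF T fh _ a], erule cwD(4)[OF V T hp a])
qed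

definition kl where "kl p' = (\<lambda>a. p' (tens K H Q a \<one>\<^bsub>Q\<^esub>))"
definition pr where "pr p' = (\<lambda>w. p' (tens K H Q \<one>\<^bsub>H\<^esub> w))"

text \<open>An algebra map on \<open>H \<otimes> Q\<close> is a pair of commuting legs. Together
  with \<open>f\<close> they are the three legs in which \<open>R_21\<close>, \<open>K_13\<close>
  and \<open>R_12\<close> are placed.\<close>

lemma split_HQ:
  fixes T (structure)
  assumes T: "assoc_algebra K T" and fp: "commute_with HQ T f p'"
  shows "comm_homs T f (kl p')" "commute_with Q T f (pr p')" "commute_with Q T (kl p') (pr p')"
    and "c \<in> carrier H \<Longrightarrow> w \<in> carrier Q \<Longrightarrow> p' (tens K H Q c w) = kl p' c \<otimes> pr p' w"
proof -
  note p = cwD(2)[OF HQ_alg T fp] and th = tens_hom[OF H_alg Q_alg]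
  note khom = alg_hom_comp[OF th(1) p] and phom = alg_hom_comp[OF th(2) p]
  note tc = alg_hom_closed[OF th(1)] alg_hom_closed[OF th(2)]
  show "comm_homs T f (kl p')" unfolding comm_homs_def kl_def
    by (intro conjI ballI cwD(1)[OF HQ_alg T fp] khom) (rule cwD(4)[OF HQ_alg T fp, symmetric], assumption, erule tc)
  show "commute_with Q T f (pr p')" unfolding pr_def
    by (rule commute_with_comp[OF HQ_alg T fp th(2)])
  show v: "c \<in> carrier H \<Longrightarrow> w \<in> carrier Q \<Longrightarrow> p' (tens K H Q c w) = kl p' c \<otimes> pr p' w" for c w
    unfolding kl_def pr_def by (simp add: alg_homD(2)[OF p, symmetric] tc th(3))
  show "commute_with Q T (kl p') (pr p')"
    unfolding commute_with_def
  proof (intro conjI ballI)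
    fix a q assume [simp]: "a \<in> carrier H" "q \<in> carrier Q"
    show "kl p' a \<otimes> pr p' q = pr p' q \<otimes> kl p' a"
      unfolding kl_def pr_def by (simp add: alg_homD(2)[OF p, symmetric] tc th(3,4))
  qed (simp_all add: khom phom kl_def[abs_def] pr_def[abs_def])
qed

lemma KK_dX':
  fixes T (structure)
  assumes T: "assoc_algebra K T" and fp: "commute_with HQ T f p'"
  shows "KK T f p' (Kt HQ dX) = RR T (kl p') f \<otimes> (KK T f (pr p') kq \<otimes> RR T f (kl p'))"
  by (rule KK_dX[OF T split_HQ(1-3)[OF T fp] alg_homD(1)[OF cwD(2)[OF HQ_alg T fp]] split_HQ(4)[OF T fp]])

text \<open>The R-matrices with a convolution leg split by the coproduct axioms; after that the
  claim is \<open>reflection_swap\<close> with two instances of \<open>YBE\<close>.\<close>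

lemma dX_KC:
  fixes T (structure)
  assumes T: "assoc_algebra K T" and fg: "comm_homs T f g" and fp: "commute_with HQ T f p'" and gp: "commute_with HQ T g p'"
  shows "KK T (cv T f g) p' (Kt HQ dX) \<otimes> RR T g f =
    KK T g p' (Kt HQ dX) \<otimes> (RR T g f \<otimes> KK T f p' (Kt HQ dX))"
proof -
  interpret T: assoc_algebra K T by (rule T)
  note gf = comm_homs_sym[OF fg]
  note cp = commute_with_cv[OF HQ_alg T fg fp gp]
  note F = split_HQ[OF T fp] and G = split_HQ[OF T gp] and C = split_HQ[OF T cp]
  note kf = comm_homs_sym[OF F(1)] and kg = comm_homs_sym[OF G(1)]
  note KC = kq_KC[OF T fg F(2) G(2)]
  show ?thesis
    unfolding KK_dX'[OF T fp] KK_dX'[OF T gp] KK_dX'[OF T cp] RR_cv_left[OF T fg F(1) G(1)] RR_cv_right[OF T kf kg fg]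
    by (rule T.A.reflection_swap[OF _ _ _ _ _ _ _ _ KC YBE[OF T gf G(1) F(1)] YBE[OF T G(1) gf kf]
          RR_KK[OF T Q_alg kq_closed kf G(2) F(3) F(2) G(1) gf] RR_KK[OF T Q_alg kq_closed G(1) F(2) G(2) F(3) fg F(1)]])
      (rule RR_closed[OF T] KK_closed[OF Q_alg T _ kq_closed] kf kg F G C gf)+
qed

lemma dX_mult: "dual_mult HQ dX"
  by (rule mult_of_KC[OF HQ_alg dX_lin])
    (rule dX_KC[OF T3_alg[OF HQ_alg dX_lin] fg3[OF HQ_alg dX_lin] fp3[OF HQ_alg dX_lin] gp3[OF HQ_alg dX_lin]])

lemma et_commute:
  assumes V: "assoc_algebra K V" and T: "assoc_algebra K T" and p: "p \<in> alg_hom K V T"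
  shows "commute_with V T (et T) p"
proof -
  interpret T: assoc_algebra K T by (rule T)
  show ?thesis
    by (rule commute_withI[OF et_hom[OF T] p])
      (simp add: et_def \<epsilon>_closed alg_hom_closed[OF p] T.smult_mult_left T.smult_mult_right)
qed

lemma KK_dX_et:
  assumes T: "assoc_algebra K T" and p: "p' \<in> alg_hom K HQ T"
  shows "KK T (et T) p' (Kt HQ dX) = \<one>\<^bsub>T\<^esub>"
proof -
  interpret T: assoc_algebra K T by (rule T)
  note fp = et_commute[OF HQ_alg T p]
  note F = split_HQ[OF T fp]
  show ?thesis
    unfolding KK_dX'[OF T fp]
    by (simp add: RR_et[OF T commD(2)[OF T F(1)]] kq_et[OF T cwD(2)[OF Q_alg T F(2)]])
qed

lemma dX_hom: "dX \<in> alg_hom K B HQ"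
proof (rule alg_homI[OF dX_lin])
  show "dX (x \<otimes>\<^bsub>B\<^esub> y) = dX x \<otimes>\<^bsub>HQ\<^esub> dX y" if "x \<in> carrier B" "y \<in> carrier B" for x y
    using dX_mult that by (simp add: dual_mult_def B_simps(1))
  have id: "(\<lambda>w. w) \<in> alg_hom K HQ HQ" by (rule alg_homI[OF lin_id]) simp_all
  show "dX \<one>\<^bsub>B\<^esub> = \<one>\<^bsub>HQ\<^esub>"
    using KK_et[OF HQ_alg HQ_alg dX_lin id] KK_dX_et[OF HQ_alg id] by simp
qed

lemma co_alg_hom:
  fixes T (structure)
  assumes T: "assoc_algebra K T" and f: "f \<in> alg_hom K H T" and be: "be \<in> alg_hom K A T"
    and c: "\<And>a b. a \<in> carrier H \<Longrightarrow> b \<in> carrier A \<Longrightarrow> f a \<otimes> be b = be b \<otimes> f a"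
  shows "co T f be \<in> alg_hom K A T"
  unfolding co_def by (rule alg_hom_comp[OF A.coaction_hom tensor_lift_alg_hom(2)[OF H_alg A_alg T f be c]])

text \<open>The map induced by \<open>\<delta>\<close>, written as \<open>co\<close> so that
  regrouping and intertwining of coactions apply to it; \<open>dA_eq\<close> returns to
  \<open>tensor_map\<close>.\<close>

definition dA where "dA = co HQ (\<lambda>a. tens K H Q a \<one>\<^bsub>Q\<^esub>) (\<lambda>b. tens K H Q \<one>\<^bsub>H\<^esub> (iA b))"

lemma dA_hom: "dA \<in> alg_hom K A HQ"
  unfolding dA_def
  by (rule co_alg_hom[OF HQ_alg tens_hom(1)[OF H_alg Q_alg] alg_hom_comp[OF C.inl1_hom tens_hom(2)[OF H_alg Q_alg]]])
    (simp add: tens_hom(3,4)[OF H_alg Q_alg] alg_hom_closed[OF C.inl1_hom])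

lemma dA_eq:
  assumes a: "a \<in> carrier A"
  shows "dA a = tensor_map K H Q (\<lambda>x. x) iA (\<delta> a)"
  unfolding dA_def co_def tensor_map_def
  by (rule A.co_cong[OF HQ_alg tensor_map_bilin[OF H_alg Q_alg lin_id iA_lin] _ a, symmetric])
    (simp add: tens_hom(3)[OF H_alg Q_alg] alg_hom_closed[OF C.inl1_hom])

lemma hom_dA:
  assumes T: "assoc_algebra K T" and p: "p' \<in> alg_hom K HQ T" and a: "a \<in> carrier A"
  shows "p' (dA a) = co T (kl p') (\<lambda>b. pr p' (iA b)) a"
proof -
  note th = tens_hom[OF H_alg Q_alg] and ic = alg_hom_closed[OF C.inl1_hom]
  have b: "bilin K H A HQ (\<lambda>l b. tens K H Q l \<one>\<^bsub>Q\<^esub> \<otimes>\<^bsub>HQ\<^esub> tens K H Q \<one>\<^bsub>H\<^esub> (iA b))"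
    by (rule co_lin(1)[OF HQ_alg alg_homD(1)[OF th(1)] lin_comp[OF alg_homD(1)[OF th(2)] iA_lin]])
  have "p' (dA a) = TL T (\<lambda>l b. p' (tens K H Q l \<one>\<^bsub>Q\<^esub> \<otimes>\<^bsub>HQ\<^esub> tens K H Q \<one>\<^bsub>H\<^esub> (iA b))) (\<delta> a)"
    unfolding dA_def co_def by (rule A.co_hom[OF HQ_alg T alg_homD(1)[OF p] b a])
  also have "\<dots> = co T (kl p') (\<lambda>b. pr p' (iA b)) a"
    unfolding co_def kl_def pr_def
    by (rule A.co_cong[OF T co_lin(1)[OF T lin_comp[OF alg_homD(1)[OF p] alg_homD(1)[OF th(1)]]
            lin_comp[OF alg_homD(1)[OF p] lin_comp[OF alg_homD(1)[OF th(2)] iA_lin]]] _ a, symmetric])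
      (simp add: alg_homD(2)[OF p] alg_hom_closed[OF th(1)] alg_hom_closed[OF th(2)] ic)
  finally show ?thesis .
qed

lemma co_cong_fun:
  assumes T: "assoc_algebra K T" and f: "f \<in> lin_map K H T" and be: "be \<in> lin_map K A T" and a: "a \<in> carrier A"
    and "\<And>b. b \<in> carrier A \<Longrightarrow> be b = be' b"
  shows "co T f be a = co T f be' a"
  unfolding co_def by (rule A.co_cong[OF T co_lin(1)[OF T f be] _ a]) (simp add: assms(5))

lemma co_dA:
  assumes T: "assoc_algebra K T" and fp: "commute_with HQ T f p'" and a: "a \<in> carrier A"
  shows "co T f (\<lambda>b. p' (dA b)) a = co T (cv T f (kl p')) (\<lambda>b. pr p' (iA b)) a"
proof -
  note p = cwD(2)[OF HQ_alg T fp] and F = split_HQ[OF T fp]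
  note f = alg_homD(1)[OF cwD(1)[OF HQ_alg T fp]]
  note be = lin_comp[OF alg_homD(1)[OF cwD(2)[OF Q_alg T F(2)]] iA_lin]
  have "co T f (\<lambda>b. p' (dA b)) a = co T f (co T (kl p') (\<lambda>b. pr p' (iA b))) a"
    by (rule co_cong_fun[OF T f lin_comp[OF alg_homD(1)[OF p] alg_homD(1)[OF dA_hom]] a hom_dA[OF T p]])
  also have "\<dots> = co T (cv T f (kl p')) (\<lambda>b. pr p' (iA b)) a"
    by (rule co_co[OF T F(1) be a])
  finally show ?thesis .
qed

text \<open>The three factors act on the doubled coaction in turn: \<open>RR T f (kl p')\<close>
  exchanges its two legs, \<open>K\<close> commutes with the exchanged version because the
  \<open>f\<close> leg is then innermost and \<open>kq_KA\<close> applies, and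
  \<open>RR T (kl p') f\<close> exchanges the legs back.\<close>

lemma dX_KA:
  fixes T (structure)
  assumes T: "assoc_algebra K T" and fp: "commute_with HQ T f p'" and a: "a \<in> carrier A"
  shows "KK T f p' (Kt HQ dX) \<otimes> co T f (\<lambda>b. p' (dA b)) a = co T f (\<lambda>b. p' (dA b)) a \<otimes> KK T f p' (Kt HQ dX)"
proof -
  interpret T: assoc_algebra K T by (rule T)
  note p = cwD(2)[OF HQ_alg T fp] and F = split_HQ[OF T fp]
  note f = alg_homD(1)[OF cwD(1)[OF HQ_alg T fp]]
  note kf = comm_homs_sym[OF F(1)]
  let ?k = "kl p'" and ?be = "\<lambda>b. pr p' (iA b)"
  note phom = cwD(2)[OF Q_alg T F(2)]
  note be = lin_comp[OF alg_homD(1)[OF phom] iA_lin]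
  note cfk = alg_homD(1)[OF cv_hom[OF T F(1)]] and ckf = alg_homD(1)[OF cv_hom[OF T kf]]
  note ic = alg_hom_closed[OF C.inl1_hom]
  have bc: "b \<in> carrier A \<Longrightarrow> ?be b \<in> carrier T" for b by (rule lin_mapD(1)[OF be])
  let ?K = "KK T f (pr p') kq" and ?r = "RR T f ?k" and ?r' = "RR T ?k f"
  let ?c = "co T (cv T f ?k) ?be a" and ?c' = "co T (cv T ?k f) ?be a"
  have cl [simp]: "?K \<in> carrier T" "?r \<in> carrier T" "?r' \<in> carrier T" "?c \<in> carrier T" "?c' \<in> carrier T"
    by (rule KK_closed[OF Q_alg T F(2) kq_closed] RR_closed[OF T F(1)] RR_closed[OF T kf] lin_mapD(1)[OF co_lin(2)[OF T cfk be] a]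
        lin_mapD(1)[OF co_lin(2)[OF T ckf be] a])+
  have rb: "RR T g h \<otimes> ?be b = ?be b \<otimes> RR T g h"
    if "comm_homs T g h" "commute_with Q T g (pr p')" "commute_with Q T h (pr p')" and b: "b \<in> carrier A" for g h b
    by (rule RR_commute[OF T that(1) bc[OF b]])
      (rule cwD(4)[OF Q_alg T that(2), symmetric] cwD(4)[OF Q_alg T that(3), symmetric]; simp add: ic b)+
  have e1: "?r \<otimes> ?c = ?c' \<otimes> ?r"
    by (rule co_intertwine[OF T cfk ckf be a RR_closed[OF T F(1)] RR_cv[OF T F(1)] rb[OF F(1) F(2,3)]])
  have e2: "?r' \<otimes> ?c' = ?c \<otimes> ?r'"
    by (rule co_intertwine[OF T ckf cfk be a RR_closed[OF T kf] RR_cv[OF T kf] rb[OF kf F(3,2)]])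
  have e3: "?K \<otimes> ?c' = ?c' \<otimes> ?K"
    unfolding co_co[OF T kf be a, symmetric]
  proof (rule co_intertwine[OF T alg_homD(1)[OF commD(2)[OF T F(1)]] alg_homD(1)[OF commD(2)[OF T F(1)]] co_lin(2)[OF T f be] a cl(1)])
    show "?K \<otimes> ?k l = ?k l \<otimes> ?K" if l: "l \<in> carrier H" for l
      by (rule KK_commute[OF Q_alg T F(2) kq_closed commD(6)[OF T F(1) l]])
        (erule commD(4)[OF T F(1) _ l], erule cwD(4)[OF Q_alg T F(3) l])
    show "?K \<otimes> co T f ?be b = co T f ?be b \<otimes> ?K" if "b \<in> carrier A" for b
      by (rule kq_KA[OF T F(2) that])
  qed
  have "(?r' \<otimes> (?K \<otimes> ?r)) \<otimes> ?c = ?r' \<otimes> (?K \<otimes> (?r \<otimes> ?c))" by (simp add: T.A.m_assoc)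
  also have "\<dots> = ?r' \<otimes> ((?K \<otimes> ?c') \<otimes> ?r)" by (simp only: e1) (simp add: T.A.m_assoc)
  also have "\<dots> = (?r' \<otimes> ?c') \<otimes> (?K \<otimes> ?r)" by (simp only: e3) (simp add: T.A.m_assoc)
  also have "\<dots> = ?c \<otimes> (?r' \<otimes> (?K \<otimes> ?r))" by (simp only: e2) (simp add: T.A.m_assoc)
  finally show ?thesis unfolding KK_dX'[OF T fp] co_dA[OF T fp a] .
qed

lemma dX_cross: "cross_rel HQ dX dA"
  by (rule cross_of_KA[OF HQ_alg dX_lin dA_hom])
    (rule dX_KA[OF assoc_algebra_tensor[OF H_alg HQ_alg] commute_tens[OF HQ_alg]])

text \<open>\<open>dA\<close> and \<open>dX\<close> are algebra maps satisfying the cross relations,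
  so the universal property of \<open>Q\<close> joins them into one map.\<close>

lemma reflective_coaction:
  obtains d where "d \<in> alg_hom K Q HQ" "\<And>a. a \<in> carrier A \<Longrightarrow> d (iA a) = dA a" "\<And>z. z \<in> dual \<Longrightarrow> d (iX z) = dX z"
proof -
  have "dX z \<otimes>\<^bsub>HQ\<^esub> dA a = TL HQ (\<lambda>l b. dA b \<otimes>\<^bsub>HQ\<^esub> dX (act z l)) (\<delta> a)"
    if "z \<in> carrier B" "a \<in> carrier A" for z a
    using dX_cross that by (simp add: cross_rel_def B_simps(1))
  from C.CP_universal[OF HQ_alg dA_hom dX_hom this] obtain p where "p \<in> alg_hom K Q HQ"
    "\<And>a. a \<in> carrier A \<Longrightarrow> p (iA a) = dA a" "\<And>b. b \<in> carrier B \<Longrightarrow> p (iX b) = dX b" by blast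
  then show thesis by (rule that) (auto simp: B_simps(1))
qed

end

section \<open>The comodule axioms\<close>

context reflective_data
begin

lemma alg_hom_Q_eq:
  assumes T: "assoc_algebra K T" and F: "F \<in> alg_hom K Q T" and G: "G \<in> alg_hom K Q T"
    and A: "\<And>a. a \<in> carrier A \<Longrightarrow> F (iA a) = G (iA a)" and X1: "\<And>z. z \<in> dual \<Longrightarrow> F (iX z) = G (iX z)"
    and q: "q \<in> carrier Q"
  shows "F q = G q"
proof (rule C.lin_map_CP_eq[OF T alg_homD(1)[OF F] alg_homD(1)[OF G] _ q])
  fix a x assume ax: "a \<in> carrier A" "x \<in> carrier B"
  then show "F (iA a \<otimes>\<^bsub>Q\<^esub> iX x) = G (iA a \<otimes>\<^bsub>Q\<^esub> iX x)"
    by (simp add: alg_homD(2)[OF F] alg_homD(2)[OF G] alg_hom_closed[OF C.inl1_hom] alg_hom_closed[OF C.inr1_hom] A X1 B_simps(1))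
qed

abbreviation "TQ \<equiv> tensor3 K H H Q"
abbreviation "fQ \<equiv> \<lambda>a. tens3 K H H Q a \<one>\<^bsub>H\<^esub> \<one>\<^bsub>Q\<^esub>"
abbreviation "gQ \<equiv> \<lambda>b. tens3 K H H Q \<one>\<^bsub>H\<^esub> b \<one>\<^bsub>Q\<^esub>"
abbreviation "pQ \<equiv> \<lambda>w. tens3 K H H Q \<one>\<^bsub>H\<^esub> \<one>\<^bsub>H\<^esub> w"
abbreviation "jQ \<equiv> \<lambda>w. tens K H HQ \<one>\<^bsub>H\<^esub> w"

lemmas TQ_alg = T3_alg[OF Q_alg iX_lin]
lemmas fgQ = fg3[OF Q_alg iX_lin] and fpQ = fp3[OF Q_alg iX_lin] and gpQ = gp3[OF Q_alg iX_lin]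
  and legsQ = legs3[OF Q_alg iX_lin]

lemma fjQ: "commute_with HQ TQ fQ jQ"
proof -
  have "fQ = (\<lambda>a. tens K H HQ a \<one>\<^bsub>HQ\<^esub>)" by (simp add: tens3_def tens_one[OF H_alg Q_alg])
  then show ?thesis using commute_tens[OF HQ_alg] by (simp add: tensor3_def)
qed

lemma jQ_split: "kl jQ = gQ" "pr jQ = pQ"
  by (simp_all add: kl_def pr_def tens3_def)

text \<open>Comultiplying the first factor means that the first leg of \<open>K\<close> becomes the
  convolution of the first two legs of \<open>H \<otimes> H \<otimes> Q\<close>.\<close>

lemma comult_KK:
  assumes z: "z \<in> carrier HQ"
  shows "tensor_assoc K H H Q (tensor_map K (tensor K H H) Q \<Delta> (\<lambda>x. x) z) = KK TQ (cv TQ fQ gQ) pQ z"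
proof -
  interpret TQ: assoc_algebra K TQ by (rule TQ_alg)
  interpret Qa: assoc_algebra K Q by (rule Q_alg)
  note b3 = tens3_trilin[OF H_alg H_alg Q_alg]
  note cp = commute_with_cv[OF Q_alg TQ_alg fgQ fpQ gpQ]
  have b: "bilin K (tensor K H H) Q TQ (\<lambda>x w. TL TQ (\<lambda>u v. tens3 K H H Q u v w) x)"
  proof (rule bilinI)
    fix v assume v: "v \<in> carrier (tensor K H H)"
    show "(\<lambda>w. TL TQ (\<lambda>u v. tens3 K H H Q u v w) v) \<in> lin_map K Q TQ"
      by (rule lin_lift_fun[OF H_alg H_alg TQ_alg v Q_alg]) (erule trilinD(6)[OF b3], erule trilinD(1)[OF b3])
  next
    fix w assume w: "w \<in> carrier Q"
    show "(\<lambda>x. TL TQ (\<lambda>u v. tens3 K H H Q u v w) x) \<in> lin_map K (tensor K H H) TQ"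
      by (rule tensor_lift_lin[OF H_alg H_alg TQ_alg trilinD(6)[OF b3 w]])
  qed
  have "tensor_assoc K H H Q (tensor_map K (tensor K H H) Q \<Delta> (\<lambda>x. x) z) =
    TL TQ (\<lambda>a w. TL TQ (\<lambda>u v. tens3 K H H Q u v w) (\<Delta> a)) z"
    unfolding tensor_assoc_def
    by (rule tensor_lift_tensor_map[OF H_alg Q_alg HH_alg Q_alg TQ_alg \<Delta>_lin lin_id b z])
  also have "\<dots> = KK TQ (cv TQ fQ gQ) pQ z"
    unfolding KK_def
  proof (rule tensor_lift_cong[OF H_alg Q_alg TQ_alg cwD(3)[OF Q_alg TQ_alg cp] _ z, symmetric])
    fix a w assume a: "a \<in> carrier H" and w: "w \<in> carrier Q"
    note pc = cwD(6)[OF Q_alg TQ_alg fpQ w]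
    show "cv TQ fQ gQ a \<otimes>\<^bsub>TQ\<^esub> pQ w = TL TQ (\<lambda>u v. tens3 K H H Q u v w) (\<Delta> a)" (is "?l = ?r")
    proof -
    have "?l = TL TQ (\<lambda>u v. (fQ u \<otimes>\<^bsub>TQ\<^esub> gQ v) \<otimes>\<^bsub>TQ\<^esub> pQ w) (\<Delta> a)"
      unfolding cv_def by (rule mult_tensor_lift(2)[OF H_alg H_alg TQ_alg commD(3)[OF TQ_alg fgQ] \<Delta>_closed[OF a] pc])
    also have "\<dots> = ?r"
      by (rule sw_cong[OF TQ_alg trilinD(6)[OF b3 w] _ a, symmetric]) (simp add: tens3_mult[OF H_alg H_alg Q_alg] w)
    finally show ?thesis .
    qed
  qed
  finally show ?thesis .
qed

lemma map_right_KK: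
  assumes d: "d \<in> alg_hom K Q HQ" and z: "z \<in> carrier HQ"
  shows "tensor_map K H HQ (\<lambda>x. x) d z = KK TQ fQ (\<lambda>w. jQ (d w)) z"
proof -
  note cp = commute_with_comp[OF HQ_alg TQ_alg fjQ d]
  have "tensor_map K H HQ (\<lambda>x. x) d z = TL TQ (\<lambda>a w. tens K H HQ a (d w)) z"
    by (simp add: tensor_map_def tensor3_def)
  also have "\<dots> = KK TQ fQ (\<lambda>w. jQ (d w)) z"
    unfolding KK_def
    by (rule tensor_lift_cong[OF H_alg Q_alg TQ_alg cwD(3)[OF Q_alg TQ_alg cp] _ z, symmetric])
      (simp add: tens3_def tens_one[OF H_alg Q_alg] tensor3_def tens_hom(3)[OF H_alg HQ_alg] alg_hom_closed[OF d])
  finally show ?thesis .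
qed

lemma hom_cv:
  fixes T (structure)
  assumes T: "assoc_algebra K T" and U: "assoc_algebra K U" and p: "p \<in> alg_hom K T U" and fg: "comm_homs T f g" and a: "a \<in> carrier H"
  shows "p (cv T f g a) = cv U (\<lambda>x. p (f x)) (\<lambda>x. p (g x)) a"
proof -
  note c = commD(5,6)[OF T fg] and h = alg_homD(1)[OF p]
  have b: "bilin K H H U (\<lambda>x y. p (f x \<otimes> g y))" by (intro bilinI lin_comp[OF h] bilinD[OF commD(3)[OF T fg]])
  have "p (cv T f g a) = TL U (\<lambda>x y. p (f x \<otimes> g y)) (\<Delta> a)"
    unfolding cv_def by (rule sw_hom[OF T U h commD(3)[OF T fg] a])
  also have "\<dots> = cv U (\<lambda>x. p (f x)) (\<lambda>x. p (g x)) a"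
    unfolding cv_def by (rule sw_cong[OF U b _ a]) (simp add: alg_homD(2)[OF p] c)
  finally show ?thesis .
qed

context
  fixes d assumes d: "d \<in> alg_hom K Q HQ" and dA: "\<And>a. a \<in> carrier A \<Longrightarrow> d (iA a) = dA a"
    and dX: "\<And>z. z \<in> dual \<Longrightarrow> d (iX z) = dX z"
begin

lemma KK_d_iA:
  assumes T: "assoc_algebra K T" and fp: "commute_with Q T f p" and a: "a \<in> carrier A"
  shows "KK T f p (d (iA a)) = co T f (\<lambda>b. p (iA b)) a"
proof -
  interpret T: assoc_algebra K T by (rule T)
  interpret Qa: assoc_algebra K Q by (rule Q_alg)
  note h = KK_hom[OF Q_alg T fp]
  have "KK T f p (d (iA a)) = co T (kl (KK T f p)) (\<lambda>b. pr (KK T f p) (iA b)) a"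
    unfolding dA[OF a] by (rule hom_dA[OF T h a])
  also have "\<dots> = co T f (\<lambda>b. p (iA b)) a"
    unfolding co_def
    by (rule A.co_cong[OF T co_lin(1)[OF T alg_homD(1)[OF cwD(1)[OF Q_alg T fp]] lin_comp[OF alg_homD(1)[OF cwD(2)[OF Q_alg T fp]] iA_lin]] _ a, symmetric])
      (simp add: kl_def pr_def KK_tens[OF Q_alg T fp] alg_hom_closed[OF C.inl1_hom] alg_homD(3)[OF cwD(1)[OF Q_alg T fp]]
        alg_homD(3)[OF cwD(2)[OF Q_alg T fp]] cwD(5,6)[OF Q_alg T fp])
  finally show ?thesis .
qed

lemma KK_d:
  fixes T (structure)
  assumes T: "assoc_algebra K T" and fp: "commute_with HQ T f p'"
  shows "KK T f (\<lambda>w. p' (d w)) kq = RR T (kl p') f \<otimes> (KK T f (pr p') kq \<otimes> RR T f (kl p'))"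
proof -
  interpret HV: assoc_algebra K "tensor K H HQ" by (rule assoc_algebra_tensor[OF H_alg HQ_alg])
  have "Kt HQ (\<lambda>z. d (iX z)) = Kt HQ dX"
    unfolding Kt_def[OF HQ_alg lin_comp[OF alg_homD(1)[OF d] iX_lin]] Kt_def[OF HQ_alg dX_lin]
    by (rule HV.A.finsum_cong') (auto simp: dX xb intro!: tens_closed H_alg HQ_alg lin_mapD(1)[OF dX_lin] simp: B_simps(1))
  then show ?thesis
    using KK_Kt_comp[OF Q_alg HQ_alg T iX_lin alg_homD(1)[OF cwD(1)[OF HQ_alg T fp]] alg_homD(1)[OF cwD(2)[OF HQ_alg T fp]] alg_homD(1)[OF d]]
    by (simp add: KK_dX'[OF T fp])
qed

text \<open>Serves to compute \<open>K\<close> for the coaction followed by a further algebra map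
  \<open>h\<close>. The last two hypotheses name the legs of \<open>p\<close> after
  \<open>h\<close>, so that the result is stated with the legs of the intended application.\<close>

lemma coaction_dX_KK:
  fixes T (structure)
  assumes T: "assoc_algebra K T" and V: "assoc_algebra K V" and fp: "commute_with V T f p" and h: "h \<in> alg_hom K HQ V"
    and k: "\<And>a. a \<in> carrier H \<Longrightarrow> p (h (tens K H Q a \<one>\<^bsub>Q\<^esub>)) = k a"
    and p0: "\<And>w. w \<in> carrier Q \<Longrightarrow> p (h (tens K H Q \<one>\<^bsub>H\<^esub> w)) = p0 w"
  shows "KK T f p (Kt V (\<lambda>z. h (dX z))) = RR T k f \<otimes> (KK T f p0 kq \<otimes> RR T f k)"
proof -
  note fh = commute_with_comp[OF V T fp h]
  note F = split_HQ[OF T fh]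
  have "KK T f p (Kt V (\<lambda>z. h (dX z))) = KK T f (\<lambda>w. p (h w)) (Kt HQ dX)"
    by (rule KK_Kt_comp[OF HQ_alg V T dX_lin alg_homD(1)[OF cwD(1)[OF V T fp]] alg_homD(1)[OF cwD(2)[OF V T fp]] alg_homD(1)[OF h]])
  moreover have "RR T (kl (\<lambda>w. p (h w))) f = RR T k f"
    by (rule RR_cong[OF T comm_homs_sym[OF F(1)]]) (simp_all add: kl_def k)
  moreover have "RR T f (kl (\<lambda>w. p (h w))) = RR T f k"
    by (rule RR_cong[OF T F(1)]) (simp_all add: kl_def k)
  moreover have "KK T f (pr (\<lambda>w. p (h w))) kq = KK T f p0 kq"
    by (rule KK_cong[OF Q_alg T F(2) kq_closed]) (simp_all add: pr_def p0)
  ultimately show ?thesis by (simp add: KK_dX'[OF T fh])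
qed

lemma comm_homs_comp:
  fixes T (structure)
  assumes V: "assoc_algebra K V" and T: "assoc_algebra K T"
  shows "commute_with V T f p \<Longrightarrow> h \<in> alg_hom K H V \<Longrightarrow> comm_homs T f (\<lambda>x. p (h x))"
    and "comm_homs V g h \<Longrightarrow> p \<in> alg_hom K V T \<Longrightarrow> comm_homs T (\<lambda>x. p (g x)) (\<lambda>x. p (h x))"
proof -
  assume fp: "commute_with V T f p" and h: "h \<in> alg_hom K H V"
  show "comm_homs T f (\<lambda>x. p (h x))" unfolding comm_homs_def
    by (intro conjI ballI cwD(1)[OF V T fp] alg_hom_comp[OF h cwD(2)[OF V T fp]])
      (rule cwD(4)[OF V T fp, symmetric], assumption, erule alg_hom_closed[OF h])
next
  assume gh: "comm_homs V g h" and p: "p \<in> alg_hom K V T"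
  show "comm_homs T (\<lambda>x. p (g x)) (\<lambda>x. p (h x))" unfolding comm_homs_def
  proof (intro conjI ballI alg_hom_comp[OF commD(1)[OF V gh] p] alg_hom_comp[OF commD(2)[OF V gh] p])
    fix a b assume ab: "a \<in> carrier H" "b \<in> carrier H"
    show "p (g a) \<otimes> p (h b) = p (h b) \<otimes> p (g a)"
      using commD(4)[OF V gh ab] by (simp add: alg_homD(2)[OF p, symmetric] commD(5,6)[OF V gh] ab)
  qed
qed

text \<open>Four legs occur: \<open>f\<close> from the encoding and three from \<open>TQ\<close>,
  whose images under \<open>p\<close> are \<open>?f\<close>, \<open>?g\<close>, \<open>?p\<close>.
  Splitting the convolution on one side and applying the coaction twice on the other give the same
  word \<open>RR ?f f\<close>, \<open>RR ?g f\<close>, \<open>K\<close>, \<open>RR f ?g\<close>,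
  \<open>RR f ?f\<close>.\<close>

lemma d_coassoc_KK:
  fixes T (structure)
  assumes T: "assoc_algebra K T" and fp: "commute_with TQ T f p"
  shows "KK T f p (Kt TQ (\<lambda>z. KK TQ (cv TQ fQ gQ) pQ (dX z))) = KK T f p (Kt TQ (\<lambda>z. KK TQ fQ (\<lambda>w. jQ (d w)) (dX z)))"
proof -
  interpret T: assoc_algebra K T by (rule T)
  interpret TQ: assoc_algebra K TQ by (rule TQ_alg)
  interpret Qa: assoc_algebra K Q by (rule Q_alg)
  note p = cwD(2)[OF TQ_alg T fp]
  note cp = commute_with_cv[OF Q_alg TQ_alg fgQ fpQ gpQ] and jd = commute_with_comp[OF HQ_alg TQ_alg fjQ d]
  let ?f = "\<lambda>x. p (fQ x)" and ?g = "\<lambda>x. p (gQ x)" and ?p = "\<lambda>x. p (pQ x)"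
  note ff = comm_homs_comp(1)[OF TQ_alg T fp legsQ(1)] and fg = comm_homs_comp(1)[OF TQ_alg T fp legsQ(2)]
    and fg' = comm_homs_comp(2)[OF TQ_alg T fgQ p]
  note f'f = comm_homs_sym[OF ff] and g'f = comm_homs_sym[OF fg]
  note fpp = commute_with_comp[OF TQ_alg T fp legsQ(3)]
  note cc = commD(5)[OF TQ_alg fgQ] alg_hom_closed[OF cv_hom[OF TQ_alg fgQ]] cwD(6)[OF Q_alg TQ_alg fpQ] cwD(6)[OF Q_alg TQ_alg jd]
  note ones = alg_homD(3)[OF legsQ(3)] alg_homD(3)[OF cv_hom[OF TQ_alg fgQ]] alg_homD(3)[OF legsQ(1)] alg_homD(3)[OF cwD(2)[OF Q_alg TQ_alg jd]]
  have "KK T f p (Kt TQ (\<lambda>z. KK TQ (cv TQ fQ gQ) pQ (dX z))) =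
    RR T (cv T ?f ?g) f \<otimes> (KK T f ?p kq \<otimes> RR T f (cv T ?f ?g))"
    by (rule coaction_dX_KK[OF T TQ_alg fp KK_hom[OF Q_alg TQ_alg cp]])
      (simp_all only: KK_tens[OF Q_alg TQ_alg cp] Qa.A.one_closed A.one_closed ones cc TQ.A.r_one TQ.A.l_one hom_cv[OF TQ_alg T p fgQ])
  also have "\<dots> = (RR T ?f f \<otimes> RR T ?g f) \<otimes> (KK T f ?p kq \<otimes> (RR T f ?g \<otimes> RR T f ?f))"
    by (simp only: RR_cv_left[OF T fg' f'f g'f] RR_cv_right[OF T ff fg fg'])
  also have "\<dots> = RR T ?f f \<otimes> ((RR T ?g f \<otimes> (KK T f ?p kq \<otimes> RR T f ?g)) \<otimes> RR T f ?f)"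
    by (simp add: T.A.m_assoc RR_closed[OF T ff] RR_closed[OF T fg] RR_closed[OF T f'f] RR_closed[OF T g'f] KK_closed[OF Q_alg T fpp kq_closed])
  also have "\<dots> = RR T ?f f \<otimes> (KK T f (\<lambda>w. p (jQ (d w))) kq \<otimes> RR T f ?f)"
    by (simp add: KK_d[OF T commute_with_comp[OF TQ_alg T fp cwD(2)[OF HQ_alg TQ_alg fjQ]]] kl_def pr_def tens3_def)
  also have "\<dots> = KK T f p (Kt TQ (\<lambda>z. KK TQ fQ (\<lambda>w. jQ (d w)) (dX z)))"
    by (rule coaction_dX_KK[OF T TQ_alg fp KK_hom[OF Q_alg TQ_alg jd], symmetric])
      (simp_all only: KK_tens[OF Q_alg TQ_alg jd] Qa.A.one_closed A.one_closed ones cc TQ.A.r_one TQ.A.l_one)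
  finally show ?thesis .
qed

lemma d_coassoc:
  assumes q: "q \<in> carrier Q"
  shows "tensor_assoc K H H Q (tensor_map K (tensor K H H) Q \<Delta> (\<lambda>x. x) (d q)) = tensor_map K H HQ (\<lambda>x. x) d (d q)"
proof -
  interpret TQ: assoc_algebra K TQ by (rule TQ_alg)
  note cp = commute_with_cv[OF Q_alg TQ_alg fgQ fpQ gpQ] and jd = commute_with_comp[OF HQ_alg TQ_alg fjQ d]
  note F = KK_hom[OF Q_alg TQ_alg cp] and G = KK_hom[OF Q_alg TQ_alg jd]
  note dc = alg_hom_closed[OF d]
  have "KK TQ (cv TQ fQ gQ) pQ (d q) = KK TQ fQ (\<lambda>w. jQ (d w)) (d q)"
  proof (rule alg_hom_Q_eq[OF TQ_alg alg_hom_comp[OF d F] alg_hom_comp[OF d G] _ _ q])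
    fix a assume a: "a \<in> carrier A"
    show "KK TQ (cv TQ fQ gQ) pQ (d (iA a)) = KK TQ fQ (\<lambda>w. jQ (d w)) (d (iA a))" (is "?l = ?r")
    proof -
    have "?l = co TQ (cv TQ fQ gQ) (\<lambda>b. pQ (iA b)) a"
      by (rule KK_d_iA[OF TQ_alg cp a])
    also have "\<dots> = co TQ fQ (\<lambda>b. jQ (dA b)) a"
      using co_dA[OF TQ_alg fjQ a] by (simp add: jQ_split)
    also have "\<dots> = co TQ fQ (\<lambda>b. jQ (d (iA b))) a"
      by (rule co_cong_fun[OF TQ_alg alg_homD(1)[OF legsQ(1)] lin_comp[OF alg_homD(1)[OF cwD(2)[OF HQ_alg TQ_alg fjQ]] alg_homD(1)[OF dA_hom]] a])
        (simp add: dA)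
    also have "\<dots> = ?r"
      by (rule KK_d_iA[OF TQ_alg jd a, symmetric])
    finally show ?thesis .
    qed
  next
    fix z assume z: "z \<in> dual"
    note x1 = lin_comp[OF alg_homD(1)[OF F] dX_lin] and x2 = lin_comp[OF alg_homD(1)[OF G] dX_lin]
    have "KK TQ (cv TQ fQ gQ) pQ (dX z) = KK TQ fQ (\<lambda>w. jQ (d w)) (dX z)"
      by (rule lin_dual_eq[OF TQ_alg x1 x2 d_coassoc_KK z])
    then show "KK TQ (cv TQ fQ gQ) pQ (d (iX z)) = KK TQ fQ (\<lambda>w. jQ (d w)) (d (iX z))" by (simp add: dX z)
  qed
  then show ?thesis by (simp add: comult_KK map_right_KK[OF d] dc q)
qed

lemma d_counit:
  assumes q: "q \<in> carrier Q"
  shows "TL Q (\<lambda>x y. \<epsilon> x \<odot>\<^bsub>Q\<^esub> y) (d q) = q"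
proof -
  interpret Qa: assoc_algebra K Q by (rule Q_alg)
  have id: "(\<lambda>w. w) \<in> alg_hom K Q Q" by (rule alg_homI[OF lin_id]) simp_all
  note ew = et_commute[OF Q_alg Q_alg id]
  note G = KK_hom[OF Q_alg Q_alg ew]
  note dc = alg_hom_closed[OF d]
  have et1: "et Q a \<otimes>\<^bsub>Q\<^esub> w = \<epsilon> a \<odot>\<^bsub>Q\<^esub> w" if "a \<in> carrier H" "w \<in> carrier Q" for a w
    using that by (simp add: et_def Qa.smult_mult_left \<epsilon>_closed)
  have "TL Q (\<lambda>x y. \<epsilon> x \<odot>\<^bsub>Q\<^esub> y) (d q) = KK Q (et Q) (\<lambda>w. w) (d q)"
    unfolding KK_def
    by (rule tensor_lift_cong[OF H_alg Q_alg Q_alg cwD(3)[OF Q_alg Q_alg ew] _ dc[OF q], symmetric]) (rule et1)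
  also have "\<dots> = q"
  proof (rule alg_hom_Q_eq[OF Q_alg alg_hom_comp[OF d G] id _ _ q])
    fix a assume a: "a \<in> carrier A"
    show "KK Q (et Q) (\<lambda>w. w) (d (iA a)) = iA a" (is "?l = ?r")
    proof -
    have "?l = co Q (et Q) iA a"
      by (rule KK_d_iA[OF Q_alg ew a])
    also have "\<dots> = TL Q (\<lambda>x y. \<epsilon> x \<odot>\<^bsub>Q\<^esub> iA y) (\<delta> a)"
      unfolding co_def
      by (rule A.co_cong[OF Q_alg co_lin(1)[OF Q_alg alg_homD(1)[OF et_hom[OF Q_alg]] iA_lin] _ a])
        (simp add: et1 alg_hom_closed[OF C.inl1_hom])
    also have "\<dots> = ?r" by (rule A.coaction_counit_lin[OF Q_alg iA_lin a])
    finally show ?thesis .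
    qed
  next
    fix z assume z: "z \<in> dual"
    \<comment> \<open>The type of \<open>T\<close> is fixed to that of \<open>HQ\<close>, the one
      for which \<open>lin_dual_eq\<close> asks.\<close>
    have e: "KK T f p (Kt Q (\<lambda>z. KK Q (et Q) (\<lambda>w. w) (dX z))) = KK T f p kq"
      if T: "assoc_algebra K T" and fp: "commute_with Q T f p" for T :: "('k, ('h \<times> (('a + ('h \<Rightarrow> 'k)) list \<Rightarrow> 'k) set set \<Rightarrow> 'k) set) module" and f p
    proof -
      interpret T: assoc_algebra K T by (rule T)
      note p = cwD(2)[OF Q_alg T fp]
      have "KK T f p (Kt Q (\<lambda>z. KK Q (et Q) (\<lambda>w. w) (dX z))) = RR T (et T) f \<otimes>\<^bsub>T\<^esub> (KK T f p kq \<otimes>\<^bsub>T\<^esub> RR T f (et T))"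
        by (rule coaction_dX_KK[OF T Q_alg fp G])
          (simp_all add: KK_tens[OF Q_alg Q_alg ew] et1 \<epsilon>_one, simp add: et_def lin_mapD(3)[OF alg_homD(1)[OF p]] alg_homD(3)[OF p] \<epsilon>_closed)
      then show ?thesis
        by (simp add: RR_et[OF T cwD(1)[OF Q_alg T fp]] KK_closed[OF Q_alg T fp kq_closed])
    qed
    have "KK Q (et Q) (\<lambda>w. w) (dX z) = iX z"
      by (rule lin_dual_eq[OF Q_alg lin_comp[OF alg_homD(1)[OF G] dX_lin] iX_lin e z])
    then show "KK Q (et Q) (\<lambda>w. w) (d (iX z)) = iX z" by (simp add: dX z)
  qed
  finally show ?thesis .
qed

lemma d_comodule: "left_comodule_algebra K H \<Delta> \<epsilon> Q d"
  by (intro left_comodule_algebra.intro bialgebra_axioms Q_alg left_comodule_algebra_axioms.intro d d_coassoc d_counit)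

end

end

section \<open>The K-matrix identities\<close>

context reflective_data
begin

lemma KK_intertwine:
  fixes T (structure)
  assumes V: "assoc_algebra K V" and T: "assoc_algebra K T" and fp: "commute_with V T f p" and gp: "commute_with V T g p"
    and k: "k \<in> carrier (tensor K H V)" and y: "y \<in> carrier T"
    and fg: "\<And>l. l \<in> carrier H \<Longrightarrow> y \<otimes> f l = g l \<otimes> y"
    and c: "\<And>w. w \<in> carrier V \<Longrightarrow> y \<otimes> p w = p w \<otimes> y"
  shows "y \<otimes> KK T f p k = KK T g p k \<otimes> y"
proof -
  interpret T: assoc_algebra K T by (rule T)
  note bf = cwD(3)[OF V T fp] and bg = cwD(3)[OF V T gp]
  note cl = cwD(5,6)[OF V T fp] cwD(5)[OF V T gp] y
  have "y \<otimes> KK T f p k = TL T (\<lambda>a w. y \<otimes> (f a \<otimes> p w)) k"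
    unfolding KK_def by (rule mult_tensor_lift(1)[OF H_alg V T bf k y])
  also have "\<dots> = TL T (\<lambda>a w. (g a \<otimes> p w) \<otimes> y) k"
  proof (rule tensor_lift_cong[OF H_alg V T _ _ k])
    fix a w assume aw: "a \<in> carrier H" "w \<in> carrier V"
    note cl [simp] = cl(1)[OF aw(1)] cl(2)[OF aw(2)] cl(3)[OF aw(1)] cl(4)
    show "y \<otimes> (f a \<otimes> p w) = (g a \<otimes> p w) \<otimes> y" (is "?l = ?r")
    proof -
    have "?l = (y \<otimes> f a) \<otimes> p w" by (simp add: T.A.m_assoc)
    also have "\<dots> = g a \<otimes> (y \<otimes> p w)" by (simp only: fg[OF aw(1)]) (simp add: T.A.m_assoc)
    also have "\<dots> = ?r" by (simp only: c[OF aw(2)]) (simp add: T.A.m_assoc)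
    finally show ?thesis .
    qed
  qed (intro bilinI lin_mult_l[OF T y] bilinD[OF bf])
  also have "\<dots> = KK T g p k \<otimes> y"
    unfolding KK_def by (rule mult_tensor_lift(2)[OF H_alg V T bg k y, symmetric])
  finally show ?thesis .
qed

text \<open>A fixed factor in the last leg can be taken out of \<open>KK\<close>. Applied to
  \<open>Kt HQ dX\<close>, it computes \<open>K\<close> for multiplication by \<open>kq\<close>
  after the coaction.\<close>

lemma KK_mult_base:
  fixes T (structure)
  assumes V: "assoc_algebra K V" and T: "assoc_algebra K T" and fp: "commute_with V T f p"
    and k: "k \<in> carrier (tensor K H V)" and y: "y \<in> carrier V"
  shows "KK T f (\<lambda>w. p (y \<otimes>\<^bsub>V\<^esub> w)) k = p y \<otimes> KK T f p k"
    and "KK T f (\<lambda>w. p (w \<otimes>\<^bsub>V\<^esub> y)) k = KK T f p k \<otimes> p y"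
proof -
  interpret T: assoc_algebra K T by (rule T)
  note bf = cwD(3)[OF V T fp] and p = cwD(2)[OF V T fp]
  note cl = cwD(5,6)[OF V T fp] and py = cwD(6)[OF V T fp y]
  show "KK T f (\<lambda>w. p (y \<otimes>\<^bsub>V\<^esub> w)) k = p y \<otimes> KK T f p k" (is "?l = ?r")
  proof -
  have "?r = TL T (\<lambda>a w. p y \<otimes> (f a \<otimes> p w)) k"
    unfolding KK_def by (rule mult_tensor_lift(1)[OF H_alg V T bf k py])
  also have "\<dots> = ?l"
    unfolding KK_def
    by (rule tensor_lift_cong[OF H_alg V T _ _ k], intro bilinI lin_mult_l[OF T py] bilinD[OF bf])
      (simp_all add: alg_homD(2)[OF p] y cwD(7)[OF V T fp] cl)
  finally show ?thesis by simp
  qed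
  show "KK T f (\<lambda>w. p (w \<otimes>\<^bsub>V\<^esub> y)) k = KK T f p k \<otimes> p y" (is "?l = ?r")
  proof -
  have "?r = TL T (\<lambda>a w. (f a \<otimes> p w) \<otimes> p y) k"
    unfolding KK_def by (rule mult_tensor_lift(2)[OF H_alg V T bf k py])
  also have "\<dots> = ?l"
    unfolding KK_def
    by (rule tensor_lift_cong[OF H_alg V T _ _ k], intro bilinI lin_mult_r[OF T py] bilinD[OF bf])
      (simp_all add: alg_homD(2)[OF p] y T.A.m_assoc cl)
  finally show ?thesis by simp
  qed
qed

lemma hom_kq:
  assumes T: "assoc_algebra K T" and p: "p \<in> alg_hom K HQ T"
  shows "p kq = KK T (kl p) (pr p) kq"
proof -
  note F = split_HQ[OF T et_commute[OF HQ_alg T p]]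
  have "p kq = p (TL HQ (\<lambda>a b. tens K H Q a b) kq)"
    by (simp add: tensor_lift_tens_id[OF H_alg Q_alg kq_closed])
  also have "\<dots> = TL T (\<lambda>a b. p (tens K H Q a b)) kq"
    by (rule lin_tensor_lift[OF H_alg Q_alg HQ_alg T alg_homD(1)[OF p] tens_bilin[OF H_alg Q_alg] kq_closed])
  also have "\<dots> = KK T (kl p) (pr p) kq"
    unfolding KK_def
    by (rule tensor_lift_cong[OF H_alg Q_alg T cwD(3)[OF Q_alg T F(3)] _ kq_closed, symmetric]) (simp add: F(4))
  finally show ?thesis .
qed

text \<open>With \<open>k\<close> the second leg, this is the reflection equation
  \<open>K_k R_kf K_f R_fk = R_kf K_f R_fk K_k\<close>. The equation for
  \<open>(\<Delta> \<otimes> Id) K\<close> rewrites the first three factors, \<open>R_kf\<close>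
  carries the convolution to its opposite, and the same equation with exchanged legs
  finishes.\<close>

lemma kq_dX_KK:
  fixes T (structure)
  assumes T: "assoc_algebra K T" and fp: "commute_with HQ T f p"
  shows "KK T f p (Kt HQ (\<lambda>z. kq \<otimes>\<^bsub>HQ\<^esub> dX z)) = KK T f p (Kt HQ (\<lambda>z. dX z \<otimes>\<^bsub>HQ\<^esub> kq))"
proof -
  interpret T: assoc_algebra K T by (rule T)
  note p = cwD(2)[OF HQ_alg T fp] and F = split_HQ[OF T fp]
  let ?k = "kl p" and ?p = "pr p"
  let ?K = "\<lambda>g. KK T g ?p kq" and ?r = "RR T f ?k" and ?r' = "RR T ?k f"
  note kf = comm_homs_sym[OF F(1)]
  note cfk = commute_with_cv[OF Q_alg T F(1) F(2,3)] and ckf = commute_with_cv[OF Q_alg T kf F(3,2)]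
  note cl [simp] = KK_closed[OF Q_alg T F(2) kq_closed] KK_closed[OF Q_alg T F(3) kq_closed] KK_closed[OF Q_alg T cfk kq_closed]
    KK_closed[OF Q_alg T ckf kq_closed] RR_closed[OF T F(1)] RR_closed[OF T kf]
  note KC1 = kq_KC[OF T F(1) F(2,3)] and KC2 = kq_KC[OF T kf F(3,2)]
  have I: "?r' \<otimes> ?K (cv T ?k f) = ?K (cv T f ?k) \<otimes> ?r'"
  proof (rule KK_intertwine[OF Q_alg T ckf cfk kq_closed cl(6) RR_cv[OF T kf]])
    fix w assume w: "w \<in> carrier Q"
    show "?r' \<otimes> ?p w = ?p w \<otimes> ?r'"
      by (rule RR_commute[OF T kf cwD(6)[OF Q_alg T F(2) w]])
        (erule cwD(4)[OF Q_alg T F(3) _ w, symmetric], erule cwD(4)[OF Q_alg T F(2) _ w, symmetric])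
  qed
  note f = alg_homD(1)[OF cwD(1)[OF HQ_alg T fp]] and pl = alg_homD(1)[OF p]
  note x1 = lin_mult_l[OF HQ_alg kq_closed lin_id] and x2 = lin_mult_r[OF HQ_alg kq_closed lin_id]
  have "KK T f p (Kt HQ (\<lambda>z. kq \<otimes>\<^bsub>HQ\<^esub> dX z)) = KK T f (\<lambda>w. p (kq \<otimes>\<^bsub>HQ\<^esub> w)) (Kt HQ dX)"
    by (rule KK_Kt_comp[OF HQ_alg HQ_alg T dX_lin f pl x1])
  also have "\<dots> = ?K ?k \<otimes> (?r' \<otimes> (?K f \<otimes> ?r))"
    by (simp only: KK_mult_base(1)[OF HQ_alg T fp Kt_closed[OF HQ_alg dX_lin] kq_closed] hom_kq[OF T p] KK_dX'[OF T fp])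
  also have "\<dots> = (?K ?k \<otimes> (?r' \<otimes> ?K f)) \<otimes> ?r" by (simp add: T.A.m_assoc)
  also have "\<dots> = (?r' \<otimes> ?K (cv T ?k f)) \<otimes> ?r" by (simp only: KC1[symmetric] I)
  also have "\<dots> = ?r' \<otimes> (?K f \<otimes> (?r \<otimes> ?K ?k))" by (simp only: KC2[symmetric]) (simp add: T.A.m_assoc)
  also have "\<dots> = (?r' \<otimes> (?K f \<otimes> ?r)) \<otimes> ?K ?k" by (simp add: T.A.m_assoc)
  also have "\<dots> = KK T f (\<lambda>w. p (w \<otimes>\<^bsub>HQ\<^esub> kq)) (Kt HQ dX)"
    by (simp only: KK_mult_base(2)[OF HQ_alg T fp Kt_closed[OF HQ_alg dX_lin] kq_closed] hom_kq[OF T p] KK_dX'[OF T fp])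
  also have "\<dots> = KK T f p (Kt HQ (\<lambda>z. dX z \<otimes>\<^bsub>HQ\<^esub> kq))"
    by (rule KK_Kt_comp[OF HQ_alg HQ_alg T dX_lin f pl x2, symmetric])
  finally show ?thesis .
qed

lemma legs_KK:
  shows "z \<in> carrier HQ \<Longrightarrow> leg23 K H H Q z = KK TQ gQ pQ z" and "z \<in> carrier HQ \<Longrightarrow> leg13 K H H Q z = KK TQ fQ pQ z"
    and "leg12 K H H Q R = RR TQ fQ gQ" and "leg12 K H H Q (tensor_flip K H H R) = RR TQ gQ fQ"
proof -
  interpret Qa: assoc_algebra K Q by (rule Q_alg)
  note m = tens3_mult[OF H_alg H_alg Q_alg]
  show "z \<in> carrier HQ \<Longrightarrow> leg23 K H H Q z = KK TQ gQ pQ z" for z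
    unfolding leg23_def KK_def
    by (rule tensor_lift_cong[OF H_alg Q_alg TQ_alg cwD(3)[OF Q_alg TQ_alg gpQ], symmetric]) (simp_all add: m)
  show "z \<in> carrier HQ \<Longrightarrow> leg13 K H H Q z = KK TQ fQ pQ z" for z
    unfolding leg13_def KK_def
    by (rule tensor_lift_cong[OF H_alg Q_alg TQ_alg cwD(3)[OF Q_alg TQ_alg fpQ], symmetric]) (simp_all add: m)
  show "leg12 K H H Q R = RR TQ fQ gQ"
    unfolding leg12_def RR_def
    by (rule R_cong[OF TQ_alg commD(3)[OF TQ_alg fgQ], symmetric]) (simp_all add: m)
  show "leg12 K H H Q (tensor_flip K H H R) = RR TQ gQ fQ" (is "?l = ?r")
  proof -
  have "?l = TL TQ (\<lambda>a b. tens3 K H H Q b a \<one>\<^bsub>Q\<^esub>) R"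
    unfolding leg12_def by (rule tensor_lift_flip(1)[OF H_alg H_alg TQ_alg leg_bilins(1)[OF H_alg H_alg Q_alg] R_closed])
  also have "\<dots> = ?r"
    unfolding RR_def
    by (rule R_cong[OF TQ_alg commD(3)[OF TQ_alg comm_homs_sym[OF fgQ]], symmetric]) (simp_all add: m)
  finally show ?thesis .
  qed
qed

text \<open>\<open>kq_KC\<close> is the axiom with \<open>R_21\<close> kept on the left side;
  invertibility of \<open>R_21\<close> moves it over.\<close>

lemma kq_comult:
  "tensor_assoc K H H Q (tensor_map K (tensor K H H) Q \<Delta> (\<lambda>x. x) kq) =
    leg23 K H H Q kq \<otimes>\<^bsub>TQ\<^esub> leg12 K H H Q (tensor_flip K H H R) \<otimes>\<^bsub>TQ\<^esub> leg13 K H H Q kq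
      \<otimes>\<^bsub>TQ\<^esub> inv\<^bsub>TQ\<^esub> (leg12 K H H Q (tensor_flip K H H R))"
proof -
  interpret TQ: assoc_algebra K TQ by (rule TQ_alg)
  note cp = commute_with_cv[OF Q_alg TQ_alg fgQ fpQ gpQ]
  note u = RR_unit[OF TQ_alg comm_homs_sym[OF fgQ]]
  note cl [simp] = KK_closed[OF Q_alg TQ_alg fpQ kq_closed] KK_closed[OF Q_alg TQ_alg gpQ kq_closed] KK_closed[OF Q_alg TQ_alg cp kq_closed]
    RR_closed[OF TQ_alg comm_homs_sym[OF fgQ]] TQ.A.Units_inv_closed[OF u]
  have "KK TQ (cv TQ fQ gQ) pQ kq = (KK TQ (cv TQ fQ gQ) pQ kq \<otimes>\<^bsub>TQ\<^esub> RR TQ gQ fQ) \<otimes>\<^bsub>TQ\<^esub> inv\<^bsub>TQ\<^esub> RR TQ gQ fQ"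
    by (simp add: TQ.A.m_assoc TQ.A.Units_r_inv[OF u])
  also have "\<dots> = KK TQ gQ pQ kq \<otimes>\<^bsub>TQ\<^esub> RR TQ gQ fQ \<otimes>\<^bsub>TQ\<^esub> KK TQ fQ pQ kq \<otimes>\<^bsub>TQ\<^esub> inv\<^bsub>TQ\<^esub> RR TQ gQ fQ"
    unfolding kq_KC[OF TQ_alg fgQ fpQ gpQ] by (simp add: TQ.A.m_assoc)
  finally show ?thesis unfolding comult_KK[OF kq_closed] legs_KK(1,2)[OF kq_closed] legs_KK(4) .
qed

context
  fixes d assumes d: "d \<in> alg_hom K Q HQ" and dA: "\<And>a. a \<in> carrier A \<Longrightarrow> d (iA a) = dA a"
    and dX: "\<And>z. z \<in> dual \<Longrightarrow> d (iX z) = dX z"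
begin

lemma kq_coaction:
  "tensor_map K H HQ (\<lambda>x. x) d kq =
    leg12 K H H Q (tensor_flip K H H R) \<otimes>\<^bsub>TQ\<^esub> leg13 K H H Q kq \<otimes>\<^bsub>TQ\<^esub> leg12 K H H Q R"
proof -
  interpret TQ: assoc_algebra K TQ by (rule TQ_alg)
  note cl [simp] = KK_closed[OF Q_alg TQ_alg fpQ kq_closed] RR_closed[OF TQ_alg comm_homs_sym[OF fgQ]] RR_closed[OF TQ_alg fgQ]
  have "KK TQ fQ (\<lambda>w. jQ (d w)) kq = RR TQ gQ fQ \<otimes>\<^bsub>TQ\<^esub> (KK TQ fQ pQ kq \<otimes>\<^bsub>TQ\<^esub> RR TQ fQ gQ)"
    using KK_d[OF d dA dX TQ_alg fjQ] unfolding jQ_split .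
  then show ?thesis
    unfolding map_right_KK[OF d kq_closed] legs_KK(2)[OF kq_closed] legs_KK(3,4)
    by (simp add: TQ.A.m_assoc)
qed

lemma kq_intertwines:
  assumes q: "q \<in> carrier Q"
  shows "kq \<otimes>\<^bsub>HQ\<^esub> d q = d q \<otimes>\<^bsub>HQ\<^esub> kq"
proof -
  interpret HQ: assoc_algebra K HQ by (rule HQ_alg)
  note dl = alg_homD(1)[OF d] and dc = alg_hom_closed[OF d]
  note ic = alg_hom_closed[OF C.inl1_hom] alg_hom_closed[OF C.inr1_hom]
  show ?thesis
  proof (rule C.lin_map_CP_eq[OF HQ_alg lin_mult_l[OF HQ_alg kq_closed dl] lin_mult_r[OF HQ_alg kq_closed dl] _ q])
    fix a x assume a: "a \<in> carrier A" and x: "x \<in> carrier B"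
    have xd: "x \<in> dual" using x by (simp add: B_simps(1))
    have 1: "kq \<otimes>\<^bsub>HQ\<^esub> d (iA a) = d (iA a) \<otimes>\<^bsub>HQ\<^esub> kq"
      using kq_KA[OF HQ_alg commute_tens[OF Q_alg] a] by (simp add: KK_id[OF Q_alg kq_closed] dA[OF a] dA_def)
    have "kq \<otimes>\<^bsub>HQ\<^esub> dX x = dX x \<otimes>\<^bsub>HQ\<^esub> kq"
      by (rule lin_dual_eq[OF HQ_alg lin_mult_l[OF HQ_alg kq_closed dX_lin] lin_mult_r[OF HQ_alg kq_closed dX_lin] kq_dX_KK xd])
    then have 2: "kq \<otimes>\<^bsub>HQ\<^esub> d (iX x) = d (iX x) \<otimes>\<^bsub>HQ\<^esub> kq" by (simp add: dX[OF xd])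
    note c [simp] = dc[OF ic(1)[OF a]] dc[OF ic(2)[OF x]] kq_closed
    have "kq \<otimes>\<^bsub>HQ\<^esub> (d (iA a) \<otimes>\<^bsub>HQ\<^esub> d (iX x)) = (kq \<otimes>\<^bsub>HQ\<^esub> d (iA a)) \<otimes>\<^bsub>HQ\<^esub> d (iX x)" by (simp add: HQ.A.m_assoc)
    also have "\<dots> = d (iA a) \<otimes>\<^bsub>HQ\<^esub> (kq \<otimes>\<^bsub>HQ\<^esub> d (iX x))" by (simp only: 1) (simp add: HQ.A.m_assoc)
    also have "\<dots> = (d (iA a) \<otimes>\<^bsub>HQ\<^esub> d (iX x)) \<otimes>\<^bsub>HQ\<^esub> kq" by (simp only: 2) (simp add: HQ.A.m_assoc)
    finally show "kq \<otimes>\<^bsub>HQ\<^esub> d (iA a \<otimes>\<^bsub>Q\<^esub> iX x) = d (iA a \<otimes>\<^bsub>Q\<^esub> iX x) \<otimes>\<^bsub>HQ\<^esub> kq"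
      by (simp add: alg_homD(2)[OF d] ic a x)
  qed
qed

end

end

context reflective_data
begin

lemma drinfeld'_antipode2:
  assumes h [simp]: "h \<in> carrier H"
  shows "drinfeld' \<star> S (S h) = h \<star> drinfeld'"
proof -
  note [simp] = S_closed
  have "S (S drinfeld') = S (S drinfeld') \<star> (drinfeld \<star> drinfeld')" by (simp add: drinfeld_inverse)
  also have "\<dots> = (S (S drinfeld') \<star> drinfeld) \<star> drinfeld'" by (simp add: A.m_assoc)
  finally have vu: "drinfeld' \<star> drinfeld = \<one>\<^bsub>H\<^esub>" using drinfeld_inverse(2) by simp
  have "drinfeld' \<star> S (S h) = drinfeld' \<star> (S (S h) \<star> (drinfeld \<star> drinfeld'))" by (simp add: drinfeld_inverse)
  also have "\<dots> = drinfeld' \<star> ((S (S h) \<star> drinfeld) \<star> drinfeld')" by (simp add: A.m_assoc)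
  also have "\<dots> = (drinfeld' \<star> drinfeld) \<star> (h \<star> drinfeld')" by (simp only: antipode2_drinfeld[OF h]) (simp add: A.m_assoc)
  finally show ?thesis by (simp add: vu)
qed

subsection \<open>Invertibility of the canonical element\<close>

text \<open>
  The right and the left inverse of \<open>K\<close> are its images under \<open>phi\<close> and \<open>psi\<close> in the first leg.
\<close>

definition w0 where "w0 = TL H (\<lambda>p q. S p \<star> Si q) R"

lemma w0_closed [simp, mlin]: "w0 \<in> carrier H" unfolding w0_def by (rule mlin | assumption)+

text \<open>The left side is the image of \<open>R\<close> times \<open>(S \<otimes> Id) R\<close>
  under \<open>x \<otimes> y \<mapsto> x \<star> Si y\<close>; the shape of \<open>w0\<close> is
  chosen for this.\<close>

lemma w0_contract: "TL H (\<lambda>a b. a \<star> w0 \<star> Si b) R = \<one>\<^bsub>H\<^esub>"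
proof -
  have b: "bilin K H H H (\<lambda>p q. S p \<star> Si q)" "bilin K H H H (\<lambda>x y. x \<star> Si y)" by (rule mlin | assumption)+
  have "TL H (\<lambda>a b. a \<star> w0 \<star> Si b) R =
    TL H (\<lambda>a b. TL H (\<lambda>c d. (a \<star> S c) \<star> Si (b \<star> d)) R) R"
  proof (rule R_cong[OF H_alg])
    fix a b assume [simp, mlin]: "a \<in> carrier H" "b \<in> carrier H"
    have F: "(\<lambda>u. a \<star> u \<star> Si b) \<in> lin_map K H H" by (rule mlin)+
    have "a \<star> w0 \<star> Si b = TL H (\<lambda>c d. a \<star> (S c \<star> Si d) \<star> Si b) R"
      unfolding w0_def by (rule R_hom[OF H_alg H_alg F b(1)])
    also have "\<dots> = TL H (\<lambda>c d. (a \<star> S c) \<star> Si (b \<star> d)) R"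
      by (rule R_cong[OF H_alg], (rule mlin | assumption)+) (simp add: Si_mult A.m_assoc S_closed Si_closed)
    finally show "a \<star> w0 \<star> Si b = \<dots>" .
  qed (rule mlin | assumption)+
  also have "\<dots> = \<one>\<^bsub>H\<^esub> \<star> Si \<one>\<^bsub>H\<^esub>" by (rule R_inverse_right[OF H_alg b(2)])
  finally show ?thesis by (simp add: Si_one)
qed

text \<open>Read off from the requirement \<open>hat_phi\<close>: the factors \<open>m\<close> and
  \<open>Si n\<close> are there to cancel the outer copy of \<open>R\<close> in the braided
  coproduct, and \<open>w0\<close> to cancel the inner one. What remains is
  \<open>y \<star> Si x\<close>, which contracts.\<close>

definition phi where "phi u = TL H (\<lambda>m n. m \<star> w0 \<star> Si u \<star> Si n) R"

lemma phi_lin: "phi \<in> lin_map K H H"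
  unfolding phi_def[abs_def] by (rule mlin | assumption)+

lemma hat_phi:
  assumes c: "c \<in> carrier H"
  shows "TL H (\<lambda>a b. b \<star> phi a) (hat c) = \<epsilon> c \<odot>\<^bsub>H\<^esub> \<one>\<^bsub>H\<^esub>"
proof -
  note [mlin] = lin_comp[OF phi_lin] lin_mapD(1)[OF phi_lin] c
  have b: "bilin K H H H (\<lambda>a b. b \<star> phi a)" by (rule mlin | assumption)+
  have "TL H (\<lambda>a b. b \<star> phi a) (hat c) = TL H (\<lambda>x y. TL H (\<lambda>a b.
    TL H (\<lambda>c d. (y \<star> a \<star> Si c) \<star> phi (d \<star> x \<star> b)) R) R) (\<Delta> c)"
    by (rule hat_lift[OF H_alg b c])
  also have "\<dots> = TL H (\<lambda>x y. y \<star> Si x) (\<Delta> c)"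
  proof (rule sw_cong[OF H_alg _ _ c])
    fix x y assume xy [simp, mlin]: "x \<in> carrier H" "y \<in> carrier H"
    have "TL H (\<lambda>a b. TL H (\<lambda>c d. (y \<star> a \<star> Si c) \<star> phi (d \<star> x \<star> b)) R) R =
      TL H (\<lambda>a b. y \<star> (a \<star> w0 \<star> Si b) \<star> Si x) R"
    proof (rule R_cong[OF H_alg])
      fix a b assume ab [simp, mlin]: "a \<in> carrier H" "b \<in> carrier H"
      \<comment> \<open>The slots \<open>n\<close> and \<open>m\<close> receive
        \<open>n \<star> d\<close> and \<open>Si c \<star> m\<close>, the combination that
        \<open>R_inverse_Si\<close> collapses.\<close>
      let ?be = "\<lambda>n m. y \<star> a \<star> m \<star> w0 \<star> Si b \<star> Si x \<star> Si n"
      have be: "bilin K H H H ?be" by (rule mlin | assumption)+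
      have "TL H (\<lambda>c d. (y \<star> a \<star> Si c) \<star> phi (d \<star> x \<star> b)) R =
        TL H (\<lambda>c d. TL H (\<lambda>m n. ?be (n \<star> d) (Si c \<star> m)) R) R"
      proof (rule R_cong[OF H_alg])
        fix c d assume [simp, mlin]: "c \<in> carrier H" "d \<in> carrier H"
        have F: "(\<lambda>u. (y \<star> a \<star> Si c) \<star> u) \<in> lin_map K H H" by (rule mlin)+
        have "(y \<star> a \<star> Si c) \<star> phi (d \<star> x \<star> b) = TL H (\<lambda>m n. (y \<star> a \<star> Si c) \<star>
            (m \<star> w0 \<star> Si (d \<star> x \<star> b) \<star> Si n)) R"
          unfolding phi_def by (rule R_hom[OF H_alg H_alg F]) (rule mlin | assumption)+
        also have "\<dots> = TL H (\<lambda>m n. ?be (n \<star> d) (Si c \<star> m)) R"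
          by (rule R_cong[OF H_alg], (rule mlin | assumption)+) (simp add: Si_mult A.m_assoc Si_closed)
        finally show "(y \<star> a \<star> Si c) \<star> phi (d \<star> x \<star> b) = \<dots>" .
      qed (rule mlin | assumption)+
      also have "\<dots> = TL H (\<lambda>m n. TL H (\<lambda>c d. ?be (n \<star> d) (Si c \<star> m)) R) R"
        by (rule R_swap[OF H_alg]) (rule mlin | assumption)+
      also have "\<dots> = ?be \<one>\<^bsub>H\<^esub> \<one>\<^bsub>H\<^esub>" by (rule R_inverse_Si(2)[OF H_alg be])
      also have "\<dots> = y \<star> (a \<star> w0 \<star> Si b) \<star> Si x" by (simp add: Si_one Si_closed A.m_assoc)
      finally show "TL H (\<lambda>c d. (y \<star> a \<star> Si c) \<star> phi (d \<star> x \<star> b)) R = \<dots>" .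
    qed (rule mlin | assumption)+
    also have "\<dots> = y \<star> TL H (\<lambda>a b. a \<star> w0 \<star> Si b) R \<star> Si x"
    proof -
      have F: "(\<lambda>u. y \<star> u \<star> Si x) \<in> lin_map K H H" by (rule mlin)+
      show ?thesis by (rule R_hom[OF H_alg H_alg F, symmetric]) (rule mlin | assumption)+
    qed
    finally show "TL H (\<lambda>a b. TL H (\<lambda>c d. (y \<star> a \<star> Si c) \<star> phi (d \<star> x \<star> b)) R) R = y \<star> Si x"
      by (simp add: w0_contract)
  qed (rule mlin | assumption)+
  also have "\<dots> = \<epsilon> c \<odot>\<^bsub>H\<^esub> \<one>\<^bsub>H\<^esub>"
    by (rule Si_contract(1)[OF H_alg lin_id c])
  finally show ?thesis .
qed

lemma antipode_drinfeld'_intertwines: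
  assumes h [simp]: "h \<in> carrier H"
  shows "S drinfeld' \<star> h = S (S h) \<star> S drinfeld'"
  using drinfeld'_antipode2[OF Si_closed[OF h], THEN arg_cong, of S]
  by (simp add: S_mult S_closed Si_closed S_Si)

lemma antipode_drinfeld'_eq: "S drinfeld' = TL H (\<lambda>p q. S (S p) \<star> q) R"
proof -
  have "S drinfeld' = TL H (\<lambda>a b. S (b \<star> S (S a))) R"
    unfolding drinfeld'_def by (rule R_hom[OF H_alg H_alg antipode_linear]) (rule mlin | assumption)+
  also have "\<dots> = TL H (\<lambda>a b. S (S (S a)) \<star> S b) R"
    by (rule R_cong[OF H_alg], (rule mlin | assumption)+) (simp add: S_mult S_closed)
  also have "\<dots> = TL H (\<lambda>p q. S (S p) \<star> q) R"
    by (rule R_antipode2[OF H_alg]) (rule mlin | assumption)+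
  finally show ?thesis .
qed

text \<open>Inserting the sum for \<open>S drinfeld'\<close> gives
  \<open>S(a) S(S(p)) q b = S(S(p) a) (q b)\<close>, the image of \<open>(S \<otimes> Id) R\<close>
  times \<open>R\<close>.\<close>

lemma antipode_drinfeld'_contract: "TL H (\<lambda>a b. S a \<star> S drinfeld' \<star> b) R = \<one>\<^bsub>H\<^esub>"
proof -
  have b: "bilin K H H H (\<lambda>p q. S (S p) \<star> q)" "bilin K H H H (\<lambda>x y. S x \<star> y)" by (rule mlin | assumption)+
  have "TL H (\<lambda>a b. S a \<star> S drinfeld' \<star> b) R =
    TL H (\<lambda>a b. TL H (\<lambda>p q. S (S p \<star> a) \<star> (q \<star> b)) R) R"
  proof (rule R_cong[OF H_alg])
    fix a b assume [simp, mlin]: "a \<in> carrier H" "b \<in> carrier H"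
    have F: "(\<lambda>u. S a \<star> u \<star> b) \<in> lin_map K H H" by (rule mlin)+
    have "S a \<star> S drinfeld' \<star> b = TL H (\<lambda>p q. S a \<star> (S (S p) \<star> q) \<star> b) R"
      unfolding antipode_drinfeld'_eq by (rule R_hom[OF H_alg H_alg F b(1)])
    also have "\<dots> = TL H (\<lambda>p q. S (S p \<star> a) \<star> (q \<star> b)) R"
      by (rule R_cong[OF H_alg], (rule mlin | assumption)+) (simp add: S_mult A.m_assoc S_closed)
    finally show "S a \<star> S drinfeld' \<star> b = \<dots>" .
  qed (rule mlin | assumption)+
  also have "\<dots> = TL H (\<lambda>p q. TL H (\<lambda>a b. S (S p \<star> a) \<star> (q \<star> b)) R) R"
    by (rule R_swap[OF H_alg]) (rule mlin | assumption)+
  also have "\<dots> = S \<one>\<^bsub>H\<^esub> \<star> \<one>\<^bsub>H\<^esub>" by (rule R_inverse_left[OF H_alg b(2)])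
  finally show ?thesis by (simp add: S_one)
qed

text \<open>In \<open>hat_psi\<close> the element \<open>S y\<close> stands left of
  \<open>x\<close>, so the antipode axiom can contract them only after \<open>x\<close> has crossed
  over as \<open>S (S x)\<close>. The factor \<open>S drinfeld'\<close> makes this crossing, and
  afterwards it is absorbed by \<open>antipode_drinfeld'_contract\<close>.\<close>

definition psi where "psi u = TL H (\<lambda>m n. S m \<star> S u \<star> S drinfeld' \<star> n) R"

lemma psi_lin: "psi \<in> lin_map K H H"
  unfolding psi_def[abs_def] by (rule mlin | assumption)+

lemma hat_psi:
  assumes c: "c \<in> carrier H"
  shows "TL H (\<lambda>a b. psi b \<star> a) (hat c) = \<epsilon> c \<odot>\<^bsub>H\<^esub> \<one>\<^bsub>H\<^esub>"
proof -
  note [mlin] = lin_comp[OF psi_lin] lin_mapD(1)[OF psi_lin] c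
  have b: "bilin K H H H (\<lambda>a b. psi b \<star> a)" by (rule mlin | assumption)+
  \<comment> \<open>What is left once the outer copy of \<open>R\<close> has cancelled; being
    linear, it passes the antipode axiom for \<open>S x \<star> y\<close> on to the unit.\<close>
  let ?L = "\<lambda>u. TL H (\<lambda>a b. S a \<star> (S u \<star> S drinfeld') \<star> b) R"
  have L: "?L \<in> lin_map K H H" by (rule mlin | assumption)+
  have "TL H (\<lambda>a b. psi b \<star> a) (hat c) = TL H (\<lambda>x y. TL H (\<lambda>a b.
    TL H (\<lambda>c d. psi (y \<star> a \<star> Si c) \<star> (d \<star> x \<star> b)) R) R) (\<Delta> c)"
    by (rule hat_lift[OF H_alg b c])
  also have "\<dots> = TL H (\<lambda>x y. ?L (S x \<star> y)) (\<Delta> c)"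
  proof (rule sw_cong[OF H_alg _ _ c])
    fix x y assume xy [simp, mlin]: "x \<in> carrier H" "y \<in> carrier H"
    show "TL H (\<lambda>a b. TL H (\<lambda>c d. psi (y \<star> a \<star> Si c) \<star> (d \<star> x \<star> b)) R) R = ?L (S x \<star> y)"
    proof (rule R_cong[OF H_alg])
      fix a b assume ab [simp, mlin]: "a \<in> carrier H" "b \<in> carrier H"
      let ?be = "\<lambda>m n. m \<star> (S a \<star> S y \<star> S drinfeld') \<star> n \<star> x \<star> b"
      have be: "bilin K H H H ?be" by (rule mlin | assumption)+
      have "TL H (\<lambda>c d. psi (y \<star> a \<star> Si c) \<star> (d \<star> x \<star> b)) R =
        TL H (\<lambda>c d. TL H (\<lambda>m n. ?be (S m \<star> c) (n \<star> d)) R) R"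
      proof (rule R_cong[OF H_alg])
        fix c d assume [simp, mlin]: "c \<in> carrier H" "d \<in> carrier H"
        have F: "(\<lambda>u. u \<star> (d \<star> x \<star> b)) \<in> lin_map K H H" by (rule mlin)+
        have "psi (y \<star> a \<star> Si c) \<star> (d \<star> x \<star> b) = TL H (\<lambda>m n.
            (S m \<star> S (y \<star> a \<star> Si c) \<star> S drinfeld' \<star> n) \<star> (d \<star> x \<star> b)) R"
          unfolding psi_def by (rule R_hom[OF H_alg H_alg F]) (rule mlin | assumption)+
        also have "\<dots> = TL H (\<lambda>m n. ?be (S m \<star> c) (n \<star> d)) R"
          by (rule R_cong[OF H_alg], (rule mlin | assumption)+) (simp add: S_mult S_Si A.m_assoc S_closed Si_closed)
        finally show "psi (y \<star> a \<star> Si c) \<star> (d \<star> x \<star> b) = \<dots>" .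
      qed (rule mlin | assumption)+
      also have "\<dots> = TL H (\<lambda>m n. TL H (\<lambda>c d. ?be (S m \<star> c) (n \<star> d)) R) R"
        by (rule R_swap[OF H_alg]) (rule mlin | assumption)+
      also have "\<dots> = ?be \<one>\<^bsub>H\<^esub> \<one>\<^bsub>H\<^esub>" by (rule R_inverse_left[OF H_alg be])
      also have "\<dots> = S a \<star> (S y \<star> (S drinfeld' \<star> x)) \<star> b" by (simp add: S_closed A.m_assoc)
      also have "\<dots> = S a \<star> (S (S x \<star> y) \<star> S drinfeld') \<star> b"
        by (simp only: antipode_drinfeld'_intertwines[OF xy(1)]) (simp add: S_closed S_mult A.m_assoc)
      finally show "TL H (\<lambda>c d. psi (y \<star> a \<star> Si c) \<star> (d \<star> x \<star> b)) R = \<dots>" .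
    qed (rule mlin | assumption)+
  qed (rule mlin | assumption)+
  also have "\<dots> = \<epsilon> c \<odot>\<^bsub>H\<^esub> ?L \<one>\<^bsub>H\<^esub>"
    by (rule antipode_left_mult(1)[OF H_alg L c])
  also have "?L \<one>\<^bsub>H\<^esub> = \<one>\<^bsub>H\<^esub>" using antipode_drinfeld'_contract by (simp add: S_one S_closed)
  finally show ?thesis .
qed

text \<open>Two copies of \<open>K\<close> merge by \<open>Kt_mult\<close>, so a bilinear map that
  sends the braided coproduct to the counit turns their product into \<open>K\<close> with the
  trivial leg, which is the unit. Both inverses of \<open>K\<close> are instances.\<close>

lemma kq_lift_mult:
  assumes \<beta>: "bilin K H H H \<beta>" and h: "\<And>c. c \<in> carrier H \<Longrightarrow> TL H \<beta> (hat c) = \<epsilon> c \<odot>\<^bsub>H\<^esub> \<one>\<^bsub>H\<^esub>"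
  shows "TL HQ (\<lambda>b w. TL HQ (\<lambda>a w'. tens K H Q (\<beta> a b) (w \<otimes>\<^bsub>Q\<^esub> w')) kq) kq = \<one>\<^bsub>HQ\<^esub>"
proof -
  interpret HQ: assoc_algebra K HQ by (rule HQ_alg)
  note [mlin] = lin_comp[OF bilinD(1)[OF \<beta>]] lin_comp[OF bilinD(2)[OF \<beta>]] bilin_closed[OF \<beta>] hat_closed
  note ec = et_commute[OF Q_alg HQ_alg tens_hom(2)[OF H_alg Q_alg]]
  have tri: "trilin K H H Q HQ (\<lambda>a b w. tens K H Q (\<beta> a b) w)" by (rule mlin lin_id | assumption)+
  have "TL HQ (\<lambda>b w. TL HQ (\<lambda>a w'. tens K H Q (\<beta> a b) (w \<otimes>\<^bsub>Q\<^esub> w')) kq) kq =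
    TL HQ (\<lambda>c w. TL HQ (\<lambda>a b. tens K H Q (\<beta> a b) w) (hat c)) kq"
    by (rule Kt_mult[OF Q_alg iX_lin iX_mult HQ_alg tri])
  also have "\<dots> = KK HQ (et HQ) (\<lambda>w. tens K H Q \<one>\<^bsub>H\<^esub> w) kq"
    unfolding KK_def
  proof (rule tensor_lift_cong[OF H_alg Q_alg HQ_alg cwD(3)[OF Q_alg HQ_alg ec] _ kq_closed, symmetric])
    fix c w assume c: "c \<in> carrier H" and w [mlin]: "w \<in> carrier Q"
    have F: "(\<lambda>u. tens K H Q u w) \<in> lin_map K H HQ" by (rule mlin)+
    show "et HQ c \<otimes>\<^bsub>HQ\<^esub> tens K H Q \<one>\<^bsub>H\<^esub> w = TL HQ (\<lambda>a b. tens K H Q (\<beta> a b) w) (hat c)" (is "?l = ?r")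
    proof -
    have "?r = tens K H Q (\<epsilon> c \<odot>\<^bsub>H\<^esub> \<one>\<^bsub>H\<^esub>) w"
      unfolding h[OF c, symmetric]
      by (rule lin_tensor_lift[OF H_alg H_alg H_alg HQ_alg F \<beta> hat_closed[OF c], symmetric])
    also have "\<dots> = ?l"
      by (simp add: lin_mapD(3)[OF F] et_def \<epsilon>_closed HQ.smult_mult_left tens_closed[OF H_alg Q_alg] w c)
    finally show ?thesis by simp
    qed
  qed
  also have "\<dots> = \<one>\<^bsub>HQ\<^esub>" by (rule kq_et[OF HQ_alg tens_hom(2)[OF H_alg Q_alg]])
  finally show ?thesis .
qed

lemma kq_unit: "kq \<in> Units HQ"
proof -
  interpret HQ: assoc_algebra K HQ by (rule HQ_alg)
  interpret Qa: assoc_algebra K Q by (rule Q_alg)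
  note pc = lin_mapD(1)[OF phi_lin] lin_mapD(1)[OF psi_lin]
  note [mlin] = lin_comp[OF phi_lin] lin_comp[OF psi_lin] pc
  let ?G = "TL HQ (\<lambda>a w. tens K H Q (phi a) w) kq" and ?G' = "TL HQ (\<lambda>a w. tens K H Q (psi a) w) kq"
  have kt: "kq = TL HQ (\<lambda>a w. tens K H Q a w) kq"
    by (simp add: tensor_lift_tens_id[OF H_alg Q_alg kq_closed])
  note tb = tens_bilin[OF H_alg Q_alg]
  have b: "bilin K H Q HQ (\<lambda>a w. tens K H Q (phi a) w)" "bilin K H Q HQ (\<lambda>a w. tens K H Q (psi a) w)"
    "bilin K H H H (\<lambda>a b. b \<star> phi a)" "bilin K H H H (\<lambda>a b. psi b \<star> a)"
    by (rule mlin lin_id | assumption)+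
  have G: "?G \<in> carrier HQ" "?G' \<in> carrier HQ"
    by (rule tensor_lift_closed[OF H_alg Q_alg HQ_alg kq_closed b(1)] tensor_lift_closed[OF H_alg Q_alg HQ_alg kq_closed b(2)])+
  have inv: "TL HQ (\<lambda>b w. TL HQ (\<lambda>a w'. tens K H Q (F b) w \<otimes>\<^bsub>HQ\<^esub> tens K H Q (G a) w') kq) kq = \<one>\<^bsub>HQ\<^esub>"
    if F: "F \<in> lin_map K H H" and G: "G \<in> lin_map K H H"
      and h: "\<And>c. c \<in> carrier H \<Longrightarrow> TL H (\<lambda>a b. F b \<star> G a) (hat c) = \<epsilon> c \<odot>\<^bsub>H\<^esub> \<one>\<^bsub>H\<^esub>" for F G
  proof -
    note [mlin] = lin_comp[OF F] lin_comp[OF G] lin_mapD(1)[OF F] lin_mapD(1)[OF G]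
    have be: "bilin K H H H (\<lambda>a b. F b \<star> G a)" by (rule mlin | assumption)+
    have "TL HQ (\<lambda>b w. TL HQ (\<lambda>a w'. tens K H Q (F b) w \<otimes>\<^bsub>HQ\<^esub> tens K H Q (G a) w') kq) kq =
      TL HQ (\<lambda>b w. TL HQ (\<lambda>a w'. tens K H Q (F b \<star> G a) (w \<otimes>\<^bsub>Q\<^esub> w')) kq) kq"
      apply (rule tensor_lift_cong[OF H_alg Q_alg HQ_alg _ _ kq_closed], (rule mlin lin_id | assumption)+)
      apply (rule tensor_lift_cong[OF H_alg Q_alg HQ_alg _ _ kq_closed], (rule mlin lin_id | assumption)+)
      apply (simp add: tens_mult[OF H_alg Q_alg] lin_mapD(1)[OF F] lin_mapD(1)[OF G])
      done
    also have "\<dots> = \<one>\<^bsub>HQ\<^esub>" by (rule kq_lift_mult[OF be h])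
    finally show ?thesis .
  qed
  have "kq \<otimes>\<^bsub>HQ\<^esub> ?G = TL HQ (\<lambda>b w. TL HQ (\<lambda>a w'. tens K H Q b w \<otimes>\<^bsub>HQ\<^esub> tens K H Q (phi a) w') kq) kq"
    using mult_lifts[OF H_alg Q_alg H_alg Q_alg HQ_alg tb b(1) kq_closed kq_closed] by (simp add: kt[symmetric])
  also have "\<dots> = \<one>\<^bsub>HQ\<^esub>" by (rule inv[OF lin_id phi_lin hat_phi])
  finally have r: "kq \<otimes>\<^bsub>HQ\<^esub> ?G = \<one>\<^bsub>HQ\<^esub>" .
  have "?G' \<otimes>\<^bsub>HQ\<^esub> kq = TL HQ (\<lambda>b w. TL HQ (\<lambda>a w'. tens K H Q (psi b) w \<otimes>\<^bsub>HQ\<^esub> tens K H Q a w') kq) kq"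
    using mult_lifts[OF H_alg Q_alg H_alg Q_alg HQ_alg b(2) tb kq_closed kq_closed] by (simp add: kt[symmetric])
  also have "\<dots> = \<one>\<^bsub>HQ\<^esub>" by (rule inv[OF psi_lin lin_id hat_psi])
  finally have l: "?G' \<otimes>\<^bsub>HQ\<^esub> kq = \<one>\<^bsub>HQ\<^esub>" .
  have "?G' = (?G' \<otimes>\<^bsub>HQ\<^esub> kq) \<otimes>\<^bsub>HQ\<^esub> ?G" using G kq_closed r by (simp add: HQ.A.m_assoc)
  then have "?G' = ?G" using l G by simp
  then show ?thesis using r l G kq_closed by (auto simp: Units_def)
qed

end

section \<open>Uniqueness of the coaction and the final statement\<close>

context reflective_data
begin

text \<open>Membership in \<open>extensional\<close> fixes the values outside the carrier, so that
  uniqueness holds for HOL functions.\<close>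

abbreviation "is_coaction d \<equiv> d \<in> lin_map K Q HQ \<inter> extensional (carrier Q) \<and>
  (\<forall>a\<in>carrier A. d (iA a) = tensor_map K H Q (\<lambda>x. x) iA (\<delta> a)) \<and>
  (\<forall>z\<in>dual. d (iX z) = (\<Oplus>\<^bsub>HQ\<^esub>i\<in>I. \<Oplus>\<^bsub>HQ\<^esub>j\<in>I. \<Oplus>\<^bsub>HQ\<^esub>e\<in>D.
     z (t j \<star> hb e \<star> s i) \<odot>\<^bsub>HQ\<^esub> tens K H Q (s j \<star> t i) (iX (xb e)))) \<and>
  (\<forall>a\<in>carrier A. \<forall>z\<in>dual. d (iA a \<otimes>\<^bsub>Q\<^esub> iX z) = d (iA a) \<otimes>\<^bsub>HQ\<^esub> d (iX z))"

lemma is_coaction_agree: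
  assumes "is_coaction d" "is_coaction e" and q: "q \<in> carrier Q"
  shows "d q = e q"
proof (rule C.lin_map_CP_eq[OF HQ_alg _ _ _ q])
  show "d (iA a \<otimes>\<^bsub>Q\<^esub> iX x) = e (iA a \<otimes>\<^bsub>Q\<^esub> iX x)" if "a \<in> carrier A" "x \<in> carrier B" for a x
    using assms that by (simp add: B_simps(1))
qed (use assms in auto)

lemma is_coaction_ex: "\<exists>d. is_coaction d \<and> d \<in> alg_hom K Q HQ"
proof -
  interpret Qa: assoc_algebra K Q by (rule Q_alg)
  obtain d where d: "d \<in> alg_hom K Q HQ" "\<And>a. a \<in> carrier A \<Longrightarrow> d (iA a) = dA a" "\<And>z. z \<in> dual \<Longrightarrow> d (iX z) = dX z"
    using reflective_coaction by blast
  note ic = alg_hom_closed[OF C.inl1_hom] alg_hom_closed[OF C.inr1_hom, unfolded B_simps(1)]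
  let ?d = "restrict d (carrier Q)"
  have h: "?d \<in> alg_hom K Q HQ"
  proof (rule alg_homI)
    show "?d \<in> lin_map K Q HQ" by (rule lin_map_cong[OF Q_alg alg_homD(1)[OF d(1)]]) simp
  qed (simp_all add: alg_homD(2,3)[OF d(1)])
  then have "is_coaction ?d"
    using alg_homD(1)[OF h] by (simp add: d ic dA_eq[symmetric] dX_def[symmetric] alg_homD(2)[OF d(1)])
  with h show ?thesis by blast
qed

text \<open>The characterization speaks of linearity and of products \<open>a x\<close>. Since these
  products span, it determines the map, which is therefore the algebra map already
  constructed.\<close>

lemma is_coaction_hom:
  assumes d: "is_coaction d"
  shows "d \<in> alg_hom K Q HQ"
proof -
  obtain e where e: "is_coaction e" "e \<in> alg_hom K Q HQ" using is_coaction_ex by blast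
  have "d = e" by (rule extensionalityI[of _ "carrier Q"]) (use d e(1) is_coaction_agree[OF d e(1)] in auto)
  then show ?thesis using e(2) by simp
qed

lemma reflective_quasitriangular:
  "(\<exists>!d. is_coaction d) \<and> (\<forall>d. is_coaction d \<longrightarrow> left_comodule_algebra K H \<Delta> \<epsilon> Q d \<and>
    quasitriangular_comodule_algebra K H \<Delta> \<epsilon> S R Q d (\<Oplus>\<^bsub>HQ\<^esub>e\<in>D. tens K H Q (hb e) (iX (xb e))))"
proof (intro conjI allI impI)
  show "\<exists>!d. is_coaction d"
  proof -
    obtain e where e: "is_coaction e" using is_coaction_ex by blast
    show ?thesis
    proof (rule ex1I[of "\<lambda>d. is_coaction d" e])
      show "is_coaction e" by (rule e)
      fix d assume d: "is_coaction d"
      show "d = e" by (rule extensionalityI[of _ "carrier Q"]) (use d e is_coaction_agree[OF d e] in auto)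
    qed
  qed
  fix d assume c: "is_coaction d"
  note d = is_coaction_hom[OF c]
  have dA: "d (iA a) = dA a" if "a \<in> carrier A" for a using c that by (simp add: dA_eq)
  have dX: "d (iX z) = dX z" if "z \<in> dual" for z using c that by (simp add: dX_def)
  note com = d_comodule[OF d dA dX]
  show "left_comodule_algebra K H \<Delta> \<epsilon> Q d" by (rule com)
  have "kq = (\<Oplus>\<^bsub>HQ\<^esub>e\<in>D. tens K H Q (hb e) (iX (xb e)))" by (rule Kt_def[OF Q_alg iX_lin])
  moreover have "quasitriangular_comodule_algebra K H \<Delta> \<epsilon> S R Q d kq"
    by (intro quasitriangular_comodule_algebra.intro quasitriangular_hopf_algebra_axioms com quasitriangular_comodule_algebra_axioms.intro
        kq_unit kq_comult kq_coaction[OF d dA dX] kq_intertwines[OF d dA dX])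
  ultimately show "quasitriangular_comodule_algebra K H \<Delta> \<epsilon> S R Q d (\<Oplus>\<^bsub>HQ\<^esub>e\<in>D. tens K H Q (hb e) (iX (xb e)))" by simp
qed

end

theorem corollaryC:
  fixes K :: "'k ring"
    and H :: "('k, 'h) module"
    and \<Delta> :: "'h \<Rightarrow> ('h \<times> 'h \<Rightarrow> 'k) set"
    and \<epsilon> :: "'h \<Rightarrow> 'k"
    and S :: "'h \<Rightarrow> 'h"
    and I :: "'i set" and s t :: "'i \<Rightarrow> 'h"
    and A :: "('k, 'a) module"
    and \<delta> :: "'a \<Rightarrow> ('h \<times> 'a \<Rightarrow> 'k) set"
    and D :: "'d set" and h :: "'d \<Rightarrow> 'h" and \<xi> :: "'d \<Rightarrow> 'h \<Rightarrow> 'k"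
  defines "R \<equiv> \<Oplus>\<^bsub>tensor K H H\<^esub>i\<in>I. tens K H H (s i) (t i)"
    and "Q \<equiv> reflective_algebra K H \<Delta> \<epsilon> S I s t A \<delta>"
    and "inA \<equiv> reflective_inl K H \<Delta> \<epsilon> S I s t A \<delta>"
    and "inX \<equiv> reflective_inr K H \<Delta> \<epsilon> S I s t A \<delta>"
  defines "is_delta_ref \<equiv> (\<lambda>dref.
      dref \<in> lin_map K Q (tensor K H Q) \<inter> extensional (carrier Q) \<and>
      (\<forall>a\<in>carrier A. dref (inA a) = tensor_map K H Q (\<lambda>x. x) inA (\<delta> a)) \<and>
      (\<forall>\<zeta>\<in>dual_carrier K H. dref (inX \<zeta>) =
         (\<Oplus>\<^bsub>tensor K H Q\<^esub>i\<in>I. \<Oplus>\<^bsub>tensor K H Q\<^esub>j\<in>I. \<Oplus>\<^bsub>tensor K H Q\<^esub>d\<in>D.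
            \<zeta> (t j \<otimes>\<^bsub>H\<^esub> h d \<otimes>\<^bsub>H\<^esub> s i) \<odot>\<^bsub>tensor K H Q\<^esub>
              tens K H Q (s j \<otimes>\<^bsub>H\<^esub> t i) (inX (\<xi> d)))) \<and>
      (\<forall>a\<in>carrier A. \<forall>\<zeta>\<in>dual_carrier K H.
         dref (inA a \<otimes>\<^bsub>Q\<^esub> inX \<zeta>) = dref (inA a) \<otimes>\<^bsub>tensor K H Q\<^esub> dref (inX \<zeta>)))"
  assumes "algebraically_closed K"
    and "finite I" and "s \<in> I \<rightarrow> carrier H" and "t \<in> I \<rightarrow> carrier H"
    and "quasitriangular_hopf_algebra K H \<Delta> \<epsilon> S R"
    and "finite_dimensional K H"
    and "left_comodule_algebra K H \<Delta> \<epsilon> A \<delta>"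
    and "dual_basis K H D h \<xi>"
  shows "(\<exists>!dref. is_delta_ref dref) \<and>
    (\<forall>dref. is_delta_ref dref \<longrightarrow>
       left_comodule_algebra K H \<Delta> \<epsilon> Q dref \<and>
       quasitriangular_comodule_algebra K H \<Delta> \<epsilon> S R Q dref
         (\<Oplus>\<^bsub>tensor K H Q\<^esub>d\<in>D. tens K H Q (h d) (inX (\<xi> d))))"
proof -
  interpret r: reflective_data K H \<Delta> \<epsilon> S R A \<delta> I s t D h \<xi>
    using assms by (simp add: reflective_data_def reflective_data_axioms_def)
  have Q: "Q = r.Q" and inA: "inA = r.iA" and inX: "inX = r.iX"
    by (simp_all add: Q_def inA_def inX_def fun_eq_iff reflective_algebra_def reflective_ideal_def
        reflective_inl_def reflective_inr_def Let_def r.C.inl1_def r.C.inr1_def)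
  show ?thesis
    unfolding is_delta_ref_def Q inA inX by (rule r.reflective_quasitriangular)
qed

end
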